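(* Let $H$ be a cocommutative Hopf algebra over a field $\Bbbk$ of characteristic zero and let $J$ be a simple finite Jordan $H$-pseudoalgebra. Then the Tits–Kantor–Koecher construction $\mathrm T(J)$ is a simple finite Lie $H$-pseudoalgebra.
   Context: Pseudoalgebras. $H$ has coproduct $\Delta(h)=h_{(1)}\otimes h_{(2)}$, iterated coproduct $\Delta^{[n]}$ ($\Delta^{[1]}=\mathrm{id}$), antipode $S$. $H^{\otimes n}$ is a right $H$-module via $(f_1\otimes\dots\otimes f_n)\cdot h=f_1h_{(1)}\otimes\dots\otimes f_nh_{(n)}$; $\otimes_H$ refers to this action. An $H$-pseudoalgebra is a left $H$-module $P$ with an $H$-bilinear map $*:P\otimes P\to (H\otimes H)\otimes_H P$, i.e. $(fa)*(gb)=((f\otimes g)\otimes_H 1)(a*b)$; it is finite if $P$ is a finitely generated $H$-module. Any such map $*$ (also for three different modules) extends to $H^{\otimes n}\otimes_H(\cdot)$, $H^{\otimes m}\otimes_H(\cdot)$: if $a*b=\sum_i(f_i\otimes g_i)\otimes_H c_i$ then $(F\otimes_H a)*(G\otimes_H b)=\sum_i(F\Delta^{[n]}(f_i)\otimes G\Delta^{[m]}(g_i))\otimes_H c_i$. $S_n$ acts on $H^{\otimes n}$ by $\sigma(h_1\otimes\dots\otimes h_n)=h_{1\sigma^{-1}}\otimes\dots\otimes h_{n\sigma^{-1}}$; $\sigma_{ij}=(i\,j)$; we abbreviate $\sigma\otimes_H\mathrm{id}$ by $\sigma$. Jordan: $a*b=\sigma_{12}(b*a)$ and $a*(b*(c*d))+\sigma_{14}\,d*(b*(c*a))+\sigma_{13}\,c*(b*(a*d))=(a*b)*(c*d)+\sigma_{23}(a*c)*(b*d)+\sigma_{24}(a*d)*(c*b)$.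 Lie (pseudoproduct $[a*b]$): $[a*b]=-\sigma_{12}[b*a]$ and $[a*[b*c]]=[[a*b]*c]+\sigma_{12}[b*[a*c]]$. An ideal is an $H$-submodule $I$ with $I*P,P*I\subseteq(H\otimes H)\otimes_HI$; $P$ is simple if its pseudoproduct is not identically zero and its only ideals are $0$ and $P$. Fourier coefficients. Fix a basis $\{h_i\}$ of $H$, $X=H^*$. Each element of $(H\otimes H)\otimes_H M$ is uniquely $\sum_i(h_i\otimes1)\otimes_Hc_i$; if $a*b=\sum_i(h_i\otimes 1)\otimes_Hc_i$ then $(a\circ_xb)=\sum_i\langle x,S(h_i)\rangle c_i$, $x\in X$. Conformal endomorphisms. $\mathrm{Cend}^l(P)$ is the set of linear maps $\varphi:P\to(H\otimes H)\otimes_HP$ with $\varphi(ha)=((1\otimes h)\otimes_H1)\varphi(a)$; it is an $H$-module via $(h\varphi)(a)=((h\otimes1)\otimes_H1)\varphi(a)$; write $\varphi*a=\varphi(a)$. If $P$ is finite, $\mathrm{Cend}^l(P)$ is an associative pseudoalgebra with $(\varphi*\psi)*a=\varphi*(\psi*a)$, and $[\varphi*\psi]=\varphi*\psi-\sigma_{12}(\psi*\varphi)$ makes it a Lie pseudoalgebra. $T\in\mathrm{Cend}^l(P)$ is a pseudoderivation if $T*(a*b)=(T*a)*b+\sigma_{12}(a*(T*b))$ for all $a,b\in P$; $\mathrm{Der}^l(P)$ is the set of pseudoderivations. $L_a\in\mathrm{Cend}^l(P)$ is $L_a*b=a*b$, and for $A=\sum_iF_i\otimes_Ha_i$, $L_A=\sum_iF_i\otimes_HL_{a_i}$.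 Structure pseudoalgebra. For a finite Jordan pseudoalgebra $J$ let $L(J)$ be the $H$-submodule of $\mathrm{Cend}^l(J)$ generated by $\{L_a: a\in J\}$. $\mathrm S(J)=L(J)\oplus\mathrm{Der}^l(J)$ (formal direct sum of $H$-modules) with $[(L_a+D)*(L_b+T)]=L_{D*b}-\sigma_{12}L_{T*a}+[L_a*L_b]+[D*T]$, where $[L_a*L_b]$ (all of whose Fourier coefficients are pseudoderivations) and $[D*T]$ are placed in the $\mathrm{Der}^l(J)$ component; this is a Lie pseudoalgebra. Put $U_{a,b}=L_{a*b}+[L_a*L_b]$, $U^*_{a,b}=-L_{a*b}+[L_a*L_b]$ in $(H\otimes H)\otimes_H\mathrm S(J)$; $\mathrm S_0(J)$ is the linear span of all $U_{(a\circ_xb)}=L_{(a\circ_xb)}+[L_a\circ_xL_b]$, $a,b\in J$, $x\in X$ (it is an $H$-submodule and a subalgebra of $\mathrm S(J)$). TKK construction. $\mathrm T(J)=J^-\oplus\mathrm S_0(J)\oplus J^+$, $J^\pm$ copies of $J$ (the image of $a$ is $a^\pm$). For $\Sigma=L_c+D\in\mathrm S_0(J)$ put $\Sigma^*=-L_c+D$, $\Sigma*a=c*a+D*a$, $\Sigma^**a=-c*a+D*a$. The pseudoproduct on $\mathrm S_0(J)$ is that of $\mathrm S(J)$, and $[a^+*b^-]=U^*_{a,b}$, $[a^-*b^+]=U_{a,b}$, $[a^+*b^+]=[a^-*b^-]=0$, $[\Sigma*a^-]=(\Sigma*a)^-$, $[a^-*\Sigma]=-\sigma_{12}(\Sigma*a)^-$,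 $[\Sigma*a^+]=(\Sigma^**a)^+$, $[a^+*\Sigma]=-\sigma_{12}(\Sigma^**a)^+$. This is a Lie pseudoalgebra. *)

theory Defs
  imports
    Complex_Main
    "HOL-Library.Poly_Mapping"
    "HOL-Library.Function_Algebras"
    "HOL-Library.Product_Plus"
    "HOL-Combinatorics.Permutations"
begin

section \<open>Quotients of free vector spaces\<close>

definition fscale :: "'k::field \<Rightarrow> ('x \<Rightarrow>\<^sub>0 'k) \<Rightarrow> ('x \<Rightarrow>\<^sub>0 'k)" where
  "fscale c f = Poly_Mapping.map ((*) c) f"

lemma lookup_fscale: "Poly_Mapping.lookup (fscale c f) x = c * Poly_Mapping.lookup f x"
  by (simp add: fscale_def Poly_Mapping.map.rep_eq when_def)

global_interpretation free: vector_space fscale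
  by unfold_locales
    (rule poly_mapping_eqI; simp add: lookup_fscale lookup_add algebra_simps)+

text \<open>
  Let \<open>F\<close> be the space of formal combinations of elements of \<open>S\<close>, and \<open>N\<close> a subspace of \<open>F\<close>.
  The quotient \<open>F / N\<close> is realised by linearly chosen representatives: \<open>qmap S N f\<close> is the chosen
  representative of the class of \<open>f\<close>. That such a choice exists, and that \<open>qmap S N f = qmap S N g\<close>
  holds exactly if \<open>f - g \<in> N\<close>, is proved below. A linear map out of the quotient is obtained by
  applying a linear map on \<open>F\<close> that vanishes on \<open>N\<close> to the representative.
\<close>

definition formal :: "'x set \<Rightarrow> ('x \<Rightarrow>\<^sub>0 'k::field) set" where
  "formal S = {f. Poly_Mapping.keys f \<subseteq> S}"

definition qmap :: "'x set \<Rightarrow> ('x \<Rightarrow>\<^sub>0 'k::field) set \<Rightarrow> ('x \<Rightarrow>\<^sub>0 'k) \<Rightarrow> ('x \<Rightarrow>\<^sub>0 'k)" where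
  "qmap S N = (SOME p. Vector_Spaces.linear fscale fscale p \<and> (\<forall>f. p f \<in> formal S) \<and>
     (\<forall>f\<in>N. p f = 0) \<and> (\<forall>f\<in>formal S. p f - f \<in> N))"

lemma subspace_formal: "free.subspace (formal S :: ('a \<Rightarrow>\<^sub>0 'b::field) set)"
proof (rule free.subspaceI)
  fix x y :: "'a \<Rightarrow>\<^sub>0 'b"
  assume "x \<in> formal S" "y \<in> formal S"
  then show "x + y \<in> formal S"
    using keys_add[of x y] by (auto simp: formal_def)
next
  fix c :: 'b and x :: "'a \<Rightarrow>\<^sub>0 'b"
  assume "x \<in> formal S"
  then show "fscale c x \<in> formal S"
    by (auto simp: formal_def in_keys_iff lookup_fscale)
qed (simp add: formal_def)

lemma qmap_exists:
  fixes N :: "('x \<Rightarrow>\<^sub>0 'k::field) set"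
  assumes N: "free.subspace N" and NS: "N \<subseteq> formal S"
  shows "\<exists>p. Vector_Spaces.linear fscale fscale p \<and> (\<forall>f. p f \<in> formal S) \<and>
     (\<forall>f\<in>N. p f = 0) \<and> (\<forall>f\<in>formal S. p f - f \<in> N)"
proof -
  interpret P: vector_space_pair "fscale :: 'k \<Rightarrow> ('x \<Rightarrow>\<^sub>0 'k) \<Rightarrow> _" "fscale :: 'k \<Rightarrow> ('x \<Rightarrow>\<^sub>0 'k) \<Rightarrow> _"
    by unfold_locales
  obtain B where B: "B \<subseteq> N" "free.independent B" "N \<subseteq> free.span B"
    using free.maximal_independent_subset[of N] by blast
  obtain C where C: "B \<subseteq> C" "C \<subseteq> formal S" "free.independent C" "formal S \<subseteq> free.span C"
    using free.maximal_independent_subset_extend[of B "formal S"] B NS by blast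
  let ?D = "free.extend_basis C"
  have D: "C \<subseteq> ?D" "free.independent ?D" "free.span ?D = UNIV"
    using free.extend_basis_superset free.independent_extend_basis C(3) by auto
  obtain p where p: "Vector_Spaces.linear fscale fscale p"
    and pD: "\<And>b. b \<in> ?D \<Longrightarrow> p b = (if b \<in> C - B then b else 0)"
    using P.linear_independent_extend[OF D(2), of "\<lambda>b. if b \<in> C - B then b else 0"] by blast
  interpret p: Vector_Spaces.linear fscale fscale p by (rule p)
  have "p f \<in> formal S" for f
  proof -
    have "f \<in> free.span ?D" using D by simp
    then show ?thesis
    proof (rule free.span_induct)
      show "free.subspace {f. p f \<in> formal S}"
        by (rule p.subspace_vimage[unfolded vimage_def, OF subspace_formal])
      show "p b \<in> formal S" if "b \<in> ?D" for b
        using pD[OF that] C(2) free.subspace_0[OF subspace_formal] by auto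
    qed
  qed
  moreover have "p f = 0" if "f \<in> N" for f
  proof -
    have "f \<in> free.span B" using that B by blast
    then show ?thesis
    proof (rule free.span_induct)
      show "free.subspace {f. p f = 0}"
        by (rule p.subspace_kernel)
      show "p b = 0" if "b \<in> B" for b
        using pD[of b] that C D by auto
    qed
  qed
  moreover have "p f - f \<in> N" if "f \<in> formal S" for f
  proof -
    have "f \<in> free.span C" using that C by blast
    then show ?thesis
    proof (rule free.span_induct)
      show "free.subspace {f. p f - f \<in> N}"
      proof (rule free.subspaceI)
        fix x y assume "x \<in> {f. p f - f \<in> N}" "y \<in> {f. p f - f \<in> N}"
        then have "(p x - x) + (p y - y) \<in> N" using free.subspace_add[OF N] by blast
        then show "x + y \<in> {f. p f - f \<in> N}" by (simp add: p.add algebra_simps)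
      next
        fix c x assume "x \<in> {f. p f - f \<in> N}"
        then have "fscale c (p x - x) \<in> N" using free.subspace_scale[OF N] by blast
        then show "fscale c x \<in> {f. p f - f \<in> N}"
          by (simp add: p.scale free.scale_right_diff_distrib)
      qed (simp add: free.subspace_0[OF N])
      show "p b - b \<in> N" if "b \<in> C" for b
      proof (cases "b \<in> B")
        case True
        then have "b \<in> N" "p b = 0"
          using pD[of b] that D(1) B(1) by auto
        then show ?thesis
          using free.subspace_neg[OF N, of b] by simp
      next
        case False
        then have "p b = b"
          using pD[of b] that D(1) by auto
        then show ?thesis
          using free.subspace_0[OF N] by simp
      qed
    qed
  qed
  ultimately show ?thesis using p by blast
qed

lemma
  assumes N: "free.subspace N" and NS: "N \<subseteq> formal S"
  shows linear_qmap: "Vector_Spaces.linear fscale fscale (qmap S N)"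
    and qmap_formal: "qmap S N f \<in> formal S"
    and qmap_zero: "f \<in> N \<Longrightarrow> qmap S N f = 0"
    and qmap_rep: "f \<in> formal S \<Longrightarrow> qmap S N f - f \<in> N"
  using someI_ex[OF qmap_exists[OF assms]] unfolding qmap_def[symmetric] by blast+

lemma qmap_eq_iff:
  assumes N: "free.subspace N" and NS: "N \<subseteq> formal S"
    and f: "f \<in> formal S" and g: "g \<in> formal S"
  shows "qmap S N f = qmap S N g \<longleftrightarrow> f - g \<in> N"
proof -
  interpret q: Vector_Spaces.linear fscale fscale "qmap S N" by (rule linear_qmap[OF N NS])
  have "f - g \<in> formal S" using f g free.subspace_diff[OF subspace_formal] by blast
  then have "qmap S N (f - g) - (f - g) \<in> N" by (rule qmap_rep[OF N NS])
  then have "f - g \<in> N" if "qmap S N (f - g) = 0"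
    using that free.subspace_neg[OF N] by fastforce
  then show ?thesis using qmap_zero[OF N NS, of "f - g"] by (auto simp: q.diff)
qed

definition lin_ext :: "('k::zero \<Rightarrow> 'v \<Rightarrow> 'v) \<Rightarrow> ('x \<Rightarrow> 'v) \<Rightarrow> ('x \<Rightarrow>\<^sub>0 'k) \<Rightarrow> 'v::comm_monoid_add" where
  "lin_ext s g f = (\<Sum>x\<in>Poly_Mapping.keys f. s (Poly_Mapping.lookup f x) (g x))"

abbreviation fext :: "('x \<Rightarrow> 'y \<Rightarrow>\<^sub>0 'k) \<Rightarrow> ('x \<Rightarrow>\<^sub>0 'k::field) \<Rightarrow> 'y \<Rightarrow>\<^sub>0 'k" where
  "fext \<equiv> lin_ext fscale"


section \<open>Hopf algebras\<close>

text \<open>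
  The ring structure of \<open>H\<close> is that of the type \<open>'h\<close>. An element of the \<open>n\<close>-th tensor power is a
  (chosen representative of a) formal combination of lists of length \<open>n\<close>.
\<close>

type_synonym ('k, 'h) tensor = "'h list \<Rightarrow>\<^sub>0 'k"

record (overloaded) ('k, 'h) hopf =
  scl :: "'k \<Rightarrow> 'h \<Rightarrow> 'h"
  comult :: "'h \<Rightarrow> ('k, 'h) tensor"
  counit :: "'h \<Rightarrow> 'k"
  antipode :: "'h \<Rightarrow> 'h"

definition tensor_rels :: "('k::field, 'h::ring_1) hopf \<Rightarrow> nat \<Rightarrow> ('k, 'h) tensor set" where
  "tensor_rels H n = free.span
    ({Poly_Mapping.single (xs @ (a + b) # ys) 1 - Poly_Mapping.single (xs @ a # ys) 1
        - Poly_Mapping.single (xs @ b # ys) 1 | xs a b ys. Suc (length xs + length ys) = n} \<union>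
     {Poly_Mapping.single (xs @ scl H c a # ys) 1 - fscale c (Poly_Mapping.single (xs @ a # ys) 1)
        | xs c a ys. Suc (length xs + length ys) = n})"

definition tensor_power :: "('k::field, 'h::ring_1) hopf \<Rightarrow> nat \<Rightarrow> ('k, 'h) tensor set" where
  "tensor_power H n = qmap {xs. length xs = n} (tensor_rels H n) ` formal {xs. length xs = n}"

definition tens :: "('k::field, 'h::ring_1) hopf \<Rightarrow> 'h list \<Rightarrow> ('k, 'h) tensor" where
  "tens H xs = qmap {ys. length ys = length xs} (tensor_rels H (length xs)) (Poly_Mapping.single xs 1)"

definition tmul :: "('k::field, 'h::ring_1) hopf \<Rightarrow> ('k, 'h) tensor \<Rightarrow> ('k, 'h) tensor \<Rightarrow> ('k, 'h) tensor" where
  "tmul H F G = fext (\<lambda>xs. fext (\<lambda>ys. tens H (map2 (*) xs ys)) G) F"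

definition tcat :: "('k::field, 'h::ring_1) hopf \<Rightarrow> ('k, 'h) tensor \<Rightarrow> ('k, 'h) tensor \<Rightarrow> ('k, 'h) tensor" where
  "tcat H F G = fext (\<lambda>xs. fext (\<lambda>ys. tens H (xs @ ys)) G) F"

text \<open>Permutations act on positions, which are counted from \<open>0\<close>.\<close>

definition tperm :: "('k::field, 'h::ring_1) hopf \<Rightarrow> (nat \<Rightarrow> nat) \<Rightarrow> ('k, 'h) tensor \<Rightarrow> ('k, 'h) tensor" where
  "tperm H \<sigma> F = fext (\<lambda>xs. tens H (permute_list (inv \<sigma>) xs)) F"

definition cocommutative_hopf_algebra :: "('k::field, 'h::ring_1) hopf \<Rightarrow> bool" where
  "cocommutative_hopf_algebra H \<longleftrightarrow>
    vector_space (scl H) \<and>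
    (\<forall>c a b. scl H c a * b = scl H c (a * b) \<and> a * scl H c b = scl H c (a * b)) \<and>
    Vector_Spaces.linear (scl H) fscale (comult H) \<and>
    (\<forall>h. comult H h \<in> tensor_power H 2) \<and>
    Vector_Spaces.linear (scl H) (*) (counit H) \<and>
    (\<forall>h. fext (\<lambda>xs. tcat H (comult H (xs ! 0)) (tens H [xs ! 1])) (comult H h) =
         fext (\<lambda>xs. tcat H (tens H [xs ! 0]) (comult H (xs ! 1))) (comult H h)) \<and>
    (\<forall>h. lin_ext (scl H) (\<lambda>xs. scl H (counit H (xs ! 0)) (xs ! 1)) (comult H h) = h) \<and>
    (\<forall>h. lin_ext (scl H) (\<lambda>xs. scl H (counit H (xs ! 1)) (xs ! 0)) (comult H h) = h) \<and>
    comult H 1 = tens H [1, 1] \<and>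
    (\<forall>a b. comult H (a * b) = tmul H (comult H a) (comult H b)) \<and>
    counit H 1 = 1 \<and>
    (\<forall>a b. counit H (a * b) = counit H a * counit H b) \<and>
    Vector_Spaces.linear (scl H) (scl H) (antipode H) \<and>
    (\<forall>h. lin_ext (scl H) (\<lambda>xs. antipode H (xs ! 0) * xs ! 1) (comult H h) = scl H (counit H h) 1) \<and>
    (\<forall>h. lin_ext (scl H) (\<lambda>xs. xs ! 0 * antipode H (xs ! 1)) (comult H h) = scl H (counit H h) 1) \<and>
    (\<forall>h. tperm H (transpose 0 1) (comult H h) = comult H h)"

definition is_basis :: "('k::field, 'h::ring_1) hopf \<Rightarrow> 'h set \<Rightarrow> bool" where
  "is_basis H B \<longleftrightarrow> \<not> module.dependent (scl H) B \<and> module.span (scl H) B = UNIV"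

definition dual :: "('k::field, 'h::ring_1) hopf \<Rightarrow> ('h \<Rightarrow> 'k) set" where
  "dual H = {x. Vector_Spaces.linear (scl H) (*) x}"

fun iter_comult :: "('k::field, 'h::ring_1) hopf \<Rightarrow> nat \<Rightarrow> 'h \<Rightarrow> ('k, 'h) tensor" where
  "iter_comult H 0 h = fscale (counit H h) (tens H [])"
| "iter_comult H (Suc 0) h = tens H [h]"
| "iter_comult H (Suc (Suc n)) h =
     fext (\<lambda>xs. tcat H (tens H [xs ! 0]) (iter_comult H (Suc n) (xs ! 1))) (comult H h)"


section \<open>Modules and tensor products over \<open>H\<close>\<close>

record ('h, 'm) hmodule =
  carr :: "'m set"
  act :: "'h \<Rightarrow> 'm \<Rightarrow> 'm"

definition left_module :: "('h::ring_1, 'm::ab_group_add, 'z) hmodule_scheme \<Rightarrow> bool" where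
  "left_module M \<longleftrightarrow>
    0 \<in> carr M \<and> (\<forall>a\<in>carr M. \<forall>b\<in>carr M. a - b \<in> carr M) \<and>
    (\<forall>f. \<forall>a\<in>carr M. act M f a \<in> carr M) \<and>
    (\<forall>f. \<forall>a\<in>carr M. \<forall>b\<in>carr M. act M f (a + b) = act M f a + act M f b) \<and>
    (\<forall>f g. \<forall>a\<in>carr M. act M (f + g) a = act M f a + act M g a) \<and>
    (\<forall>f g. \<forall>a\<in>carr M. act M (f * g) a = act M f (act M g a)) \<and>
    (\<forall>a\<in>carr M. act M 1 a = a)"

definition submodule :: "('h::ring_1, 'm::ab_group_add, 'z) hmodule_scheme \<Rightarrow> 'm set \<Rightarrow> bool" where
  "submodule M N \<longleftrightarrow> N \<subseteq> carr M \<and> 0 \<in> N \<and> (\<forall>a\<in>N. \<forall>b\<in>N. a - b \<in> N) \<and>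
    (\<forall>f. \<forall>a\<in>N. act M f a \<in> N)"

definition generated_submodule :: "('h::ring_1, 'm::ab_group_add, 'z) hmodule_scheme \<Rightarrow> 'm set \<Rightarrow> 'm set" where
  "generated_submodule M X = \<Inter>{N. submodule M N \<and> X \<subseteq> N}"

definition finitely_generated :: "('h::ring_1, 'm::ab_group_add, 'z) hmodule_scheme \<Rightarrow> bool" where
  "finitely_generated M \<longleftrightarrow>
    (\<exists>X. finite X \<and> X \<subseteq> carr M \<and> generated_submodule M X = carr M)"

text \<open>The base field acts on a module through its image in \<open>H\<close>.\<close>

definition linear_span ::
  "('k::field, 'h::ring_1) hopf \<Rightarrow> ('h, 'm::ab_group_add, 'z) hmodule_scheme \<Rightarrow> 'm set \<Rightarrow> 'm set" where
  "linear_span H M X = \<Inter>{V. V \<subseteq> carr M \<and> 0 \<in> V \<and> (\<forall>a\<in>V. \<forall>b\<in>V. a + b \<in> V) \<and>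
     (\<forall>c. \<forall>a\<in>V. act M (scl H c 1) a \<in> V) \<and> X \<subseteq> V}"

text \<open>
  \<open>pseudo H n M\<close> is the tensor product over \<open>H\<close> of the \<open>n\<close>-th tensor power of \<open>H\<close>, on which
  \<open>h\<close> acts from the right by multiplication with its iterated coproduct, and \<open>M\<close>.
\<close>

type_synonym ('k, 'h, 'm) pseudo = "('k, 'h) tensor \<times> 'm \<Rightarrow>\<^sub>0 'k"

definition pseudo_gens ::
  "('k::field, 'h::ring_1) hopf \<Rightarrow> nat \<Rightarrow> ('h, 'm::ab_group_add, 'z) hmodule_scheme \<Rightarrow>
    (('k, 'h) tensor \<times> 'm) set" where
  "pseudo_gens H n M = tensor_power H n \<times> carr M"

definition pseudo_rels ::
  "('k::field, 'h::ring_1) hopf \<Rightarrow> nat \<Rightarrow> ('h, 'm::ab_group_add, 'z) hmodule_scheme \<Rightarrow>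
    ('k, 'h, 'm) pseudo set" where
  "pseudo_rels H n M = free.span
    ({Poly_Mapping.single (F + G, a) 1 - Poly_Mapping.single (F, a) 1 - Poly_Mapping.single (G, a) 1
        | F G a. F \<in> tensor_power H n \<and> G \<in> tensor_power H n \<and> a \<in> carr M} \<union>
     {Poly_Mapping.single (F, a + b) 1 - Poly_Mapping.single (F, a) 1 - Poly_Mapping.single (F, b) 1
        | F a b. F \<in> tensor_power H n \<and> a \<in> carr M \<and> b \<in> carr M} \<union>
     {Poly_Mapping.single (fscale c F, a) 1 - fscale c (Poly_Mapping.single (F, a) 1)
        | c F a. F \<in> tensor_power H n \<and> a \<in> carr M} \<union>
     {Poly_Mapping.single (tmul H F (iter_comult H n h), a) 1 - Poly_Mapping.single (F, act M h a) 1
        | F h a. F \<in> tensor_power H n \<and> a \<in> carr M})"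

definition pseudo ::
  "('k::field, 'h::ring_1) hopf \<Rightarrow> nat \<Rightarrow> ('h, 'm::ab_group_add, 'z) hmodule_scheme \<Rightarrow>
    ('k, 'h, 'm) pseudo set" where
  "pseudo H n M = qmap (pseudo_gens H n M) (pseudo_rels H n M) ` formal (pseudo_gens H n M)"

definition ptens ::
  "('k::field, 'h::ring_1) hopf \<Rightarrow> nat \<Rightarrow> ('h, 'm::ab_group_add, 'z) hmodule_scheme \<Rightarrow>
    ('k, 'h) tensor \<Rightarrow> 'm \<Rightarrow> ('k, 'h, 'm) pseudo" where
  "ptens H n M F a = qmap (pseudo_gens H n M) (pseudo_rels H n M) (Poly_Mapping.single (F, a) 1)"

text \<open>\<open>M\<close> is identified with \<open>pseudo H 1 M\<close>.\<close>

definition emb ::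
  "('k::field, 'h::ring_1) hopf \<Rightarrow> ('h, 'm::ab_group_add, 'z) hmodule_scheme \<Rightarrow> 'm \<Rightarrow>
    ('k, 'h, 'm) pseudo" where
  "emb H M a = ptens H 1 M (tens H [1]) a"

text \<open>Left multiplication by \<open>F \<otimes>\<^sub>H 1\<close>, and the action of a permutation.\<close>

definition lmul ::
  "('k::field, 'h::ring_1) hopf \<Rightarrow> nat \<Rightarrow> ('h, 'm::ab_group_add, 'z) hmodule_scheme \<Rightarrow>
    ('k, 'h) tensor \<Rightarrow> ('k, 'h, 'm) pseudo \<Rightarrow> ('k, 'h, 'm) pseudo" where
  "lmul H n M F A = fext (\<lambda>(G, a). ptens H n M (tmul H F G) a) A"

definition pperm ::
  "('k::field, 'h::ring_1) hopf \<Rightarrow> nat \<Rightarrow> ('h, 'm::ab_group_add, 'z) hmodule_scheme \<Rightarrow>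
    (nat \<Rightarrow> nat) \<Rightarrow> ('k, 'h, 'm) pseudo \<Rightarrow> ('k, 'h, 'm) pseudo" where
  "pperm H n M \<sigma> A = fext (\<lambda>(G, a). ptens H n M (tperm H \<sigma> G) a) A"

text \<open>\<open>push H n N g\<close> is \<open>id \<otimes>\<^sub>H g\<close>, with values in \<open>pseudo H n N\<close>.\<close>

definition push ::
  "('k::field, 'h::ring_1) hopf \<Rightarrow> nat \<Rightarrow> ('h, 'n::ab_group_add, 'z) hmodule_scheme \<Rightarrow>
    ('m \<Rightarrow> 'n) \<Rightarrow> ('k, 'h, 'm) pseudo \<Rightarrow> ('k, 'h, 'n) pseudo" where
  "push H n N g A = fext (\<lambda>(G, a). ptens H n N G (g a)) A"

text \<open>
  For a submodule \<open>N\<close> of \<open>M\<close>, the space \<open>pseudo H n N\<close> embeds into \<open>pseudo H n M\<close>; \<open>restr H n N M\<close>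
  is the inverse of this embedding.
\<close>

definition restr ::
  "('k::field, 'h::ring_1) hopf \<Rightarrow> nat \<Rightarrow> ('h, 'm::ab_group_add, 'y) hmodule_scheme \<Rightarrow>
    ('h, 'm, 'z) hmodule_scheme \<Rightarrow> ('k, 'h, 'm) pseudo \<Rightarrow> ('k, 'h, 'm) pseudo" where
  "restr H n N M A = (THE A'. A' \<in> pseudo H n N \<and> push H n M (\<lambda>a. a) A' = A)"

text \<open>
  The extension of a pseudoproduct \<open>\<mu>\<close>, with values in \<open>pseudo H 2 C\<close>, to arguments from
  \<open>pseudo H n A\<close> and \<open>pseudo H m B\<close>.
\<close>

definition pext ::
  "('k::field, 'h::ring_1) hopf \<Rightarrow> nat \<Rightarrow> nat \<Rightarrow> ('h, 'c::ab_group_add, 'z) hmodule_scheme \<Rightarrow>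
    ('a \<Rightarrow> 'b \<Rightarrow> ('k, 'h, 'c) pseudo) \<Rightarrow>
    ('k, 'h, 'a) pseudo \<Rightarrow> ('k, 'h, 'b) pseudo \<Rightarrow> ('k, 'h, 'c) pseudo" where
  "pext H n m C \<mu> X Y =
    fext (\<lambda>(F, a). fext (\<lambda>(G, b). fext (\<lambda>(P, c). fext (\<lambda>fg.
      ptens H (n + m) C
        (tcat H (tmul H F (iter_comult H n (fg ! 0))) (tmul H G (iter_comult H m (fg ! 1)))) c)
      P) (\<mu> a b)) Y) X"

text \<open>
  With respect to a basis \<open>B\<close> of \<open>H\<close>: the coefficients \<open>c\<close> with \<open>A = \<Sum>h\<in>B. (h \<otimes> 1) \<otimes>\<^sub>H c h\<close>,
  and the Fourier coefficients.
\<close>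

definition coeffs ::
  "('k::field, 'h::ring_1) hopf \<Rightarrow> 'h set \<Rightarrow> ('h, 'm::ab_group_add, 'z) hmodule_scheme \<Rightarrow>
    ('k, 'h, 'm) pseudo \<Rightarrow> 'h \<Rightarrow> 'm" where
  "coeffs H B M A = (THE c. (\<forall>h. c h \<in> carr M) \<and> {h. c h \<noteq> 0} \<subseteq> B \<and> finite {h. c h \<noteq> 0} \<and>
     A = (\<Sum>h | c h \<noteq> 0. ptens H 2 M (tens H [h, 1]) (c h)))"

definition fourier ::
  "('k::field, 'h::ring_1) hopf \<Rightarrow> 'h set \<Rightarrow> ('h, 'm::ab_group_add, 'z) hmodule_scheme \<Rightarrow>
    ('h \<Rightarrow> 'k) \<Rightarrow> ('k, 'h, 'm) pseudo \<Rightarrow> 'm" where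
  "fourier H B M x A = (\<Sum>h | coeffs H B M A h \<noteq> 0.
     act M (scl H (x (antipode H h)) 1) (coeffs H B M A h))"


section \<open>Pseudoalgebras\<close>

record (overloaded) ('k, 'h, 'm) pseudoalg = "('h, 'm) hmodule" +
  pprod :: "'m \<Rightarrow> 'm \<Rightarrow> ('k, 'h, 'm) pseudo"

definition pseudoalgebra ::
  "('k::field, 'h::ring_1) hopf \<Rightarrow> ('k, 'h, 'm::ab_group_add) pseudoalg \<Rightarrow> bool" where
  "pseudoalgebra H P \<longleftrightarrow> left_module P \<and>
    (\<forall>a\<in>carr P. \<forall>b\<in>carr P. pprod P a b \<in> pseudo H 2 P) \<and>
    (\<forall>a\<in>carr P. \<forall>b\<in>carr P. \<forall>c\<in>carr P. pprod P (a + b) c = pprod P a c + pprod P b c) \<and>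
    (\<forall>a\<in>carr P. \<forall>b\<in>carr P. \<forall>c\<in>carr P. pprod P a (b + c) = pprod P a b + pprod P a c) \<and>
    (\<forall>f g. \<forall>a\<in>carr P. \<forall>b\<in>carr P.
      pprod P (act P f a) (act P g b) = lmul H 2 P (tens H [f, g]) (pprod P a b))"

abbreviation pp ::
  "('k::field, 'h::ring_1) hopf \<Rightarrow> ('k, 'h, 'm::ab_group_add) pseudoalg \<Rightarrow> nat \<Rightarrow> nat \<Rightarrow>
    ('k, 'h, 'm) pseudo \<Rightarrow> ('k, 'h, 'm) pseudo \<Rightarrow> ('k, 'h, 'm) pseudo" where
  "pp H P n m \<equiv> pext H n m P (pprod P)"

definition jordan_pseudoalgebra ::
  "('k::field, 'h::ring_1) hopf \<Rightarrow> ('k, 'h, 'm::ab_group_add) pseudoalg \<Rightarrow> bool" where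
  "jordan_pseudoalgebra H J \<longleftrightarrow> pseudoalgebra H J \<and>
    (\<forall>a\<in>carr J. \<forall>b\<in>carr J. pprod J a b = pperm H 2 J (transpose 0 1) (pprod J b a)) \<and>
    (\<forall>a\<in>carr J. \<forall>b\<in>carr J. \<forall>c\<in>carr J. \<forall>d\<in>carr J.
      pp H J 1 3 (emb H J a) (pp H J 1 2 (emb H J b) (pprod J c d))
      + pperm H 4 J (transpose 0 3) (pp H J 1 3 (emb H J d) (pp H J 1 2 (emb H J b) (pprod J c a)))
      + pperm H 4 J (transpose 0 2) (pp H J 1 3 (emb H J c) (pp H J 1 2 (emb H J b) (pprod J a d)))
      = pp H J 2 2 (pprod J a b) (pprod J c d)
      + pperm H 4 J (transpose 1 2) (pp H J 2 2 (pprod J a c) (pprod J b d))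
      + pperm H 4 J (transpose 1 3) (pp H J 2 2 (pprod J a d) (pprod J c b)))"

definition lie_pseudoalgebra ::
  "('k::field, 'h::ring_1) hopf \<Rightarrow> ('k, 'h, 'm::ab_group_add) pseudoalg \<Rightarrow> bool" where
  "lie_pseudoalgebra H L \<longleftrightarrow> pseudoalgebra H L \<and>
    (\<forall>a\<in>carr L. \<forall>b\<in>carr L. pprod L a b = - pperm H 2 L (transpose 0 1) (pprod L b a)) \<and>
    (\<forall>a\<in>carr L. \<forall>b\<in>carr L. \<forall>c\<in>carr L.
      pp H L 1 2 (emb H L a) (pprod L b c)
      = pp H L 2 1 (pprod L a b) (emb H L c)
      + pperm H 3 L (transpose 0 1) (pp H L 1 2 (emb H L b) (pprod L a c)))"

definition pideal ::
  "('k::field, 'h::ring_1) hopf \<Rightarrow> ('k, 'h, 'm::ab_group_add) pseudoalg \<Rightarrow> 'm set \<Rightarrow> bool" where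
  "pideal H P I \<longleftrightarrow> submodule P I \<and>
    (\<forall>a\<in>I. \<forall>b\<in>carr P.
      pprod P a b \<in> free.span {ptens H 2 P F c | F c. F \<in> tensor_power H 2 \<and> c \<in> I} \<and>
      pprod P b a \<in> free.span {ptens H 2 P F c | F c. F \<in> tensor_power H 2 \<and> c \<in> I})"

definition simple_pseudoalgebra ::
  "('k::field, 'h::ring_1) hopf \<Rightarrow> ('k, 'h, 'm::ab_group_add) pseudoalg \<Rightarrow> bool" where
  "simple_pseudoalgebra H P \<longleftrightarrow>
    (\<exists>a\<in>carr P. \<exists>b\<in>carr P. pprod P a b \<noteq> 0) \<and>
    (\<forall>I. pideal H P I \<longrightarrow> I = {0} \<or> I = carr P)"


section \<open>Conformal endomorphisms and pseudoderivations\<close>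

type_synonym ('k, 'h, 'm) conf = "'m \<Rightarrow> ('k, 'h, 'm) pseudo"

text \<open>Maps on \<open>carr P\<close> are represented by functions that vanish outside of \<open>carr P\<close>.\<close>

definition cend ::
  "('k::field, 'h::ring_1) hopf \<Rightarrow> ('h, 'm::ab_group_add, 'z) hmodule_scheme \<Rightarrow>
    ('h, ('k, 'h, 'm) conf) hmodule" where
  "cend H P = \<lparr>
    carr = {\<phi>. (\<forall>a\<in>carr P. \<phi> a \<in> pseudo H 2 P) \<and> (\<forall>a. a \<notin> carr P \<longrightarrow> \<phi> a = 0) \<and>
      (\<forall>a\<in>carr P. \<forall>b\<in>carr P. \<phi> (a + b) = \<phi> a + \<phi> b) \<and>
      (\<forall>h. \<forall>a\<in>carr P. \<phi> (act P h a) = lmul H 2 P (tens H [1, h]) (\<phi> a))},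
    act = (\<lambda>h \<phi> a. lmul H 2 P (tens H [h, 1]) (\<phi> a))\<rparr>"

text \<open>The extended application \<open>\<Phi> * A\<close>.\<close>

abbreviation capp ::
  "('k::field, 'h::ring_1) hopf \<Rightarrow> ('h, 'm::ab_group_add, 'z) hmodule_scheme \<Rightarrow> nat \<Rightarrow> nat \<Rightarrow>
    ('k, 'h, ('k, 'h, 'm) conf) pseudo \<Rightarrow> ('k, 'h, 'm) pseudo \<Rightarrow> ('k, 'h, 'm) pseudo" where
  "capp H P n m \<equiv> pext H n m P (\<lambda>\<phi> a. \<phi> a)"

definition cend_prod ::
  "('k::field, 'h::ring_1) hopf \<Rightarrow> ('h, 'm::ab_group_add, 'z) hmodule_scheme \<Rightarrow>
    ('k, 'h, 'm) conf \<Rightarrow> ('k, 'h, 'm) conf \<Rightarrow> ('k, 'h, ('k, 'h, 'm) conf) pseudo" where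
  "cend_prod H P \<phi> \<psi> = (THE A. A \<in> pseudo H 2 (cend H P) \<and>
    (\<forall>a\<in>carr P. capp H P 2 1 A (emb H P a) = capp H P 1 2 (emb H (cend H P) \<phi>) (\<psi> a)))"

definition cend_bracket ::
  "('k::field, 'h::ring_1) hopf \<Rightarrow> ('h, 'm::ab_group_add, 'z) hmodule_scheme \<Rightarrow>
    ('k, 'h, 'm) conf \<Rightarrow> ('k, 'h, 'm) conf \<Rightarrow> ('k, 'h, ('k, 'h, 'm) conf) pseudo" where
  "cend_bracket H P \<phi> \<psi> =
    cend_prod H P \<phi> \<psi> - pperm H 2 (cend H P) (transpose 0 1) (cend_prod H P \<psi> \<phi>)"

definition der ::
  "('k::field, 'h::ring_1) hopf \<Rightarrow> ('k, 'h, 'm::ab_group_add) pseudoalg \<Rightarrow>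
    ('h, ('k, 'h, 'm) conf) hmodule" where
  "der H P = \<lparr>
    carr = {T \<in> carr (cend H P). \<forall>a\<in>carr P. \<forall>b\<in>carr P.
      capp H P 1 2 (emb H (cend H P) T) (pprod P a b)
      = pp H P 2 1 (T a) (emb H P b)
      + pperm H 3 P (transpose 0 1) (pp H P 1 2 (emb H P a) (T b))},
    act = act (cend H P)\<rparr>"

definition lmap :: "('k, 'h, 'm) pseudoalg \<Rightarrow> 'm \<Rightarrow> ('k::zero, 'h, 'm) conf" where
  "lmap P a = (\<lambda>b. if b \<in> carr P then pprod P a b else 0)"


section \<open>The structure pseudoalgebra\<close>

text \<open>Pairs \<open>(L\<^sub>a, D)\<close> represent the elements \<open>L\<^sub>a + D\<close> of the formal direct sum.\<close>

definition lmodule ::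
  "('k::field, 'h::ring_1) hopf \<Rightarrow> ('k, 'h, 'm::ab_group_add) pseudoalg \<Rightarrow> ('k, 'h, 'm) conf set" where
  "lmodule H J = generated_submodule (cend H J) (lmap J ` carr J)"

definition str_module ::
  "('k::field, 'h::ring_1) hopf \<Rightarrow> ('k, 'h, 'm::ab_group_add) pseudoalg \<Rightarrow>
    ('h, ('k, 'h, 'm) conf \<times> ('k, 'h, 'm) conf) hmodule" where
  "str_module H J = \<lparr>
    carr = lmodule H J \<times> carr (der H J),
    act = (\<lambda>h (l, D). (act (cend H J) h l, act (cend H J) h D))\<rparr>"

text \<open>\<open>L\<^sub>A\<close> for \<open>A\<close> in \<open>pseudo H 2 J\<close>, and elements of \<open>pseudo H 2 (cend H J)\<close> whose coefficients are
  pseudoderivations, both as elements of \<open>pseudo H 2 (str_module H J)\<close>.\<close>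

definition in_L ::
  "('k::field, 'h::ring_1) hopf \<Rightarrow> ('k, 'h, 'm::ab_group_add) pseudoalg \<Rightarrow>
    ('k, 'h, 'm) pseudo \<Rightarrow> ('k, 'h, ('k, 'h, 'm) conf \<times> ('k, 'h, 'm) conf) pseudo" where
  "in_L H J A = push H 2 (str_module H J) (\<lambda>a. (lmap J a, 0)) A"

definition in_Der ::
  "('k::field, 'h::ring_1) hopf \<Rightarrow> ('k, 'h, 'm::ab_group_add) pseudoalg \<Rightarrow>
    ('k, 'h, ('k, 'h, 'm) conf) pseudo \<Rightarrow>
    ('k, 'h, ('k, 'h, 'm) conf \<times> ('k, 'h, 'm) conf) pseudo" where
  "in_Der H J A = push H 2 (str_module H J) (\<lambda>D. (0, D)) (restr H 2 (der H J) (cend H J) A)"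

text \<open>The bracket of \<open>L\<^sub>a + D\<close> and \<open>L\<^sub>b + T\<close> does not depend on the choice of \<open>a\<close> and \<open>b\<close>.\<close>

definition str_bracket ::
  "('k::field, 'h::ring_1) hopf \<Rightarrow> ('k, 'h, 'm::ab_group_add) pseudoalg \<Rightarrow>
    ('k, 'h, 'm) conf \<times> ('k, 'h, 'm) conf \<Rightarrow> ('k, 'h, 'm) conf \<times> ('k, 'h, 'm) conf \<Rightarrow>
    ('k, 'h, ('k, 'h, 'm) conf \<times> ('k, 'h, 'm) conf) pseudo" where
  "str_bracket H J = (\<lambda>(l, D) (m, T).
    let a = (SOME a. a \<in> carr J \<and> lmap J a = l); b = (SOME b. b \<in> carr J \<and> lmap J b = m) in
      in_L H J (D b) - pperm H 2 (str_module H J) (transpose 0 1) (in_L H J (T a))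
      + in_Der H J (cend_bracket H J (lmap J a) (lmap J b)) + in_Der H J (cend_bracket H J D T))"

definition structure_pseudoalgebra ::
  "('k::field, 'h::ring_1) hopf \<Rightarrow> ('k, 'h, 'm::ab_group_add) pseudoalg \<Rightarrow>
    ('k, 'h, ('k, 'h, 'm) conf \<times> ('k, 'h, 'm) conf) pseudoalg" where
  "structure_pseudoalgebra H J = \<lparr>
    carr = carr (str_module H J), act = act (str_module H J), pprod = str_bracket H J\<rparr>"

definition U_op ::
  "('k::field, 'h::ring_1) hopf \<Rightarrow> ('k, 'h, 'm::ab_group_add) pseudoalg \<Rightarrow> 'm \<Rightarrow> 'm \<Rightarrow>
    ('k, 'h, ('k, 'h, 'm) conf \<times> ('k, 'h, 'm) conf) pseudo" where
  "U_op H J a b = in_L H J (pprod J a b) + in_Der H J (cend_bracket H J (lmap J a) (lmap J b))"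

definition U_star ::
  "('k::field, 'h::ring_1) hopf \<Rightarrow> ('k, 'h, 'm::ab_group_add) pseudoalg \<Rightarrow> 'm \<Rightarrow> 'm \<Rightarrow>
    ('k, 'h, ('k, 'h, 'm) conf \<times> ('k, 'h, 'm) conf) pseudo" where
  "U_star H J a b = - in_L H J (pprod J a b) + in_Der H J (cend_bracket H J (lmap J a) (lmap J b))"

definition S0 ::
  "('k::field, 'h::ring_1) hopf \<Rightarrow> 'h set \<Rightarrow> ('k, 'h, 'm::ab_group_add) pseudoalg \<Rightarrow>
    (('k, 'h, 'm) conf \<times> ('k, 'h, 'm) conf) set" where
  "S0 H B J = linear_span H (structure_pseudoalgebra H J)
    {(lmap J (fourier H B J x (pprod J a b)),
      fourier H B (cend H J) x (cend_bracket H J (lmap J a) (lmap J b)))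
     | a b x. a \<in> carr J \<and> b \<in> carr J \<and> x \<in> dual H}"


section \<open>The Tits--Kantor--Koecher construction\<close>

type_synonym ('k, 'h, 'm) tkk = "'m \<times> (('k, 'h, 'm) conf \<times> ('k, 'h, 'm) conf) \<times> 'm"

text \<open>
  A triple \<open>(a, \<Sigma>, b)\<close> represents the sum of \<open>a\<close> in the minus copy of \<open>J\<close>, of \<open>\<Sigma>\<close>, and of \<open>b\<close> in the
  plus copy. The bracket is first written down with coefficients in the direct sum of the two copies
  of \<open>J\<close> with the whole structure pseudoalgebra; its coefficients lie in \<open>tkk_module H B J\<close>.
\<close>

definition tkk_ambient ::
  "('k::field, 'h::ring_1) hopf \<Rightarrow> ('k, 'h, 'm::ab_group_add) pseudoalg \<Rightarrow>
    ('h, ('k, 'h, 'm) tkk) hmodule" where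
  "tkk_ambient H J = \<lparr>
    carr = carr J \<times> carr (structure_pseudoalgebra H J) \<times> carr J,
    act = (\<lambda>h (a, \<Sigma>, b). (act J h a, act (structure_pseudoalgebra H J) h \<Sigma>, act J h b))\<rparr>"

definition tkk_module ::
  "('k::field, 'h::ring_1) hopf \<Rightarrow> 'h set \<Rightarrow> ('k, 'h, 'm::ab_group_add) pseudoalg \<Rightarrow>
    ('h, ('k, 'h, 'm) tkk) hmodule" where
  "tkk_module H B J = \<lparr>
    carr = carr J \<times> S0 H B J \<times> carr J, act = act (tkk_ambient H J)\<rparr>"

definition str_app ::
  "('k::field, 'h, 'm) conf \<times> ('k, 'h, 'm) conf \<Rightarrow> 'm \<Rightarrow> ('k, 'h, 'm) pseudo" where
  "str_app = (\<lambda>(l, D) a. l a + D a)"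

definition str_star ::
  "('k::field, 'h, 'm) conf \<times> ('k, 'h, 'm) conf \<Rightarrow> ('k, 'h, 'm) conf \<times> ('k, 'h, 'm) conf" where
  "str_star = (\<lambda>(l, D). (- l, D))"

definition tkk_bracket ::
  "('k::field, 'h::ring_1) hopf \<Rightarrow> ('k, 'h, 'm::ab_group_add) pseudoalg \<Rightarrow>
    ('k, 'h, 'm) tkk \<Rightarrow> ('k, 'h, 'm) tkk \<Rightarrow> ('k, 'h, ('k, 'h, 'm) tkk) pseudo" where
  "tkk_bracket H J = (\<lambda>(a, \<Sigma>, b) (a', \<Sigma>', b').
    push H 2 (tkk_ambient H J) (\<lambda>c. (c, 0, 0))
      (str_app \<Sigma> a' - pperm H 2 J (transpose 0 1) (str_app \<Sigma>' a))
    + push H 2 (tkk_ambient H J) (\<lambda>\<Theta>. (0, \<Theta>, 0))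
      (pprod (structure_pseudoalgebra H J) \<Sigma> \<Sigma>' + U_op H J a b' + U_star H J b a')
    + push H 2 (tkk_ambient H J) (\<lambda>c. (0, 0, c))
      (str_app (str_star \<Sigma>) b' - pperm H 2 J (transpose 0 1) (str_app (str_star \<Sigma>') b)))"

definition TKK ::
  "('k::field, 'h::ring_1) hopf \<Rightarrow> 'h set \<Rightarrow> ('k, 'h, 'm::ab_group_add) pseudoalg \<Rightarrow>
    ('k, 'h, ('k, 'h, 'm) tkk) pseudoalg" where
  "TKK H B J = \<lparr>
    carr = carr (tkk_module H B J), act = act (tkk_module H B J),
    pprod = (\<lambda>x y. restr H 2 (tkk_module H B J) (tkk_ambient H J) (tkk_bracket H J x y))\<rparr>"

end

theory Submission imports Defs begin

text \<open>
  The tensor products over \<open>H\<close> are embedded into spaces of words with labelled letters, on which every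
  \<open>H\<close>-bilinear pseudoproduct becomes an ordinary bilinear product. There the Jordan identity is the
  linearised Jordan identity of a commutative algebra, pseudoderivations are derivations, and the Jacobi
  identity of \<open>T(J)\<close> reduces to the classical calculation with the operators \<open>V\<^sub>a\<^sub>,\<^sub>b\<close> of the Jordan triple
  product.

  If \<open>J\<close> is simple, it is generated by the coefficients of products. The sum and the difference of \<open>U\<^sub>a\<^sub>,\<^sub>b\<close>
  and of its transpose \<open>\<sigma>\<^sub>1\<^sub>2 U\<^sub>b\<^sub>,\<^sub>a\<close> are \<open>2 L\<close> and \<open>2 [L, L]\<close>, hence \<open>S\<^sub>0(J)\<close> is the direct sum of \<open>L(J)\<close> and of the
  inner pseudoderivations, and the generators of \<open>J\<close> yield those of \<open>T(J)\<close>. Let \<open>I\<close> be an ideal of \<open>T(J)\<close>.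
  The elements of \<open>J\<^sup>-\<close> in \<open>I\<close> form an ideal of \<open>J\<close>. If this is \<open>J\<close>, then \<open>I\<close> contains the coefficients of
  \<open>[J\<^sup>- * J\<^sup>+]\<close>, which generate \<open>S\<^sub>0(J)\<close>, and then \<open>J\<^sup>+\<close>. Otherwise \<open>I\<close> does not meet \<open>J\<^sup>-\<close>; if a component in
  \<open>J\<^sup>+\<close> of an element of \<open>I\<close> were nonzero, then brackets with \<open>J\<^sup>-\<close> would show that \<open>S\<^sub>0(J)\<close> acts on \<open>J\<^sup>-\<close> by
  zero, and once these components vanish, brackets with \<open>J\<^sup>-\<close> and \<open>J\<^sup>+\<close> show that \<open>I = 0\<close>.
\<close>

section \<open>Linear extension\<close>

text \<open>A tensor is stored as a chosen representative of its class, so every map out of a tensor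
  product must be shown to be independent of that choice. Such maps are described by their values on
  pure tensors; linearity in each slot and compatibility with \<open>H\<close> are what has to be
  proved. Cocommutativity makes the action of \<open>H\<close> on a word independent of the order of
  its letters, so that permuting tensor factors is the same as permuting words. Submodules and
  single coefficients are not visible on words; they are reached by slicing off tensor factors,
  which the antipode makes possible. Finite generation of \<open>J\<close> is used to form products
  of conformal endomorphisms, whose coefficients must be finite in number. The part of an identity
  of \<open>T(J)\<close> in \<open>S0 H B J\<close> is checked on \<open>J\<close>: an element
  \<open>L + D\<close> acts on the two copies by \<open>D + L\<close> and \<open>D - L\<close>,
  which determine \<open>2 L\<close> and \<open>2 D\<close>, and here characteristic zero enters. In
  the simplicity proof, a zero action of \<open>S0 H B J\<close> is absurd because
  \<open>S0 H B J\<close> contains every \<open>L_a\<close> and the product of \<open>J\<close> is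
  not zero.\<close>

definition flin :: "(('x \<Rightarrow>\<^sub>0 'k::field) \<Rightarrow> ('y \<Rightarrow>\<^sub>0 'k)) \<Rightarrow> bool" where
  "flin L \<longleftrightarrow> (\<forall>x y. L (x + y) = L x + L y) \<and> (\<forall>c x. L (fscale c x) = fscale c (L x))"

lemma linear_imp_flin: "Vector_Spaces.linear fscale fscale L \<Longrightarrow> flin L"
  unfolding flin_def by (metis Vector_Spaces.linear_iff)

lemma flinD: assumes "flin L"
  shows "L (x + y) = L x + L y" "L (fscale c x) = fscale c (L x)" "L 0 = 0" "L (- x) = - L x"
    "L (x - y) = L x - L y"
proof -
  show *: "L (x + y) = L x + L y" "L (fscale c x) = fscale c (L x)" for x y c
    using assms by (auto simp: flin_def)
  show 0: "L 0 = 0" using *(1)[of 0 0] by simp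
  show m: "L (- x) = - L x" for x using *(1)[of x "- x"] 0 by (simp add: eq_neg_iff_add_eq_0 add.commute)
  show "L (x - y) = L x - L y" using *(1)[of x "- y"] m by simp
qed

lemma flin_sum: "flin L \<Longrightarrow> L (sum f A) = (\<Sum>x\<in>A. L (f x))"
  by (induction A rule: infinite_finite_induct) (auto simp: flinD)

lemma fext_superset:
  assumes "finite K" "Poly_Mapping.keys f \<subseteq> K"
  shows "fext g f = (\<Sum>x\<in>K. fscale (Poly_Mapping.lookup f x) (g x))"
  unfolding lin_ext_def using assms
  by (intro sum.mono_neutral_left) (auto simp: in_keys_iff)

lemma fext_add: "fext g (x + y) = fext g x + fext g y"
proof -
  let ?K = "Poly_Mapping.keys x \<union> Poly_Mapping.keys y"
  have "Poly_Mapping.keys (x + y) \<subseteq> ?K" by (rule keys_add)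
  then show ?thesis
    by (simp add: fext_superset[of ?K] lookup_add free.scale_left_distrib sum.distrib)
qed

lemma fext_scale: "fext g (fscale c x) = fscale c (fext g x)"
proof -
  have "Poly_Mapping.keys (fscale c x) \<subseteq> Poly_Mapping.keys x"
    by (auto simp: in_keys_iff lookup_fscale)
  then show ?thesis
    by (simp add: fext_superset[of "Poly_Mapping.keys x"] lookup_fscale free.scale_sum_right)
qed

lemma flin_fext: "flin (fext g)"
  by (simp add: flin_def fext_add fext_scale)

lemmas fext_diff = flinD(5)[OF flin_fext]
  and fext_zero [simp] = flinD(3)[OF flin_fext]

lemma fext_single [simp]: "fext g (Poly_Mapping.single x 1) = g x"
  by (simp add: lin_ext_def)

lemma fext_cong: "(\<And>x. x \<in> Poly_Mapping.keys f \<Longrightarrow> g x = g' x) \<Longrightarrow> fext g f = fext g' f"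
  by (simp add: lin_ext_def)

lemma fext_add_fun: "fext (\<lambda>x. g x + g' x) f = fext g f + fext g' f"
  by (simp add: lin_ext_def free.scale_right_distrib sum.distrib)

lemma fext_scale_fun: "fext (\<lambda>x. fscale c (g x)) f = fscale c (fext g f)"
  by (simp add: lin_ext_def free.scale_sum_right mult.commute)

lemma fext_zero_fun [simp]: "fext (\<lambda>x. 0) f = 0"
  by (simp add: lin_ext_def)

lemma flin_fext_comm: "flin L \<Longrightarrow> L (fext g f) = fext (\<lambda>x. L (g x)) f"
  by (simp add: lin_ext_def flin_sum flinD)

lemma fext_fext: "fext g (fext h f) = fext (\<lambda>x. fext g (h x)) f"
  by (rule flin_fext_comm[OF flin_fext])

text \<open>Fubini for formal sums. The interchanges of Sweedler sums and of actions on words below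
  reduce to it once these are written as \<open>fext\<close>.\<close>

lemma fext_swap: "fext (\<lambda>x. fext (\<lambda>y. g x y) q) p = fext (\<lambda>y. fext (\<lambda>x. g x y) p) q"
proof -
  have "fext (\<lambda>x. fext (\<lambda>y. g x y) q) p
      = (\<Sum>x\<in>Poly_Mapping.keys p. \<Sum>y\<in>Poly_Mapping.keys q.
          fscale (Poly_Mapping.lookup p x * Poly_Mapping.lookup q y) (g x y))"
    by (simp add: lin_ext_def free.scale_sum_right)
  also have "\<dots> = (\<Sum>y\<in>Poly_Mapping.keys q. \<Sum>x\<in>Poly_Mapping.keys p.
          fscale (Poly_Mapping.lookup p x * Poly_Mapping.lookup q y) (g x y))"
    by (rule sum.swap)
  also have "\<dots> = fext (\<lambda>y. fext (\<lambda>x. g x y) p) q"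
    by (simp add: lin_ext_def free.scale_sum_right mult.commute)
  finally show ?thesis .
qed

lemma fext_id: "fext (\<lambda>x. Poly_Mapping.single x 1) f = f"
proof -
  have "Poly_Mapping.lookup (fext (\<lambda>x. Poly_Mapping.single x 1) f) y = Poly_Mapping.lookup f y" for y
    by (simp add: lin_ext_def lookup_sum lookup_fscale lookup_single when_def in_keys_iff sum.delta' if_distrib
        cong: if_cong)
  then show ?thesis by (intro poly_mapping_eqI) auto
qed

lemma flin_as_fext: "flin L \<Longrightarrow> L f = fext (\<lambda>x. L (Poly_Mapping.single x 1)) f"
  by (metis flin_fext_comm fext_id)

lemma flin_zero_on_span:
  assumes "flin L" "\<And>x. x \<in> X \<Longrightarrow> L x = 0" "y \<in> free.span X" shows "L y = 0"
  using assms(3)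
  by (rule free.span_induct) (auto intro!: free.subspaceI simp: flinD[OF assms(1)] assms(2))

lemma flin_in_span:
  assumes "flin L" "\<And>x. x \<in> X \<Longrightarrow> L x \<in> V" "free.subspace V" "y \<in> free.span X" shows "L y \<in> V"
  using assms(4)
  by (rule free.span_induct)
    (auto intro!: free.subspaceI free.subspace_add[OF assms(3)] free.subspace_scale[OF assms(3)]
      free.subspace_0[OF assms(3)] simp: flinD[OF assms(1)] assms(2))

lemma fext_mem:
  assumes "free.subspace V" "\<And>x. x \<in> Poly_Mapping.keys f \<Longrightarrow> g x \<in> V" shows "fext g f \<in> V"
  unfolding lin_ext_def
  by (intro free.subspace_sum free.subspace_scale assms)

lemma flin_eq_on_span:
  assumes "flin L" "flin L'" "\<And>x. x \<in> X \<Longrightarrow> L x = L' x" "y \<in> free.span X" shows "L y = L' y"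
proof -
  have "flin (\<lambda>x. L x - L' x)"
    using assms(1,2) by (simp add: flin_def free.scale_right_diff_distrib)
  from flin_zero_on_span[OF this _ assms(4)] show ?thesis using assms(3) by simp
qed

lemma formal_single [simp]: "Poly_Mapping.single x 1 \<in> formal S \<longleftrightarrow> x \<in> S"
  by (simp add: formal_def)

lemma span_formal: "X \<subseteq> formal S \<Longrightarrow> free.span X \<subseteq> formal S"
  by (rule free.span_minimal[OF _ subspace_formal])

lemma formal_diff: "f \<in> formal S \<Longrightarrow> g \<in> formal S \<Longrightarrow> f - g \<in> formal S"
  by (rule free.subspace_diff[OF subspace_formal])

lemma formal_scale: "f \<in> formal S \<Longrightarrow> fscale c f \<in> formal S"
  by (rule free.subspace_scale[OF subspace_formal])

text \<open>The representative differs from \<open>f\<close> by an element of \<open>N\<close>,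
  which \<open>L\<close> kills. This is the universal property of the quotient in a form that
  evaluates representatives.\<close>

lemma qmap_universal:
  assumes N: "free.subspace N" "N \<subseteq> formal S" and L: "flin L" "\<And>x. x \<in> N \<Longrightarrow> L x = 0"
    and f: "f \<in> formal S"
  shows "L (qmap S N f) = L f"
proof -
  have "L (qmap S N f - f) = 0" using qmap_rep[OF N f] L(2) by blast
  then show ?thesis by (simp add: flinD[OF L(1)])
qed

section \<open>Tensor powers of a cocommutative Hopf algebra\<close>

locale cocommutative_hopf =
  fixes H :: "('k::field, 'h::ring_1) hopf"
  assumes cocommutative: "cocommutative_hopf_algebra H"
begin

lemma scl_rules:
  "scl H c (a + b) = scl H c a + scl H c b" "scl H (c + d) a = scl H c a + scl H d a"
  "scl H c (scl H d a) = scl H (c * d) a" "scl H 1 a = a"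
  "scl H c a * b = scl H c (a * b)" "a * scl H c b = scl H c (a * b)"
proof -
  have "vector_space (scl H)" using cocommutative by (simp add: cocommutative_hopf_algebra_def)
  then interpret vector_space "scl H" .
  show "scl H c (a + b) = scl H c a + scl H c b" "scl H (c + d) a = scl H c a + scl H d a"
    "scl H c (scl H d a) = scl H (c * d) a" "scl H 1 a = a"
    by (simp_all add: scale_right_distrib scale_left_distrib)
  show "scl H c a * b = scl H c (a * b)" "a * scl H c b = scl H c (a * b)"
    using cocommutative by (simp_all add: cocommutative_hopf_algebra_def)
qed

lemma scl_zero [simp]: "scl H c 0 = 0" "scl H 0 a = 0"
  using scl_rules(1)[of c 0 0] scl_rules(2)[of 0 0 a] by simp_all

definition hlin :: "('h \<Rightarrow> ('x \<Rightarrow>\<^sub>0 'k)) \<Rightarrow> bool" where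
  "hlin f \<longleftrightarrow> (\<forall>a b. f (a + b) = f a + f b) \<and> (\<forall>c a. f (scl H c a) = fscale c (f a))"

lemma hlinD: assumes "hlin f"
  shows "f (a + b) = f a + f b" "f (scl H c a) = fscale c (f a)" "f 0 = 0"
  using assms by (auto simp: hlin_def) (metis add_cancel_left_left add_0)

lemma hlinI: "(\<And>a b. f (a + b) = f a + f b) \<Longrightarrow> (\<And>c a. f (scl H c a) = fscale c (f a)) \<Longrightarrow> hlin f"
  by (simp add: hlin_def)

lemma hlin_fext: "(\<And>x. hlin (\<lambda>a. g a x)) \<Longrightarrow> hlin (\<lambda>a. fext (g a) p)"
proof (rule hlinI)
  assume g: "\<And>x. hlin (\<lambda>a. g a x)"
  show "fext (g (a + b)) p = fext (g a) p + fext (g b) p" for a b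
    unfolding fext_add_fun[symmetric] by (rule fext_cong) (rule hlinD(1)[OF g])
  show "fext (g (scl H c a)) p = fscale c (fext (g a) p)" for c a
    unfolding fext_scale_fun[symmetric] by (rule fext_cong) (rule hlinD(2)[OF g])
qed

lemma hlin_flin: "flin L \<Longrightarrow> hlin f \<Longrightarrow> hlin (\<lambda>a. L (f a))"
  by (simp add: hlin_def flin_def)

lemma hlin_mult: "hlin f \<Longrightarrow> hlin (\<lambda>a. f (x * a))" "hlin f \<Longrightarrow> hlin (\<lambda>a. f (a * x))"
  by (simp_all add: hlin_def distrib_left distrib_right scl_rules)

lemma hlin_fscale: "hlin f \<Longrightarrow> hlin (\<lambda>a. fscale c (f a))"
  by (simp add: hlin_def free.scale_right_distrib mult.commute)

lemma hlin_zero: "hlin (\<lambda>a. 0)"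
  by (simp add: hlin_def)

text \<open>These are the functions on lists of length \<open>n\<close> that factor through the
  \<open>n\<close>-th tensor power; nothing is required of lists of other lengths.\<close>

definition mlin :: "nat \<Rightarrow> ('h list \<Rightarrow> ('x \<Rightarrow>\<^sub>0 'k)) \<Rightarrow> bool" where
  "mlin n G \<longleftrightarrow> (\<forall>xs ys. Suc (length xs + length ys) = n \<longrightarrow> hlin (\<lambda>a. G (xs @ a # ys)))"

lemma mlinD: "mlin n G \<Longrightarrow> Suc (length xs + length ys) = n \<Longrightarrow> hlin (\<lambda>a. G (xs @ a # ys))"
  by (simp add: mlin_def)

lemma mlin_flin: "flin L \<Longrightarrow> mlin n G \<Longrightarrow> mlin n (\<lambda>xs. L (G xs))"
  unfolding mlin_def by (intro allI impI) (rule hlin_flin, auto)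

lemma mlin_append1: "mlin (n + m) G \<Longrightarrow> length ys = m \<Longrightarrow> mlin n (\<lambda>xs. G (xs @ ys))"
  unfolding mlin_def
proof (intro allI impI)
  fix u v :: "'h list"
  assume a: "\<forall>xs ys. Suc (length xs + length ys) = n + m \<longrightarrow> hlin (\<lambda>a. G (xs @ a # ys))"
    "length ys = m" "Suc (length u + length v) = n"
  then show "hlin (\<lambda>a. G ((u @ a # v) @ ys))"
    using a(1)[rule_format, of u "v @ ys"] by simp
qed

lemma mlin_append2: "mlin (n + m) G \<Longrightarrow> length xs = n \<Longrightarrow> mlin m (\<lambda>ys. G (xs @ ys))"
  unfolding mlin_def
proof (intro allI impI)
  fix u v :: "'h list"
  assume a: "\<forall>xs ys. Suc (length xs + length ys) = n + m \<longrightarrow> hlin (\<lambda>a. G (xs @ a # ys))"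
    "length xs = n" "Suc (length u + length v) = m"
  then show "hlin (\<lambda>a. G (xs @ u @ a # v))"
    using a(1)[rule_format, of "xs @ u" v] by simp
qed

lemma mlin_Cons: "mlin (Suc n) G \<Longrightarrow> mlin n (\<lambda>xs. G (a # xs))"
  using mlin_append2[of 1 n G "[a]"] by simp

lemma mlin_hd: "mlin (Suc n) G \<Longrightarrow> length ys = n \<Longrightarrow> hlin (\<lambda>a. G (a # ys))"
  using mlinD[of "Suc n" G "[]" ys] by simp

lemma mlin_fext: "(\<And>x. mlin n (\<lambda>xs. g xs x)) \<Longrightarrow> mlin n (\<lambda>xs. fext (g xs) p)"
  unfolding mlin_def by (intro allI impI hlin_fext) auto

lemma mlin_SucI:
  assumes "\<And>ys. length ys = n \<Longrightarrow> hlin (\<lambda>a. G (a # ys))" "\<And>a. mlin n (\<lambda>xs. G (a # xs))"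
  shows "mlin (Suc n) G"
  unfolding mlin_def
proof (intro allI impI)
  fix xs ys :: "'h list" assume l: "Suc (length xs + length ys) = Suc n"
  show "hlin (\<lambda>a. G (xs @ a # ys))"
  proof (cases xs)
    case Nil then show ?thesis using assms(1)[of ys] l by simp
  next
    case (Cons x xs') then show ?thesis using mlinD[OF assms(2)[of x], of xs' ys] l by simp
  qed
qed

lemma mlin_0: "mlin 0 G"
  by (simp add: mlin_def)

lemma tensor_rels_subspace: "free.subspace (tensor_rels H n)"
  by (simp add: tensor_rels_def)

lemma tensor_rels_formal: "tensor_rels H n \<subseteq> formal {xs. length xs = n}"
  unfolding tensor_rels_def
  by (rule span_formal) (auto intro!: formal_diff formal_scale)

lemmas tensor_rels_facts = tensor_rels_subspace tensor_rels_formal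

lemma fext_tensor_rels:
  assumes "mlin n G" "f \<in> tensor_rels H n" shows "fext G f = 0"
  using assms(2) unfolding tensor_rels_def
proof (rule flin_zero_on_span[OF flin_fext, rotated])
  fix x assume "x \<in> {Poly_Mapping.single (xs @ (a + b) # ys) 1 - Poly_Mapping.single (xs @ a # ys) 1
        - Poly_Mapping.single (xs @ b # ys) 1 | xs a b ys. Suc (length xs + length ys) = n} \<union>
     {Poly_Mapping.single (xs @ scl H c a # ys) 1 - fscale c (Poly_Mapping.single (xs @ a # ys) 1)
        | xs c a ys. Suc (length xs + length ys) = n}"
  then show "fext G x = 0"
    using hlinD[OF mlinD[OF assms(1)]] by (auto simp: fext_diff fext_scale)
qed

text \<open>\<open>tens H xs\<close> is a representative that may involve many lists. A multilinear
  function vanishes on the relators, so its extension still takes the value at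
  \<open>xs\<close>.\<close>

lemma fext_tens: "mlin n G \<Longrightarrow> length xs = n \<Longrightarrow> fext G (tens H xs) = G xs"
  unfolding tens_def
  by (subst qmap_universal[OF tensor_rels_facts flin_fext])
    (auto simp: fext_tensor_rels)

lemma tens_in_tensor_power [simp]: "length xs = n \<Longrightarrow> tens H xs \<in> tensor_power H n"
  unfolding tensor_power_def tens_def by (auto intro!: imageI)

lemma subspace_tensor_power: "free.subspace (tensor_power H n)"
  unfolding tensor_power_def
  by (rule module_hom.subspace_image[OF Vector_Spaces.linear.axioms(3)[OF linear_qmap[OF tensor_rels_facts]] subspace_formal])

lemma keys_tensor_power: "F \<in> tensor_power H n \<Longrightarrow> xs \<in> Poly_Mapping.keys F \<Longrightarrow> length xs = n"
  unfolding tensor_power_def using qmap_formal[OF tensor_rels_facts] by (fastforce simp: formal_def)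

lemma keys_tens: "xs \<in> Poly_Mapping.keys (tens H ys) \<Longrightarrow> length xs = length ys"
  by (rule keys_tensor_power[OF tens_in_tensor_power[OF refl]])

lemma mlin_tens: "mlin n (tens H)"
  unfolding mlin_def
proof (intro allI impI hlinI)
  fix xs ys :: "'h list" and a b c assume n: "Suc (length xs + length ys) = n"
  let ?q = "qmap {xs. length xs = n} (tensor_rels H n)"
  have q: "flin ?q" by (rule linear_imp_flin[OF linear_qmap[OF tensor_rels_facts]])
  have t: "tens H (xs @ d # ys) = ?q (Poly_Mapping.single (xs @ d # ys) 1)" for d
    using n by (simp add: tens_def)
  have "?q (Poly_Mapping.single (xs @ (a + b) # ys) 1 - Poly_Mapping.single (xs @ a # ys) 1
        - Poly_Mapping.single (xs @ b # ys) 1) = 0"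
    using n unfolding tensor_rels_def
    by (intro qmap_zero[OF tensor_rels_facts, unfolded tensor_rels_def] free.span_base) blast
  then show "tens H (xs @ (a + b) # ys) = tens H (xs @ a # ys) + tens H (xs @ b # ys)"
    unfolding t flinD[OF q] by (simp add: algebra_simps)
  have "?q (Poly_Mapping.single (xs @ scl H c a # ys) 1
      - fscale c (Poly_Mapping.single (xs @ a # ys) 1)) = 0"
    using n unfolding tensor_rels_def
    by (intro qmap_zero[OF tensor_rels_facts, unfolded tensor_rels_def] free.span_base) blast
  then show "tens H (xs @ scl H c a # ys) = fscale c (tens H (xs @ a # ys))"
    unfolding t flinD[OF q] by simp
qed

text \<open>Both sides represent the same class, and since \<open>qmap\<close> chooses
  representatives linearly they are equal and not merely congruent.\<close>

lemma fext_tens_id: "F \<in> tensor_power H n \<Longrightarrow> fext (tens H) F = F"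
proof -
  assume "F \<in> tensor_power H n"
  then obtain f where f: "f \<in> formal {xs. length xs = n}" "F = qmap {xs. length xs = n} (tensor_rels H n) f"
    unfolding tensor_power_def by auto
  let ?q = "qmap {xs. length xs = n} (tensor_rels H n)"
  have q: "flin ?q" by (rule linear_imp_flin[OF linear_qmap[OF tensor_rels_facts]])
  have "fext (tens H) F = fext (tens H) f"
    unfolding f(2) by (rule qmap_universal[OF tensor_rels_facts flin_fext _ f(1)])
      (rule fext_tensor_rels[OF mlin_tens])
  also have "\<dots> = fext (\<lambda>x. ?q (Poly_Mapping.single x 1)) f"
    using f(1) by (intro fext_cong) (auto simp: formal_def tens_def)
  also have "\<dots> = ?q f" by (rule flin_as_fext[OF q, symmetric])
  finally show ?thesis using f(2) by simp
qed

lemma tensor_power_span: "tensor_power H n = free.span (tens H ` {xs. length xs = n})"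
proof
  show "free.span (tens H ` {xs. length xs = n}) \<subseteq> tensor_power H n"
    by (rule free.span_minimal[OF _ subspace_tensor_power]) auto
  show "tensor_power H n \<subseteq> free.span (tens H ` {xs. length xs = n})"
  proof
    fix F assume F: "F \<in> tensor_power H n"
    have "fext (tens H) F \<in> free.span (tens H ` {xs. length xs = n})"
      using keys_tensor_power[OF F] by (intro fext_mem free.subspace_span free.span_base) auto
    then show "F \<in> free.span (tens H ` {xs. length xs = n})" by (simp add: fext_tens_id[OF F])
  qed
qed

lemma tensor_power_eqI:
  assumes "flin L" "flin L'" "\<And>xs. length xs = n \<Longrightarrow> L (tens H xs) = L' (tens H xs)" "F \<in> tensor_power H n"
  shows "L F = L' F"
  by (rule flin_eq_on_span[OF assms(1,2) _ assms(4)[unfolded tensor_power_span]]) (use assms(3) in auto)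

lemma mlin_map2: "mlin n G \<Longrightarrow> length xs = n \<Longrightarrow> mlin n (\<lambda>ys. G (map2 (*) xs ys))"
  unfolding mlin_def
proof (intro allI impI)
  fix u v :: "'h list"
  assume a: "\<forall>xs ys. Suc (length xs + length ys) = n \<longrightarrow> hlin (\<lambda>a. G (xs @ a # ys))"
    "length xs = n" "Suc (length u + length v) = n"
  define x1 x x2 where "x1 = take (length u) xs" "x = xs ! length u" "x2 = drop (Suc (length u)) xs"
  have "xs = x1 @ x # x2" "length x1 = length u" "length x2 = length v"
    using a(2,3) by (auto simp: x1_x_x2_def id_take_nth_drop)
  then show "hlin (\<lambda>a. G (map2 (*) xs (u @ a # v)))"
    using hlin_mult(1)[OF a(1)[rule_format, of "map2 (*) x1 u" "map2 (*) x2 v"], of x] a(3)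
    by simp
qed

lemma mlin_map2': "mlin n G \<Longrightarrow> length ys = n \<Longrightarrow> mlin n (\<lambda>xs. G (map2 (*) xs ys))"
  unfolding mlin_def
proof (intro allI impI)
  fix u v :: "'h list"
  assume a: "\<forall>xs ys. Suc (length xs + length ys) = n \<longrightarrow> hlin (\<lambda>a. G (xs @ a # ys))"
    "length ys = n" "Suc (length u + length v) = n"
  define x1 x x2 where "x1 = take (length u) ys" "x = ys ! length u" "x2 = drop (Suc (length u)) ys"
  have "ys = x1 @ x # x2" "length x1 = length u" "length x2 = length v"
    using a(2,3) by (auto simp: x1_x_x2_def id_take_nth_drop)
  then show "hlin (\<lambda>a. G (map2 (*) (u @ a # v) ys))"
    using hlin_mult(2)[OF a(1)[rule_format, of "map2 (*) u x1" "map2 (*) v x2"], of x] a(3)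
    by simp
qed

lemma flin_tmul: "flin (\<lambda>F. tmul H F G)" "flin (tmul H F)"
  unfolding tmul_def flin_def by (simp_all add: fext_add fext_scale fext_add_fun fext_scale_fun)

lemma flin_tcat: "flin (\<lambda>F. tcat H F G)" "flin (tcat H F)"
  unfolding tcat_def flin_def by (simp_all add: fext_add fext_scale fext_add_fun fext_scale_fun)

lemma flin_tperm: "flin (tperm H \<sigma>)"
  unfolding tperm_def by (rule flin_fext)

lemma fext_tmul:
  assumes k: "mlin n k" and "length fs = n" "F \<in> tensor_power H n"
  shows "fext k (tmul H (tens H fs) F) = fext (\<lambda>ys. k (map2 (*) fs ys)) F"
proof -
  have "fext k (tmul H (tens H fs) F)
      = fext (\<lambda>xs. fext (\<lambda>ys. fext k (tens H (map2 (*) xs ys))) F) (tens H fs)"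
    by (simp add: tmul_def fext_fext)
  also have "\<dots> = fext (\<lambda>xs. fext (\<lambda>ys. k (map2 (*) xs ys)) F) (tens H fs)"
    using assms keys_tens keys_tensor_power[OF assms(3)] by (intro fext_cong fext_tens[OF k]) auto
  also have "\<dots> = fext (\<lambda>ys. fext (\<lambda>xs. k (map2 (*) xs ys)) (tens H fs)) F"
    by (rule fext_swap)
  also have "\<dots> = fext (\<lambda>ys. k (map2 (*) fs ys)) F"
    using assms keys_tensor_power[OF assms(3)]
    by (intro fext_cong fext_tens[OF mlin_map2'[OF k]]) auto
  finally show ?thesis .
qed

lemma tmul_tens: "length fs = length gs \<Longrightarrow> tmul H (tens H fs) (tens H gs) = tens H (map2 (*) fs gs)"
proof -
  assume l: "length fs = length gs"
  have "tmul H (tens H fs) (tens H gs) = fext (\<lambda>xs. fext (\<lambda>ys. tens H (map2 (*) xs ys)) (tens H gs)) (tens H fs)"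
    by (simp add: tmul_def)
  also have "\<dots> = fext (\<lambda>xs. tens H (map2 (*) xs gs)) (tens H fs)"
    using l keys_tens by (intro fext_cong fext_tens[OF mlin_map2[OF mlin_tens]]) auto
  also have "\<dots> = tens H (map2 (*) fs gs)"
    using l by (intro fext_tens[OF mlin_map2'[OF mlin_tens]]) auto
  finally show ?thesis .
qed

lemma tmul_in [simp]:
  assumes "F \<in> tensor_power H n" "G \<in> tensor_power H n" shows "tmul H F G \<in> tensor_power H n"
  unfolding tmul_def using keys_tensor_power[OF assms(1)] keys_tensor_power[OF assms(2)]
  by (intro fext_mem subspace_tensor_power tens_in_tensor_power) auto

lemma tcat_in [simp]:
  assumes "F \<in> tensor_power H n" "G \<in> tensor_power H m" shows "tcat H F G \<in> tensor_power H (n + m)"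
  unfolding tcat_def using keys_tensor_power[OF assms(1)] keys_tensor_power[OF assms(2)]
  by (intro fext_mem subspace_tensor_power tens_in_tensor_power) auto

lemma mlin_permute_list:
  assumes "mlin n G" "\<sigma> permutes {..<n}" shows "mlin n (\<lambda>xs. G (permute_list \<sigma> xs))"
  unfolding mlin_def
proof (intro allI impI)
  fix u v :: "'h list"
  assume n: "Suc (length u + length v) = n"
  obtain j where j: "j < n" "\<sigma> j = length u"
    using permutes_surj[OF assms(2)] permutes_in_image[OF assms(2)] n
    by (metis less_add_Suc1 lessThan_iff surjD)
  \<comment> \<open>The entry 0 is a placeholder for the varying slot. After the permutation that
    slot sits at the position \<open>j\<close> with \<open>\<sigma> j = length u\<close>, and the
    other entries do not depend on it.\<close>
  define w where "w = permute_list \<sigma> (u @ 0 # v)"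
  have "permute_list \<sigma> (u @ a # v) = take j w @ a # drop (Suc j) w" for a
  proof (rule nth_equalityI)
    show len: "length (permute_list \<sigma> (u @ a # v)) = length (take j w @ a # drop (Suc j) w)"
      using n j by (simp add: w_def)
    fix i assume "i < length (permute_list \<sigma> (u @ a # v))"
    then have i: "i < n" using n by simp
    have s: "(\<sigma> i = length u) = (i = j)" using j permutes_inj[OF assms(2)] by (metis injD)
    have "permute_list \<sigma> (u @ a # v) ! i = (u @ a # v) ! \<sigma> i"
      using i n assms(2) by (subst permute_list_nth) auto
    also have "\<dots> = (if i = j then a else w ! i)"
      using i n assms(2) s unfolding w_def by (subst permute_list_nth) (auto simp: nth_append nth_Cons')
    also have "\<dots> = (take j w @ a # drop (Suc j) w) ! i"
      using i j n by (auto simp: nth_append nth_Cons' w_def min_def)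
    finally show "permute_list \<sigma> (u @ a # v) ! i = (take j w @ a # drop (Suc j) w) ! i" .
  qed
  moreover have "hlin (\<lambda>a. G (take j w @ a # drop (Suc j) w))"
    using j n by (intro mlinD[OF assms(1)]) (simp add: w_def)
  ultimately show "hlin (\<lambda>a. G (permute_list \<sigma> (u @ a # v)))" by simp
qed

lemma tperm_tens:
  assumes "\<sigma> permutes {..<n}" "length xs = n"
  shows "tperm H \<sigma> (tens H xs) = tens H (permute_list (inv \<sigma>) xs)"
  unfolding tperm_def
  by (rule fext_tens[OF mlin_permute_list[OF mlin_tens permutes_inv[OF assms(1)]] assms(2)])

lemma tperm_in [simp]: "F \<in> tensor_power H n \<Longrightarrow> tperm H \<sigma> F \<in> tensor_power H n"
  unfolding tperm_def using keys_tensor_power[of F n]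
  by (intro fext_mem subspace_tensor_power tens_in_tensor_power) auto

section \<open>Sweedler notation\<close>

definition sw :: "('h \<Rightarrow> 'h \<Rightarrow> ('x \<Rightarrow>\<^sub>0 'k)) \<Rightarrow> 'h \<Rightarrow> ('x \<Rightarrow>\<^sub>0 'k)" where
  "sw G h = fext (\<lambda>xs. G (xs ! 0) (xs ! 1)) (comult H h)"

lemma flin_fscale: "flin (fscale c)"
  by (simp add: flin_def free.scale_right_distrib mult.commute)

lemma sw_cong [cong]: "(\<And>a b. G a b = G' a b) \<Longrightarrow> h = h' \<Longrightarrow> sw G h = sw G' h'"
  by (simp add: sw_def)

definition blin :: "('h \<Rightarrow> 'h \<Rightarrow> ('x \<Rightarrow>\<^sub>0 'k)) \<Rightarrow> bool" where
  "blin G \<longleftrightarrow> (\<forall>a. hlin (G a)) \<and> (\<forall>b. hlin (\<lambda>a. G a b))"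

lemma blinD: "blin G \<Longrightarrow> hlin (G a)" "blin G \<Longrightarrow> hlin (\<lambda>a. G a b)"
  by (auto simp: blin_def)

lemma comult_in [simp]: "comult H h \<in> tensor_power H 2"
  using cocommutative by (simp add: cocommutative_hopf_algebra_def)

lemma hlin_comult: "hlin (comult H)"
  using cocommutative by (auto simp: cocommutative_hopf_algebra_def hlin_def Vector_Spaces.linear_iff)

lemma length2: "length xs = 2 \<Longrightarrow> xs = [xs ! 0, xs ! 1]"
  by (cases xs; cases "tl xs") (auto simp: numeral_2_eq_2)

lemma length2E: assumes "length xs = 2" obtains a b where "xs = [a, b]"
  using length2[OF assms] by blast

lemma mlin_1: "hlin G \<Longrightarrow> mlin (Suc 0) (\<lambda>xs. G (xs ! 0))"
  by (auto simp: mlin_def)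

lemma mlin_2: assumes "blin G" shows "mlin 2 (\<lambda>xs. G (xs ! 0) (xs ! 1))"
  unfolding numeral_2_eq_2
  by (intro mlin_SucI mlin_0) (auto simp: blinD[OF assms] length_Suc_conv)

lemma mlin_2D: "mlin 2 k \<Longrightarrow> blin (\<lambda>a b. k [a, b])"
  unfolding blin_def using mlinD[of 2 k "[]" "[_]"] mlinD[of 2 k "[_]" "[]"] by simp

lemma hlin_sw [simp]: "hlin (sw G)"
  unfolding sw_def by (rule hlin_flin[OF flin_fext hlin_comult])

lemma hlin_sw_fun: "(\<And>x y. hlin (\<lambda>a. G a x y)) \<Longrightarrow> hlin (\<lambda>a. sw (G a) h)"
  unfolding sw_def by (rule hlin_fext)

lemma sw_flin: "flin L \<Longrightarrow> L (sw G h) = sw (\<lambda>a b. L (G a b)) h"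
  unfolding sw_def by (rule flin_fext_comm)

lemma sw_swap: "sw (\<lambda>a b. sw (G a b) h) g = sw (\<lambda>c d. sw (\<lambda>a b. G a b c d) g) h"
  unfolding sw_def by (rule fext_swap)

text \<open>The coassociativity axiom equates two sums of concatenated tensors, whose
  representatives can be evaluated only by a multilinear function of lists of length 3. Hence the
  trilinearity of \<open>G\<close>.\<close>

lemma sw_coassoc:
  fixes G :: "'h \<Rightarrow> 'h \<Rightarrow> 'h \<Rightarrow> ('x \<Rightarrow>\<^sub>0 'k)"
  assumes G: "\<And>a b. hlin (\<lambda>c. G a b c)" "\<And>a c. hlin (\<lambda>b. G a b c)" "\<And>b c. hlin (\<lambda>a. G a b c)"
  shows "sw (\<lambda>a b. sw (\<lambda>c d. G c d b) a) h = sw (\<lambda>a b. sw (\<lambda>c d. G a c d) b) h"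
proof -
  let ?K = "\<lambda>xs. G (xs ! 0) (xs ! 1) (xs ! 2)"
  have K: "mlin 3 ?K"
    unfolding numeral_3_eq_3
    by (intro mlin_SucI mlin_0) (auto simp: G length_Suc_conv numeral_2_eq_2)
  have 1: "fext ?K (tcat H (comult H a) (tens H [b])) = sw (\<lambda>c d. G c d b) a" for a b
  proof -
    have "fext ?K (tcat H (comult H a) (tens H [b]))
      = fext (\<lambda>xs. fext (\<lambda>ys. ?K (xs @ ys)) (tens H [b])) (comult H a)"
      unfolding tcat_def fext_fext
      using keys_tensor_power[OF comult_in] keys_tens
      by (intro fext_cong fext_tens[OF K]) auto
    also have "\<dots> = fext (\<lambda>xs. ?K (xs @ [b])) (comult H a)"
      using keys_tensor_power[OF comult_in]
      by (intro fext_cong fext_tens[of 1] mlin_append2[of 2]) (auto simp: K[simplified])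
    also have "\<dots> = sw (\<lambda>c d. G c d b) a"
      unfolding sw_def using keys_tensor_power[OF comult_in]
      by (intro fext_cong) (auto simp: nth_append)
    finally show ?thesis .
  qed
  have 2: "fext ?K (tcat H (tens H [b]) (comult H a)) = sw (\<lambda>c d. G b c d) a" for a b
  proof -
    have "fext ?K (tcat H (tens H [b]) (comult H a))
      = fext (\<lambda>xs. fext (\<lambda>ys. ?K (xs @ ys)) (comult H a)) (tens H [b])"
      unfolding tcat_def fext_fext
      using keys_tensor_power[OF comult_in] keys_tens
      by (intro fext_cong fext_tens[OF K]) auto
    also have "\<dots> = fext (\<lambda>ys. fext (\<lambda>xs. ?K (xs @ ys)) (tens H [b])) (comult H a)"
      by (rule fext_swap)
    also have "\<dots> = fext (\<lambda>ys. ?K ([b] @ ys)) (comult H a)"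
      using keys_tensor_power[OF comult_in]
      by (intro fext_cong fext_tens[of 1] mlin_append1[of 1 2]) (auto simp: K[unfolded numeral_3_eq_3, simplified])
    also have "\<dots> = sw (\<lambda>c d. G b c d) a"
      unfolding sw_def by (simp add: numeral_2_eq_2)
    finally show ?thesis .
  qed
  have "fext (\<lambda>xs. tcat H (comult H (xs ! 0)) (tens H [xs ! 1])) (comult H h) =
         fext (\<lambda>xs. tcat H (tens H [xs ! 0]) (comult H (xs ! 1))) (comult H h)"
    using cocommutative by (simp add: cocommutative_hopf_algebra_def)
  from arg_cong[OF this, of "fext ?K"] show ?thesis
    unfolding fext_fext 1 2 by (simp add: sw_def)
qed

lemma sw_cocomm: assumes "blin G" shows "sw G h = sw (\<lambda>a b. G b a) h"
proof -
  let ?K = "\<lambda>xs. G (xs ! 0) (xs ! 1)"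
  have "tperm H (transpose 0 1) (comult H h) = comult H h"
    using cocommutative by (simp add: cocommutative_hopf_algebra_def)
  from arg_cong[OF this, of "fext ?K"]
  have "sw G h = fext (\<lambda>xs. fext ?K (tens H (permute_list (transpose 0 1) xs))) (comult H h)"
    by (simp add: sw_def tperm_def fext_fext)
  also have "\<dots> = sw (\<lambda>a b. G b a) h"
    unfolding sw_def using keys_tensor_power[OF comult_in]
    by (intro fext_cong trans[OF fext_tens[OF mlin_2[OF assms]]])
      (auto simp: permute_list_def elim!: length2E)
  finally show ?thesis .
qed

lemma hlin_lin_ext: "hlin f \<Longrightarrow> f (lin_ext (scl H) g p) = fext (\<lambda>xs. f (g xs)) p"
proof -
  assume f: "hlin f"
  have "f (\<Sum>x\<in>A. scl H (c x) (g x)) = (\<Sum>x\<in>A. fscale (c x) (f (g x)))" for A c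
    by (induction A rule: infinite_finite_induct) (auto simp: hlinD[OF f])
  then show ?thesis by (simp add: lin_ext_def)
qed

lemma sw_counit:
  assumes "hlin f"
  shows "sw (\<lambda>a b. fscale (counit H a) (f b)) h = f h" "sw (\<lambda>a b. fscale (counit H b) (f a)) h = f h"
proof -
  have "lin_ext (scl H) (\<lambda>xs. scl H (counit H (xs ! 0)) (xs ! 1)) (comult H h) = h"
    "lin_ext (scl H) (\<lambda>xs. scl H (counit H (xs ! 1)) (xs ! 0)) (comult H h) = h"
    using cocommutative by (simp_all add: cocommutative_hopf_algebra_def)
  from arg_cong[OF this(1), of f] arg_cong[OF this(2), of f]
  show "sw (\<lambda>a b. fscale (counit H a) (f b)) h = f h" "sw (\<lambda>a b. fscale (counit H b) (f a)) h = f h"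
    by (simp_all add: hlin_lin_ext[OF assms] hlinD[OF assms] sw_def)
qed

lemma sw_antipode:
  assumes "hlin f"
  shows "sw (\<lambda>a b. f (antipode H a * b)) h = fscale (counit H h) (f 1)"
    "sw (\<lambda>a b. f (a * antipode H b)) h = fscale (counit H h) (f 1)"
proof -
  have "lin_ext (scl H) (\<lambda>xs. antipode H (xs ! 0) * xs ! 1) (comult H h) = scl H (counit H h) 1"
    "lin_ext (scl H) (\<lambda>xs. xs ! 0 * antipode H (xs ! 1)) (comult H h) = scl H (counit H h) 1"
    using cocommutative by (simp_all add: cocommutative_hopf_algebra_def)
  from arg_cong[OF this(1), of f] arg_cong[OF this(2), of f]
  show "sw (\<lambda>a b. f (antipode H a * b)) h = fscale (counit H h) (f 1)"
    "sw (\<lambda>a b. f (a * antipode H b)) h = fscale (counit H h) (f 1)"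
    by (simp_all add: hlin_lin_ext[OF assms] hlinD[OF assms] sw_def)
qed

lemma sw_one: assumes "blin G" shows "sw G 1 = G 1 1"
proof -
  have "comult H 1 = tens H [1, 1]"
    using cocommutative by (simp add: cocommutative_hopf_algebra_def)
  then show ?thesis unfolding sw_def by (simp add: fext_tens[OF mlin_2[OF assms], simplified])
qed

lemma sw_mult:
  assumes "blin G"
  shows "sw G (h * g) = sw (\<lambda>a b. sw (\<lambda>c d. G (a * c) (b * d)) g) h"
proof -
  have c: "comult H (h * g) = tmul H (comult H h) (comult H g)"
    using cocommutative by (simp add: cocommutative_hopf_algebra_def)
  have "fext (\<lambda>zs. G (zs ! 0) (zs ! 1)) (tens H (map2 (*) xs ys)) = G (xs ! 0 * ys ! 0) (xs ! 1 * ys ! 1)"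
    if "length xs = 2" "length ys = 2" for xs ys
    using that by (subst fext_tens[OF mlin_2[OF assms]]) auto
  then show ?thesis unfolding sw_def c tmul_def fext_fext
    using keys_tensor_power[OF comult_in] by (intro fext_cong) blast
qed

lemma counit_rules:
  "counit H (a + b) = counit H a + counit H b" "counit H (scl H c a) = c * counit H a"
  "counit H 1 = 1" "counit H (a * b) = counit H a * counit H b"
  using cocommutative by (auto simp: cocommutative_hopf_algebra_def Vector_Spaces.linear_iff)

lemma antipode_rules:
  "antipode H (a + b) = antipode H a + antipode H b" "antipode H (scl H c a) = scl H c (antipode H a)"
  using cocommutative by (auto simp: cocommutative_hopf_algebra_def Vector_Spaces.linear_iff)

lemma hlin_antipode: "hlin f \<Longrightarrow> hlin (\<lambda>a. f (antipode H a))"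
  by (simp add: hlin_def antipode_rules)

text \<open>A linear functional with value 1 on \<open>a - b\<close> separates the two. Identities
  between elements of \<open>H\<close> can thus be proved inside \<open>tens H [_]\<close>, whose
  values the Sweedler calculus accepts.\<close>

lemma tens1_inj: assumes "tens H [a] = tens H [b]" shows "a = b"
proof -
  have vs: "vector_space (scl H)" using cocommutative by (simp add: cocommutative_hopf_algebra_def)
  then interpret vector_space "scl H" .
  interpret P: vector_space_pair "scl H" "(*) :: 'k \<Rightarrow> 'k \<Rightarrow> 'k"
    by unfold_locales (simp_all add: algebra_simps)
  show ?thesis
  proof (rule ccontr)
    assume "a \<noteq> b"
    then have "independent {a - b}" by simp
    from P.linear_independent_extend[OF this, of "\<lambda>_. 1"]
    obtain y where y: "Vector_Spaces.linear (scl H) (*) y" "y (a - b) = 1" by auto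
    \<comment> \<open>The base field appears as the space of formal combinations of
      \<open>()\<close>, because \<open>hlin\<close> speaks of maps into spaces of formal
      combinations.\<close>
    let ?f = "\<lambda>x. Poly_Mapping.single () (y x)"
    have f: "hlin ?f"
      using y(1) by (auto simp: hlin_def Vector_Spaces.linear_iff single_add
          intro!: poly_mapping_eqI simp: lookup_fscale lookup_single)
    have "?f a = ?f b"
      using arg_cong[OF assms, of "fext (\<lambda>xs. ?f (xs ! 0))"]
      by (simp add: fext_tens[OF mlin_1[OF f]])
    then have "?f (a - b) = 0" using hlinD(1)[OF f, of "a - b" b] by simp
    then show False using y(2) by (metis lookup_single_eq lookup_zero zero_neq_one)
  qed
qed

lemma hlin_tens1: "hlin (\<lambda>a. tens H [a])"
  using mlinD[OF mlin_tens, of "[]" "[]" 1] by simp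

lemma antipode_1: "antipode H 1 = 1"
proof -
  have "blin (\<lambda>a b. tens H [antipode H a * b])"
    unfolding blin_def by (intro conjI allI hlin_mult hlin_antipode[where f = "\<lambda>a. tens H [a * b]" for b] hlin_tens1)
  then have "tens H [antipode H 1] = fscale (counit H 1) (tens H [1])"
    by (subst sw_antipode(1)[OF hlin_tens1, symmetric]) (simp add: sw_one)
  then show ?thesis by (intro tens1_inj) (simp add: counit_rules)
qed

lemma sw_add_fun: "sw (\<lambda>a b. G a b + G' a b) h = sw G h + sw G' h"
  by (simp add: sw_def fext_add_fun)

lemma sw_scale_fun: "sw (\<lambda>a b. fscale c (G a b)) h = fscale c (sw G h)"
  by (simp add: sw_def fext_scale_fun)

lemmas lin_simps = hlin_def blin_def sw_add_fun sw_scale_fun hlinD(1,2)[OF hlin_sw] hlinD(1,2)[OF hlin_tens1]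
  scl_rules(1,5,6) antipode_rules counit_rules distrib_left distrib_right
  free.scale_left_distrib free.scale_right_distrib mult.assoc add_ac

text \<open>Write \<open>S\<close> for the antipode and consider the sum of
  \<open>S(h1 g1) h2 g2 S(g3) S(h3)\<close>. Cancelling \<open>S(h1 g1)\<close> against
  \<open>h2 g2\<close> leaves \<open>S(g) S(h)\<close>; cancelling \<open>g2 S(g3)\<close> and then
  \<open>h2 S(h3)\<close> leaves \<open>S(h g)\<close>.\<close>

lemma antipode_mult: "antipode H (h * g) = antipode H g * antipode H h"
proof (rule tens1_inj)
  let ?S = "antipode H" and ?t = "\<lambda>x. tens H [x]"
  let ?F = "\<lambda>a b c p q r. ?t (?S (a * p) * (b * (q * (?S r * ?S c))))"
  have lin: "hlin (\<lambda>a. ?F a b c p q r)" "hlin (\<lambda>a. ?F b a c p q r)" "hlin (\<lambda>a. ?F b c a p q r)"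
     "hlin (\<lambda>a. ?F b c p a q r)" "hlin (\<lambda>a. ?F b c p q a r)" "hlin (\<lambda>a. ?F b c p q r a)" for b c p q r
    by (simp_all add: lin_simps)
  have inner1: "sw (\<lambda>a b. sw (\<lambda>p q. ?F a b c p q r) y) x = fscale (counit H x * counit H y) (?t (?S r * ?S c))"
    for x y c r
  proof -
    have "blin (\<lambda>u v. ?t (?S u * (v * (?S r * ?S c))))"
      by (simp add: lin_simps)
    from sw_mult[OF this, of x y]
    have "sw (\<lambda>a b. sw (\<lambda>p q. ?F a b c p q r) y) x = sw (\<lambda>u v. ?t (?S u * v * (?S r * ?S c))) (x * y)"
      by (simp add: mult.assoc)
    then show ?thesis
      using sw_antipode(1)[of "\<lambda>x. ?t (x * (?S r * ?S c))" "x * y"]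
      by (simp add: hlin_mult(2)[OF hlin_tens1] counit_rules)
  qed
  have "sw (\<lambda>x c. sw (\<lambda>a b. sw (\<lambda>y r. sw (\<lambda>p q. ?F a b c p q r) y) g) x) h
      = sw (\<lambda>x c. sw (\<lambda>y r. sw (\<lambda>a b. sw (\<lambda>p q. ?F a b c p q r) y) x) g) h"
    by (subst (2) sw_swap) simp
  also have "\<dots> = sw (\<lambda>x c. fscale (counit H x) (sw (\<lambda>y r. fscale (counit H y) (?t (?S r * ?S c))) g)) h"
    by (simp add: inner1 sw_scale_fun flip: free.scale_scale)
  also have "\<dots> = ?t (?S g * ?S h)"
  proof -
    have "sw (\<lambda>y r. fscale (counit H y) (?t (?S r * ?S c))) g = ?t (?S g * ?S c)" for c
      by (rule sw_counit(1)) (simp add: lin_simps)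
    then show ?thesis
      by (simp, intro sw_counit(1)) (simp add: lin_simps)
  qed
  finally have 1: "sw (\<lambda>x c. sw (\<lambda>a b. sw (\<lambda>y r. sw (\<lambda>p q. ?F a b c p q r) y) g) x) h = ?t (?S g * ?S h)" .
  have "sw (\<lambda>y r. sw (\<lambda>p q. ?F a b c p q r) y) g = ?t (?S (a * g) * (b * ?S c))" for a b c
  proof -
    have "sw (\<lambda>y r. sw (\<lambda>p q. ?F a b c p q r) y) g = sw (\<lambda>p d. sw (\<lambda>q r. ?F a b c p q r) d) g"
      by (rule sw_coassoc[of "\<lambda>p q r. ?F a b c p q r"]) (rule lin)+
    also have "\<dots> = sw (\<lambda>p d. fscale (counit H d) (?t (?S (a * p) * (b * ?S c)))) g"
    proof -
      have "sw (\<lambda>q r. ?F a b c p q r) d = fscale (counit H d) (?t (?S (a * p) * (b * (1 * ?S c))))" for p d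
        by (subst sw_antipode(2)[of "\<lambda>x. ?t (?S (a * p) * (b * (x * ?S c)))", symmetric])
          (simp_all add: mult.assoc lin_simps)
      then show ?thesis by simp
    qed
    also have "\<dots> = ?t (?S (a * g) * (b * ?S c))"
      by (rule sw_counit(2)[of "\<lambda>p. ?t (?S (a * p) * (b * ?S c))"])
        (simp add: lin_simps)
    finally show ?thesis .
  qed
  then have "sw (\<lambda>x c. sw (\<lambda>a b. sw (\<lambda>y r. sw (\<lambda>p q. ?F a b c p q r) y) g) x) h
     = sw (\<lambda>x c. sw (\<lambda>a b. ?t (?S (a * g) * (b * ?S c))) x) h" by simp
  also have "\<dots> = sw (\<lambda>a d. sw (\<lambda>b c. ?t (?S (a * g) * (b * ?S c))) d) h"
    by (rule sw_coassoc[of "\<lambda>a b c. ?t (?S (a * g) * (b * ?S c))"])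
      (simp_all add: lin_simps)
  also have "\<dots> = sw (\<lambda>a d. fscale (counit H d) (?t (?S (a * g)))) h"
  proof -
    have "sw (\<lambda>b c. ?t (?S (a * g) * (b * ?S c))) d = fscale (counit H d) (?t (?S (a * g)))" for a d
      using sw_antipode(2)[of "\<lambda>x. ?t (?S (a * g) * x)" d] by (simp add: hlin_mult(1)[OF hlin_tens1])
    then show ?thesis by simp
  qed
  also have "\<dots> = ?t (?S (h * g))"
    by (rule sw_counit(2)[of "\<lambda>a. ?t (?S (a * g))"]) (simp add: lin_simps)
  finally show "?t (?S (h * g)) = ?t (?S g * ?S h)" using 1 by simp
qed

text \<open>The sum of \<open>S(S(h1)) S(h2) h3\<close> is \<open>S(S(h))\<close> if the last two
  factors are cancelled. Cocommutativity exchanges \<open>h1\<close> and \<open>h2\<close>, so the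
  first two factors become \<open>S(h1 S(h2))\<close> and cancel as well, which leaves
  \<open>h\<close>.\<close>

lemma antipode_antipode: "antipode H (antipode H h) = h"
proof (rule tens1_inj)
  let ?S = "antipode H" and ?t = "\<lambda>x. tens H [x]"
  have "sw (\<lambda>x b. sw (\<lambda>c d. ?t (?S (?S c) * (?S d * b))) x) h
      = sw (\<lambda>c x. sw (\<lambda>d b. ?t (?S (?S c) * (?S d * b))) x) h"
    by (rule sw_coassoc[of "\<lambda>c d b. ?t (?S (?S c) * (?S d * b))"])
      (simp_all add: lin_simps)
  also have "\<dots> = sw (\<lambda>c x. fscale (counit H x) (?t (?S (?S c)))) h"
  proof -
    have "sw (\<lambda>d b. ?t (?S (?S c) * (?S d * b))) x = fscale (counit H x) (?t (?S (?S c)))" for c x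
      using sw_antipode(1)[of "\<lambda>y. ?t (?S (?S c) * y)" x] by (simp add: hlin_mult(1)[OF hlin_tens1])
    then show ?thesis by simp
  qed
  also have "\<dots> = ?t (?S (?S h))"
    by (rule sw_counit(2)[of "\<lambda>a. ?t (?S (?S a))"]) (simp add: lin_simps)
  finally have 1: "sw (\<lambda>x b. sw (\<lambda>c d. ?t (?S (?S c) * (?S d * b))) x) h = ?t (?S (?S h))" .
  have "sw (\<lambda>c d. ?t (?S (?S c) * (?S d * b))) x = fscale (counit H x) (?t b)" for x b
  proof -
    have "sw (\<lambda>c d. ?t (?S (?S c) * (?S d * b))) x = sw (\<lambda>d c. ?t (?S (?S c) * (?S d * b))) x"
      by (rule sw_cocomm) (simp add: lin_simps)
    also have "\<dots> = sw (\<lambda>d c. ?t (?S (d * ?S c) * b)) x"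
      by (simp add: antipode_mult mult.assoc)
    also have "\<dots> = fscale (counit H x) (?t (?S 1 * b))"
      by (rule sw_antipode(2)[of "\<lambda>y. ?t (?S y * b)"]) (simp add: lin_simps)
    finally show ?thesis by (simp add: antipode_1)
  qed
  then have "sw (\<lambda>x b. sw (\<lambda>c d. ?t (?S (?S c) * (?S d * b))) x) h = ?t h"
    using sw_counit(1)[OF hlin_tens1, of h] by simp
  with 1 show "?t (?S (?S h)) = ?t h" by simp
qed

section \<open>The action of the Hopf algebra on labelled words\<close>

text \<open>
  A word of letters \<open>(i, x)\<close> stands for a product of copies of elements of \<open>H\<close>, and \<open>h\<close> acts on it from
  the right by multiplication with its iterated coproduct. To avoid formal sums of words, the action is
  written in continuation passing style: \<open>wact k w h\<close> is the value of the linear extension of \<open>k\<close>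
  at \<open>w\<close> acted on by \<open>h\<close>.
\<close>

fun wact :: "(('l \<times> 'h) list \<Rightarrow> ('x \<Rightarrow>\<^sub>0 'k)) \<Rightarrow> ('l \<times> 'h) list \<Rightarrow> 'h \<Rightarrow> ('x \<Rightarrow>\<^sub>0 'k)" where
  "wact k [] h = fscale (counit H h) (k [])"
| "wact k ((i, x) # w) h = sw (\<lambda>a b. wact (\<lambda>u. k ((i, x * a) # u)) w b) h"

lemma wact_cong [cong]: "(\<And>u. k u = k' u) \<Longrightarrow> w = w' \<Longrightarrow> h = h' \<Longrightarrow> wact k w h = wact k' w' h'"
  by presburger

text \<open>The same action on lists without labels: tensors are indexed by such lists, whereas
  reordering letters needs labels.\<close>

fun lact :: "('h list \<Rightarrow> ('x \<Rightarrow>\<^sub>0 'k)) \<Rightarrow> 'h list \<Rightarrow> 'h \<Rightarrow> ('x \<Rightarrow>\<^sub>0 'k)" where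
  "lact k [] h = fscale (counit H h) (k [])"
| "lact k (x # w) h = sw (\<lambda>a b. lact (\<lambda>u. k (x * a # u)) w b) h"

lemma lact_cong [cong]: "(\<And>u. k u = k' u) \<Longrightarrow> w = w' \<Longrightarrow> h = h' \<Longrightarrow> lact k w h = lact k' w' h'"
  by presburger

definition wlin :: "(('l \<times> 'h) list \<Rightarrow> ('x \<Rightarrow>\<^sub>0 'k)) \<Rightarrow> bool" where
  "wlin k \<longleftrightarrow> (\<forall>u i v. hlin (\<lambda>a. k (u @ (i, a) # v)))"

text \<open>Invariance under adjacent transpositions is invariance under all reorderings, by
  \<open>wsym_mset\<close>. Together with \<open>wlin\<close> it describes the linear maps on a free
  commutative algebra.\<close>

definition wsym :: "(('l \<times> 'h) list \<Rightarrow> ('x \<Rightarrow>\<^sub>0 'k)) \<Rightarrow> bool" where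
  "wsym k \<longleftrightarrow> (\<forall>u p q v. k (u @ p # q # v) = k (u @ q # p # v))"

lemma wlinD: "wlin k \<Longrightarrow> hlin (\<lambda>a. k (u @ (i, a) # v))"
  by (simp add: wlin_def)

lemma wlin_append: assumes "wlin k" shows "wlin (\<lambda>w. k (u @ w))" "wlin (\<lambda>w. k (w @ v))"
  unfolding wlin_def using wlinD[OF assms, of "u @ _"] wlinD[OF assms, of _ _ "_ @ v"] by simp_all

lemma wlin_Cons: "wlin k \<Longrightarrow> wlin (\<lambda>w. k (p # w))" "wlin k \<Longrightarrow> hlin (\<lambda>a. k ((i, a) # w))"
  using wlin_append(1)[of k "[p]"] wlinD[of k "[]" i w] by simp_all

lemma wsym_append: assumes "wsym k" shows "wsym (\<lambda>w. k (u @ w))" "wsym (\<lambda>w. k (w @ v))"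
  using assms unfolding wsym_def by (metis append.assoc, simp)

lemma wsym_Cons: "wsym k \<Longrightarrow> wsym (\<lambda>w. k (p # w))"
  using wsym_append(1)[of k "[p]"] by simp

lemma wsym_move: assumes "wsym k" shows "k (u @ p # v @ w) = k (u @ v @ p # w)"
proof (induction v arbitrary: u)
  case (Cons q v)
  have "k (u @ p # (q # v) @ w) = k (u @ q # p # v @ w)"
    using assms[unfolded wsym_def, rule_format, of u p q "v @ w"] by simp
  also have "\<dots> = k ((u @ [q]) @ p # v @ w)" by simp
  also have "\<dots> = k ((u @ [q]) @ v @ p # w)" by (rule Cons.IH)
  finally show ?case by simp
qed simp

text \<open>The first letter of \<open>w\<close> occurs somewhere in \<open>w'\<close> and can be
  moved to the front there; the rest is induction.\<close>

lemma wsym_mset: "wsym k \<Longrightarrow> mset w = mset w' \<Longrightarrow> k w = k w'"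
proof (induction w arbitrary: w' k)
  case (Cons p w)
  have "p \<in> set w'" using Cons.prems(2) by (metis list.set_intros(1) mset_eq_setD)
  then obtain u v where w': "w' = u @ p # v" by (metis split_list)
  have "mset w = mset (u @ v)" using Cons.prems(2) w' by simp
  then have "k (p # w) = k (p # u @ v)"
    by (rule Cons.IH[OF wsym_Cons[OF Cons.prems(1)]])
  also have "\<dots> = k w'"
    using wsym_move[OF Cons.prems(1), of "[]" p u v] by (simp add: w')
  finally show ?case .
qed simp

lemma hlin_wact [simp]: "hlin (wact k w)"
proof (cases w)
  case Nil then show ?thesis by (simp add: hlin_def counit_rules free.scale_left_distrib)
next
  case (Cons p v)
  then show ?thesis by (cases p) (simp add: hlin_def hlinD[OF hlin_sw])
qed

lemma hlin_wact_fun: "(\<And>u. hlin (\<lambda>a. k a u)) \<Longrightarrow> hlin (\<lambda>a. wact (k a) w h)"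
proof (induction w arbitrary: k h)
  case Nil then show ?case by (simp add: hlin_fscale)
next
  case (Cons p w)
  obtain i x where p: "p = (i, x)" by force
  show ?case unfolding p by (simp, intro hlin_sw_fun Cons.IH Cons.prems)
qed

lemma wact_flin: "flin L \<Longrightarrow> L (wact k w h) = wact (\<lambda>u. L (k u)) w h"
  by (induction k w h rule: wact.induct) (simp_all add: flinD sw_flin)

lemma wact_sw: "wact (\<lambda>u. sw (G u) g) w h = sw (\<lambda>c d. wact (\<lambda>u. G u c d) w h) g"
proof (induction w arbitrary: G h)
  case Nil then show ?case by (simp add: sw_scale_fun)
next
  case (Cons p w)
  obtain i x where p: "p = (i, x)" by force
  have "wact (\<lambda>u. sw (G u) g) (p # w) h = sw (\<lambda>a b. sw (\<lambda>c d. wact (\<lambda>u. G ((i, x * a) # u) c d) w b) g) h"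
    unfolding p by (simp add: Cons.IH)
  also have "\<dots> = sw (\<lambda>c d. wact (\<lambda>u. G u c d) (p # w) h) g"
    unfolding p by (subst sw_swap) simp
  finally show ?case .
qed

lemma wact_swap: "wact (\<lambda>x. wact (\<lambda>y. k x y) v g) u f = wact (\<lambda>y. wact (\<lambda>x. k x y) u f) v g"
proof (induction u arbitrary: k f)
  case Nil
  show ?case by (simp add: wact_flin[OF flin_fscale])
next
  case (Cons p w)
  obtain i x where p: "p = (i, x)" by force
  show ?case unfolding p by (simp add: Cons.IH wact_sw)
qed

lemma wlin_wact_fun: "(\<And>x. wlin (\<lambda>u. k u x)) \<Longrightarrow> wlin (\<lambda>u. wact (k u) w h)"
  unfolding wlin_def by (intro allI hlin_wact_fun) blast

lemma wsym_wact_fun: "(\<And>x. wsym (\<lambda>u. k u x)) \<Longrightarrow> wsym (\<lambda>u. wact (k u) w h)"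
  unfolding wsym_def by presburger

lemma wlin_wact: "wlin k \<Longrightarrow> wlin (\<lambda>w. wact k w h)"
proof -
  have "hlin (\<lambda>a. wact k (u @ (i, a) # v) h)" if "wlin k" for u v i and k :: "('a \<times> 'h) list \<Rightarrow> ('b \<Rightarrow>\<^sub>0 'k)" and h
    using that
  proof (induction u arbitrary: k h)
    case Nil
    show ?case by (simp, intro hlin_sw_fun hlin_wact_fun hlin_mult(2) wlin_Cons(2) Nil)
  next
    case (Cons p u)
    obtain j x where p: "p = (j, x)" by force
    show ?case unfolding p by (simp, intro hlin_sw_fun Cons.IH wlin_Cons(1) Cons.prems)
  qed
  then show "wlin k \<Longrightarrow> wlin (\<lambda>w. wact k w h)" by (simp add: wlin_def)
qed

text \<open>A concatenation receives \<open>h1\<close> on its first word and \<open>h2\<close> on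
  its second; coassociativity lets the induction peel off one letter at a time.\<close>

lemma wact_append:
  "wlin k \<Longrightarrow> wact k (u @ v) h = sw (\<lambda>a b. wact (\<lambda>x. wact (\<lambda>y. k (x @ y)) v b) u a) h"
proof (induction u arbitrary: k h)
  case Nil
  show ?case by (simp add: sw_counit(1))
next
  case (Cons p u)
  obtain i x where p: "p = (i, x)" by force
  let ?G = "\<lambda>a c d. wact (\<lambda>z. wact (\<lambda>y. k ((i, x * a) # z @ y)) v d) u c"
  have "wact k ((p # u) @ v) h = sw (\<lambda>a b. sw (\<lambda>c d. ?G a c d) b) h"
    by (simp add: p Cons.IH wlin_Cons(1) Cons.prems)
  also have "\<dots> = sw (\<lambda>a b. sw (\<lambda>c d. ?G c d b) a) h"
    by (rule sw_coassoc[symmetric])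
      (intro hlin_wact_fun hlin_wact hlin_mult(1) wlin_Cons(2) Cons.prems)+
  finally show ?case by (simp add: p)
qed

text \<open>Multiplicativity of the coproduct makes this a right action: \<open>h\<close> acts first
  and \<open>g\<close> afterwards.\<close>

lemma wact_wact: "wlin k \<Longrightarrow> wact (\<lambda>u. wact k u g) w h = wact k w (h * g)"
proof (induction w arbitrary: k h g)
  case Nil then show ?case by (simp add: counit_rules)
next
  case (Cons p w)
  obtain i x where p: "p = (i, x)" by force
  have b: "blin (\<lambda>a b. wact (\<lambda>u. k ((i, x * a) # u)) w b)"
    unfolding blin_def by (intro conjI allI hlin_wact hlin_wact_fun hlin_mult(1) wlin_Cons(2) Cons.prems)
  have "wact (\<lambda>u. wact k u g) (p # w) h
      = sw (\<lambda>a b. sw (\<lambda>c d. wact (\<lambda>u. wact (\<lambda>z. k ((i, x * a * c) # z)) u d) w b) g) h"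
    by (simp add: p wact_sw)
  also have "\<dots> = sw (\<lambda>a b. sw (\<lambda>c d. wact (\<lambda>z. k ((i, x * (a * c)) # z)) w (b * d)) g) h"
    by (simp add: Cons.IH wlin_Cons(1) Cons.prems mult.assoc)
  also have "\<dots> = wact k (p # w) (h * g)"
    by (simp add: p sw_mult[OF b])
  finally show ?case .
qed

lemma wact_1: "wlin k \<Longrightarrow> wact k w 1 = k w"
proof (induction w arbitrary: k)
  case Nil then show ?case by (simp add: counit_rules)
next
  case (Cons p w)
  obtain i x where p: "p = (i, x)" by force
  have b: "blin (\<lambda>a b. wact (\<lambda>u. k ((i, x * a) # u)) w b)"
    unfolding blin_def by (intro conjI allI hlin_wact hlin_wact_fun hlin_mult(1) wlin_Cons(2) Cons.prems)
  show ?case by (simp add: p sw_one[OF b] Cons.IH wlin_Cons(1) Cons.prems)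
qed

text \<open>Here cocommutativity enters: two adjacent letters receive two consecutive parts of the
  coproduct of \<open>h\<close>, and these parts may be exchanged.\<close>

lemma wsym_wact: assumes "wlin k" "wsym k" shows "wsym (\<lambda>w. wact k w h)"
proof -
  have "wact k (u @ p # q # v) h = wact k (u @ q # p # v) h" if "wlin k" "wsym k"
    for u p q v and k :: "('a \<times> 'h) list \<Rightarrow> ('b \<Rightarrow>\<^sub>0 'k)" and h
    using that
  proof (induction u arbitrary: k h)
    case Nil
    obtain i x where p: "p = (i, x)" by force
    obtain j y where q: "q = (j, y)" by force
    have lin: "hlin (\<lambda>a. wact (\<lambda>z. k ((i, x * a) # (j, y * c) # z)) v d)"
      "hlin (\<lambda>c. wact (\<lambda>z. k ((i, x * a) # (j, y * c) # z)) v d)"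
      "hlin (\<lambda>d. wact (\<lambda>z. k ((i, x * a) # (j, y * c) # z)) v d)" for a c d and i j :: 'a and x y
      by (auto intro!: hlin_wact_fun hlin_mult(1) wlin_Cons(2)[OF Nil(1)] wlin_Cons(2)[OF wlin_Cons(1)[OF Nil(1)]])
    have "wact k ([] @ p # q # v) h = sw (\<lambda>e d. sw (\<lambda>a c. wact (\<lambda>z. k ((i, x * a) # (j, y * c) # z)) v d) e) h"
      by (simp add: p q, rule sw_coassoc[symmetric]; rule lin)
    also have "\<dots> = sw (\<lambda>e d. sw (\<lambda>c a. wact (\<lambda>z. k ((j, y * c) # (i, x * a) # z)) v d) e) h"
    proof -
      have "sw (\<lambda>a c. wact (\<lambda>z. k ((i, x * a) # (j, y * c) # z)) v d) e
          = sw (\<lambda>c a. wact (\<lambda>z. k ((i, x * a) # (j, y * c) # z)) v d) e" for e d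
        by (rule sw_cocomm) (simp add: blin_def lin)
      moreover have "k (r # s # z) = k (s # r # z)" for r s z
        using Nil(2)[unfolded wsym_def, rule_format, of "[]"] by simp
      ultimately show ?thesis by simp
    qed
    also have "\<dots> = wact k ([] @ q # p # v) h"
      by (simp add: p q, rule sw_coassoc; rule lin)
    finally show ?case .
  next
    case (Cons r u)
    obtain j x where r: "r = (j, x)" by force
    show ?case unfolding r by (simp add: Cons.IH wlin_Cons(1) wsym_Cons Cons.prems)
  qed
  then show ?thesis using assms by (simp add: wsym_def)
qed

lemma wact_zip: "length ls = length fs \<Longrightarrow> wact k (zip ls fs) h = lact (\<lambda>gs. k (zip ls gs)) fs h"
proof (induction ls fs arbitrary: k h rule: list_induct2)
  case (Cons l ls f fs)
  then show ?case by simp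
qed simp

lemma lact_cong_length: "(\<And>gs. length gs = length fs \<Longrightarrow> k gs = k' gs) \<Longrightarrow> lact k fs h = lact k' fs h"
proof (induction fs arbitrary: k k' h)
  case (Cons f fs)
  show ?case by (simp, intro arg_cong2[where f = sw] ext Cons.IH refl Cons.prems) simp
qed simp

text \<open>The labels are dummies that the function forgets; \<open>zip fs fs\<close> is simply a
  labelled word of the right length. In this way results on \<open>wact\<close> carry over to
  lists.\<close>

lemma lact_wact: "lact k fs h = wact (\<lambda>u. k (map snd u)) (zip fs fs) h"
  by (subst wact_zip) (auto intro: lact_cong_length)

lemma lact_flin: "flin L \<Longrightarrow> L (lact k w h) = lact (\<lambda>u. L (k u)) w h"
  by (simp add: lact_wact wact_flin)

lemma hlin_lact [simp]: "hlin (lact k fs)"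
proof (cases fs)
  case Nil then show ?thesis by (simp add: hlin_def counit_rules free.scale_left_distrib)
next
  case (Cons p v)
  then show ?thesis by (simp add: hlin_def hlinD[OF hlin_sw])
qed

lemma hlin_lact_fun:
  assumes "\<And>u. length u = length w \<Longrightarrow> hlin (\<lambda>a. k a u)" shows "hlin (\<lambda>a. lact (k a) w h)"
proof -
  \<comment> \<open>Linearity of \<open>k\<close> is known only for lists of the right length, so
    the function is set to 0 elsewhere. The action does not change lengths.\<close>
  have "lact (k a) w h = wact (\<lambda>u. if length u = length w then k a (map snd u) else 0) (zip w w) h" for a
    by (subst wact_zip) (auto intro: lact_cong_length)
  moreover have "hlin (\<lambda>a. if length u = length w then k a (map snd u) else 0)" for u :: "('h \<times> 'h) list"
    using assms[of "map snd u"] by (cases "length u = length w") (auto simp: hlin_zero)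
  ultimately show ?thesis by (simp, intro hlin_wact_fun)
qed

lemma lact_sw: "lact (\<lambda>u. sw (G u) g) w h = sw (\<lambda>c d. lact (\<lambda>u. G u c d) w h) g"
  unfolding lact_wact by (rule wact_sw)

lemma lact_swap: "lact (\<lambda>x. lact (\<lambda>y. k x y) v g) u f = lact (\<lambda>y. lact (\<lambda>x. k x y) u f) v g"
  unfolding lact_wact by (rule wact_swap)

lemma hlin_lact_Cons:
  "mlin (Suc n) k \<Longrightarrow> length w = n \<Longrightarrow> hlin (\<lambda>a. lact (\<lambda>u. k (x * a # u)) w b)"
  by (rule hlin_lact_fun, rule hlin_mult(1)[OF mlin_hd]) auto

lemma lact_lact: "mlin n k \<Longrightarrow> length w = n \<Longrightarrow> lact (\<lambda>u. lact k u g) w h = lact k w (h * g)"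
proof (induction w arbitrary: n k h g)
  case Nil then show ?case by (simp add: counit_rules)
next
  case (Cons x w)
  then obtain m where n: "n = Suc m" "length w = m" by auto
  have k: "mlin m (\<lambda>u. k (a # u))" for a using Cons.prems n by (simp add: mlin_Cons)
  have b: "blin (\<lambda>a b. lact (\<lambda>u. k (x * a # u)) w b)"
    unfolding blin_def using hlin_lact_Cons[of m k w x] Cons.prems(1) n by auto
  have "lact (\<lambda>u. lact k u g) (x # w) h
      = sw (\<lambda>a b. sw (\<lambda>c d. lact (\<lambda>u. lact (\<lambda>z. k (x * a * c # z)) u d) w b) g) h"
    by (simp add: lact_sw)
  also have "\<dots> = sw (\<lambda>a b. sw (\<lambda>c d. lact (\<lambda>z. k (x * (a * c) # z)) w (b * d)) g) h"
    by (simp add: Cons.IH[OF k n(2)] mult.assoc)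
  also have "\<dots> = lact k (x # w) (h * g)"
    by (simp add: sw_mult[OF b])
  finally show ?case .
qed

lemma lact_append:
  "mlin (length u + length v) k \<Longrightarrow>
   lact k (u @ v) h = sw (\<lambda>a b. lact (\<lambda>x. lact (\<lambda>y. k (x @ y)) v b) u a) h"
proof (induction u arbitrary: k h)
  case Nil
  show ?case by (simp add: sw_counit(1))
next
  case (Cons x u)
  let ?G = "\<lambda>a c d. lact (\<lambda>z. lact (\<lambda>y. k ((x * a) # z @ y)) v d) u c"
  have k: "mlin (length u + length v) (\<lambda>z. k (a # z))" for a
    using Cons.prems by (intro mlin_Cons) simp
  have "hlin (\<lambda>a. ?G a c d)" for c d
  proof (intro hlin_lact_fun)
    fix z y :: "'h list" assume "length z = length u" "length y = length v"
    then show "hlin (\<lambda>a. k (x * a # z @ y))"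
      using hlin_mult(1)[OF mlin_hd[of "length u + length v" k "z @ y"]] Cons.prems by simp
  qed
  moreover have "hlin (\<lambda>d. ?G a c d)" for a c by (intro hlin_lact_fun) simp
  ultimately have "sw (\<lambda>a b. sw (\<lambda>c d. ?G a c d) b) h = sw (\<lambda>a b. sw (\<lambda>c d. ?G c d b) a) h"
    by (intro sw_coassoc[symmetric]) simp_all
  then show ?case by (simp add: Cons.IH k)
qed

lemma fext_tcat:
  assumes k: "mlin (n + m) k" and "F \<in> tensor_power H n" "G \<in> tensor_power H m"
  shows "fext k (tcat H F G) = fext (\<lambda>xs. fext (\<lambda>ys. k (xs @ ys)) G) F"
  unfolding tcat_def fext_fext
  using keys_tensor_power[OF assms(2)] keys_tensor_power[OF assms(3)]
  by (intro fext_cong fext_tens[OF k]) auto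

lemma iter_comult_in [simp]: "iter_comult H n h \<in> tensor_power H n"
proof (induction n arbitrary: h)
  case 0 then show ?case using free.subspace_scale[OF subspace_tensor_power] by simp
next
  case (Suc n)
  show ?case
  proof (cases n)
    case (Suc m)
    show ?thesis unfolding Suc iter_comult.simps
      using tcat_in[of "tens H [_]" 1] Suc.IH[unfolded Suc]
      by (intro fext_mem subspace_tensor_power) simp
  qed simp
qed

text \<open>This identifies the action on lists with multiplication by the iterated coproduct, that
  is, with the right action of \<open>H\<close> in the relations of \<open>pseudo\<close>.\<close>

lemma fext_tmul_iter_comult:
  "mlin n k \<Longrightarrow> length fs = n \<Longrightarrow> fext k (tmul H (tens H fs) (iter_comult H n h)) = lact k fs h"
proof -
  have "fext (\<lambda>ys. k (map2 (*) fs ys)) (iter_comult H n h) = lact k fs h" if "mlin n k" "length fs = n"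
    using that
  proof (induction n arbitrary: k fs h)
    case 0
    then show ?case by (simp add: fext_scale fext_tens[OF mlin_0])
  next
    case (Suc n)
    then obtain f fs' where fs: "fs = f # fs'" "length fs' = n" by (cases fs) auto
    show ?case
    \<comment> \<open>At length 1 \<open>iter_comult\<close> does not split \<open>h\<close>, while
      \<open>lact\<close> still splits off a counit for the empty rest; the counit axiom removes
      it.\<close>
    proof (cases n)
      case 0
      have "hlin (\<lambda>a. k [f * a])" using hlin_mult(1)[OF mlin_hd[OF Suc.prems(1), of "[]"]] 0 by simp
      moreover have "fext (\<lambda>ys. k (map2 (*) [f] ys)) (tens H [h]) = k [f * h]"
        using 0 Suc.prems(1) by (subst fext_tens[OF mlin_map2[of "Suc 0"]]) auto
      ultimately show ?thesis using fs 0 by (simp add: sw_counit(2))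
    next
      case (Suc m)
      let ?K = "\<lambda>ys. k (map2 (*) fs ys)"
      have K: "mlin (1 + n) ?K" using Suc.prems by (intro mlin_map2) simp_all
      have "fext ?K (tcat H (tens H [a]) (iter_comult H n b)) = lact (\<lambda>u. k (f * a # u)) fs' b" for a b
      proof -
        have "fext ?K (tcat H (tens H [a]) (iter_comult H n b))
          = fext (\<lambda>xs. fext (\<lambda>ys. ?K (xs @ ys)) (iter_comult H n b)) (tens H [a])"
          by (rule fext_tcat[OF K]) simp_all
        also have "\<dots> = fext (\<lambda>ys. fext (\<lambda>xs. ?K (xs @ ys)) (tens H [a])) (iter_comult H n b)"
          by (rule fext_swap)
        also have "\<dots> = fext (\<lambda>ys. ?K ([a] @ ys)) (iter_comult H n b)"
          using keys_tensor_power[OF iter_comult_in]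
          by (intro fext_cong fext_tens[of 1] mlin_append1[of 1 n] K) auto
        also have "\<dots> = lact (\<lambda>u. k (f * a # u)) fs' b"
          using Suc.IH[OF mlin_Cons[OF Suc.prems(1)] fs(2)] by (simp add: fs)
        finally show ?thesis .
      qed
      then show ?thesis unfolding Suc iter_comult.simps fext_fext by (simp add: sw_def fs Suc)
    qed
  qed
  moreover assume "mlin n k" "length fs = n"
  ultimately show ?thesis by (simp add: fext_tmul)
qed

lemma lact_2: assumes "mlin 2 k" shows "lact k [x, y] h = sw (\<lambda>a b. k [x * a, y * b]) h"
proof -
  have "hlin (\<lambda>b. k [x * a, y * b])" for a
    using hlin_mult(1)[OF mlinD[OF assms, of "[x * a]" "[]"], of y] by simp
  from sw_counit(2)[OF this] show ?thesis by simp
qed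

lemma lact_single: assumes "mlin 1 k" shows "lact k [x] h = k [x * h]"
  using sw_counit(2)[OF hlin_mult(1)[OF mlinD[OF assms, of "[]" "[]"], of x], of h] by simp

text \<open>
  A function of lists of length \<open>n\<close> becomes a symmetric function of words if the letters are
  put in the order of their labels \<open>0, \<dots>, n - 1\<close>.
\<close>

definition by_label :: "nat \<Rightarrow> ('h list \<Rightarrow> ('x \<Rightarrow>\<^sub>0 'k)) \<Rightarrow> (nat \<times> 'h) list \<Rightarrow> ('x \<Rightarrow>\<^sub>0 'k)" where
  "by_label n k w = (if mset (map fst w) = mset [0..<n] then k (map (\<lambda>i. the (map_of w i)) [0..<n]) else 0)"

lemma by_label_zip: "length fs = n \<Longrightarrow> by_label n k (zip [0..<n] fs) = k fs"
proof -
  assume "length fs = n"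
  then have "the (map_of (zip [0..<n] fs) i) = fs ! i" if "i < n" for i
    using arg_cong[OF map_of_zip_nth[of "[0..<n]" fs i], of the] that by simp
  then have "map (\<lambda>i. the (map_of (zip [0..<n] fs) i)) [0..<n] = fs"
    using \<open>length fs = n\<close> by (intro nth_equalityI) auto
  then show ?thesis using \<open>length fs = n\<close> by (simp add: by_label_def)
qed

text \<open>Varying the letter with label \<open>i\<close> varies exactly the entry \<open>i\<close>
  of the sorted list; if the labels are not those of \<open>[0..<n]\<close>, the function is
  constantly 0.\<close>

lemma wlin_by_label: assumes "mlin n k" shows "wlin (by_label n k)"
  unfolding wlin_def
proof (intro allI)
  fix u v :: "(nat \<times> 'h) list" and i
  show "hlin (\<lambda>a. by_label n k (u @ (i, a) # v))"
  proof (cases "mset (map fst (u @ (i, 0) # v)) = mset [0..<n]")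
    case False
    then show ?thesis by (simp add: by_label_def hlin_zero)
  next
    case True
    have d: "distinct (map fst (u @ (i, 0) # v))" by (metis True distinct_upt mset_eq_imp_distinct_iff)
    have "i \<in> set [0..<n]" by (metis True in_set_conv_decomp list.simps(9) map_append fst_conv mset_eq_setD)
    then have i: "i < n" by simp
    have 1: "the (map_of (u @ (i, a) # v) j) = (if j = i then a else the (map_of (u @ (i, 0) # v) j))" for a j
    proof (cases "j = i")
      case True
      have "map_of u i = None" using d by (simp add: map_of_eq_None_iff)
      then show ?thesis using True by (simp add: map_add_def)
    qed (simp add: map_add_def split: option.split)
    let ?f = "\<lambda>j. the (map_of (u @ (i, 0) # v) j)"
    have "map (\<lambda>j. the (map_of (u @ (i, a) # v) j)) [0..<n] = map ?f [0..<i] @ a # map ?f [Suc i..<n]" for a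
    proof -
      have "[0..<n] = [0..<i] @ i # [Suc i..<n]"
        using upt_add_eq_append[of 0 i "n - i"] upt_conv_Cons[of i n] i by simp
      then show ?thesis by (simp add: 1[of a] del: map_of_append)
    qed
    then have by_label: "by_label n k (u @ (i, a) # v) = k (map ?f [0..<i] @ a # map ?f [Suc i..<n])" for a
      using True unfolding by_label_def by (simp del: map_of_append)
    moreover have "hlin (\<lambda>a. k (map ?f [0..<i] @ a # map ?f [Suc i..<n]))"
      using i by (intro mlinD[OF assms]) simp
    ultimately show ?thesis unfolding by_label by blast
  qed
qed

lemma wsym_by_label: "wsym (by_label n k)"
  unfolding wsym_def
proof (intro allI)
  fix u v :: "(nat \<times> 'h) list" and p q
  show "by_label n k (u @ p # q # v) = by_label n k (u @ q # p # v)"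
  proof (cases "mset (map fst (u @ p # q # v)) = mset [0..<n]")
    case True
    have "distinct (map fst (u @ p # q # v))" by (metis True distinct_upt mset_eq_imp_distinct_iff)
    then have "map_of (p # q # v) = map_of (q # p # v)" by (auto simp: fun_upd_twist)
    then have "map_of (u @ p # q # v) = map_of (u @ q # p # v)" by simp
    then show ?thesis unfolding by_label_def by (simp add: add_mset_commute)
  qed (auto simp: by_label_def add_mset_commute)
qed

text \<open>The list is read as a word labelled by positions. Permuting it only reorders the word,
  and by \<open>wsym_wact\<close> the action is insensitive to the order.\<close>

lemma lact_permute_list:
  assumes "\<sigma> permutes {..<n}" "mlin n k" "length fs = n"
  shows "lact (\<lambda>gs. k (permute_list \<sigma> gs)) fs h = lact k (permute_list \<sigma> fs) h"
proof -
  let ?\<tau> = "inv \<sigma>"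
  have t: "?\<tau> permutes {..<n}" by (rule permutes_inv[OF assms(1)])
  define gs where "gs = permute_list \<sigma> fs"
  have gs: "length gs = n" using assms(3) by (simp add: gs_def)
  have inv1: "permute_list \<sigma> (permute_list ?\<tau> xs) = xs" "permute_list ?\<tau> (permute_list \<sigma> xs) = xs"
    if "length xs = n" for xs :: "'z list"
    using permute_list_compose[of \<sigma> xs ?\<tau>] permute_list_compose[of ?\<tau> xs \<sigma>] assms(1) t that
    by (simp_all add: permutes_inv_o[OF assms(1)])
  have "lact k gs h = wact (by_label n k) (zip [0..<n] gs) h"
    by (subst wact_zip) (auto simp: gs by_label_zip intro!: lact_cong_length)
  also have "\<dots> = wact (by_label n k) (permute_list ?\<tau> (zip [0..<n] gs)) h"
    by (rule wsym_mset[OF wsym_wact[OF wlin_by_label[OF assms(2)] wsym_by_label]])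
      (use t gs in simp)
  also have "permute_list ?\<tau> (zip [0..<n] gs) = zip (permute_list ?\<tau> [0..<n]) fs"
  proof -
    have "permute_list ?\<tau> gs = fs" unfolding gs_def by (rule inv1(2)[OF assms(3)])
    moreover have "permute_list ?\<tau> (zip [0..<n] gs) = zip (permute_list ?\<tau> [0..<n]) (permute_list ?\<tau> gs)"
      by (rule permute_list_zip[OF t]) (simp_all add: gs)
    ultimately show ?thesis by simp
  qed
  also have "wact (by_label n k) \<dots> h = lact (\<lambda>xs. k (permute_list \<sigma> xs)) fs h"
  proof (subst wact_zip)
    show "lact (\<lambda>gs. by_label n k (zip (permute_list ?\<tau> [0..<n]) gs)) fs h = lact (\<lambda>xs. k (permute_list \<sigma> xs)) fs h"
    proof (rule lact_cong_length)
      fix xs :: "'h list" assume "length xs = length fs"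
      then have l: "length xs = n" using assms(3) by simp
      have "zip (permute_list ?\<tau> [0..<n]) xs = permute_list ?\<tau> (zip [0..<n] (permute_list \<sigma> xs))"
        using permute_list_zip[OF t, of "[0..<n]" "permute_list \<sigma> xs"] inv1(2)[OF l] l by simp
      then have "by_label n k (zip (permute_list ?\<tau> [0..<n]) xs) = by_label n k (zip [0..<n] (permute_list \<sigma> xs))"
        using t l by (simp add: wsym_mset[OF wsym_by_label mset_permute_list])
      then show "by_label n k (zip (permute_list ?\<tau> [0..<n]) xs) = k (permute_list \<sigma> xs)"
        using l by (simp add: by_label_zip)
    qed
  qed (use assms in simp)
  finally show ?thesis by (simp add: gs_def)
qed

end

section \<open>Tensor products over the Hopf algebra\<close>

abbreviation (in cocommutative_hopf) "ptn n M xs \<equiv> ptens H n M (tens H xs)"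
abbreviation (in cocommutative_hopf) "pswap M \<equiv> pperm H 2 M (transpose 0 1)"

section \<open>Submodules and homomorphisms of modules\<close>

lemma left_moduleD:
  assumes "left_module M"
  shows "0 \<in> carr M" "a \<in> carr M \<Longrightarrow> b \<in> carr M \<Longrightarrow> a - b \<in> carr M"
    "a \<in> carr M \<Longrightarrow> b \<in> carr M \<Longrightarrow> a + b \<in> carr M" "a \<in> carr M \<Longrightarrow> - a \<in> carr M"
    "a \<in> carr M \<Longrightarrow> act M f a \<in> carr M"
    "a \<in> carr M \<Longrightarrow> b \<in> carr M \<Longrightarrow> act M f (a + b) = act M f a + act M f b"
    "a \<in> carr M \<Longrightarrow> act M (f + g) a = act M f a + act M g a"
    "a \<in> carr M \<Longrightarrow> act M (f * g) a = act M f (act M g a)"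
    "a \<in> carr M \<Longrightarrow> act M 1 a = a" "act M f 0 = 0"
    "a \<in> carr M \<Longrightarrow> act M f (- a) = - act M f a"
    "a \<in> carr M \<Longrightarrow> b \<in> carr M \<Longrightarrow> act M f (a - b) = act M f a - act M f b"
proof -
  note M = assms[unfolded left_module_def]
  show z: "0 \<in> carr M" and d: "\<And>a b. a \<in> carr M \<Longrightarrow> b \<in> carr M \<Longrightarrow> a - b \<in> carr M"
    "\<And>a f. a \<in> carr M \<Longrightarrow> act M f a \<in> carr M"
    and p: "\<And>a b f. a \<in> carr M \<Longrightarrow> b \<in> carr M \<Longrightarrow> act M f (a + b) = act M f a + act M f b"
    "\<And>a f g. a \<in> carr M \<Longrightarrow> act M (f + g) a = act M f a + act M g a"
    "\<And>a f g. a \<in> carr M \<Longrightarrow> act M (f * g) a = act M f (act M g a)"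
    "\<And>a. a \<in> carr M \<Longrightarrow> act M 1 a = a"
    using M by auto
  show m: "\<And>a. a \<in> carr M \<Longrightarrow> - a \<in> carr M" using d(1)[OF z] by simp
  show "\<And>a b. a \<in> carr M \<Longrightarrow> b \<in> carr M \<Longrightarrow> a + b \<in> carr M"
    using d(1) m by (metis diff_minus_eq_add)
  show a0: "act M f 0 = 0" for f using p(1)[OF z z, of f] by simp
  show am: "act M f (- a) = - act M f a" if "a \<in> carr M" for f a
    using p(1)[OF that m[OF that], of f] a0[of f] by (simp add: eq_neg_iff_add_eq_0 add.commute)
  show "\<And>a b f. a \<in> carr M \<Longrightarrow> b \<in> carr M \<Longrightarrow> act M f (a - b) = act M f a - act M f b"
    using p(1)[OF _ m] am by simp
qed

lemma left_module_cong:
  "carr M = carr M' \<Longrightarrow> act M = act M' \<Longrightarrow> left_module M = left_module M'"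
  by (simp add: left_module_def)

lemma submoduleD:
  assumes "submodule M N"
  shows "N \<subseteq> carr M" "0 \<in> N" "a \<in> N \<Longrightarrow> b \<in> N \<Longrightarrow> a - b \<in> N" "a \<in> N \<Longrightarrow> - a \<in> N"
    "a \<in> N \<Longrightarrow> b \<in> N \<Longrightarrow> a + b \<in> N" "a \<in> N \<Longrightarrow> act M f a \<in> N"
proof -
  note N = assms[unfolded submodule_def]
  show "N \<subseteq> carr M" and z: "0 \<in> N" and d: "\<And>a b. a \<in> N \<Longrightarrow> b \<in> N \<Longrightarrow> a - b \<in> N"
    and "a \<in> N \<Longrightarrow> act M f a \<in> N" using N by auto
  show m: "\<And>a. a \<in> N \<Longrightarrow> - a \<in> N" using d[OF z] by simp
  show "a \<in> N \<Longrightarrow> b \<in> N \<Longrightarrow> a + b \<in> N" using d[OF _ m] by simp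
qed

lemma submoduleI:
  assumes "N \<subseteq> carr M" "0 \<in> N" "\<And>a b. a \<in> N \<Longrightarrow> b \<in> N \<Longrightarrow> a - b \<in> N" "\<And>f a. a \<in> N \<Longrightarrow> act M f a \<in> N"
  shows "submodule M N"
  using assms by (simp add: submodule_def)

lemma left_module_submodule:
  assumes "left_module M" "submodule M (carr N)" "act N = act M"
  shows "left_module N"
  using submoduleD[OF assms(2)] left_moduleD[OF assms(1)] assms(3)
  unfolding left_module_def by (simp add: subset_iff)

lemma submodule_carr: "left_module M \<Longrightarrow> submodule M (carr M)"
  by (rule submoduleI) (auto simp: left_moduleD)

lemma submodule_zero: "left_module M \<Longrightarrow> submodule M {0}"
  by (rule submoduleI) (auto simp: left_moduleD)

lemma generated_submodule_props:
  assumes "left_module M" "X \<subseteq> carr M"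
  shows "submodule M (generated_submodule M X)" "X \<subseteq> generated_submodule M X"
    "submodule M N \<Longrightarrow> X \<subseteq> N \<Longrightarrow> generated_submodule M X \<subseteq> N"
proof -
  have "generated_submodule M X \<subseteq> carr M"
    unfolding generated_submodule_def using submodule_carr[OF assms(1)] assms(2) by blast
  then show "submodule M (generated_submodule M X)"
  proof (rule submoduleI)
    show "0 \<in> generated_submodule M X" unfolding generated_submodule_def using submoduleD(2) by blast
    show "\<And>a b. a \<in> generated_submodule M X \<Longrightarrow> b \<in> generated_submodule M X \<Longrightarrow> a - b \<in> generated_submodule M X"
      unfolding generated_submodule_def using submoduleD(3) by blast
    show "\<And>f a. a \<in> generated_submodule M X \<Longrightarrow> act M f a \<in> generated_submodule M X"
      unfolding generated_submodule_def using submoduleD(6) by blast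
  qed
  show "X \<subseteq> generated_submodule M X" unfolding generated_submodule_def by blast
  show "submodule M N \<Longrightarrow> X \<subseteq> N \<Longrightarrow> generated_submodule M X \<subseteq> N"
    unfolding generated_submodule_def by blast
qed

definition module_hom_on ::
  "('h::ring_1, 'm::ab_group_add, 'y) hmodule_scheme \<Rightarrow> ('h, 'n::ab_group_add, 'z) hmodule_scheme \<Rightarrow>
    ('m \<Rightarrow> 'n) \<Rightarrow> bool" where
  "module_hom_on M N q \<longleftrightarrow> (\<forall>a\<in>carr M. q a \<in> carr N) \<and>
    (\<forall>a\<in>carr M. \<forall>b\<in>carr M. q (a + b) = q a + q b) \<and>
    (\<forall>h. \<forall>a\<in>carr M. q (act M h a) = act N h (q a))"

lemma module_hom_onD: assumes "module_hom_on M N q"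
  shows "a \<in> carr M \<Longrightarrow> q a \<in> carr N" "a \<in> carr M \<Longrightarrow> b \<in> carr M \<Longrightarrow> q (a + b) = q a + q b"
    "a \<in> carr M \<Longrightarrow> q (act M h a) = act N h (q a)"
  using assms by (auto simp: module_hom_on_def)

lemma module_hom_on_zero: "left_module M \<Longrightarrow> module_hom_on M N q \<Longrightarrow> q 0 = 0"
  using module_hom_onD(2)[of M N q 0 0] left_moduleD(1)[of M] by simp

lemma module_hom_on_diff:
  "left_module M \<Longrightarrow> module_hom_on M N q \<Longrightarrow> a \<in> carr M \<Longrightarrow> b \<in> carr M \<Longrightarrow> q (a - b) = q a - q b"
  using module_hom_onD(2)[of M N q "a - b" b] left_moduleD(2)[of M] by simp

lemma module_hom_on_id: "submodule M (carr N) \<Longrightarrow> act N = act M \<Longrightarrow> module_hom_on N M (\<lambda>a. a)"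
  using submoduleD(1) by (auto simp: module_hom_on_def)

lemma submodule_preimage:
  assumes M: "left_module M" and W: "submodule N W" and q: "module_hom_on M N q"
  shows "submodule M {a \<in> carr M. q a \<in> W}"
proof (rule submoduleI)
  note w = submoduleD[OF W] and m = left_moduleD[OF M]
  show "0 \<in> {a \<in> carr M. q a \<in> W}" using m(1) w(2) module_hom_on_zero[OF M q] by simp
  show "a - b \<in> {a \<in> carr M. q a \<in> W}" if "a \<in> {a \<in> carr M. q a \<in> W}" "b \<in> {a \<in> carr M. q a \<in> W}" for a b
    using that m(2) w(3) module_hom_on_diff[OF M q, of a b] by simp
  show "act M f a \<in> {a \<in> carr M. q a \<in> W}" if "a \<in> {a \<in> carr M. q a \<in> W}" for f a
    using that m(5) w(6) module_hom_onD(3)[OF q, of a f] by simp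
qed auto

lemma submodule_image:
  assumes M: "left_module M" and W: "submodule M W" and q: "module_hom_on M N q"
  shows "submodule N (q ` W)"
proof (rule submoduleI)
  note w = submoduleD[OF W]
  have WM: "a \<in> W \<Longrightarrow> a \<in> carr M" for a using w(1) by blast
  show "q ` W \<subseteq> carr N" using module_hom_onD(1)[OF q] WM by blast
  show "0 \<in> q ` W" by (rule image_eqI[where f = q, OF module_hom_on_zero[OF M q, symmetric] w(2)])
  fix x assume "x \<in> q ` W"
  then obtain a where a: "x = q a" "a \<in> W" by (rule imageE)
  show "x - y \<in> q ` W" if y: "y \<in> q ` W" for y
  proof -
    obtain b where b: "y = q b" "b \<in> W" using y by (rule imageE)
    show ?thesis by (rule image_eqI[OF _ w(3)[OF a(2) b(2)]]) (simp add: a b module_hom_on_diff[OF M q] WM)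
  qed
  show "act N f x \<in> q ` W" for f
    by (rule image_eqI[OF _ w(6)[OF a(2), of f]]) (simp add: a module_hom_onD(3)[OF q] WM)
qed

lemma submodule_trans:
  "submodule N W \<Longrightarrow> submodule M (carr N) \<Longrightarrow> act N = act M \<Longrightarrow> submodule M W"
  by (auto simp: submodule_def)

text \<open>The tensor products see only the carrier and the action. A pseudoalgebra may thus be
  replaced by its underlying module, as with \<open>TKK\<close> and
  \<open>tkk_module\<close>.\<close>

lemma pseudo_cong:
  assumes "carr M = carr M'" "act M = act M'"
  shows "pseudo H n M = pseudo H n M'" "ptens H n M = ptens H n M'" "emb H M = emb H M'"
    "lmul H n M = lmul H n M'" "pperm H n M = pperm H n M'" "push H n M = push H n M'"
proof -
  have 1: "pseudo_gens H n M = pseudo_gens H n M'" "pseudo_rels H n M = pseudo_rels H n M'" for n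
    using assms by (simp_all add: pseudo_gens_def pseudo_rels_def)
  show "pseudo H n M = pseudo H n M'" by (simp add: pseudo_def 1)
  show 2: "ptens H n M = ptens H n M'" for n by (intro ext) (simp add: ptens_def 1)
  show "emb H M = emb H M'" by (intro ext) (simp add: emb_def 2)
  show "lmul H n M = lmul H n M'" "pperm H n M = pperm H n M'" "push H n M = push H n M'"
    by (intro ext; simp add: lmul_def pperm_def push_def 2)+
qed

context cocommutative_hopf
begin

section \<open>Linear maps out of tensor products over the Hopf algebra\<close>

lemma tmul_assoc:
  assumes "F \<in> tensor_power H n" "G \<in> tensor_power H n" "K \<in> tensor_power H n"
  shows "tmul H (tmul H F G) K = tmul H F (tmul H G K)"
proof -
  have 1: "tmul H (tmul H (tens H xs) (tens H ys)) (tens H zs) = tmul H (tens H xs) (tmul H (tens H ys) (tens H zs))"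
    if "length xs = n" "length ys = n" "length zs = n" for xs ys zs
  proof -
    have "map2 (*) (map2 (*) xs ys) zs = map2 (*) xs (map2 (*) ys zs)"
      using that by (intro nth_equalityI) (auto simp: mult.assoc)
    then show ?thesis using that by (simp add: tmul_tens)
  qed
  have c: "flin (\<lambda>F. L (L' F))" if "flin L" "flin L'" for L :: "('k, 'h) tensor \<Rightarrow> ('k, 'h) tensor" and L'
    using that by (simp add: flin_def)
  have 2: "tmul H (tmul H (tens H xs) (tens H ys)) K = tmul H (tens H xs) (tmul H (tens H ys) K)"
    if "length xs = n" "length ys = n" for xs ys
    by (rule tensor_power_eqI[OF flin_tmul(2) c[OF flin_tmul(2) flin_tmul(2)] _ assms(3)])
      (rule 1[OF that])
  have 3: "tmul H (tmul H (tens H xs) G) K = tmul H (tens H xs) (tmul H G K)"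
    if "length xs = n" for xs
    by (rule tensor_power_eqI[OF c[OF flin_tmul(1) flin_tmul(2)] c[OF flin_tmul(2) flin_tmul(1)] _ assms(2)])
      (rule 2[OF that])
  show ?thesis
    by (rule tensor_power_eqI[OF c[OF flin_tmul(1) flin_tmul(1)] flin_tmul(1) _ assms(1)]) (rule 3)
qed

lemma pseudo_rels_facts:
  assumes "left_module M"
  shows "free.subspace (pseudo_rels H n M)" "pseudo_rels H n M \<subseteq> formal (pseudo_gens H n M)"
proof -
  show "free.subspace (pseudo_rels H n M)" by (simp add: pseudo_rels_def)
  have t: "F + G \<in> tensor_power H n" "fscale c F \<in> tensor_power H n"
    if "F \<in> tensor_power H n" "G \<in> tensor_power H n" for F G c
    using that subspace_tensor_power free.subspace_add free.subspace_scale by blast+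
  show "pseudo_rels H n M \<subseteq> formal (pseudo_gens H n M)"
    unfolding pseudo_rels_def
    by (rule span_formal) (auto intro!: formal_diff formal_scale t simp: pseudo_gens_def left_moduleD[OF assms])
qed

lemma ptens_rules:
  assumes M: "left_module M" and F: "F \<in> tensor_power H n" and a: "a \<in> carr M"
  shows "G \<in> tensor_power H n \<Longrightarrow> ptens H n M (F + G) a = ptens H n M F a + ptens H n M G a"
    "b \<in> carr M \<Longrightarrow> ptens H n M F (a + b) = ptens H n M F a + ptens H n M F b"
    "ptens H n M (fscale c F) a = fscale c (ptens H n M F a)"
    "ptens H n M (tmul H F (iter_comult H n h)) a = ptens H n M F (act M h a)"
proof -
  let ?q = "qmap (pseudo_gens H n M) (pseudo_rels H n M)" and ?s = "\<lambda>x. Poly_Mapping.single x (1::'k)"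
  note f = pseudo_rels_facts[OF M, of n]
  have q: "flin ?q" by (rule linear_imp_flin[OF linear_qmap[OF f]])
  show "ptens H n M (F + G) a = ptens H n M F a + ptens H n M G a" if "G \<in> tensor_power H n"
  proof -
    have "?q (?s (F + G, a) - ?s (F, a) - ?s (G, a)) = 0"
      by (rule qmap_zero[OF f]) (use F a that in \<open>unfold pseudo_rels_def, blast intro: free.span_base\<close>)
    then show ?thesis by (simp add: ptens_def flinD[OF q] algebra_simps)
  qed
  show "ptens H n M F (a + b) = ptens H n M F a + ptens H n M F b" if "b \<in> carr M"
  proof -
    have "?q (?s (F, a + b) - ?s (F, a) - ?s (F, b)) = 0"
      by (rule qmap_zero[OF f]) (use F a that in \<open>unfold pseudo_rels_def, blast intro: free.span_base\<close>)
    then show ?thesis by (simp add: ptens_def flinD[OF q] algebra_simps)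
  qed
  have "?q (?s (fscale c F, a) - fscale c (?s (F, a))) = 0"
    by (rule qmap_zero[OF f]) (use F a in \<open>unfold pseudo_rels_def, blast intro: free.span_base\<close>)
  then show "ptens H n M (fscale c F) a = fscale c (ptens H n M F a)"
    by (simp add: ptens_def flinD[OF q])
  have "?q (?s (tmul H F (iter_comult H n h), a) - ?s (F, act M h a)) = 0"
    by (rule qmap_zero[OF f]) (use F a in \<open>unfold pseudo_rels_def, blast intro: free.span_base\<close>)
  then show "ptens H n M (tmul H F (iter_comult H n h)) a = ptens H n M F (act M h a)"
    by (simp add: ptens_def flinD[OF q])
qed

text \<open>The map \<open>g\<close> is linear on the tensor power only, not on all formal
  combinations; on the tensor power it still agrees with a linear extension, to which the calculus
  of \<open>fext\<close> applies.\<close>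

lemma tensor_power_linear_eq_fext:
  assumes "\<And>F G. F \<in> tensor_power H n \<Longrightarrow> G \<in> tensor_power H n \<Longrightarrow> g (F + G) = g F + g G"
    "\<And>c F. F \<in> tensor_power H n \<Longrightarrow> g (fscale c F) = fscale c (g F)"
    and F: "F \<in> tensor_power H n"
  shows "g F = fext (\<lambda>u. g (tens H u)) F" "mlin n (\<lambda>u. g (tens H u))"
proof -
  show m: "mlin n (\<lambda>u. g (tens H u))"
    unfolding mlin_def
  proof (intro allI impI hlinI)
    fix xs ys :: "'h list" and a b c assume n: "Suc (length xs + length ys) = n"
    have t: "tens H (xs @ d # ys) \<in> tensor_power H n" for d
      by (rule tens_in_tensor_power) (use n in simp)
    show "g (tens H (xs @ (a + b) # ys)) = g (tens H (xs @ a # ys)) + g (tens H (xs @ b # ys))"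
      unfolding hlinD(1)[OF mlinD[OF mlin_tens n]] by (rule assms(1)[OF t t])
    show "g (tens H (xs @ scl H c a # ys)) = fscale c (g (tens H (xs @ a # ys)))"
      unfolding hlinD(2)[OF mlinD[OF mlin_tens n]] by (rule assms(2)[OF t])
  qed
  have "F \<in> free.span (tens H ` {xs. length xs = n})" by (rule F[unfolded tensor_power_span])
  then have "F \<in> tensor_power H n \<and> g F = fext (\<lambda>u. g (tens H u)) F"
  proof (rule free.span_induct)
    have "g 0 = 0"
      using assms(2)[of 0 0] free.subspace_0[OF subspace_tensor_power] by simp
    then show "free.subspace {F. F \<in> tensor_power H n \<and> g F = fext (\<lambda>u. g (tens H u)) F}"
      using subspace_tensor_power[of n]
      by (intro free.subspaceI) (auto simp: assms(1,2) fext_add fext_scale free.subspace_0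
          free.subspace_add free.subspace_scale)
  qed (auto simp: fext_tens[OF m])
  then show "g F = fext (\<lambda>u. g (tens H u)) F" by simp
qed

text \<open>The universal property of the tensor product over \<open>H\<close>. Compatibility with
  the action is assumed for pure tensors only, in the form of \<open>lact\<close>; the step
  \<open>bal\<close> extends it to all tensors by linearity.\<close>

lemma ptens_universal:
  assumes M: "left_module M"
    and g: "\<And>F G m. F \<in> tensor_power H n \<Longrightarrow> G \<in> tensor_power H n \<Longrightarrow> m \<in> carr M \<Longrightarrow> g (F + G) m = g F m + g G m"
      "\<And>c F m. F \<in> tensor_power H n \<Longrightarrow> m \<in> carr M \<Longrightarrow> g (fscale c F) m = fscale c (g F m)"
      "\<And>F m m'. F \<in> tensor_power H n \<Longrightarrow> m \<in> carr M \<Longrightarrow> m' \<in> carr M \<Longrightarrow> g F (m + m') = g F m + g F m'"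
      "\<And>xs m h. length xs = n \<Longrightarrow> m \<in> carr M \<Longrightarrow> lact (\<lambda>u. g (tens H u) m) xs h = g (tens H xs) (act M h m)"
    and F: "F \<in> tensor_power H n" and a: "a \<in> carr M"
  shows "fext (\<lambda>(F, m). g F m) (ptens H n M F a) = g F a"
proof -
  let ?L = "fext (\<lambda>(F, m). g F m)"
  have bal: "g (tmul H F (iter_comult H n h)) m = g F (act M h m)" if "F \<in> tensor_power H n" "m \<in> carr M" for F m h
  proof -
    have am: "act M h m \<in> carr M" by (rule left_moduleD(5)[OF M that(2)])
    have "g (tmul H F (iter_comult H n h)) m = fext (\<lambda>u. g (tens H u) m) (tmul H F (iter_comult H n h))"
      by (rule tensor_power_linear_eq_fext(1)[where g = "\<lambda>F. g F m"]) (use that g(1,2) in auto)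
    also have "\<dots> = fext (\<lambda>u. g (tens H u) (act M h m)) F"
    proof (rule tensor_power_eqI[OF _ flin_fext _ that(1)])
      show "flin (\<lambda>F. fext (\<lambda>u. g (tens H u) m) (tmul H F (iter_comult H n h)))"
        using flin_tmul(1)[of "iter_comult H n h"] by (simp add: flin_def fext_add fext_scale)
      fix xs :: "'h list" assume xs: "length xs = n"
      have m1: "mlin n (\<lambda>u. g (tens H u) m)" "mlin n (\<lambda>u. g (tens H u) (act M h m))"
        using tensor_power_linear_eq_fext(2)[of n "\<lambda>F. g F m" F]
          tensor_power_linear_eq_fext(2)[of n "\<lambda>F. g F (act M h m)" F] that g(1,2) am by auto
      show "fext (\<lambda>u. g (tens H u) m) (tmul H (tens H xs) (iter_comult H n h))
          = fext (\<lambda>u. g (tens H u) (act M h m)) (tens H xs)"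
        using xs by (simp add: fext_tmul_iter_comult[OF m1(1)] fext_tens[OF m1(2)] g(4) that)
    qed
    also have "\<dots> = g F (act M h m)"
      by (rule tensor_power_linear_eq_fext(1)[where g = "\<lambda>F. g F (act M h m)", symmetric])
        (use that g(1,2) am in auto)
    finally show ?thesis .
  qed
  have z: "?L x = 0" if "x \<in> pseudo_rels H n M" for x
    using that unfolding pseudo_rels_def
    by (rule flin_zero_on_span[OF flin_fext, rotated])
      (auto simp: fext_diff fext_scale g(1-3) bal)
  show ?thesis unfolding ptens_def
    using F a by (subst qmap_universal[OF pseudo_rels_facts[OF M] flin_fext z]) (auto simp: pseudo_gens_def)
qed

lemma ptens_in [simp]: "F \<in> tensor_power H n \<Longrightarrow> a \<in> carr M \<Longrightarrow> ptens H n M F a \<in> pseudo H n M"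
  unfolding ptens_def pseudo_def by (auto simp: pseudo_gens_def)

lemma ptens_fext:
  assumes "left_module M" "F \<in> tensor_power H n" "a \<in> carr M"
  shows "ptens H n M F a = fext (\<lambda>u. ptn n M u a) F"
  by (rule tensor_power_linear_eq_fext(1)[where g = "\<lambda>F. ptens H n M F a"])
    (use assms ptens_rules[OF assms(1) _ assms(3)] in auto)

lemma mlin_ptens:
  assumes "left_module M" "a \<in> carr M" shows "mlin n (\<lambda>u. ptn n M u a)"
  using tensor_power_linear_eq_fext(2)[of n "\<lambda>F. ptens H n M F a" 0]
    ptens_rules[OF assms(1) _ assms(2)] free.subspace_0[OF subspace_tensor_power] by auto

lemma lact_ptens:
  assumes "left_module M" "a \<in> carr M" "length xs = n"
  shows "lact (\<lambda>u. ptn n M u a) xs h = ptn n M xs (act M h a)"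
proof -
  have "lact (\<lambda>u. ptn n M u a) xs h
      = fext (\<lambda>u. ptn n M u a) (tmul H (tens H xs) (iter_comult H n h))"
    using assms by (simp add: fext_tmul_iter_comult mlin_ptens)
  also have "\<dots> = ptens H n M (tmul H (tens H xs) (iter_comult H n h)) a"
    using assms by (intro ptens_fext[symmetric]) auto
  also have "\<dots> = ptn n M xs (act M h a)"
    using assms by (simp add: ptens_rules)
  finally show ?thesis .
qed

lemma ptens_zero: "left_module M \<Longrightarrow> F \<in> tensor_power H n \<Longrightarrow> ptens H n M F 0 = 0"
  using ptens_rules(2)[of M F n 0 0] left_moduleD(1)[of M] by simp

lemma ptens_minus:
  "left_module M \<Longrightarrow> F \<in> tensor_power H n \<Longrightarrow> a \<in> carr M \<Longrightarrow> ptens H n M F (- a) = - ptens H n M F a"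
  using ptens_rules(2)[of M F n a "- a"] left_moduleD(4)[of M a] ptens_zero[of M F n]
  by (simp add: eq_neg_iff_add_eq_0 add.commute)

lemma subspace_pseudo: "left_module M \<Longrightarrow> free.subspace (pseudo H n M)"
  unfolding pseudo_def
  by (rule module_hom.subspace_image[OF Vector_Spaces.linear.axioms(3)[OF linear_qmap[OF pseudo_rels_facts]] subspace_formal])

text \<open>For a submodule \<open>N\<close> of \<open>M\<close> this is the image of the tensor
  product over \<open>N\<close>, so the condition on products in \<open>pideal\<close> is membership
  in it.\<close>

definition pspan :: "nat \<Rightarrow> ('h, 'm::ab_group_add, 'z) hmodule_scheme \<Rightarrow> 'm set \<Rightarrow> ('k, 'h, 'm) pseudo set" where
  "pspan n M N = free.span {ptens H n M F c | F c. F \<in> tensor_power H n \<and> c \<in> N}"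

lemma subspace_pspan: "free.subspace (pspan n M N)"
  by (simp add: pspan_def)

lemma pspan_base: "F \<in> tensor_power H n \<Longrightarrow> c \<in> N \<Longrightarrow> ptens H n M F c \<in> pspan n M N"
  unfolding pspan_def by (rule free.span_base) blast

lemma pspan_tens: assumes "left_module M" "N \<subseteq> carr M"
  shows "pspan n M N = free.span {ptn n M xs c | xs c. length xs = n \<and> c \<in> N}"
proof
  let ?R = "free.span {ptn n M xs c | xs c. length xs = n \<and> c \<in> N}"
  show "?R \<subseteq> pspan n M N" unfolding pspan_def
    by (rule free.span_mono) (use tens_in_tensor_power in blast)
  show "pspan n M N \<subseteq> ?R"
    unfolding pspan_def
  proof (rule free.span_minimal, clarify)
    fix F c assume "F \<in> tensor_power H n" "c \<in> N"
    have "fext (\<lambda>u. ptn n M u c) F \<in> ?R"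
    proof (rule fext_mem[OF free.subspace_span])
      fix xs assume "xs \<in> Poly_Mapping.keys F"
      with \<open>F \<in> tensor_power H n\<close> have "length xs = n" by (rule keys_tensor_power)
      with \<open>c \<in> N\<close> show "ptn n M xs c \<in> ?R" by (intro free.span_base) blast
    qed
    then show "ptens H n M F c \<in> ?R"
      using assms \<open>F \<in> tensor_power H n\<close> \<open>c \<in> N\<close> by (subst ptens_fext) auto
  qed simp
qed

lemma pseudo_eq_pspan:
  fixes M :: "('h, 'm::ab_group_add, 'z) hmodule_scheme"
  assumes M: "left_module M" shows "pseudo H n M = pspan n M (carr M)"
proof
  show "pspan n M (carr M) \<subseteq> pseudo H n M"
    unfolding pspan_def by (rule free.span_minimal[OF _ subspace_pseudo[OF M]]) auto
  show "pseudo H n M \<subseteq> pspan n M (carr M)"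
    unfolding pseudo_def
  proof clarify
    let ?q = "qmap (pseudo_gens H n M) (pseudo_rels H n M)"
    fix f :: "('k, 'h, 'm) pseudo" assume f: "f \<in> formal (pseudo_gens H n M)"
    have "?q f = fext (\<lambda>x. ?q (Poly_Mapping.single x 1)) f"
      by (rule flin_as_fext[OF linear_imp_flin[OF linear_qmap[OF pseudo_rels_facts[OF M]]]])
    also have "\<dots> \<in> pspan n M (carr M)"
    proof (rule fext_mem[OF subspace_pspan])
      fix x assume "x \<in> Poly_Mapping.keys f"
      then obtain F a where "x = (F, a)" "F \<in> tensor_power H n" "a \<in> carr M"
        using f by (auto simp: formal_def pseudo_gens_def)
      then show "?q (Poly_Mapping.single x 1) \<in> pspan n M (carr M)"
        using pspan_base[of F n a "carr M" M] by (simp add: ptens_def)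
    qed
    finally show "?q f \<in> pspan n M (carr M)" .
  qed
qed

lemma pspan_eqI:
  assumes "left_module M" "N \<subseteq> carr M" "flin L" "flin L'"
    "\<And>xs c. length xs = n \<Longrightarrow> c \<in> N \<Longrightarrow> L (ptn n M xs c) = L' (ptn n M xs c)"
    "X \<in> pspan n M N"
  shows "L X = L' X"
  by (rule flin_eq_on_span[OF assms(3,4) _ assms(6)[unfolded pspan_tens[OF assms(1,2)]]]) (use assms(5) in auto)

lemma pspan_memI:
  assumes "left_module M" "N \<subseteq> carr M" "flin L" "free.subspace V"
    "\<And>xs c. length xs = n \<Longrightarrow> c \<in> N \<Longrightarrow> L (ptn n M xs c) \<in> V"
    "X \<in> pspan n M N"
  shows "L X \<in> V"
  by (rule flin_in_span[OF assms(3) _ assms(4) assms(6)[unfolded pspan_tens[OF assms(1,2)]]]) (use assms(5) in auto)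

lemma pseudo_eqI:
  assumes "left_module M" "flin L" "flin L'"
    "\<And>xs c. length xs = n \<Longrightarrow> c \<in> carr M \<Longrightarrow> L (ptn n M xs c) = L' (ptn n M xs c)"
    "X \<in> pseudo H n M"
  shows "L X = L' X"
  using pspan_eqI[OF assms(1) subset_refl assms(2-4)] assms(1,5) by (simp add: pseudo_eq_pspan)

lemma pseudo_memI:
  assumes "left_module M" "flin L" "free.subspace V"
    "\<And>xs c. length xs = n \<Longrightarrow> c \<in> carr M \<Longrightarrow> L (ptn n M xs c) \<in> V"
    "X \<in> pseudo H n M"
  shows "L X \<in> V"
  using pspan_memI[OF assms(1) subset_refl assms(2-4)] assms(1,5) by (simp add: pseudo_eq_pspan)

lemma pspan_mono: "N \<subseteq> N' \<Longrightarrow> pspan n M N \<subseteq> pspan n M N'"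
  unfolding pspan_def by (rule free.span_mono) auto

lemma pspan_zero: "left_module M \<Longrightarrow> pspan n M {0} = {0}"
proof -
  assume "left_module M"
  then have "{ptens H n M F c | F c. F \<in> tensor_power H n \<and> c \<in> {0}} \<subseteq> {0}" by (auto simp: ptens_zero)
  then show ?thesis unfolding pspan_def
    using free.span_mono[of _ "{0}"] free.span_zero by (auto simp: free.span_insert_0)
qed

lemma keys_pseudo: "left_module M \<Longrightarrow> X \<in> pseudo H n M \<Longrightarrow> (P, c) \<in> Poly_Mapping.keys X \<Longrightarrow> P \<in> tensor_power H n \<and> c \<in> carr M"
  unfolding pseudo_def using qmap_formal[OF pseudo_rels_facts, of M] by (fastforce simp: formal_def pseudo_gens_def)

text \<open>
  Linear maps out of \<open>pseudo H n M\<close> are given by multilinear functions of a list of length \<open>n\<close>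
  and an element of \<open>M\<close> that are balanced with respect to the action of \<open>H\<close>.
\<close>

definition balanced :: "nat \<Rightarrow> ('h, 'm::ab_group_add, 'z) hmodule_scheme \<Rightarrow> ('h list \<Rightarrow> 'm \<Rightarrow> ('x \<Rightarrow>\<^sub>0 'k)) \<Rightarrow> bool" where
  "balanced n M g \<longleftrightarrow> (\<forall>m\<in>carr M. mlin n (\<lambda>xs. g xs m)) \<and>
    (\<forall>xs. \<forall>m\<in>carr M. \<forall>m'\<in>carr M. length xs = n \<longrightarrow> g xs (m + m') = g xs m + g xs m') \<and>
    (\<forall>xs h. \<forall>m\<in>carr M. length xs = n \<longrightarrow> lact (\<lambda>u. g u m) xs h = g xs (act M h m))"

definition pfun :: "('h list \<Rightarrow> 'm \<Rightarrow> ('x \<Rightarrow>\<^sub>0 'k)) \<Rightarrow> ('k, 'h, 'm) pseudo \<Rightarrow> ('x \<Rightarrow>\<^sub>0 'k)" where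
  "pfun g X = fext (\<lambda>(F, m). fext (\<lambda>xs. g xs m) F) X"

lemma flin_pfun: "flin (pfun g)"
  unfolding pfun_def by (rule flin_fext)

lemma pfun_ptens:
  assumes M: "left_module M" and g: "balanced n M g" and "length xs = n" "a \<in> carr M"
  shows "pfun g (ptn n M xs a) = g xs a"
proof -
  have m: "mlin n (\<lambda>xs. g xs m)" if "m \<in> carr M" for m using g that by (simp add: balanced_def)
  have "pfun g (ptn n M xs a) = fext (\<lambda>xs. g xs a) (tens H xs)"
    unfolding pfun_def
  proof (rule ptens_universal[OF M])
    fix F m m' assume F: "F \<in> tensor_power H n" and mm: "m \<in> carr M" "m' \<in> carr M"
    show "fext (\<lambda>xs. g xs (m + m')) F = fext (\<lambda>xs. g xs m) F + fext (\<lambda>xs. g xs m') F"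
      unfolding fext_add_fun[symmetric]
      by (rule fext_cong) (use g mm keys_tensor_power[OF F] in \<open>simp add: balanced_def\<close>)
  next
    fix xs :: "'h list" and m h assume xs: "length xs = n" and mm: "m \<in> carr M"
    have "lact (\<lambda>u. fext (\<lambda>xs. g xs m) (tens H u)) xs h = lact (\<lambda>u. g u m) xs h"
      by (rule lact_cong_length) (use xs fext_tens[OF m[OF mm]] in simp)
    then show "lact (\<lambda>u. fext (\<lambda>xs. g xs m) (tens H u)) xs h = fext (\<lambda>xs. g xs (act M h m)) (tens H xs)"
      using g xs mm left_moduleD(5)[OF M mm] by (simp add: fext_tens[OF m] balanced_def)
  qed (use assms in \<open>auto simp: fext_add fext_scale\<close>)
  then show ?thesis using fext_tens[OF m[OF assms(4)] assms(3)] by simp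
qed

lemma balanced_ptens: "left_module M \<Longrightarrow> balanced n M (\<lambda>xs a. ptn n M xs a)"
  unfolding balanced_def by (simp add: mlin_ptens ptens_rules lact_ptens)

lemma flin_lmul: "flin (lmul H n M F)" "flin (pperm H n M \<sigma>)" "flin (push H n N q)"
  unfolding lmul_def pperm_def push_def by (rule flin_fext)+

lemma lmul_ptens:
  assumes M: "left_module M" and F: "F \<in> tensor_power H n" "G \<in> tensor_power H n" and a: "a \<in> carr M"
  shows "lmul H n M F (ptens H n M G a) = ptens H n M (tmul H F G) a"
  unfolding lmul_def
proof (rule ptens_universal[OF M])
  fix xs :: "'h list" and m h assume xs: "length xs = n" and m: "m \<in> carr M"
  have mm: "mlin n (\<lambda>u. ptens H n M (tmul H F (tens H u)) m)"
    by (rule tensor_power_linear_eq_fext(2)[of n "\<lambda>G. ptens H n M (tmul H F G) m", OF _ _ F(1)])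
      (use F m in \<open>auto simp: flinD[OF flin_tmul(2)] ptens_rules[OF M]\<close>)
  have "lact (\<lambda>u. ptens H n M (tmul H F (tens H u)) m) xs h
      = fext (\<lambda>u. ptens H n M (tmul H F (tens H u)) m) (tmul H (tens H xs) (iter_comult H n h))"
    using xs by (simp add: fext_tmul_iter_comult[OF mm])
  also have "\<dots> = ptens H n M (tmul H F (tmul H (tens H xs) (iter_comult H n h))) m"
    by (rule tensor_power_linear_eq_fext(1)[of n "\<lambda>G. ptens H n M (tmul H F G) m", symmetric])
      (use F m xs in \<open>auto simp: flinD[OF flin_tmul(2)] ptens_rules[OF M]\<close>)
  also have "\<dots> = ptens H n M (tmul H F (tens H xs)) (act M h m)"
    using F m xs by (simp add: tmul_assoc[of _ n, symmetric] ptens_rules[OF M])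
  finally show "lact (\<lambda>u. ptens H n M (tmul H F (tens H u)) m) xs h
    = ptens H n M (tmul H F (tens H xs)) (act M h m)" .
qed (use F a in \<open>auto simp: flinD[OF flin_tmul(2)] ptens_rules[OF M]\<close>)

lemma lmul_tens:
  assumes "left_module M" "length fs = n" "length gs = n" "a \<in> carr M"
  shows "lmul H n M (tens H fs) (ptn n M gs a) = ptn n M (map2 (*) fs gs) a"
  using assms by (simp add: lmul_ptens tmul_tens)

lemma pperm_tens:
  assumes M: "left_module M" and s: "\<sigma> permutes {..<n}" and gs: "length gs = n" and a: "a \<in> carr M"
  shows "pperm H n M \<sigma> (ptn n M gs a) = ptn n M (permute_list (inv \<sigma>) gs) a"
proof -
  have "pperm H n M \<sigma> (ptn n M gs a) = ptens H n M (tperm H \<sigma> (tens H gs)) a"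
    unfolding pperm_def
  proof (rule ptens_universal[OF M])
    fix xs :: "'h list" and m h assume xs: "length xs = n" and m: "m \<in> carr M"
    have "lact (\<lambda>u. ptens H n M (tperm H \<sigma> (tens H u)) m) xs h
      = lact (\<lambda>u. ptn n M (permute_list (inv \<sigma>) u) m) xs h"
      by (rule lact_cong_length) (use xs s in \<open>simp add: tperm_tens\<close>)
    also have "\<dots> = lact (\<lambda>u. ptn n M u m) (permute_list (inv \<sigma>) xs) h"
      by (rule lact_permute_list[OF permutes_inv[OF s] mlin_ptens[OF M m] xs])
    finally show "lact (\<lambda>u. ptens H n M (tperm H \<sigma> (tens H u)) m) xs h
        = ptens H n M (tperm H \<sigma> (tens H xs)) (act M h m)"
      using xs s m by (simp add: lact_ptens[OF M] tperm_tens)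
  qed (use gs a in \<open>auto simp: flinD[OF flin_tperm] ptens_rules[OF M]\<close>)
  then show ?thesis using gs s by (simp add: tperm_tens)
qed

lemma push_ptens:
  assumes M: "left_module M" and N: "left_module N" and q: "module_hom_on M N q"
    and F: "F \<in> tensor_power H n" and a: "a \<in> carr M"
  shows "push H n N q (ptens H n M F a) = ptens H n N F (q a)"
  unfolding push_def
  by (rule ptens_universal[OF M])
    (use F a in \<open>auto simp: ptens_rules[OF N] module_hom_onD[OF q] lact_ptens[OF N]\<close>)

lemma lmul_in: "left_module M \<Longrightarrow> F \<in> tensor_power H n \<Longrightarrow> X \<in> pseudo H n M \<Longrightarrow> lmul H n M F X \<in> pseudo H n M"
  by (rule pseudo_memI[OF _ flin_lmul(1) subspace_pseudo]) (auto simp: lmul_ptens)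

lemma lmul_pspan: "left_module M \<Longrightarrow> N \<subseteq> carr M \<Longrightarrow> F \<in> tensor_power H n \<Longrightarrow> X \<in> pspan n M N \<Longrightarrow> lmul H n M F X \<in> pspan n M N"
  by (rule pspan_memI[OF _ _ flin_lmul(1) subspace_pspan]) (auto simp: lmul_ptens subset_iff intro: pspan_base)

lemma pperm_in: "left_module M \<Longrightarrow> \<sigma> permutes {..<n} \<Longrightarrow> X \<in> pseudo H n M \<Longrightarrow> pperm H n M \<sigma> X \<in> pseudo H n M"
  by (rule pseudo_memI[OF _ flin_lmul(2) subspace_pseudo]) (auto simp: pperm_tens)

lemma pperm_pspan:
  "left_module M \<Longrightarrow> N \<subseteq> carr M \<Longrightarrow> \<sigma> permutes {..<n} \<Longrightarrow> X \<in> pspan n M N \<Longrightarrow> pperm H n M \<sigma> X \<in> pspan n M N"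
  by (rule pspan_memI[OF _ _ flin_lmul(2) subspace_pspan]) (auto simp: pperm_tens subset_iff intro: pspan_base)

lemma push_pspan:
  assumes "left_module M" "left_module N" "module_hom_on M N q" "M' \<subseteq> carr M" "q ` M' \<subseteq> N'" "X \<in> pspan n M M'"
  shows "push H n N q X \<in> pspan n N N'"
  by (rule pspan_memI[OF assms(1,4) flin_lmul(3) subspace_pspan _ assms(6)])
    (use assms(4,5) in \<open>auto simp: push_ptens[OF assms(1-3)] subset_iff intro!: pspan_base\<close>)

lemma push_in:
  assumes "left_module M" "left_module N" "module_hom_on M N q" "X \<in> pseudo H n M"
  shows "push H n N q X \<in> pseudo H n N"
  using push_pspan[OF assms(1-3) subset_refl, of "carr N" X n] assms
  by (auto simp: pseudo_eq_pspan module_hom_on_def)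

end

section \<open>Extension of bilinear maps\<close>

context cocommutative_hopf
begin

definition hbilinear ::
  "('h, 'a::ab_group_add, 'u) hmodule_scheme \<Rightarrow> ('h, 'b::ab_group_add, 'v) hmodule_scheme \<Rightarrow>
    ('h, 'c::ab_group_add, 'w) hmodule_scheme \<Rightarrow> ('a \<Rightarrow> 'b \<Rightarrow> ('k, 'h, 'c) pseudo) \<Rightarrow> bool" where
  "hbilinear A B C \<mu> \<longleftrightarrow>
    (\<forall>a\<in>carr A. \<forall>b\<in>carr B. \<mu> a b \<in> pseudo H 2 C) \<and>
    (\<forall>a\<in>carr A. \<forall>a'\<in>carr A. \<forall>b\<in>carr B. \<mu> (a + a') b = \<mu> a b + \<mu> a' b) \<and>
    (\<forall>a\<in>carr A. \<forall>b\<in>carr B. \<forall>b'\<in>carr B. \<mu> a (b + b') = \<mu> a b + \<mu> a b') \<and>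
    (\<forall>f g. \<forall>a\<in>carr A. \<forall>b\<in>carr B. \<mu> (act A f a) (act B g b) = lmul H 2 C (tens H [f, g]) (\<mu> a b))"

lemma hbilinearD:
  assumes "hbilinear A B C \<mu>"
  shows "a \<in> carr A \<Longrightarrow> b \<in> carr B \<Longrightarrow> \<mu> a b \<in> pseudo H 2 C"
    "a \<in> carr A \<Longrightarrow> a' \<in> carr A \<Longrightarrow> b \<in> carr B \<Longrightarrow> \<mu> (a + a') b = \<mu> a b + \<mu> a' b"
    "a \<in> carr A \<Longrightarrow> b \<in> carr B \<Longrightarrow> b' \<in> carr B \<Longrightarrow> \<mu> a (b + b') = \<mu> a b + \<mu> a b'"
    "a \<in> carr A \<Longrightarrow> b \<in> carr B \<Longrightarrow> \<mu> (act A f a) (act B g b) = lmul H 2 C (tens H [f, g]) (\<mu> a b)"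
  using assms unfolding hbilinear_def by blast+

lemma hbilinear_act:
  assumes "hbilinear A B C \<mu>" "left_module A" "left_module B" "a \<in> carr A" "b \<in> carr B"
  shows "\<mu> (act A h a) b = lmul H 2 C (tens H [h, 1]) (\<mu> a b)"
    "\<mu> a (act B h b) = lmul H 2 C (tens H [1, h]) (\<mu> a b)"
  using hbilinearD(4)[OF assms(1,4,5), of h 1] hbilinearD(4)[OF assms(1,4,5), of 1 h]
    left_moduleD(9)[OF assms(2,4)] left_moduleD(9)[OF assms(3,5)] by simp_all

lemma hbilinear_zero:
  assumes "hbilinear A B C \<mu>" "left_module A" "left_module B"
  shows "b \<in> carr B \<Longrightarrow> \<mu> 0 b = 0" "a \<in> carr A \<Longrightarrow> \<mu> a 0 = 0"
  using hbilinearD(2)[OF assms(1), of 0 0 b] hbilinearD(3)[OF assms(1), of a 0 0]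
    left_moduleD(1)[OF assms(2)] left_moduleD(1)[OF assms(3)] by simp_all

text \<open>The continuation enters linearly, so acting amounts to evaluating one fixed formal sum
  of lists. The rules for interchanging \<open>lact\<close> with other sums then follow from
  \<open>fext_swap\<close>.\<close>

lemma lact_as_fext: "lact k fs h = fext k (lact (\<lambda>u. Poly_Mapping.single u 1) fs h)"
  by (simp add: lact_flin[OF flin_fext])

lemma wact_as_fext: "wact k w h = fext k (wact (\<lambda>u. Poly_Mapping.single u 1) w h)"
  by (simp add: wact_flin[OF flin_fext])

lemma lact_fext: "lact (\<lambda>u. fext (g u) p) fs h = fext (\<lambda>x. lact (\<lambda>u. g u x) fs h) p"
  unfolding lact_as_fext[of "\<lambda>u. fext (g u) p"] lact_as_fext[of "\<lambda>u. g u _"] by (rule fext_swap)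

lemma lact_wact_swap: "lact (\<lambda>u. wact (\<lambda>x. k u x) w g) fs h = wact (\<lambda>x. lact (\<lambda>u. k u x) fs h) w g"
  unfolding wact_as_fext[of "\<lambda>x. k _ x"] wact_as_fext[of "\<lambda>x. lact (\<lambda>u. k u x) fs h"] by (rule lact_fext)

lemma lact_add_fun: "lact (\<lambda>u. k u + k' u) fs h = lact k fs h + lact k' fs h"
  unfolding lact_as_fext[of "\<lambda>u. k u + k' u"] lact_as_fext[of k] lact_as_fext[of k'] by (rule fext_add_fun)

lemma wact_add_fun: "wact (\<lambda>u. k u + k' u) w h = wact k w h + wact k' w h"
  unfolding wact_as_fext[of "\<lambda>u. k u + k' u"] wact_as_fext[of k] wact_as_fext[of k'] by (rule fext_add_fun)

lemma mlin_lact_fun: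
  assumes "\<And>y. length y = length gs \<Longrightarrow> mlin n (\<lambda>x. k x y)" shows "mlin n (\<lambda>x. lact (k x) gs b)"
  unfolding mlin_def by (intro allI impI hlin_lact_fun) (rule mlinD[OF assms])

lemma lact_mem:
  "free.subspace V \<Longrightarrow> (\<And>u. length u = length us \<Longrightarrow> k u \<in> V) \<Longrightarrow> lact k us h \<in> V"
proof (induction us arbitrary: k h)
  case (Cons x us)
  show ?case unfolding lact.simps sw_def
    by (rule fext_mem[OF Cons.prems(1)], rule Cons.IH[OF Cons.prems(1)]) (simp add: Cons.prems(2))
qed (auto intro: free.subspace_scale)

text \<open>For \<open>pq = [f, g]\<close> this is \<open>T\<close> at the concatenation of
  \<open>fs\<close> times the iterated coproduct of \<open>f\<close> with \<open>gs\<close> times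
  that of \<open>g\<close>, the expression that occurs in the extension of a bilinear map.\<close>

definition twofold :: "('h list \<Rightarrow> 'm \<Rightarrow> ('x \<Rightarrow>\<^sub>0 'k)) \<Rightarrow> 'h list \<Rightarrow> 'h list \<Rightarrow> 'h list \<Rightarrow> 'm \<Rightarrow> ('x \<Rightarrow>\<^sub>0 'k)" where
  "twofold T fs gs = (\<lambda>pq c. lact (\<lambda>u. lact (\<lambda>v. T (u @ v) c) gs (pq ! 1)) fs (pq ! 0))"

text \<open>By \<open>lact_append\<close>, acting by \<open>h\<close> on the concatenation splits
  into \<open>h1\<close> on one part and \<open>h2\<close> on the other. Moved past each other,
  these combine with \<open>p\<close> and \<open>q\<close> to \<open>p h1\<close> and
  \<open>q h2\<close>.\<close>

lemma balanced_twofold: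
  assumes C: "left_module C" and T: "balanced (n + m) C T" and fs: "length fs = n" and gs: "length gs = m"
  shows "balanced 2 C (twofold T fs gs)"
  unfolding balanced_def
proof (intro conjI allI ballI impI)
  fix c assume c: "c \<in> carr C"
  have mT: "mlin (n + m) (\<lambda>w. T w c)" using T c by (simp add: balanced_def)
  have b: "blin (\<lambda>p q. lact (\<lambda>u. lact (\<lambda>v. T (u @ v) c) gs q) fs p)"
    unfolding blin_def by (intro conjI allI hlin_lact hlin_lact_fun)
  show m2: "mlin 2 (\<lambda>pq. twofold T fs gs pq c)"
    unfolding twofold_def by (rule mlin_2[OF b])
  fix xs :: "'h list" assume "length xs = 2"
  then obtain p q where xs: "xs = [p, q]" by (rule length2E)
  {
    fix c' assume c': "c' \<in> carr C"
    have "lact (\<lambda>u. lact (\<lambda>v. T (u @ v) (c + c')) gs q) fs p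
        = lact (\<lambda>u. lact (\<lambda>v. T (u @ v) c + T (u @ v) c') gs q) fs p"
      using T c c' fs gs by (intro lact_cong_length) (simp add: balanced_def)
    then show "twofold T fs gs xs (c + c') = twofold T fs gs xs c + twofold T fs gs xs c'"
      by (simp add: twofold_def xs lact_add_fun)
  }
  fix h
  have "twofold T fs gs xs (act C h c)
      = lact (\<lambda>u. lact (\<lambda>v. lact (\<lambda>w. T w c) (u @ v) h) gs q) fs p"
    unfolding twofold_def xs using T c fs gs
    by (simp, intro lact_cong_length) (simp add: balanced_def)
  also have "\<dots> = lact (\<lambda>u. lact (\<lambda>v. sw (\<lambda>a b. lact (\<lambda>x. lact (\<lambda>y. T (x @ y) c) v b) u a) h) gs q) fs p"
    using mT fs gs by (intro lact_cong_length lact_append) simp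
  also have "\<dots> = sw (\<lambda>a b. lact (\<lambda>u. lact (\<lambda>x. lact (\<lambda>v. lact (\<lambda>y. T (x @ y) c) v b) gs q) u a) fs p) h"
    unfolding lact_sw by (subst (3) lact_swap) (rule refl)
  also have "\<dots> = sw (\<lambda>a b. lact (\<lambda>x. lact (\<lambda>y. T (x @ y) c) gs (q * b)) fs (p * a)) h"
  proof (intro sw_cong refl)
    fix a b
    have "lact (\<lambda>u. lact (\<lambda>x. lact (\<lambda>v. lact (\<lambda>y. T (x @ y) c) v b) gs q) u a) fs p
        = lact (\<lambda>u. lact (\<lambda>x. lact (\<lambda>y. T (x @ y) c) gs (q * b)) u a) fs p"
      using fs gs by (intro lact_cong_length lact_lact[OF mlin_append2[OF mT]]) simp_all
    also have "\<dots> = lact (\<lambda>x. lact (\<lambda>y. T (x @ y) c) gs (q * b)) fs (p * a)"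
      by (rule lact_lact[OF mlin_lact_fun fs], rule mlin_append1[OF mT]) (simp add: gs)
    finally show "lact (\<lambda>u. lact (\<lambda>x. lact (\<lambda>v. lact (\<lambda>y. T (x @ y) c) v b) gs q) u a) fs p
      = lact (\<lambda>x. lact (\<lambda>y. T (x @ y) c) gs (q * b)) fs (p * a)" .
  qed
  also have "\<dots> = lact (\<lambda>pq. twofold T fs gs pq c) xs h"
    unfolding xs lact_2[OF m2] by (simp add: twofold_def)
  finally show "lact (\<lambda>pq. twofold T fs gs pq c) xs h = twofold T fs gs xs (act C h c)" ..
qed

text \<open>\<open>pext\<close> sums over four chosen representatives at once. Independence of the
  choice is shown for one argument at a time by \<open>ptens_universal\<close>; the
  \<open>H\<close>-bilinearity of \<open>\<mu>\<close> supplies the balancing condition.\<close>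

lemma pext_tens:
  fixes A :: "('h, 'a::ab_group_add, 'u) hmodule_scheme" and B :: "('h, 'b::ab_group_add, 'v) hmodule_scheme"
    and C :: "('h, 'c::ab_group_add, 'w) hmodule_scheme"
  assumes A: "left_module A" and B: "left_module B" and C: "left_module C" and \<mu>: "hbilinear A B C \<mu>"
    and fs: "length fs = n" and gs: "length gs = m" and a: "a \<in> carr A" and b: "b \<in> carr B"
  shows "pext H n m C \<mu> (ptn n A fs a) (ptn m B gs b)
    = pfun (twofold (\<lambda>w c. ptn (n + m) C w c) fs gs) (\<mu> a b)"
proof -
  let ?T = "\<lambda>w c. ptn (n + m) C w c"
  define \<Psi> where "\<Psi> F G X = fext (\<lambda>(P, c). fext (\<lambda>fg. ptens H (n + m) C
        (tcat H (tmul H F (iter_comult H n (fg ! 0))) (tmul H G (iter_comult H m (fg ! 1)))) c) P) X" for F G X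
  have add: "\<Psi> (F + F') G X = \<Psi> F G X + \<Psi> F' G X" "\<Psi> (fscale e F) G X = fscale e (\<Psi> F G X)"
    "\<Psi> F (G + G') X = \<Psi> F G X + \<Psi> F G' X" "\<Psi> F (fscale e G) X = fscale e (\<Psi> F G X)"
    if "X \<in> pseudo H 2 C" "F \<in> tensor_power H n" "F' \<in> tensor_power H n" "G \<in> tensor_power H m" "G' \<in> tensor_power H m"
    for F F' G G' X e
  proof -
    have in': "tcat H (tmul H K (iter_comult H n x)) (tmul H K' (iter_comult H m y)) \<in> tensor_power H (n + m)"
      if "K \<in> tensor_power H n" "K' \<in> tensor_power H m" for K K' x y
      using that by simp
    have k: "c \<in> carr C" if "(P, c) \<in> Poly_Mapping.keys X" for P c
      using keys_pseudo[OF C \<open>X \<in> pseudo H 2 C\<close> that] by simp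
    note r = ptens_rules(1,3)[OF C in' _]
    show "\<Psi> (F + F') G X = \<Psi> F G X + \<Psi> F' G X"
      unfolding \<Psi>_def fext_add_fun[symmetric]
      by (rule fext_cong) (clarsimp simp: flinD(1)[OF flin_tmul(1)] flinD(1)[OF flin_tcat(1)] r that k in' simp flip: fext_add_fun)
    show "\<Psi> (fscale e F) G X = fscale e (\<Psi> F G X)"
      unfolding \<Psi>_def fext_scale_fun[symmetric]
      by (rule fext_cong) (clarsimp simp: flinD(2)[OF flin_tmul(1)] flinD(2)[OF flin_tcat(1)] r that k in' simp flip: fext_scale_fun)
    show "\<Psi> F (G + G') X = \<Psi> F G X + \<Psi> F G' X"
      unfolding \<Psi>_def fext_add_fun[symmetric]
      by (rule fext_cong) (clarsimp simp: flinD(1)[OF flin_tmul(1)] flinD(1)[OF flin_tcat(2)] r that k in' simp flip: fext_add_fun)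
    show "\<Psi> F (fscale e G) X = fscale e (\<Psi> F G X)"
      unfolding \<Psi>_def fext_scale_fun[symmetric]
      by (rule fext_cong) (clarsimp simp: flinD(2)[OF flin_tmul(1)] flinD(2)[OF flin_tcat(2)] r that k in' simp flip: fext_scale_fun)
  qed
  have \<Psi>_flin: "flin (\<Psi> F G)" for F G unfolding \<Psi>_def by (rule flin_fext)
  have bal: "balanced 2 C (twofold ?T fs gs)" if "length fs = n" "length gs = m" for fs gs
    by (rule balanced_twofold[OF C balanced_ptens[OF C] that])
  have \<Psi>_tens: "\<Psi> (tens H fs) (tens H gs) X = pfun (twofold ?T fs gs) X"
    if X: "X \<in> pseudo H 2 C" and fs: "length fs = n" and gs: "length gs = m" for fs gs X
    unfolding \<Psi>_def pfun_def
  proof (rule fext_cong, clarify)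
    fix P c assume "(P, c) \<in> Poly_Mapping.keys X"
    then have P: "P \<in> tensor_power H 2" and c: "c \<in> carr C" using keys_pseudo[OF C X] by auto
    have mT: "mlin (n + m) (\<lambda>w. ?T w c)" by (rule mlin_ptens[OF C c])
    show "fext (\<lambda>fg. ptens H (n + m) C
        (tcat H (tmul H (tens H fs) (iter_comult H n (fg ! 0))) (tmul H (tens H gs) (iter_comult H m (fg ! 1)))) c) P
      = fext (\<lambda>fg. twofold ?T fs gs fg c) P"
    proof (rule fext_cong)
      fix fg
      let ?F = "tmul H (tens H fs) (iter_comult H n (fg ! 0))" and ?G = "tmul H (tens H gs) (iter_comult H m (fg ! 1))"
      have F: "?F \<in> tensor_power H n" and G: "?G \<in> tensor_power H m" using fs gs by simp_all
      have "ptens H (n + m) C (tcat H ?F ?G) c = fext (\<lambda>w. ?T w c) (tcat H ?F ?G)"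
        by (rule ptens_fext[OF C tcat_in[OF F G] c])
      also have "\<dots> = fext (\<lambda>xs. fext (\<lambda>ys. ?T (xs @ ys) c) ?G) ?F"
        by (rule fext_tcat[OF mT F G])
      also have "\<dots> = fext (\<lambda>xs. lact (\<lambda>ys. ?T (xs @ ys) c) gs (fg ! 1)) ?F"
        using keys_tensor_power[OF F]
        by (intro fext_cong fext_tmul_iter_comult mlin_append2[OF mT] gs) auto
      also have "\<dots> = twofold ?T fs gs fg c"
        unfolding twofold_def
        by (intro fext_tmul_iter_comult mlin_lact_fun mlin_append1[OF mT] fs) (simp add: gs)
      finally show "ptens H (n + m) C (tcat H ?F ?G) c = twofold ?T fs gs fg c" .
    qed
  qed
  \<comment> \<open>Acting by \<open>h\<close> on one of the two tensors has the same effect as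
    multiplying the corresponding factor of the product \<open>X\<close> by \<open>h\<close> from
    the left.\<close>
  have core: "lact (\<lambda>u. \<Psi> (tens H u) (tens H gs) X) fs h = \<Psi> (tens H fs) (tens H gs) (lmul H 2 C (tens H [h, 1]) X)"
    "lact (\<lambda>u. \<Psi> (tens H fs) (tens H u) X) gs h = \<Psi> (tens H fs) (tens H gs) (lmul H 2 C (tens H [1, h]) X)"
    if X: "X \<in> pseudo H 2 C" and fs: "length fs = n" and gs: "length gs = m" for fs gs X h
  proof -
    have lin: "flin (\<lambda>X. lact (\<lambda>u. L u X) gs h)" if "\<And>u. flin (L u)"
      for L :: "'h list \<Rightarrow> ('k, 'h, 'c) pseudo \<Rightarrow> ('k, 'h, 'c) pseudo" and gs h
      unfolding flin_def
      by (simp add: flinD(1,2)[OF that] lact_add_fun lact_flin[OF flin_fscale, symmetric])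
    have lin2: "flin (\<lambda>X. \<Psi> F G (lmul H 2 C K X))" for F G K
      unfolding flin_def by (simp add: flinD(1,2)[OF \<Psi>_flin] flinD(1,2)[OF flin_lmul(1)])
    show "lact (\<lambda>u. \<Psi> (tens H u) (tens H gs) X) fs h = \<Psi> (tens H fs) (tens H gs) (lmul H 2 C (tens H [h, 1]) X)"
    proof (rule pseudo_eqI[OF C lin[OF \<Psi>_flin] lin2 _ X])
      fix xs :: "'h list" and c assume "length xs = 2" and c: "c \<in> carr C"
      then obtain p q where xs: "xs = [p, q]" by (blast elim: length2E)
      have mT: "mlin (n + m) (\<lambda>w. ?T w c)" by (rule mlin_ptens[OF C c])
      have "lact (\<lambda>u. \<Psi> (tens H u) (tens H gs) (ptn 2 C xs c)) fs h
          = lact (\<lambda>u. twofold ?T u gs xs c) fs h"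
        using fs gs c xs by (intro lact_cong_length) (simp add: \<Psi>_tens pfun_ptens[OF C bal])
      also have "\<dots> = twofold ?T fs gs [h * p, q] c"
        unfolding twofold_def xs using fs gs
          lact_lact[OF mlin_lact_fun[of gs n "\<lambda>u v. ?T (u @ v) c" q, OF mlin_append1[OF mT]], of fs p h]
        by simp
      finally show "lact (\<lambda>u. \<Psi> (tens H u) (tens H gs) (ptn 2 C xs c)) fs h
          = \<Psi> (tens H fs) (tens H gs) (lmul H 2 C (tens H [h, 1]) (ptn 2 C xs c))"
        using fs gs c by (simp add: xs lmul_tens[OF C] \<Psi>_tens pfun_ptens[OF C bal])
    qed
    show "lact (\<lambda>u. \<Psi> (tens H fs) (tens H u) X) gs h = \<Psi> (tens H fs) (tens H gs) (lmul H 2 C (tens H [1, h]) X)"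
    proof (rule pseudo_eqI[OF C lin[OF \<Psi>_flin] lin2 _ X])
      fix xs :: "'h list" and c assume "length xs = 2" and c: "c \<in> carr C"
      then obtain p q where xs: "xs = [p, q]" by (blast elim: length2E)
      have mT: "mlin (n + m) (\<lambda>w. ?T w c)" by (rule mlin_ptens[OF C c])
      have "lact (\<lambda>u. \<Psi> (tens H fs) (tens H u) (ptn 2 C xs c)) gs h
          = lact (\<lambda>u. twofold ?T fs u xs c) gs h"
        using fs gs c xs by (intro lact_cong_length) (simp add: \<Psi>_tens pfun_ptens[OF C bal])
      also have "\<dots> = lact (\<lambda>x. lact (\<lambda>u. lact (\<lambda>y. ?T (x @ y) c) u q) gs h) fs p"
        unfolding twofold_def xs by (simp, rule lact_swap)
      also have "\<dots> = twofold ?T fs gs [p, h * q] c"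
        unfolding twofold_def using fs gs
        by (simp, intro lact_cong_length lact_lact[where n = m]) (rule mlin_append2[OF mT], simp_all)
      finally show "lact (\<lambda>u. \<Psi> (tens H fs) (tens H u) (ptn 2 C xs c)) gs h
          = \<Psi> (tens H fs) (tens H gs) (lmul H 2 C (tens H [1, h]) (ptn 2 C xs c))"
        using fs gs c by (simp add: xs lmul_tens[OF C] \<Psi>_tens pfun_ptens[OF C bal])
    qed
  qed
  have inner: "fext (\<lambda>(G, b). \<Psi> F G (\<mu> a b)) (ptn m B gs b) = \<Psi> F (tens H gs) (\<mu> a b)"
    if F: "F \<in> tensor_power H n" and a: "a \<in> carr A" and b: "b \<in> carr B" and gs: "length gs = m" for F a b gs
  proof (rule ptens_universal[OF B])
    fix xs :: "'h list" and b h assume xs: "length xs = m" and b: "b \<in> carr B"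
    have X: "\<mu> a b \<in> pseudo H 2 C" "\<mu> a (act B h b) \<in> pseudo H 2 C"
      using hbilinearD(1)[OF \<mu> a] b left_moduleD(5)[OF B b] by blast+
    have e: "\<Psi> F G X = fext (\<lambda>u. \<Psi> (tens H u) G X) F" if "X \<in> pseudo H 2 C" "G \<in> tensor_power H m" for X G
      by (rule tensor_power_linear_eq_fext(1)[where g = "\<lambda>F. \<Psi> F G X" and n = n]) (use add that F in auto)
    have "lact (\<lambda>u. \<Psi> F (tens H u) (\<mu> a b)) xs h = lact (\<lambda>u. fext (\<lambda>w. \<Psi> (tens H w) (tens H u) (\<mu> a b)) F) xs h"
      by (intro lact_cong_length e X) (simp add: xs)
    also have "\<dots> = fext (\<lambda>w. \<Psi> (tens H w) (tens H xs) (lmul H 2 C (tens H [1, h]) (\<mu> a b))) F"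
      unfolding lact_fext using keys_tensor_power[OF F] by (intro fext_cong core(2) X xs) auto
    also have "\<dots> = \<Psi> F (tens H xs) (\<mu> a (act B h b))"
      using e[OF X(2), of "tens H xs"] xs hbilinear_act(2)[OF \<mu> A B a b] by simp
    finally show "lact (\<lambda>u. \<Psi> F (tens H u) (\<mu> a b)) xs h = \<Psi> F (tens H xs) (\<mu> a (act B h b))" .
  qed (use F a b gs add in \<open>auto simp: hbilinearD[OF \<mu>] flinD(1)[OF \<Psi>_flin]\<close>)
  have "fext (\<lambda>(F, a). fext (\<lambda>(G, b). \<Psi> F G (\<mu> a b)) (ptn m B gs b)) (ptn n A fs a)
      = fext (\<lambda>(G, b). \<Psi> (tens H fs) G (\<mu> a b)) (ptn m B gs b)"
  proof (rule ptens_universal[OF A])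
    fix xs :: "'h list" and a h assume xs: "length xs = n" and a: "a \<in> carr A"
    have "lact (\<lambda>u. fext (\<lambda>(G, b). \<Psi> (tens H u) G (\<mu> a b)) (ptn m B gs b)) xs h
        = lact (\<lambda>u. \<Psi> (tens H u) (tens H gs) (\<mu> a b)) xs h"
      by (intro lact_cong_length inner a b gs) (simp add: xs)
    also have "\<dots> = \<Psi> (tens H xs) (tens H gs) (\<mu> (act A h a) b)"
      using core(1)[OF hbilinearD(1)[OF \<mu> a b] xs gs] hbilinear_act(1)[OF \<mu> A B a b] by simp
    also have "\<dots> = fext (\<lambda>(G, b). \<Psi> (tens H xs) G (\<mu> (act A h a) b)) (ptn m B gs b)"
      using xs by (intro inner[symmetric] left_moduleD(5)[OF A a] b gs) simp
    finally show "lact (\<lambda>u. fext (\<lambda>(G, b). \<Psi> (tens H u) G (\<mu> a b)) (ptn m B gs b)) xs h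
      = fext (\<lambda>(G, b). \<Psi> (tens H xs) G (\<mu> (act A h a) b)) (ptn m B gs b)" .
  next
    fix F F' x assume F: "F \<in> tensor_power H n" "F' \<in> tensor_power H n" and x: "x \<in> carr A"
    have "F + F' \<in> tensor_power H n" by (rule free.subspace_add[OF subspace_tensor_power F])
    then show "fext (\<lambda>(G, b). \<Psi> (F + F') G (\<mu> x b)) (ptn m B gs b) =
       fext (\<lambda>(G, b). \<Psi> F G (\<mu> x b)) (ptn m B gs b) + fext (\<lambda>(G, b). \<Psi> F' G (\<mu> x b)) (ptn m B gs b)"
      using F x b gs add(1)[OF hbilinearD(1)[OF \<mu> x b] F tens_in_tensor_power[OF gs] tens_in_tensor_power[OF gs]]
      by (simp add: inner)
  next
    fix e F x assume F: "F \<in> tensor_power H n" and x: "x \<in> carr A"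
    have "fscale e F \<in> tensor_power H n" by (rule free.subspace_scale[OF subspace_tensor_power F])
    then show "fext (\<lambda>(G, b). \<Psi> (fscale e F) G (\<mu> x b)) (ptn m B gs b) =
       fscale e (fext (\<lambda>(G, b). \<Psi> F G (\<mu> x b)) (ptn m B gs b))"
      using F x b gs add(2)[OF hbilinearD(1)[OF \<mu> x b] F F tens_in_tensor_power[OF gs] tens_in_tensor_power[OF gs]]
      by (simp add: inner)
  next
    fix F x x' assume F: "F \<in> tensor_power H n" and x: "x \<in> carr A" "x' \<in> carr A"
    then show "fext (\<lambda>(G, b). \<Psi> F G (\<mu> (x + x') b)) (ptn m B gs b) =
       fext (\<lambda>(G, b). \<Psi> F G (\<mu> x b)) (ptn m B gs b) + fext (\<lambda>(G, b). \<Psi> F G (\<mu> x' b)) (ptn m B gs b)"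
      using b gs left_moduleD(3)[OF A] by (simp add: inner hbilinearD[OF \<mu>] flinD(1)[OF \<Psi>_flin])
  qed (use fs a in auto)
  also have "\<dots> = \<Psi> (tens H fs) (tens H gs) (\<mu> a b)"
    using fs by (intro inner a b gs) simp
  also have "\<dots> = pfun (twofold ?T fs gs) (\<mu> a b)"
    by (rule \<Psi>_tens[OF hbilinearD(1)[OF \<mu> a b] fs gs])
  finally show ?thesis unfolding pext_def \<Psi>_def .
qed

lemma flin_pext: "flin (\<lambda>X. pext H n m C \<mu> X Y)" "flin (pext H n m C \<mu> X)"
proof -
  have *: "(\<lambda>(F, a). fext (\<lambda>(G, b). g F a G b) Y) = (\<lambda>x. fext (\<lambda>y. g (fst x) (snd x) (fst y) (snd y)) Y)" for g Y
    by (auto simp: split_def)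
  show "flin (\<lambda>X. pext H n m C \<mu> X Y)" unfolding pext_def by (rule flin_fext)
  show "flin (pext H n m C \<mu> X)" unfolding flin_def pext_def *
    by (simp add: fext_add fext_scale fext_add_fun fext_scale_fun)
qed

text \<open>Keeps track of submodules through extended products; later it shows that brackets of
  inner pseudoderivations are inner.\<close>

lemma pext_pspan:
  assumes A: "left_module A" and B: "left_module B" and C: "left_module C" and \<mu>: "hbilinear A B C \<mu>"
    and sub: "A' \<subseteq> carr A" "B' \<subseteq> carr B" "C' \<subseteq> carr C"
    and \<mu>': "\<And>a b. a \<in> A' \<Longrightarrow> b \<in> B' \<Longrightarrow> \<mu> a b \<in> pspan 2 C C'"
    and X: "X \<in> pspan n A A'" and Y: "Y \<in> pspan m B B'"
  shows "pext H n m C \<mu> X Y \<in> pspan (n + m) C C'"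
proof (rule pspan_memI[OF A sub(1) flin_pext(1) subspace_pspan _ X])
  fix fs :: "'h list" and a assume fs: "length fs = n" and a: "a \<in> A'"
  show "pext H n m C \<mu> (ptn n A fs a) Y \<in> pspan (n + m) C C'"
  proof (rule pspan_memI[OF B sub(2) flin_pext(2) subspace_pspan _ Y])
    fix gs :: "'h list" and b assume gs: "length gs = m" and b: "b \<in> B'"
    have ab: "a \<in> carr A" "b \<in> carr B" using sub a b by auto
    let ?T = "\<lambda>w c. ptn (n + m) C w c"
    have "pfun (twofold ?T fs gs) (\<mu> a b) \<in> pspan (n + m) C C'"
    proof (rule pspan_memI[OF C sub(3) flin_pfun subspace_pspan _ \<mu>'[OF a b]])
      fix xs :: "'h list" and c assume xs: "length xs = 2" and c: "c \<in> C'"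
      have "\<And>u v. length u = n \<Longrightarrow> length v = m \<Longrightarrow> ?T (u @ v) c \<in> pspan (n + m) C C'"
        using c by (intro pspan_base) simp_all
      then have "twofold ?T fs gs xs c \<in> pspan (n + m) C C'"
        unfolding twofold_def using fs gs by (intro lact_mem subspace_pspan) simp
      then show "pfun (twofold ?T fs gs) (ptn 2 C xs c) \<in> pspan (n + m) C C'"
        using xs c sub(3) pfun_ptens[OF C balanced_twofold[OF C balanced_ptens[OF C] fs gs]] by auto
    qed
    then show "pext H n m C \<mu> (ptn n A fs a) (ptn m B gs b) \<in> pspan (n + m) C C'"
      using pext_tens[OF A B C \<mu> fs gs ab] by simp
  qed
qed

lemma pext_in:
  assumes "left_module A" "left_module B" "left_module C" "hbilinear A B C \<mu>"
    "X \<in> pseudo H n A" "Y \<in> pseudo H m B"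
  shows "pext H n m C \<mu> X Y \<in> pseudo H (n + m) C"
  using pext_pspan[OF assms(1-4) subset_refl subset_refl subset_refl, of X n Y m] assms(5,6)
    hbilinearD(1)[OF assms(4)]
  by (simp add: pseudo_eq_pspan[OF assms(1)] pseudo_eq_pspan[OF assms(2)] pseudo_eq_pspan[OF assms(3)])

end

section \<open>An ordinary algebra attached to a pseudoalgebra\<close>

context cocommutative_hopf
begin

text \<open>
  \<open>word_space M\<close> is the tensor product over \<open>H\<close> of the free commutative algebra on countably many
  copies of \<open>H\<close>, on which \<open>H\<close> acts as on words, and \<open>M\<close>. A bilinear map of \<open>H\<close>-modules into a pseudo
  tensor product becomes an ordinary bilinear map of word spaces, permutations of tensor
  factors turn into commutativity, and no information is lost because words with distinct labels
  embed every \<open>pseudo H n M\<close>.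
\<close>

definition word_rels ::
  "('h, 'm::ab_group_add, 'z) hmodule_scheme \<Rightarrow> ((nat \<times> 'h) list \<times> 'm \<Rightarrow>\<^sub>0 'k) set" where
  "word_rels M = free.span
    ({Poly_Mapping.single (u @ (i, a + b) # v, m) 1 - Poly_Mapping.single (u @ (i, a) # v, m) 1
        - Poly_Mapping.single (u @ (i, b) # v, m) 1 | u i a b v m. m \<in> carr M} \<union>
     {Poly_Mapping.single (u @ (i, scl H c a) # v, m) 1 - fscale c (Poly_Mapping.single (u @ (i, a) # v, m) 1)
        | u i c a v m. m \<in> carr M} \<union>
     {Poly_Mapping.single (u @ p # q # v, m) 1 - Poly_Mapping.single (u @ q # p # v, m) 1
        | u p q v m. m \<in> carr M} \<union>
     {Poly_Mapping.single (w, m + m') 1 - Poly_Mapping.single (w, m) 1 - Poly_Mapping.single (w, m') 1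
        | w m m'. m \<in> carr M \<and> m' \<in> carr M} \<union>
     {wact (\<lambda>u. Poly_Mapping.single (u, m) 1) w h - Poly_Mapping.single (w, act M h m) 1
        | w m h. m \<in> carr M})"

definition wtens ::
  "('h, 'm::ab_group_add, 'z) hmodule_scheme \<Rightarrow> (nat \<times> 'h) list \<Rightarrow> 'm \<Rightarrow> ((nat \<times> 'h) list \<times> 'm \<Rightarrow>\<^sub>0 'k)" where
  "wtens M w m = qmap (UNIV \<times> carr M) (word_rels M) (Poly_Mapping.single (w, m) 1)"

definition word_space ::
  "('h, 'm::ab_group_add, 'z) hmodule_scheme \<Rightarrow> ((nat \<times> 'h) list \<times> 'm \<Rightarrow>\<^sub>0 'k) set" where
  "word_space M = qmap (UNIV \<times> carr M) (word_rels M) ` formal (UNIV \<times> carr M)"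

lemma wact_mem: "free.subspace V \<Longrightarrow> (\<And>u. k u \<in> V) \<Longrightarrow> wact k w h \<in> V"
  by (subst wact_as_fext) (rule fext_mem)

lemma word_rels_facts:
  assumes M: "left_module M"
  shows "free.subspace (word_rels M)" "word_rels M \<subseteq> formal (UNIV \<times> carr M)"
proof -
  show "free.subspace (word_rels M)" by (simp add: word_rels_def)
  show "word_rels M \<subseteq> formal (UNIV \<times> carr M)"
    unfolding word_rels_def
    by (rule span_formal)
      (auto intro!: formal_diff formal_scale wact_mem[OF subspace_formal] simp: left_moduleD(3,5)[OF M])
qed

lemma wtens_rules:
  assumes M: "left_module M" and m: "m \<in> carr M"
  shows "wlin (\<lambda>w. wtens M w m)" "wsym (\<lambda>w. wtens M w m)"
    "m' \<in> carr M \<Longrightarrow> wtens M w (m + m') = wtens M w m + wtens M w m'"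
    "wact (\<lambda>u. wtens M u m) w h = wtens M w (act M h m)"
proof -
  let ?q = "qmap (UNIV \<times> carr M) (word_rels M)" and ?s = "\<lambda>x. Poly_Mapping.single x (1::'k)"
  note f = word_rels_facts[OF M]
  have q: "flin ?q" by (rule linear_imp_flin[OF linear_qmap[OF f]])
  show "wlin (\<lambda>w. wtens M w m)"
    unfolding wlin_def
  proof (intro allI hlinI)
    fix u v i a b
    have "?q (?s (u @ (i, a + b) # v, m) - ?s (u @ (i, a) # v, m) - ?s (u @ (i, b) # v, m)) = 0"
      by (rule qmap_zero[OF f]) (unfold word_rels_def, rule free.span_base, rule UnI1, rule UnI1, rule UnI1, rule UnI1, rule CollectI, intro exI conjI, rule refl, rule m)
    then show "wtens M (u @ (i, a + b) # v) m = wtens M (u @ (i, a) # v) m + wtens M (u @ (i, b) # v) m"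
      by (simp add: wtens_def flinD[OF q] algebra_simps)
  next
    fix u v i a c
    have "?q (?s (u @ (i, scl H c a) # v, m) - fscale c (?s (u @ (i, a) # v, m))) = 0"
      by (rule qmap_zero[OF f]) (unfold word_rels_def, rule free.span_base, rule UnI1, rule UnI1, rule UnI1, rule UnI2, rule CollectI, intro exI conjI, rule refl, rule m)
    then show "wtens M (u @ (i, scl H c a) # v) m = fscale c (wtens M (u @ (i, a) # v) m)"
      by (simp add: wtens_def flinD[OF q])
  qed
  show "wsym (\<lambda>w. wtens M w m)"
    unfolding wsym_def
  proof (intro allI)
    fix u p q' v
    have "?q (?s (u @ p # q' # v, m) - ?s (u @ q' # p # v, m)) = 0"
      by (rule qmap_zero[OF f]) (unfold word_rels_def, rule free.span_base, rule UnI1, rule UnI1, rule UnI2, rule CollectI, intro exI conjI, rule refl, rule m)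
    then show "wtens M (u @ p # q' # v) m = wtens M (u @ q' # p # v) m"
      by (simp add: wtens_def flinD[OF q])
  qed
  show "wtens M w (m + m') = wtens M w m + wtens M w m'" if "m' \<in> carr M"
  proof -
    have "?q (?s (w, m + m') - ?s (w, m) - ?s (w, m')) = 0"
      by (rule qmap_zero[OF f]) (unfold word_rels_def, rule free.span_base, rule UnI1, rule UnI2, rule CollectI, intro exI conjI, rule refl, rule m, rule that)
    then show ?thesis by (simp add: wtens_def flinD[OF q] algebra_simps)
  qed
  have "?q (wact (\<lambda>u. ?s (u, m)) w h - ?s (w, act M h m)) = 0"
    by (rule qmap_zero[OF f]) (unfold word_rels_def, rule free.span_base, rule UnI2, rule CollectI, intro exI conjI, rule refl, rule m)
  then show "wact (\<lambda>u. wtens M u m) w h = wtens M w (act M h m)"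
    by (simp add: wtens_def flinD[OF q] wact_flin[OF q])
qed

lemma wtens_zero: "left_module M \<Longrightarrow> wtens M w 0 = 0"
  using wtens_rules(3)[of M 0 0 w] left_moduleD(1)[of M] by simp

definition wfun :: "((nat \<times> 'h) list \<Rightarrow> 'm \<Rightarrow> ('x \<Rightarrow>\<^sub>0 'k)) \<Rightarrow> ((nat \<times> 'h) list \<times> 'm \<Rightarrow>\<^sub>0 'k) \<Rightarrow> ('x \<Rightarrow>\<^sub>0 'k)" where
  "wfun g X = fext (\<lambda>(w, m). g w m) X"

text \<open>The conditions under which \<open>g\<close> factors through \<open>word_space M\<close>;
  they match the families of relators in \<open>word_rels\<close>.\<close>

definition wbalanced ::
  "('h, 'm::ab_group_add, 'z) hmodule_scheme \<Rightarrow> ((nat \<times> 'h) list \<Rightarrow> 'm \<Rightarrow> ('x \<Rightarrow>\<^sub>0 'k)) \<Rightarrow> bool" where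
  "wbalanced M g \<longleftrightarrow> (\<forall>m\<in>carr M. wlin (\<lambda>w. g w m) \<and> wsym (\<lambda>w. g w m)) \<and>
    (\<forall>w. \<forall>m\<in>carr M. \<forall>m'\<in>carr M. g w (m + m') = g w m + g w m') \<and>
    (\<forall>w h. \<forall>m\<in>carr M. wact (\<lambda>u. g u m) w h = g w (act M h m))"

lemma flin_wfun: "flin (wfun g)"
  unfolding wfun_def by (rule flin_fext)

lemma wfun_wtens:
  fixes M :: "('h, 'm::ab_group_add, 'z) hmodule_scheme"
  assumes M: "left_module M" and g: "wbalanced M g" and m: "m \<in> carr M"
  shows "wfun g (wtens M w m) = g w m"
proof -
  let ?L = "fext (\<lambda>(w, m). g w m)"
  have g': "wlin (\<lambda>w. g w m)" "wsym (\<lambda>w. g w m)" "m' \<in> carr M \<Longrightarrow> g w (m + m') = g w m + g w m'"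
     "wact (\<lambda>u. g u m) w h = g w (act M h m)" if "m \<in> carr M" for m m' w h
    using g that by (simp_all add: wbalanced_def)
  have z: "?L x = 0" if "x \<in> word_rels M" for x :: "(nat \<times> 'h) list \<times> 'm \<Rightarrow>\<^sub>0 'k"
    using that unfolding word_rels_def
  proof (rule flin_zero_on_span[OF flin_fext, rotated], elim UnE CollectE exE conjE)
    fix x :: "(nat \<times> 'h) list \<times> 'm \<Rightarrow>\<^sub>0 'k" and u i a b v m
    assume x: "x = Poly_Mapping.single (u @ (i, a + b) # v, m) 1 - Poly_Mapping.single (u @ (i, a) # v, m) 1
        - Poly_Mapping.single (u @ (i, b) # v, m) 1" and m: "m \<in> carr M"
    show "?L x = 0" using hlinD(1)[OF wlinD[OF g'(1)[OF m]]] by (simp add: x fext_diff)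
  next
    fix x :: "(nat \<times> 'h) list \<times> 'm \<Rightarrow>\<^sub>0 'k" and u i c a v m
    assume x: "x = Poly_Mapping.single (u @ (i, scl H c a) # v, m) 1 - fscale c (Poly_Mapping.single (u @ (i, a) # v, m) 1)"
      and m: "m \<in> carr M"
    show "?L x = 0" using hlinD(2)[OF wlinD[OF g'(1)[OF m]]] by (simp add: x fext_diff fext_scale)
  next
    fix x :: "(nat \<times> 'h) list \<times> 'm \<Rightarrow>\<^sub>0 'k" and u p q v m
    assume x: "x = Poly_Mapping.single (u @ p # q # v, m) 1 - Poly_Mapping.single (u @ q # p # v, m) 1"
      and m: "m \<in> carr M"
    show "?L x = 0" using g'(2)[OF m, unfolded wsym_def, rule_format, of u p q v] by (simp add: x fext_diff)
  next
    fix x :: "(nat \<times> 'h) list \<times> 'm \<Rightarrow>\<^sub>0 'k" and w m m'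
    assume x: "x = Poly_Mapping.single (w, m + m') 1 - Poly_Mapping.single (w, m) 1 - Poly_Mapping.single (w, m') 1"
      and m: "m \<in> carr M" "m' \<in> carr M"
    show "?L x = 0" using g'(3)[OF m] by (simp add: x fext_diff)
  next
    fix x :: "(nat \<times> 'h) list \<times> 'm \<Rightarrow>\<^sub>0 'k" and w m h
    assume x: "x = wact (\<lambda>u. Poly_Mapping.single (u, m) 1) w h - Poly_Mapping.single (w, act M h m) 1"
      and m: "m \<in> carr M"
    show "?L x = 0" using g'(4)[OF m] by (simp add: x fext_diff wact_flin[OF flin_fext])
  qed
  show ?thesis unfolding wfun_def wtens_def
    using m by (subst qmap_universal[OF word_rels_facts[OF M] flin_fext z]) auto
qed

lemma subspace_word_space: "left_module M \<Longrightarrow> free.subspace (word_space M)"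
  unfolding word_space_def
  by (rule module_hom.subspace_image[OF Vector_Spaces.linear.axioms(3)[OF linear_qmap[OF word_rels_facts]] subspace_formal])

lemma wtens_in: "m \<in> carr M \<Longrightarrow> wtens M w m \<in> word_space M"
  unfolding wtens_def word_space_def by auto

lemma word_space_span:
  fixes M :: "('h, 'm::ab_group_add, 'z) hmodule_scheme"
  assumes M: "left_module M"
  shows "word_space M = free.span {wtens M w m | w m. m \<in> carr M}"
proof
  show "free.span {wtens M w m | w m. m \<in> carr M} \<subseteq> word_space M"
    by (rule free.span_minimal[OF _ subspace_word_space[OF M]]) (auto intro: wtens_in)
  show "word_space M \<subseteq> free.span {wtens M w m | w m. m \<in> carr M}"
    unfolding word_space_def
  proof clarify
    let ?q = "qmap (UNIV \<times> carr M) (word_rels M)"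
    fix f :: "(nat \<times> 'h) list \<times> 'm \<Rightarrow>\<^sub>0 'k" assume f: "f \<in> formal (UNIV \<times> carr M)"
    have "?q f = fext (\<lambda>x. ?q (Poly_Mapping.single x 1)) f"
      by (rule flin_as_fext[OF linear_imp_flin[OF linear_qmap[OF word_rels_facts[OF M]]]])
    also have "\<dots> \<in> free.span {wtens M w m | w m. m \<in> carr M}"
    proof (rule fext_mem[OF free.subspace_span])
      fix x assume "x \<in> Poly_Mapping.keys f"
      then obtain w m where x: "x = (w, m)" "m \<in> carr M" using f by (auto simp: formal_def)
      show "?q (Poly_Mapping.single x 1) \<in> free.span {wtens M w m | w m. m \<in> carr M}"
        by (rule free.span_base) (use x in \<open>auto simp: wtens_def\<close>)
    qed
    finally show "?q f \<in> free.span {wtens M w m | w m. m \<in> carr M}" .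
  qed
qed

lemma word_space_eqI:
  assumes "left_module M" "flin L" "flin L'" "\<And>w m. m \<in> carr M \<Longrightarrow> L (wtens M w m) = L' (wtens M w m)"
    "X \<in> word_space M"
  shows "L X = L' X"
  by (rule flin_eq_on_span[OF assms(2,3) _ assms(5)[unfolded word_space_span[OF assms(1)]]]) (use assms(4) in auto)

lemma word_space_memI:
  assumes "left_module M" "flin L" "free.subspace V" "\<And>w m. m \<in> carr M \<Longrightarrow> L (wtens M w m) \<in> V"
    "X \<in> word_space M"
  shows "L X \<in> V"
  by (rule flin_in_span[OF assms(2) _ assms(3) assms(5)[unfolded word_space_span[OF assms(1)]]]) (use assms(4) in auto)

text \<open>The recursion runs over the words alone and takes the scalars by \<open>hd\<close> and
  \<open>tl\<close>; only lists of equal length are meaningful.\<close>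

fun wsubst :: "((nat \<times> 'h) list \<Rightarrow> ('x \<Rightarrow>\<^sub>0 'k)) \<Rightarrow> (nat \<times> 'h) list list \<Rightarrow> 'h list \<Rightarrow> ('x \<Rightarrow>\<^sub>0 'k)" where
  "wsubst k [] fs = k []"
| "wsubst k (w # ws) fs = wact (\<lambda>x. wsubst (\<lambda>y. k (x @ y)) ws (tl fs)) w (hd fs)"

lemma wsubst_cong [cong]:
  "(\<And>u. k u = k' u) \<Longrightarrow> ws = ws' \<Longrightarrow> fs = fs' \<Longrightarrow> wsubst k ws fs = wsubst k' ws' fs'"
  by presburger

lemma wsubst_flin: "flin L \<Longrightarrow> L (wsubst k ws fs) = wsubst (\<lambda>u. L (k u)) ws fs"
  by (induction ws arbitrary: k fs) (simp_all add: wact_flin)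

lemma wsubst_as_fext: "wsubst k ws fs = fext k (wsubst (\<lambda>u. Poly_Mapping.single u 1) ws fs)"
  by (simp add: wsubst_flin[OF flin_fext])

lemma wsubst_fext: "wsubst (\<lambda>u. fext (g u) p) ws fs = fext (\<lambda>x. wsubst (\<lambda>u. g u x) ws fs) p"
  unfolding wsubst_as_fext[of "\<lambda>u. fext (g u) p"] wsubst_as_fext[of "\<lambda>u. g u _"] by (rule fext_swap)

lemma wsubst_add_fun: "wsubst (\<lambda>u. k u + k' u) ws fs = wsubst k ws fs + wsubst k' ws fs"
  unfolding wsubst_as_fext[of "\<lambda>u. k u + k' u"] wsubst_as_fext[of k] wsubst_as_fext[of k'] by (rule fext_add_fun)

lemma wsubst_sw: "wsubst (\<lambda>u. sw (G u) h) ws fs = sw (\<lambda>a b. wsubst (\<lambda>u. G u a b) ws fs) h"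
  unfolding sw_def by (rule wsubst_fext)

lemma wsubst_wact: "wsubst (\<lambda>u. wact (\<lambda>x. k u x) w g) ws fs = wact (\<lambda>x. wsubst (\<lambda>u. k u x) ws fs) w g"
  unfolding wact_as_fext[of "\<lambda>x. k _ x"] wact_as_fext[of "\<lambda>x. wsubst (\<lambda>u. k u x) ws fs"] by (rule wsubst_fext)

lemma wsubst_lact: "wsubst (\<lambda>u. lact (\<lambda>x. k u x) w g) ws fs = lact (\<lambda>x. wsubst (\<lambda>u. k u x) ws fs) w g"
  unfolding lact_as_fext[of "\<lambda>x. k _ x"] lact_as_fext[of "\<lambda>x. wsubst (\<lambda>u. k u x) ws fs"] by (rule wsubst_fext)

lemma wsubst_append:
  "length fs = length ws \<Longrightarrow>
   wsubst k (ws @ vs) (fs @ gs) = wsubst (\<lambda>x. wsubst (\<lambda>y. k (x @ y)) vs gs) ws fs"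
proof (induction ws arbitrary: k fs)
  case (Cons w ws)
  then obtain f fs' where "fs = f # fs'" "length fs' = length ws" by (cases fs) auto
  then show ?case by (simp add: Cons.IH)
qed simp

lemma wlin_wsubst_fun: "(\<And>x. wlin (\<lambda>u. k u x)) \<Longrightarrow> wlin (\<lambda>u. wsubst (k u) ws fs)"
proof (induction ws arbitrary: k fs)
  case (Cons w ws)
  show ?case by (simp, intro wlin_wact_fun Cons.IH Cons.prems)
qed simp

lemma mlin_wsubst: "mlin (length ws) (wsubst k ws)"
proof (induction ws arbitrary: k)
  case (Cons w ws)
  have "mlin (length ws) (\<lambda>xs. wact (\<lambda>x. wsubst (\<lambda>y. k (x @ y)) ws xs) w a)" for a
    unfolding wact_as_fext[of "\<lambda>x. wsubst (\<lambda>y. k (x @ y)) ws _"] by (intro mlin_fext Cons.IH)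
  then show ?case by (simp, intro mlin_SucI) simp_all
qed (simp add: mlin_0)

text \<open>Multiplying each scalar by a part of the coproduct of \<open>h\<close> is the same as
  letting \<open>h\<close> act on the concatenated word afterwards. This balancing condition makes
  \<open>Theta\<close> well defined.\<close>

lemma lact_wsubst:
  "wlin k \<Longrightarrow> length fs = length ws \<Longrightarrow> lact (\<lambda>gs. wsubst k ws gs) fs h = wsubst (\<lambda>x. wact k x h) ws fs"
proof (induction ws arbitrary: k fs h)
  case (Cons w ws)
  then obtain f fs' where fs: "fs = f # fs'" "length fs' = length ws" by (cases fs) auto
  have k: "wlin (\<lambda>y. k (x @ y))" for x by (rule wlin_append(1)[OF Cons.prems(1)])
  have "lact (\<lambda>gs. wsubst k (w # ws) gs) fs h
      = sw (\<lambda>a b. wact (\<lambda>x. lact (\<lambda>u. wsubst (\<lambda>y. k (x @ y)) ws u) fs' b) w (f * a)) h"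
    by (simp add: fs lact_wact_swap)
  also have "\<dots> = sw (\<lambda>a b. wact (\<lambda>x. wsubst (\<lambda>z. wact (\<lambda>y. k (x @ y)) z b) ws fs') w (f * a)) h"
    by (simp add: Cons.IH[OF k fs(2)])
  also have "\<dots> = sw (\<lambda>a b. wact (\<lambda>u. wact (\<lambda>x. wsubst (\<lambda>z. wact (\<lambda>y. k (x @ y)) z b) ws fs') u a) w f) h"
    by (intro sw_cong refl wact_wact[symmetric] wlin_wsubst_fun wlin_wact_fun wlin_append(2)[OF Cons.prems(1)])
  also have "\<dots> = wsubst (\<lambda>x. wact k x h) (w # ws) fs"
    by (simp add: fs wact_append[OF Cons.prems(1)] wsubst_sw wact_sw wsubst_wact)
  finally show ?case .
qed simp

text \<open>
  \<open>Theta M [w\<^sub>1, \<dots>, w\<^sub>n]\<close> maps \<open>(f\<^sub>1 \<otimes> \<dots> \<otimes> f\<^sub>n) \<otimes>\<^sub>H m\<close> to \<open>(w\<^sub>1 f\<^sub>1) \<dots> (w\<^sub>n f\<^sub>n) \<otimes>\<^sub>H m\<close>, where \<open>f\<^sub>i\<close> acts on the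
  word \<open>w\<^sub>i\<close>.
\<close>

definition Theta ::
  "('h, 'm::ab_group_add, 'z) hmodule_scheme \<Rightarrow> (nat \<times> 'h) list list \<Rightarrow> ('k, 'h, 'm) pseudo \<Rightarrow>
    ((nat \<times> 'h) list \<times> 'm \<Rightarrow>\<^sub>0 'k)" where
  "Theta M ws = pfun (\<lambda>fs m. wsubst (\<lambda>w. wtens M w m) ws fs)"

lemma flin_Theta: "flin (Theta M ws)"
  unfolding Theta_def by (rule flin_pfun)

lemma balanced_Theta:
  assumes M: "left_module M" shows "balanced (length ws) M (\<lambda>fs m. wsubst (\<lambda>w. wtens M w m) ws fs)"
  unfolding balanced_def
  by (simp add: mlin_wsubst wtens_rules[OF M] wsubst_add_fun lact_wsubst)

lemma Theta_tens:
  assumes "left_module M" "length fs = length ws" "m \<in> carr M"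
  shows "Theta M ws (ptn (length ws) M fs m) = wsubst (\<lambda>w. wtens M w m) ws fs"
  unfolding Theta_def by (rule pfun_ptens[OF assms(1) balanced_Theta[OF assms(1)] assms(2,3)])

lemma wsubst_mem: "free.subspace V \<Longrightarrow> (\<And>u. k u \<in> V) \<Longrightarrow> wsubst k ws fs \<in> V"
  by (subst wsubst_as_fext) (rule fext_mem)

lemma Theta_in: "left_module M \<Longrightarrow> X \<in> pseudo H (length ws) M \<Longrightarrow> Theta M ws X \<in> word_space M"
  by (rule pseudo_memI[OF _ flin_Theta subspace_word_space])
    (auto simp: Theta_tens intro!: wsubst_mem subspace_word_space wtens_in)

lemma wsym_wsubst: "(\<And>u. wsym (\<lambda>x. k (u @ x))) \<Longrightarrow> wsym k \<Longrightarrow> wsym (\<lambda>zs. wsubst k (map fst zs) (map snd zs))"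
proof -
  assume k: "wsym k"
  have "wsubst k (map fst (u @ p # q # v)) (map snd (u @ p # q # v))
      = wsubst k (map fst (u @ q # p # v)) (map snd (u @ q # p # v))" if "wsym k"
    for u v p q and k :: "(nat \<times> 'h) list \<Rightarrow> ('a \<Rightarrow>\<^sub>0 'k)"
    using that
  proof (induction u arbitrary: k)
    case Nil
    have "k (x @ y @ z) = k (y @ x @ z)" for x y z by (rule wsym_mset[OF Nil]) simp
    then show ?case by (simp, subst wact_swap) simp
  next
    case (Cons r u)
    show ?case by (simp add: Cons.IH[OF wsym_append(1)[OF Cons.prems], simplified])
  qed
  then show ?thesis using k by (simp add: wsym_def)
qed

text \<open>The words travel together with their scalars and are concatenated in another order,
  which a symmetric function does not notice.\<close>

lemma Theta_pperm:
  assumes M: "left_module M" and s: "\<sigma> permutes {..<n}" and ws: "length ws = n" and X: "X \<in> pseudo H n M"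
  shows "Theta M ws (pperm H n M \<sigma> X) = Theta M (permute_list \<sigma> ws) X"
proof (rule pseudo_eqI[OF M _ flin_Theta _ X])
  show "flin (\<lambda>X. Theta M ws (pperm H n M \<sigma> X))"
    unfolding flin_def by (simp add: flinD(1,2)[OF flin_Theta] flinD(1,2)[OF flin_lmul(2)])
  fix fs :: "'h list" and c assume fs: "length fs = n" and c: "c \<in> carr M"
  let ?k = "\<lambda>w. wtens M w c" and ?fs = "permute_list (inv \<sigma>) fs"
  have inv: "permute_list \<sigma> ?fs = fs"
    using permute_list_compose[of \<sigma> fs "inv \<sigma>"] s fs by (simp add: permutes_inv_o[OF s])
  have sym: "wsym ?k" by (rule wtens_rules(2)[OF M c])
  have "wsubst ?k ws ?fs = wsubst ?k (map fst (zip ws ?fs)) (map snd (zip ws ?fs))"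
    using fs ws by simp
  also have "\<dots> = wsubst ?k (map fst (permute_list \<sigma> (zip ws ?fs))) (map snd (permute_list \<sigma> (zip ws ?fs)))"
    by (rule wsym_mset[OF wsym_wsubst[OF wsym_append(1)[OF sym] sym]]) (use s fs ws in simp)
  also have "permute_list \<sigma> (zip ws ?fs) = zip (permute_list \<sigma> ws) fs"
    using permute_list_zip[OF s, of ws ?fs] fs ws unfolding inv by simp
  finally have "wsubst ?k ws ?fs = wsubst ?k (permute_list \<sigma> ws) fs"
    using fs ws by simp
  then show "Theta M ws (pperm H n M \<sigma> (ptn n M fs c)) = Theta M (permute_list \<sigma> ws) (ptn n M fs c)"
    using Theta_tens[OF M, of ?fs ws c] Theta_tens[OF M, of fs "permute_list \<sigma> ws" c] fs ws c s
    by (simp add: pperm_tens[OF M])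
qed

definition wmul ::
  "('h, 'c::ab_group_add, 'z) hmodule_scheme \<Rightarrow> ('a \<Rightarrow> 'b \<Rightarrow> ('k, 'h, 'c) pseudo) \<Rightarrow>
    ((nat \<times> 'h) list \<times> 'a \<Rightarrow>\<^sub>0 'k) \<Rightarrow> ((nat \<times> 'h) list \<times> 'b \<Rightarrow>\<^sub>0 'k) \<Rightarrow> ((nat \<times> 'h) list \<times> 'c \<Rightarrow>\<^sub>0 'k)" where
  "wmul C \<mu> X Y = fext (\<lambda>(w, a). fext (\<lambda>(w', b). Theta C [w, w'] (\<mu> a b)) Y) X"

lemma flin_wmul: "flin (\<lambda>X. wmul C \<mu> X Y)" "flin (wmul C \<mu> X)"
proof -
  have *: "(\<lambda>(w, a). fext (\<lambda>(w', b). g w a w' b) Y) = (\<lambda>x. fext (\<lambda>y. g (fst x) (snd x) (fst y) (snd y)) Y)" for g Y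
    by (auto simp: split_def)
  show "flin (\<lambda>X. wmul C \<mu> X Y)" unfolding wmul_def by (rule flin_fext)
  show "flin (wmul C \<mu> X)" unfolding flin_def wmul_def *
    by (simp add: fext_add fext_scale fext_add_fun fext_scale_fun)
qed

lemma Theta_2_tens:
  assumes "left_module C" "c \<in> carr C"
  shows "Theta C [w, w'] (ptn 2 C [p, q] c) = wact (\<lambda>x. wact (\<lambda>y. wtens C (x @ y) c) w' q) w p"
  using Theta_tens[OF assms(1), of "[p, q]" "[w, w']" c] assms(2) by (simp add: numeral_2_eq_2)

text \<open>\<open>wmul\<close> sums over representatives, so it has to be checked that
  \<open>Theta C [w, w'] (\<mu> a b)\<close> is linear, symmetric and balanced in each of the two
  words.\<close>

lemma wmul_wtens:
  fixes A :: "('h, 'a::ab_group_add, 'u) hmodule_scheme" and B :: "('h, 'b::ab_group_add, 'v) hmodule_scheme"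
    and C :: "('h, 'c::ab_group_add, 'w) hmodule_scheme"
  assumes A: "left_module A" and B: "left_module B" and C: "left_module C" and \<mu>: "hbilinear A B C \<mu>"
    and a: "a \<in> carr A" and b: "b \<in> carr B"
  shows "wmul C \<mu> (wtens A w a) (wtens B w' b) = Theta C [w, w'] (\<mu> a b)"
proof -
  have lin: "flin (\<lambda>X. wact (\<lambda>u. L u X) w h)" if "\<And>u. flin (L u)"
    for L :: "(nat \<times> 'h) list \<Rightarrow> ('k, 'h, 'c) pseudo \<Rightarrow> ((nat \<times> 'h) list \<times> 'c \<Rightarrow>\<^sub>0 'k)" and w h
    unfolding flin_def
    by (simp add: flinD(1,2)[OF that] wact_add_fun wact_flin[OF flin_fscale, symmetric])
  have lin2: "flin (\<lambda>X. Theta C ws (lmul H 2 C K X))" for ws K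
    unfolding flin_def by (simp add: flinD(1,2)[OF flin_Theta] flinD(1,2)[OF flin_lmul(1)])
  have c2: "wlin (\<lambda>y. wtens C (x @ y) c)" "wlin (\<lambda>x. wtens C (x @ y) c)" if "c \<in> carr C" for x y c
    using wlin_append[OF wtens_rules(1)[OF C that]] by auto
  have bal1: "wact (\<lambda>u. Theta C [u, w'] X) w h = Theta C [w, w'] (lmul H 2 C (tens H [h, 1]) X)"
    if X: "X \<in> pseudo H 2 C" for X w w' h
  proof (rule pseudo_eqI[OF C lin[OF flin_Theta] lin2 _ X])
    fix xs :: "'h list" and c assume "length xs = 2" and c: "c \<in> carr C"
    then obtain p q where xs: "xs = [p, q]" by (blast elim: length2E)
    have "wact (\<lambda>u. wact (\<lambda>x. wact (\<lambda>y. wtens C (x @ y) c) w' q) u p) w h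
        = wact (\<lambda>x. wact (\<lambda>y. wtens C (x @ y) c) w' q) w (h * p)"
      by (intro wact_wact wlin_wact_fun c2 c)
    then show "wact (\<lambda>u. Theta C [u, w'] (ptn 2 C xs c)) w h
        = Theta C [w, w'] (lmul H 2 C (tens H [h, 1]) (ptn 2 C xs c))"
      by (simp add: xs lmul_tens[OF C] Theta_2_tens[OF C] c)
  qed
  have bal2: "wact (\<lambda>u. Theta C [w, u] X) w' h = Theta C [w, w'] (lmul H 2 C (tens H [1, h]) X)"
    if X: "X \<in> pseudo H 2 C" for X w w' h
  proof (rule pseudo_eqI[OF C lin[OF flin_Theta] lin2 _ X])
    fix xs :: "'h list" and c assume "length xs = 2" and c: "c \<in> carr C"
    then obtain p q where xs: "xs = [p, q]" by (blast elim: length2E)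
    have "wact (\<lambda>u. wact (\<lambda>x. wact (\<lambda>y. wtens C (x @ y) c) u q) w p) w' h
        = wact (\<lambda>x. wact (\<lambda>u. wact (\<lambda>y. wtens C (x @ y) c) u q) w' h) w p"
      by (rule wact_swap)
    also have "\<dots> = wact (\<lambda>x. wact (\<lambda>y. wtens C (x @ y) c) w' (h * q)) w p"
      by (intro wact_cong refl wact_wact c2 c)
    finally show "wact (\<lambda>u. Theta C [w, u] (ptn 2 C xs c)) w' h
        = Theta C [w, w'] (lmul H 2 C (tens H [1, h]) (ptn 2 C xs c))"
      by (simp add: xs lmul_tens[OF C] Theta_2_tens[OF C] c)
  qed
  have wl: "wlin (\<lambda>u. Theta C [u, w'] X)" "wlin (\<lambda>u. Theta C [w, u] X)"
    "wsym (\<lambda>u. Theta C [u, w'] X)" "wsym (\<lambda>u. Theta C [w, u] X)" if X: "X \<in> pseudo H 2 C" for w w' X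
  proof -
    \<comment> \<open>The rewritten summand is 0 outside \<open>carr C\<close>, so that linearity
      and symmetry hold for every conceivable key of the sum and not just for those that
      occur.\<close>
    have e: "Theta C [w, w'] X = fext (\<lambda>(F, c). fext (\<lambda>fs. if c \<in> carr C then wact (\<lambda>x. wact (\<lambda>y. wtens C (x @ y) c) w' (fs ! 1)) w (fs ! 0) else 0) F) X" for w w'
      unfolding Theta_def pfun_def
    proof (rule fext_cong, clarify, rule fext_cong)
      fix F c fs assume "(F, c) \<in> Poly_Mapping.keys X" and fs: "fs \<in> Poly_Mapping.keys F"
      then have F: "F \<in> tensor_power H 2" and c: "c \<in> carr C" using keys_pseudo[OF C X] by auto
      obtain p q where "fs = [p, q]" by (rule length2E[OF keys_tensor_power[OF F fs]])
      then show "wsubst (\<lambda>w. wtens C w c) [w, w'] fs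
        = (if c \<in> carr C then wact (\<lambda>x. wact (\<lambda>y. wtens C (x @ y) c) w' (fs ! 1)) w (fs ! 0) else 0)"
        using c by simp
    qed
    have h: "hlin (\<lambda>a. fext (\<lambda>(F, c). g a F c) X)" if "\<And>F c. hlin (\<lambda>a. g a F c)"
      for g :: "'h \<Rightarrow> ('k, 'h) tensor \<Rightarrow> 'c \<Rightarrow> ((nat \<times> 'h) list \<times> 'c \<Rightarrow>\<^sub>0 'k)"
      using hlin_fext[of "\<lambda>a x. g a (fst x) (snd x)" X] that by (simp add: split_def)
    have w1: "wlin (\<lambda>u. if c \<in> carr C then wact (\<lambda>x. wact (\<lambda>y. wtens C (x @ y) c) w' q) u p else 0)" for c p q w'
      by (cases "c \<in> carr C") (simp_all add: wlin_wact wlin_wact_fun c2, simp add: wlin_def hlin_zero)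
    have w2: "wlin (\<lambda>u. if c \<in> carr C then wact (\<lambda>x. wact (\<lambda>y. wtens C (x @ y) c) u q) w p else 0)" for c p q w
      by (cases "c \<in> carr C") (simp_all add: wlin_wact wlin_wact_fun c2, simp add: wlin_def hlin_zero)
    have s: "wsym (\<lambda>y. wtens C (x @ y) c)" "wsym (\<lambda>x. wtens C (x @ y) c)" if "c \<in> carr C" for x y c
      using wsym_append[OF wtens_rules(2)[OF C that]] by auto
    have s1: "wsym (\<lambda>u. if c \<in> carr C then wact (\<lambda>x. wact (\<lambda>y. wtens C (x @ y) c) w' q) u p else 0)" for c p q w'
      by (cases "c \<in> carr C") (simp_all add: wsym_wact wlin_wact_fun wsym_wact_fun s c2, simp add: wsym_def)
    have s2: "wsym (\<lambda>u. if c \<in> carr C then wact (\<lambda>x. wact (\<lambda>y. wtens C (x @ y) c) u q) w p else 0)" for c p q w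
      by (cases "c \<in> carr C") (simp_all add: wsym_wact wlin_wact_fun wsym_wact_fun s c2, simp add: wsym_def)
    show "wlin (\<lambda>u. Theta C [u, w'] X)"
      unfolding wlin_def e by (intro allI h hlin_fext) (rule wlinD[OF w1])
    show "wlin (\<lambda>u. Theta C [w, u] X)"
      unfolding wlin_def e by (intro allI h hlin_fext) (rule wlinD[OF w2])
    show "wsym (\<lambda>u. Theta C [u, w'] X)"
      unfolding wsym_def e by (simp only: s1[unfolded wsym_def, rule_format]) simp
    show "wsym (\<lambda>u. Theta C [w, u] X)"
      unfolding wsym_def e by (simp only: s2[unfolded wsym_def, rule_format]) simp
  qed
  have X: "\<mu> a b \<in> pseudo H 2 C" if "a \<in> carr A" "b \<in> carr B" for a b by (rule hbilinearD(1)[OF \<mu> that])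
  have b2: "wbalanced B (\<lambda>w' b. Theta C [w, w'] (\<mu> a b))" if a: "a \<in> carr A" for a w
    unfolding wbalanced_def using wl(2,4)[OF X[OF a]] bal2[OF X[OF a]] hbilinear_act(2)[OF \<mu> A B a]
      hbilinearD(3)[OF \<mu> a] by (simp add: flinD(1)[OF flin_Theta])
  have i: "fext (\<lambda>(w', b). Theta C [w, w'] (\<mu> a b)) (wtens B w' b) = Theta C [w, w'] (\<mu> a b)"
    if "a \<in> carr A" "b \<in> carr B" for a b w w'
    using wfun_wtens[OF B b2[OF that(1)] that(2)] by (simp add: wfun_def)
  have b1: "wbalanced A (\<lambda>w a. fext (\<lambda>(w', b). Theta C [w, w'] (\<mu> a b)) (wtens B w' b))"
    unfolding wbalanced_def
    using wl(1,3)[OF X[OF _ b]] bal1[OF X[OF _ b]] hbilinear_act(1)[OF \<mu> A B _ b] hbilinearD(2)[OF \<mu> _ _ b]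
    by (simp add: i b left_moduleD(3,5)[OF A] flinD(1)[OF flin_Theta])
  show ?thesis
    unfolding wmul_def using wfun_wtens[OF A b1 a, of w] i[OF a b] by (simp add: wfun_def)
qed

text \<open>This turns nested \<open>pext\<close> into iterated products: words are concatenated on
  one side and a single \<open>wmul\<close> stands on the other. Both sides are linear in
  \<open>X\<close> and \<open>Y\<close>, so pure tensors suffice. Identities of pseudoalgebras pass
  to and from word spaces through it.\<close>

lemma Theta_pext:
  assumes A: "left_module A" and B: "left_module B" and C: "left_module C" and \<mu>: "hbilinear A B C \<mu>"
    and ws: "length ws = n" and vs: "length vs = m" and X: "X \<in> pseudo H n A" and Y: "Y \<in> pseudo H m B"
  shows "Theta C (ws @ vs) (pext H n m C \<mu> X Y) = wmul C \<mu> (Theta A ws X) (Theta B vs Y)"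
proof -
  have c: "flin (\<lambda>X. L (L' X))" if "flin L" "flin L'"
    for L :: "('p \<Rightarrow>\<^sub>0 'k) \<Rightarrow> ('q \<Rightarrow>\<^sub>0 'k)" and L' :: "('r \<Rightarrow>\<^sub>0 'k) \<Rightarrow> ('p \<Rightarrow>\<^sub>0 'k)"
    using that by (simp add: flin_def)
  show ?thesis
  proof (rule pseudo_eqI[OF A c[OF flin_Theta flin_pext(1)] c[OF flin_wmul(1) flin_Theta] _ X])
    fix fs :: "'h list" and a assume fs: "length fs = n" and a: "a \<in> carr A"
    show "Theta C (ws @ vs) (pext H n m C \<mu> (ptn n A fs a) Y)
        = wmul C \<mu> (Theta A ws (ptn n A fs a)) (Theta B vs Y)"
    proof (rule pseudo_eqI[OF B c[OF flin_Theta flin_pext(2)] c[OF flin_wmul(2) flin_Theta] _ Y])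
      fix gs :: "'h list" and b assume gs: "length gs = m" and b: "b \<in> carr B"
      let ?T = "\<lambda>w c. ptn (n + m) C w c"
      have bal: "balanced 2 C (twofold ?T fs gs)"
        by (rule balanced_twofold[OF C balanced_ptens[OF C] fs gs])
      have ths: "flin (\<lambda>X. wsubst (\<lambda>w. wsubst (\<lambda>w'. Theta C [w, w'] X) vs gs) ws fs)"
        unfolding flin_def
        by (simp add: flinD(1,2)[OF flin_Theta] wsubst_add_fun wsubst_flin[OF flin_fscale, symmetric])
      have "Theta C (ws @ vs) (pfun (twofold ?T fs gs) X) = wsubst (\<lambda>w. wsubst (\<lambda>w'. Theta C [w, w'] X) vs gs) ws fs"
        if "X \<in> pseudo H 2 C" for X
      proof (rule pseudo_eqI[OF C c[OF flin_Theta flin_pfun] ths _ that])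
        fix pq :: "'h list" and e assume "length pq = 2" and e: "e \<in> carr C"
        then obtain p q where pq: "pq = [p, q]" by (blast elim: length2E)
        let ?k = "\<lambda>w. wtens C w e"
        have k: "wlin ?k" by (rule wtens_rules(1)[OF C e])
        have "Theta C (ws @ vs) (pfun (twofold ?T fs gs) (ptn 2 C pq e))
            = lact (\<lambda>u. lact (\<lambda>v. Theta C (ws @ vs) (?T (u @ v) e)) gs q) fs p"
          unfolding pfun_ptens[OF C bal \<open>length pq = 2\<close> e] by (simp add: pq twofold_def lact_flin[OF flin_Theta])
        also have "\<dots> = lact (\<lambda>u. lact (\<lambda>v. wsubst (\<lambda>x. wsubst (\<lambda>y. ?k (x @ y)) vs v) ws u) gs q) fs p"
        proof (intro lact_cong_length)
          fix u v :: "'h list" assume u: "length u = length fs" and v: "length v = length gs"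
          show "Theta C (ws @ vs) (?T (u @ v) e) = wsubst (\<lambda>x. wsubst (\<lambda>y. ?k (x @ y)) vs v) ws u"
            using Theta_tens[OF C, of "u @ v" "ws @ vs" e] u v ws vs fs gs e by (simp add: wsubst_append)
        qed
        also have "\<dots> = lact (\<lambda>u. wsubst (\<lambda>x. wsubst (\<lambda>z. wact (\<lambda>y. ?k (x @ y)) z q) vs gs) ws u) fs p"
        proof (intro lact_cong refl)
          fix u
          have "lact (\<lambda>v. wsubst (\<lambda>x. wsubst (\<lambda>y. ?k (x @ y)) vs v) ws u) gs q
            = wsubst (\<lambda>x. lact (\<lambda>v. wsubst (\<lambda>y. ?k (x @ y)) vs v) gs q) ws u"
            by (rule wsubst_lact[symmetric])
          also have "\<dots> = wsubst (\<lambda>x. wsubst (\<lambda>z. wact (\<lambda>y. ?k (x @ y)) z q) vs gs) ws u"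
            by (intro wsubst_cong refl lact_wsubst wlin_append(1)[OF k]) (simp add: gs vs)
          finally show "lact (\<lambda>v. wsubst (\<lambda>x. wsubst (\<lambda>y. ?k (x @ y)) vs v) ws u) gs q
            = wsubst (\<lambda>x. wsubst (\<lambda>z. wact (\<lambda>y. ?k (x @ y)) z q) vs gs) ws u" .
        qed
        also have "\<dots> = wsubst (\<lambda>u. wact (\<lambda>x. wsubst (\<lambda>z. wact (\<lambda>y. ?k (x @ y)) z q) vs gs) u p) ws fs"
          by (intro lact_wsubst wlin_wsubst_fun wlin_wact_fun wlin_append(2)[OF k]) (simp add: fs ws)
        also have "\<dots> = wsubst (\<lambda>w. wsubst (\<lambda>w'. Theta C [w, w'] (ptn 2 C pq e)) vs gs) ws fs"
          by (simp add: pq Theta_2_tens[OF C e] wsubst_wact)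
        finally show "Theta C (ws @ vs) (pfun (twofold ?T fs gs) (ptn 2 C pq e))
            = wsubst (\<lambda>w. wsubst (\<lambda>w'. Theta C [w, w'] (ptn 2 C pq e)) vs gs) ws fs" .
      qed
      from this[OF hbilinearD(1)[OF \<mu> a b]]
      have "Theta C (ws @ vs) (pext H n m C \<mu> (ptn n A fs a) (ptn m B gs b))
          = wsubst (\<lambda>w. wsubst (\<lambda>w'. Theta C [w, w'] (\<mu> a b)) vs gs) ws fs"
        by (simp add: pext_tens[OF A B C \<mu> fs gs a b])
      also have "\<dots> = wsubst (\<lambda>w. wmul C \<mu> (wtens A w a) (wsubst (\<lambda>w'. wtens B w' b) vs gs)) ws fs"
        by (simp add: wsubst_flin[OF flin_wmul(2)] wmul_wtens[OF A B C \<mu> a b])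
      also have "\<dots> = wmul C \<mu> (wsubst (\<lambda>w. wtens A w a) ws fs) (wsubst (\<lambda>w'. wtens B w' b) vs gs)"
        by (rule wsubst_flin[OF flin_wmul(1), symmetric])
      finally show "Theta C (ws @ vs) (pext H n m C \<mu> (ptn n A fs a) (ptn m B gs b))
          = wmul C \<mu> (Theta A ws (ptn n A fs a)) (Theta B vs (ptn m B gs b))"
        using Theta_tens[OF A, of fs ws a] Theta_tens[OF B, of gs vs b] a b fs gs ws vs by simp
    qed
  qed
qed

lemma emb_in: "a \<in> carr M \<Longrightarrow> emb H M a \<in> pseudo H 1 M"
  by (simp add: emb_def)

lemma Theta_emb: "left_module M \<Longrightarrow> a \<in> carr M \<Longrightarrow> Theta M [w] (emb H M a) = wtens M w a"
  using Theta_tens[of M "[1]" "[w]" a] wtens_rules(1)[of M a] by (simp add: emb_def wact_1)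

definition wpush ::
  "('h, 'n::ab_group_add, 'z) hmodule_scheme \<Rightarrow> ('m \<Rightarrow> 'n) \<Rightarrow>
    ((nat \<times> 'h) list \<times> 'm \<Rightarrow>\<^sub>0 'k) \<Rightarrow> ((nat \<times> 'h) list \<times> 'n \<Rightarrow>\<^sub>0 'k)" where
  "wpush N q = wfun (\<lambda>w m. wtens N w (q m))"

lemma wpush_wtens:
  assumes M: "left_module M" and N: "left_module N" and q: "module_hom_on M N q" and m: "m \<in> carr M"
  shows "wpush N q (wtens M w m) = wtens N w (q m)"
proof -
  have "wbalanced M (\<lambda>w m. wtens N w (q m))"
    unfolding wbalanced_def by (simp add: wtens_rules[OF N] module_hom_onD[OF q])
  from wfun_wtens[OF M this m] show ?thesis by (simp add: wpush_def)
qed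

lemma flin_wpush: "flin (wpush N q)"
  unfolding wpush_def by (rule flin_wfun)

lemma wpush_in:
  assumes "left_module M" "left_module N" "module_hom_on M N q" "X \<in> word_space M"
  shows "wpush N q X \<in> word_space N"
  by (rule word_space_memI[OF assms(1) flin_wpush subspace_word_space[OF assms(2)] _ assms(4)])
    (simp add: wpush_wtens[OF assms(1-3)] wtens_in module_hom_onD[OF assms(3)])

lemma Theta_push:
  assumes M: "left_module M" and N: "left_module N" and q: "module_hom_on M N q"
    and X: "X \<in> pseudo H (length ws) M"
  shows "Theta N ws (push H (length ws) N q X) = wpush N q (Theta M ws X)"
proof -
  have c: "flin (\<lambda>X. L (L' X))" if "flin L" "flin L'"
    for L :: "('p \<Rightarrow>\<^sub>0 'k) \<Rightarrow> ('q \<Rightarrow>\<^sub>0 'k)" and L' :: "('r \<Rightarrow>\<^sub>0 'k) \<Rightarrow> ('p \<Rightarrow>\<^sub>0 'k)"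
    using that by (simp add: flin_def)
  show ?thesis
    by (rule pseudo_eqI[OF M c[OF flin_Theta flin_lmul(3)] c[OF flin_wpush flin_Theta] _ X])
      (simp add: push_ptens[OF M N q] Theta_tens[OF M] Theta_tens[OF N] module_hom_onD(1)[OF q]
        wsubst_flin[OF flin_wpush] wpush_wtens[OF M N q])
qed

lemma wmul_in:
  assumes A: "left_module A" and B: "left_module B" and C: "left_module C" and \<mu>: "hbilinear A B C \<mu>"
    and X: "X \<in> word_space A" and Y: "Y \<in> word_space B"
  shows "wmul C \<mu> X Y \<in> word_space C"
proof (rule word_space_memI[OF A flin_wmul(1) subspace_word_space[OF C] _ X])
  fix w a assume a: "a \<in> carr A"
  show "wmul C \<mu> (wtens A w a) Y \<in> word_space C"
  proof (rule word_space_memI[OF B flin_wmul(2) subspace_word_space[OF C] _ Y])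
    fix w' b assume b: "b \<in> carr B"
    show "wmul C \<mu> (wtens A w a) (wtens B w' b) \<in> word_space C"
      unfolding wmul_wtens[OF A B C \<mu> a b]
      by (rule Theta_in[OF C]) (use hbilinearD(1)[OF \<mu> a b] in \<open>simp add: numeral_2_eq_2\<close>)
  qed
qed

section \<open>Separation of pseudo tensors by words with distinct labels\<close>

abbreviation letters :: "nat \<Rightarrow> (nat \<times> 'h) list list" where
  "letters n \<equiv> map (\<lambda>i. [(i, 1)]) [0..<n]"

text \<open>A scalar acting on a one-letter word with letter 1 becomes that letter; the counit axiom
  removes the empty rest of the word.\<close>

lemma wsubst_letters: "wlin k \<Longrightarrow> length fs = length is \<Longrightarrow> wsubst k (map (\<lambda>i. [(i, 1)]) is) fs = k (zip is fs)"
proof (induction "is" arbitrary: k fs)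
  case (Cons i js)
  then obtain f gs where fs: "fs = f # gs" "length gs = length js" by (cases fs) auto
  show ?case
    using sw_counit(2)[OF wlin_Cons(2)[OF Cons.prems(1), of i "zip js gs"], of f]
    by (simp add: fs Cons.IH[OF wlin_Cons(1)[OF Cons.prems(1)]])
qed simp

lemma wact_cong_labels:
  "(\<And>u. map fst u = map fst w \<Longrightarrow> k u = k' u) \<Longrightarrow> wact k w h = wact k' w h"
proof (induction w arbitrary: k k' h)
  case (Cons p w)
  obtain i x where p: "p = (i, x)" by force
  have "wact (\<lambda>u. k ((i, x * a) # u)) w b = wact (\<lambda>u. k' ((i, x * a) # u)) w b" for a b
    by (rule Cons.IH) (simp add: Cons.prems p)
  then show ?case unfolding p by simp
qed simp

text \<open>The action leaves labels alone, so both sides vanish for the same words; for the other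
  words, symmetry allows the letters to be sorted before acting.\<close>

lemma wact_by_label: "mlin n k \<Longrightarrow> wact (by_label n k) w h = by_label n (\<lambda>fs. lact k fs h) w"
proof (cases "mset (map fst w) = mset [0..<n]")
  case False
  have "wact (by_label n k) w h = wact (\<lambda>u. 0) w h"
    by (rule wact_cong_labels) (use False in \<open>simp add: by_label_def\<close>)
  also have "\<dots> = 0" by (subst wact_as_fext) simp
  finally show ?thesis using False by (simp add: by_label_def)
next
  case True
  assume k: "mlin n k"
  define fs where "fs = map (\<lambda>i. the (map_of w i)) [0..<n]"
  have d: "distinct (map fst w)" by (metis True distinct_upt mset_eq_imp_distinct_iff)
  have s: "fst ` set w = {..<n}" using arg_cong[OF True, of set_mset] by (simp add: atLeast0LessThan)
  have len: "length fs = n" by (simp add: fs_def)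
  have "set w = set (zip [0..<n] fs)"
  proof (intro set_eqI iffI)
    fix p assume p: "p \<in> set w"
    obtain i x where ix: "p = (i, x)" by force
    have "i < n" using s p ix by (metis fst_conv imageI lessThan_iff)
    moreover have "fs ! i = x" using p ix d \<open>i < n\<close> by (simp add: fs_def map_of_eq_Some_iff)
    ultimately show "p \<in> set (zip [0..<n] fs)" using len by (force simp: ix set_zip)
  next
    fix p assume "p \<in> set (zip [0..<n] fs)"
    then obtain i where i: "i < n" "p = (i, fs ! i)" by (auto simp: set_zip len)
    then obtain x where "(i, x) \<in> set w" using s by (metis (no_types, opaque_lifting) imageE lessThan_iff prod.collapse)
    moreover have "fs ! i = x" using calculation d i by (simp add: fs_def map_of_eq_Some_iff)
    ultimately show "p \<in> set w" using i by simp
  qed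
  moreover have "distinct w" using d by (simp add: distinct_map)
  moreover have "distinct (zip [0..<n] fs)" by (rule distinct_zipI1) simp
  ultimately have m: "mset w = mset (zip [0..<n] fs)" by (simp add: set_eq_iff_mset_eq_distinct)
  have "wact (by_label n k) w h = wact (by_label n k) (zip [0..<n] fs) h"
    by (rule wsym_mset[OF wsym_wact[OF wlin_by_label[OF k] wsym_by_label] m])
  also have "\<dots> = lact k fs h"
    by (subst wact_zip) (auto simp: len by_label_zip intro!: lact_cong_length)
  finally show ?thesis using True by (simp add: by_label_def fs_def)
qed

text \<open>On one-letter words with distinct labels \<open>Theta\<close> merely writes the tensor
  factors into the letters. Sorting by label reads them off again, so \<open>wfun ?g\<close> is a
  left inverse.\<close>

lemma Theta_letters_inj:
  assumes M: "left_module M" and X: "X \<in> pseudo H n M" and Y: "Y \<in> pseudo H n M"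
    and eq: "Theta M (letters n) X = Theta M (letters n) Y"
  shows "X = Y"
proof -
  let ?g = "\<lambda>w m. by_label n (\<lambda>xs. ptn n M xs m) w"
  have bal: "wbalanced M ?g"
    unfolding wbalanced_def
  proof (intro conjI ballI allI)
    fix m assume m: "m \<in> carr M"
    show "wlin (\<lambda>w. ?g w m)" "wsym (\<lambda>w. ?g w m)"
      by (rule wlin_by_label[OF mlin_ptens[OF M m]], rule wsym_by_label)
    show "?g w (m + m') = ?g w m + ?g w m'" if "m' \<in> carr M" for w m'
      using m that by (simp add: by_label_def ptens_rules(2)[OF M])
    show "wact (\<lambda>u. ?g u m) w h = ?g w (act M h m)" for w h
      unfolding wact_by_label[OF mlin_ptens[OF M m]] using m by (simp add: by_label_def lact_ptens[OF M])
  qed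
  have c: "flin (\<lambda>X. L (L' X))" if "flin L" "flin L'"
    for L :: "('p \<Rightarrow>\<^sub>0 'k) \<Rightarrow> ('q \<Rightarrow>\<^sub>0 'k)" and L' :: "('r \<Rightarrow>\<^sub>0 'k) \<Rightarrow> ('p \<Rightarrow>\<^sub>0 'k)"
    using that by (simp add: flin_def)
  have "wfun ?g (Theta M (letters n) Z) = Z" if Z: "Z \<in> pseudo H n M" for Z
  proof (rule pseudo_eqI[OF M c[OF flin_wfun flin_Theta] _ _ Z])
    show "flin (\<lambda>x. x)" by (simp add: flin_def)
    fix xs :: "'h list" and m assume xs: "length xs = n" and m: "m \<in> carr M"
    have "Theta M (letters n) (ptn n M xs m) = wtens M (zip [0..<n] xs) m"
      using Theta_tens[OF M, of xs "letters n" m] wsubst_letters[OF wtens_rules(1)[OF M m], of xs "[0..<n]"] xs m by simp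
    then show "wfun ?g (Theta M (letters n) (ptn n M xs m)) = ptn n M xs m"
      using xs by (simp add: wfun_wtens[OF M bal m] by_label_zip)
  qed
  then show ?thesis using X Y eq by metis
qed

end

section \<open>Slices\<close>

context cocommutative_hopf
begin

lemma dualD: assumes "y \<in> dual H" shows "y (a + b) = y a + y b" "y (scl H c a) = c * y a"
  using assms by (auto simp: dual_def Vector_Spaces.linear_iff)

lemma flin_comp: "flin L \<Longrightarrow> flin L' \<Longrightarrow> flin (\<lambda>X. L (L' X))"
  by (simp add: flin_def)

text \<open>
  \<open>H\<^bsup>n+1\<^esup> \<otimes>\<^sub>H M\<close> is isomorphic to \<open>H \<otimes> (H\<^bsup>n\<^esup> \<otimes>\<^sub>H M)\<close> if \<open>n > 0\<close>: the first factor \<open>f\<close> is replaced by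
  \<open>f S(g\<^sub>1)\<close>, where \<open>g\<close> is the second one. A functional on the first factor then gives a slice.
\<close>

definition slice_list :: "('h \<Rightarrow> 'k) \<Rightarrow> ('h list \<Rightarrow> ('x \<Rightarrow>\<^sub>0 'k)) \<Rightarrow> 'h list \<Rightarrow> ('x \<Rightarrow>\<^sub>0 'k)" where
  "slice_list y k xs = sw (\<lambda>a b. fscale (y (xs ! 0 * antipode H a)) (k (b # drop 2 xs))) (xs ! 1)"

lemma slice_list_Cons:
  "slice_list y k (f # g # r) = sw (\<lambda>a b. fscale (y (f * antipode H a)) (k (b # r))) g"
  by (simp add: slice_list_def numeral_2_eq_2)

lemma length_ge_2E: assumes "length xs = Suc n" "n \<ge> 1" obtains f g r where "xs = f # g # r" "length (g # r) = n"
  using assms by (metis length_Suc_conv Suc_le_D One_nat_def)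

lemma slice_list_flin: "flin L \<Longrightarrow> L (slice_list y k xs) = slice_list y (\<lambda>u. L (k u)) xs"
  by (simp add: slice_list_def sw_flin flinD)

lemma slice_list_as_fext: "slice_list y k xs = fext k (slice_list y (\<lambda>u. Poly_Mapping.single u 1) xs)"
  by (simp add: slice_list_flin[OF flin_fext])

lemma slice_list_cong:
  "(\<And>u. length u = n \<Longrightarrow> k u = k' u) \<Longrightarrow> length xs = Suc n \<Longrightarrow> n \<ge> 1 \<Longrightarrow> slice_list y k xs = slice_list y k' xs"
  by (elim length_ge_2E) (auto simp: slice_list_Cons)

lemma mlin_slice_list:
  assumes y: "y \<in> dual H" and k: "mlin n k" and n: "n \<ge> 1"
  shows "mlin (Suc n) (slice_list y k)"
proof (rule mlin_SucI)
  obtain m where m: "n = Suc m" using n by (cases n) auto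
  fix xs :: "'h list" assume "length xs = n"
  then obtain g r where xs: "xs = g # r" by (cases xs) (auto simp: m)
  show "hlin (\<lambda>f. slice_list y k (f # xs))"
    unfolding xs slice_list_Cons
    by (intro hlin_sw_fun) (simp add: hlin_def dualD[OF y] distrib_right scl_rules free.scale_left_distrib)
next
  obtain m where m: "n = Suc m" using n by (cases n) auto
  fix f
  show "mlin n (\<lambda>xs. slice_list y k (f # xs))"
    unfolding m
  proof (rule mlin_SucI)
    show "hlin (\<lambda>g. slice_list y k (f # g # ys))" for ys by (simp add: slice_list_Cons)
    show "mlin m (\<lambda>ys. slice_list y k (f # g # ys))" for g
      unfolding slice_list_Cons sw_def
      by (intro mlin_fext mlin_flin[OF flin_fscale] mlin_Cons k[unfolded m])
  qed
qed

text \<open>The first two factors \<open>f\<close>, \<open>g\<close> become \<open>f h1\<close> and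
  \<open>g h2\<close>, so the functional sees \<open>f h1 S(h2) S(g1)\<close>. The middle part
  cancels and the rest of \<open>h\<close> acts on the remaining factors: slicing commutes with the
  action of \<open>H\<close>.\<close>

lemma lact_slice_list:
  assumes y: "y \<in> dual H" and k: "mlin n k" and n: "n \<ge> 1" and xs: "length xs = Suc n"
  shows "lact (slice_list y k) xs h = slice_list y (\<lambda>u. lact k u h) xs"
proof -
  let ?S = "antipode H"
  obtain f g r where r: "xs = f # g # r" "length (g # r) = n" by (rule length_ge_2E[OF xs n])
  obtain m where m: "n = Suc m" "length r = m" using r(2) by auto
  have kb: "hlin (\<lambda>d. lact (\<lambda>u. k (b * d # u)) r e)" for b e
    by (rule hlin_lact_Cons[OF k[unfolded m] m(2)])
  have yl: "y (u * (v + v') * w) = y (u * v * w) + y (u * v' * w)" "y (u * scl H c v * w) = c * y (u * v * w)"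
    "y (u * (v + v')) = y (u * v) + y (u * v')" "y (u * scl H c v) = c * y (u * v)" for u v v' w c
    by (simp_all add: distrib_left distrib_right scl_rules dualD[OF y])
  have main: "sw (\<lambda>h1 h'. sw (\<lambda>h2 h3. sw (\<lambda>c d. fscale (y (f * h1 * (?S c * ?S a))) (lact (\<lambda>u. k (b * d # u)) r h3)) h2) h') h
      = fscale (y (f * ?S a)) (lact k (b # r) h)" for a b
  proof -
    let ?V = "\<lambda>e. lact k (b # r) e"
    have "sw (\<lambda>h2 h3. sw (\<lambda>c d. fscale (y (f * h1 * (?S c * ?S a))) (lact (\<lambda>u. k (b * d # u)) r h3)) h2) h'
        = sw (\<lambda>c e. fscale (y (f * h1 * (?S c * ?S a))) (?V e)) h'" for h1 h'
    proof -
      have "sw (\<lambda>h2 h3. sw (\<lambda>c d. fscale (y (f * h1 * (?S c * ?S a))) (lact (\<lambda>u. k (b * d # u)) r h3)) h2) h'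
        = sw (\<lambda>c e. sw (\<lambda>d h3. fscale (y (f * h1 * (?S c * ?S a))) (lact (\<lambda>u. k (b * d # u)) r h3)) e) h'"
      proof (rule sw_coassoc[of "\<lambda>c d h3. fscale (y (f * h1 * (?S c * ?S a))) (lact (\<lambda>u. k (b * d # u)) r h3)"])
        show "hlin (\<lambda>c. fscale (y (f * h1 * (?S c * ?S a))) (lact (\<lambda>u. k (b * d # u)) r h3))" for d h3
          by (simp add: hlin_def antipode_rules distrib_right scl_rules yl dualD[OF y] free.scale_left_distrib)
      qed (intro hlin_fscale hlin_lact kb)+
      then show ?thesis by (simp add: sw_scale_fun)
    qed
    then have "sw (\<lambda>h1 h'. sw (\<lambda>h2 h3. sw (\<lambda>c d. fscale (y (f * h1 * (?S c * ?S a))) (lact (\<lambda>u. k (b * d # u)) r h3)) h2) h') h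
      = sw (\<lambda>h1 h'. sw (\<lambda>c e. fscale (y (f * h1 * (?S c * ?S a))) (?V e)) h') h" by simp
    also have "\<dots> = sw (\<lambda>x e. sw (\<lambda>h1 c. fscale (y (f * h1 * (?S c * ?S a))) (?V e)) x) h"
    proof (rule sw_coassoc[symmetric, of "\<lambda>h1 c e. fscale (y (f * h1 * (?S c * ?S a))) (?V e)"])
      show "hlin (\<lambda>c. fscale (y (f * h1 * (?S c * ?S a))) (?V e))" for h1 e
        by (simp add: hlin_def antipode_rules distrib_right scl_rules yl dualD[OF y] free.scale_left_distrib del: lact.simps)
      show "hlin (\<lambda>h1. fscale (y (f * h1 * (?S c * ?S a))) (?V e))" for c e
        by (simp add: hlin_def yl free.scale_left_distrib del: lact.simps)
    qed (intro hlin_fscale hlin_lact)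
    also have "\<dots> = sw (\<lambda>x e. fscale (counit H x) (fscale (y (f * ?S a)) (?V e))) h"
    proof (intro sw_cong refl)
      fix x e
      have "hlin (\<lambda>z. fscale (y (f * z * ?S a)) (?V e))"
        by (simp add: hlin_def yl free.scale_left_distrib del: lact.simps)
      from sw_antipode(2)[OF this, of x]
      show "sw (\<lambda>h1 c. fscale (y (f * h1 * (?S c * ?S a))) (?V e)) x = fscale (counit H x) (fscale (y (f * ?S a)) (?V e))"
        by (simp add: mult.assoc del: lact.simps)
    qed
    also have "\<dots> = fscale (y (f * ?S a)) (?V h)"
      by (rule sw_counit(1)[OF hlin_fscale[OF hlin_lact]])
    finally show ?thesis .
  qed
  have bl: "blin (\<lambda>p q. fscale (y (z * ?S p)) (k (q # u)))" if "length u = m" for z u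
    unfolding blin_def
    by (intro conjI allI hlin_fscale mlin_hd[OF k[unfolded m(1)] that])
      (simp add: hlin_def antipode_rules yl free.scale_left_distrib)
  have "lact (slice_list y k) xs h
      = sw (\<lambda>h1 h'. sw (\<lambda>h2 h3. lact (\<lambda>u. sw (\<lambda>a b. sw (\<lambda>c d. fscale (y (f * h1 * (?S c * ?S a))) (k (b * d # u))) h2) g) r h3) h') h"
    unfolding r(1) lact.simps
  proof (intro sw_cong refl lact_cong_length)
    fix h1 h' h2 h3 u assume "length (u :: 'h list) = length r"
    then show "slice_list y k (f * h1 # g * h2 # u)
       = sw (\<lambda>a b. sw (\<lambda>c d. fscale (y (f * h1 * (?S c * ?S a))) (k (b * d # u))) h2) g"
      using sw_mult[OF bl[of u "f * h1"], of g h2] m(2) by (simp add: slice_list_Cons antipode_mult mult.assoc)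
  qed
  also have "\<dots> = sw (\<lambda>a b. sw (\<lambda>h1 h'. sw (\<lambda>h2 h3. sw (\<lambda>c d. fscale (y (f * h1 * (?S c * ?S a))) (lact (\<lambda>u. k (b * d # u)) r h3)) h2) h') h) g"
  proof -
    have 1: "lact (\<lambda>u. sw (\<lambda>a b. sw (\<lambda>c d. fscale (y (f * h1 * (?S c * ?S a))) (k (b * d # u))) h2) g) r h3
      = sw (\<lambda>a b. sw (\<lambda>c d. fscale (y (f * h1 * (?S c * ?S a))) (lact (\<lambda>u. k (b * d # u)) r h3)) h2) g" for h1 h2 h3
      by (simp add: lact_sw lact_flin[OF flin_fscale])
    have "sw (\<lambda>h1 h'. sw (\<lambda>h2 h3. sw (\<lambda>a b. K a b h1 h2 h3) g) h') h
        = sw (\<lambda>a b. sw (\<lambda>h1 h'. sw (\<lambda>h2 h3. K a b h1 h2 h3) h') h) g" for K :: "'h \<Rightarrow> 'h \<Rightarrow> 'h \<Rightarrow> 'h \<Rightarrow> 'h \<Rightarrow> ('a \<Rightarrow>\<^sub>0 'k)"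
    proof -
      have "sw (\<lambda>h1 h'. sw (\<lambda>h2 h3. sw (\<lambda>a b. K a b h1 h2 h3) g) h') h
          = sw (\<lambda>h1 h'. sw (\<lambda>a b. sw (\<lambda>h2 h3. K a b h1 h2 h3) h') g) h"
        by (intro sw_cong refl sw_swap)
      also have "\<dots> = sw (\<lambda>a b. sw (\<lambda>h1 h'. sw (\<lambda>h2 h3. K a b h1 h2 h3) h') h) g"
        by (rule sw_swap)
      finally show ?thesis .
    qed
    then show ?thesis unfolding 1 .
  qed
  also have "\<dots> = slice_list y (\<lambda>u. lact k u h) xs"
    unfolding main r(1) slice_list_Cons ..
  finally show ?thesis .
qed

lemma balanced_slice_list:
  assumes M: "left_module M" and y: "y \<in> dual H" and T: "balanced n M T" and n: "n \<ge> 1"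
  shows "balanced (Suc n) M (\<lambda>xs m. slice_list y (\<lambda>u. T u m) xs)"
  unfolding balanced_def
proof (intro conjI allI ballI impI)
  fix m assume m: "m \<in> carr M"
  have k: "mlin n (\<lambda>u. T u m)" using T m by (simp add: balanced_def)
  show "mlin (Suc n) (slice_list y (\<lambda>u. T u m))" by (rule mlin_slice_list[OF y k n])
  fix xs :: "'h list" assume xs: "length xs = Suc n"
  show "slice_list y (\<lambda>u. T u (m + m')) xs = slice_list y (\<lambda>u. T u m) xs + slice_list y (\<lambda>u. T u m') xs"
    if "m' \<in> carr M" for m'
  proof -
    have "slice_list y (\<lambda>u. T u (m + m')) xs = slice_list y (\<lambda>u. T u m + T u m') xs"
      by (rule slice_list_cong[OF _ xs n]) (use T m that in \<open>simp add: balanced_def\<close>)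
    then show ?thesis by (simp add: slice_list_def free.scale_right_distrib sw_add_fun)
  qed
  show "lact (slice_list y (\<lambda>u. T u m)) xs h = slice_list y (\<lambda>u. T u (act M h m)) xs" for h
    unfolding lact_slice_list[OF y k n xs]
    by (rule slice_list_cong[OF _ xs n]) (use T m in \<open>simp add: balanced_def\<close>)
qed

definition slice ::
  "nat \<Rightarrow> ('h, 'm::ab_group_add, 'z) hmodule_scheme \<Rightarrow> ('h \<Rightarrow> 'k) \<Rightarrow> ('k, 'h, 'm) pseudo \<Rightarrow> ('k, 'h, 'm) pseudo" where
  "slice n M y = pfun (\<lambda>xs m. slice_list y (\<lambda>u. ptn n M u m) xs)"

lemma flin_slice: "flin (slice n M y)"
  unfolding slice_def by (rule flin_pfun)

lemma slice_tens:
  assumes "left_module M" "y \<in> dual H" "n \<ge> 1" "length xs = Suc n" "m \<in> carr M"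
  shows "slice n M y (ptn (Suc n) M xs m) = slice_list y (\<lambda>u. ptn n M u m) xs"
  unfolding slice_def
  by (rule pfun_ptens[OF assms(1) balanced_slice_list[OF assms(1,2) balanced_ptens[OF assms(1)] assms(3)] assms(4,5)])

lemma slice_list_mem:
  "free.subspace V \<Longrightarrow> (\<And>u. length u = n \<Longrightarrow> k u \<in> V) \<Longrightarrow> length xs = Suc n \<Longrightarrow> n \<ge> 1 \<Longrightarrow> slice_list y k xs \<in> V"
  by (elim length_ge_2E) (auto simp: slice_list_Cons sw_def intro!: fext_mem free.subspace_scale)

lemma slice_pspan:
  assumes "left_module M" "N \<subseteq> carr M" "y \<in> dual H" "n \<ge> 1" "X \<in> pspan (Suc n) M N"
  shows "slice n M y X \<in> pspan n M N"
proof (rule pspan_memI[OF assms(1,2) flin_slice subspace_pspan _ assms(5)])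
  fix xs :: "'h list" and c assume xs: "length xs = Suc n" and c: "c \<in> N"
  then have "c \<in> carr M" using assms(2) by blast
  then show "slice n M y (ptn (Suc n) M xs c) \<in> pspan n M N"
    unfolding slice_tens[OF assms(1,3,4) xs \<open>c \<in> carr M\<close>]
    by (intro slice_list_mem[OF subspace_pspan _ xs assms(4)] pspan_base c) simp
qed

lemma slice_in:
  assumes "left_module M" "y \<in> dual H" "n \<ge> 1" "X \<in> pseudo H (Suc n) M"
  shows "slice n M y X \<in> pseudo H n M"
  using slice_pspan[OF assms(1) subset_refl assms(2,3)] assms(4) by (simp add: pseudo_eq_pspan[OF assms(1)])

lemma slice_push:
  assumes M: "left_module M" and N: "left_module N" and q: "module_hom_on M N q"
    and y: "y \<in> dual H" and n: "n \<ge> 1" and X: "X \<in> pseudo H (Suc n) M"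
  shows "slice n N y (push H (Suc n) N q X) = push H n N q (slice n M y X)"
proof (rule pseudo_eqI[OF M flin_comp[OF flin_slice flin_lmul(3)] flin_comp[OF flin_lmul(3) flin_slice] _ X])
  fix xs :: "'h list" and c assume xs: "length xs = Suc n" and c: "c \<in> carr M"
  have "push H n N q (slice_list y (\<lambda>u. ptn n M u c) xs) = slice_list y (\<lambda>u. ptn n N u (q c)) xs"
    unfolding slice_list_flin[OF flin_lmul(3)]
    by (rule slice_list_cong[OF _ xs n]) (simp add: push_ptens[OF M N q] c)
  then show "slice n N y (push H (Suc n) N q (ptn (Suc n) M xs c))
      = push H n N q (slice n M y (ptn (Suc n) M xs c))"
    using xs c module_hom_onD(1)[OF q c] by (simp add: push_ptens[OF M N q] slice_tens[OF M y n] slice_tens[OF N y n])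
qed

text \<open>A slice works on the first two factors, and \<open>X\<close> has at least two. So it can
  be taken before or after multiplying by \<open>Y\<close>.\<close>

lemma slice_pext:
  assumes A: "left_module A" and B: "left_module B" and C: "left_module C" and \<mu>: "hbilinear A B C \<mu>"
    and y: "y \<in> dual H" and n: "n \<ge> 1" and X: "X \<in> pseudo H (Suc n) A" and Y: "Y \<in> pseudo H m B"
  shows "slice (n + m) C y (pext H (Suc n) m C \<mu> X Y) = pext H n m C \<mu> (slice n A y X) Y"
proof (rule pseudo_eqI[OF A flin_comp[OF flin_slice flin_pext(1)] flin_comp[OF flin_pext(1) flin_slice] _ X])
  fix xs :: "'h list" and a assume xs: "length xs = Suc n" and a: "a \<in> carr A"
  show "slice (n + m) C y (pext H (Suc n) m C \<mu> (ptn (Suc n) A xs a) Y)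
      = pext H n m C \<mu> (slice n A y (ptn (Suc n) A xs a)) Y"
  proof (rule pseudo_eqI[OF B flin_comp[OF flin_slice flin_pext(2)] flin_pext(2) _ Y])
    fix gs :: "'h list" and b assume gs: "length gs = m" and b: "b \<in> carr B"
    let ?T = "\<lambda>w c. ptn (Suc n + m) C w c" and ?T' = "\<lambda>w c. ptn (n + m) C w c"
    have nm: "n + m \<ge> 1" using n by simp
    have bal: "balanced 2 C (twofold ?T xs gs)"
      by (rule balanced_twofold[OF C balanced_ptens[OF C] xs gs])
    have bal': "balanced 2 C (twofold ?T' us gs)" if "length us = n" for us
      by (rule balanced_twofold[OF C balanced_ptens[OF C] that gs])
    have lin: "flin (\<lambda>Z. slice_list y (\<lambda>u. pfun (twofold ?T' u gs) Z) xs)"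
      unfolding flin_def by (simp add: flinD(1,2)[OF flin_pfun] slice_list_def free.scale_right_distrib sw_add_fun
          sw_flin[OF flin_fscale] mult.commute)
    have key: "slice (n + m) C y (pfun (twofold ?T xs gs) Z) = slice_list y (\<lambda>u. pfun (twofold ?T' u gs) Z) xs"
      if Z: "Z \<in> pseudo H 2 C" for Z
    proof (rule pseudo_eqI[OF C flin_comp[OF flin_slice flin_pfun] lin _ Z])
      fix pq :: "'h list" and c assume l: "length pq = 2" and c: "c \<in> carr C"
      then obtain p q where pq: "pq = [p, q]" by (blast elim: length2E)
      have mT': "mlin (n + m) (\<lambda>w. ?T' w c)" by (rule mlin_ptens[OF C c])
      let ?k = "\<lambda>u. lact (\<lambda>v. ?T' (u @ v) c) gs q"
      have k: "mlin n ?k" by (rule mlin_lact_fun, rule mlin_append1[OF mT']) (simp add: gs)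
      have "slice (n + m) C y (pfun (twofold ?T xs gs) (ptn 2 C pq c))
          = lact (\<lambda>u. lact (\<lambda>v. slice (n + m) C y (?T (u @ v) c)) gs q) xs p"
        unfolding pfun_ptens[OF C bal l c] by (simp add: pq twofold_def lact_flin[OF flin_slice])
      also have "\<dots> = lact (slice_list y ?k) xs p"
      proof (intro lact_cong_length)
        fix u :: "'h list" assume "length u = length xs"
        then have u: "length u = Suc n" using xs by simp
        obtain f g r where r: "u = f # g # r" by (rule length_ge_2E[OF u n])
        have "lact (\<lambda>v. slice (n + m) C y (?T (u @ v) c)) gs q
            = lact (\<lambda>v. slice_list y (\<lambda>x. ?T' (x @ v) c) u) gs q"
        proof (rule lact_cong_length)
          fix v :: "'h list" assume "length v = length gs"
          then show "slice (n + m) C y (?T (u @ v) c) = slice_list y (\<lambda>x. ?T' (x @ v) c) u"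
            using slice_tens[OF C y nm _ c, of "u @ v"] u gs by (simp add: r slice_list_Cons)
        qed
        also have "\<dots> = slice_list y ?k u"
          unfolding slice_list_as_fext[of y "\<lambda>x. ?T' (x @ _) c"] slice_list_as_fext[of y ?k] by (rule lact_fext)
        finally show "lact (\<lambda>v. slice (n + m) C y (?T (u @ v) c)) gs q = slice_list y ?k u" .
      qed
      also have "\<dots> = slice_list y (\<lambda>u. lact ?k u p) xs" by (rule lact_slice_list[OF y k n xs])
      also have "\<dots> = slice_list y (\<lambda>u. pfun (twofold ?T' u gs) (ptn 2 C pq c)) xs"
        by (rule slice_list_cong[OF _ xs n]) (simp add: pfun_ptens[OF C bal' l c], simp add: twofold_def pq)
      finally show "slice (n + m) C y (pfun (twofold ?T xs gs) (ptn 2 C pq c))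
        = slice_list y (\<lambda>u. pfun (twofold ?T' u gs) (ptn 2 C pq c)) xs" .
    qed
    have "pext H n m C \<mu> (slice n A y (ptn (Suc n) A xs a)) (ptn m B gs b)
        = slice_list y (\<lambda>u. pfun (twofold ?T' u gs) (\<mu> a b)) xs"
      unfolding slice_tens[OF A y n xs a] slice_list_flin[OF flin_pext(1)]
      by (rule slice_list_cong[OF _ xs n]) (rule pext_tens[OF A B C \<mu> _ gs a b])
    then show "slice (n + m) C y (pext H (Suc n) m C \<mu> (ptn (Suc n) A xs a) (ptn m B gs b))
        = pext H n m C \<mu> (slice n A y (ptn (Suc n) A xs a)) (ptn m B gs b)"
      unfolding pext_tens[OF A B C \<mu> xs gs a b] by (simp only: key[OF hbilinearD(1)[OF \<mu> a b]])
  qed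
qed

text \<open>The inverse operation puts \<open>b\<close> into a new first factor.\<close>

definition insert_list :: "'h \<Rightarrow> ('h list \<Rightarrow> ('x \<Rightarrow>\<^sub>0 'k)) \<Rightarrow> 'h list \<Rightarrow> ('x \<Rightarrow>\<^sub>0 'k)" where
  "insert_list b k xs = sw (\<lambda>a c. k (b * a # c # tl xs)) (hd xs)"

lemma insert_list_cong:
  "(\<And>u. length u = Suc n \<Longrightarrow> k u = k' u) \<Longrightarrow> length xs = n \<Longrightarrow> n \<ge> 1 \<Longrightarrow> insert_list y k xs = insert_list y k' xs"
  by (cases xs) (auto simp: insert_list_def)

lemma balanced_insert_list:
  assumes M: "left_module M" and T: "balanced (Suc n) M T" and n: "n \<ge> 1"
  shows "balanced n M (\<lambda>xs m. insert_list b (\<lambda>u. T u m) xs)"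
  unfolding balanced_def
proof (intro conjI allI ballI impI)
  obtain n' where n': "n = Suc n'" using n by (cases n) auto
  fix m assume m: "m \<in> carr M"
  have k: "mlin (Suc n) (\<lambda>u. T u m)" using T m by (simp add: balanced_def)
  show "mlin n (insert_list b (\<lambda>u. T u m))"
    unfolding n'
  proof (rule mlin_SucI)
    show "hlin (\<lambda>a. insert_list b (\<lambda>u. T u m) (a # ys))" for ys by (simp add: insert_list_def)
    show "mlin n' (\<lambda>xs. insert_list b (\<lambda>u. T u m) (a # xs))" for a
      unfolding insert_list_def sw_def by (simp, intro mlin_fext mlin_Cons k[unfolded n'])
  qed
  fix xs :: "'h list" assume xs: "length xs = n"
  then obtain x r where r: "xs = x # r" "length r = n'" by (cases xs) (auto simp: n')
  show "insert_list b (\<lambda>u. T u (m + m')) xs = insert_list b (\<lambda>u. T u m) xs + insert_list b (\<lambda>u. T u m') xs"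
    if "m' \<in> carr M" for m'
  proof -
    have "insert_list b (\<lambda>u. T u (m + m')) xs = insert_list b (\<lambda>u. T u m + T u m') xs"
      by (rule insert_list_cong[OF _ xs n]) (use T m that in \<open>simp add: balanced_def\<close>)
    then show ?thesis by (simp add: insert_list_def sw_add_fun)
  qed
  fix h
  have h1: "hlin (\<lambda>a. T (b * a # c # u) m)" if "length u = n'" for c u
    by (rule hlin_mult(1)[OF mlin_hd[OF k]]) (simp add: that n')
  have h2: "hlin (\<lambda>c. T (b * a # c # u) m)" if "length u = n'" for a u
    using mlin_hd[OF mlin_Cons[OF k[unfolded n']] that, of "b * a"] by simp
  have "lact (insert_list b (\<lambda>u. T u m)) xs h
      = sw (\<lambda>h1 h2. lact (\<lambda>u. sw (\<lambda>a c. sw (\<lambda>a' c'. T (b * (a * a') # c * c' # u) m) h1) x) r h2) h"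
    unfolding r(1) lact.simps
  proof (intro sw_cong refl lact_cong_length)
    fix h1 h2 u assume u: "length (u :: 'h list) = length r"
    have "blin (\<lambda>a c. T (b * a # c # u) m)" unfolding blin_def using h1 h2 u r(2) by simp
    from sw_mult[OF this, of x h1]
    show "insert_list b (\<lambda>u. T u m) (x * h1 # u) = sw (\<lambda>a c. sw (\<lambda>a' c'. T (b * (a * a') # c * c' # u) m) h1) x"
      by (simp add: insert_list_def)
  qed
  also have "\<dots> = sw (\<lambda>a c. sw (\<lambda>h1 h2. sw (\<lambda>a' c'. lact (\<lambda>u. T (b * (a * a') # c * c' # u) m) r h2) h1) h) x"
    by (simp add: lact_sw) (rule sw_swap)
  also have "\<dots> = sw (\<lambda>a c. lact (\<lambda>u. T u m) (b * a # c # r) h) x"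
  proof (intro sw_cong refl)
    fix a c
    have "sw (\<lambda>h1 h2. sw (\<lambda>a' c'. lact (\<lambda>u. T (b * (a * a') # c * c' # u) m) r h2) h1) h
        = sw (\<lambda>a' h1. sw (\<lambda>c' h2. lact (\<lambda>u. T (b * (a * a') # c * c' # u) m) r h2) h1) h"
    proof (rule sw_coassoc[of "\<lambda>a' c' h2. lact (\<lambda>u. T (b * (a * a') # c * c' # u) m) r h2"])
      show "hlin (\<lambda>c'. lact (\<lambda>u. T (b * (a * a') # c * c' # u) m) r h2)" for a' h2
        by (rule hlin_lact_fun, rule hlin_mult(1)[OF h2]) (simp add: r(2))
      show "hlin (\<lambda>a'. lact (\<lambda>u. T (b * (a * a') # c * c' # u) m) r h2)" for c' h2
        by (rule hlin_lact_fun, rule hlin_mult(1)[OF h1]) (simp add: r(2))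
    qed (rule hlin_lact)
    then show "sw (\<lambda>h1 h2. sw (\<lambda>a' c'. lact (\<lambda>u. T (b * (a * a') # c * c' # u) m) r h2) h1) h
        = lact (\<lambda>u. T u m) (b * a # c # r) h" by (simp add: mult.assoc)
  qed
  also have "\<dots> = insert_list b (\<lambda>u. lact (\<lambda>u. T u m) u h) xs" by (simp add: insert_list_def r(1))
  also have "\<dots> = insert_list b (\<lambda>u. T u (act M h m)) xs"
    by (rule insert_list_cong[OF _ xs n]) (use T m in \<open>simp add: balanced_def\<close>)
  finally show "lact (insert_list b (\<lambda>u. T u m)) xs h = insert_list b (\<lambda>u. T u (act M h m)) xs" .
qed

definition pinsert ::
  "nat \<Rightarrow> ('h, 'm::ab_group_add, 'z) hmodule_scheme \<Rightarrow> 'h \<Rightarrow> ('k, 'h, 'm) pseudo \<Rightarrow> ('k, 'h, 'm) pseudo" where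
  "pinsert n M b = pfun (\<lambda>xs m. insert_list b (\<lambda>u. ptn (Suc n) M u m) xs)"

lemma flin_pinsert: "flin (pinsert n M b)"
  unfolding pinsert_def by (rule flin_pfun)

lemma pinsert_tens:
  assumes "left_module M" "n \<ge> 1" "length xs = n" "m \<in> carr M"
  shows "pinsert n M b (ptn n M xs m) = insert_list b (\<lambda>u. ptn (Suc n) M u m) xs"
  unfolding pinsert_def
  by (rule pfun_ptens[OF assms(1) balanced_insert_list[OF assms(1) balanced_ptens[OF assms(1)] assms(2)] assms(3,4)])

lemma pinsert_pspan:
  assumes "left_module M" "N \<subseteq> carr M" "n \<ge> 1" "X \<in> pspan n M N"
  shows "pinsert n M b X \<in> pspan (Suc n) M N"
proof (rule pspan_memI[OF assms(1,2) flin_pinsert subspace_pspan _ assms(4)])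
  fix xs :: "'h list" and c assume xs: "length xs = n" and c: "c \<in> N"
  then have "c \<in> carr M" using assms(2) by blast
  then show "pinsert n M b (ptn n M xs c) \<in> pspan (Suc n) M N"
    unfolding pinsert_tens[OF assms(1,3) xs \<open>c \<in> carr M\<close>] insert_list_def sw_def
    using xs c assms(3) by (intro fext_mem subspace_pspan pspan_base) auto
qed

end

section \<open>Coefficients\<close>

text \<open>The rank of a tensor is written as a numeral, so \<open>1\<close> must not be rewritten to \<open>Suc 0\<close>.\<close>

declare One_nat_def [simp del] One_nat_def [symmetric, simp]

locale cocommutative_hopf_basis = cocommutative_hopf H for H :: "('k::field, 'h::ring_1) hopf" +
  fixes B :: "'h set"
  assumes basis: "is_basis H B"
begin

lemma vector_space_scl: "vector_space (scl H)"
  using cocommutative by (simp add: cocommutative_hopf_algebra_def)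

definition coord :: "'h \<Rightarrow> 'h \<Rightarrow> 'k" where
  "coord b z = module.representation (scl H) B z b"

lemma coord_props:
  shows "coord b \<in> dual H" "finite {b. coord b z \<noteq> 0}" "{b. coord b z \<noteq> 0} \<subseteq> B"
    "(\<Sum>b | coord b z \<noteq> 0. scl H (coord b z) b) = z"
    "b \<in> B \<Longrightarrow> coord c b = (if c = b then 1 else 0)"
proof -
  interpret vector_space "scl H" by (rule vector_space_scl)
  have ind: "independent B" and span: "span B = UNIV"
    using basis by (auto simp: is_basis_def)
  show "finite {b. coord b z \<noteq> 0}" unfolding coord_def by (rule finite_representation)
  show "{b. coord b z \<noteq> 0} \<subseteq> B" unfolding coord_def using representation_ne_zero by blast
  show "(\<Sum>b | coord b z \<noteq> 0. scl H (coord b z) b) = z"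
    unfolding coord_def using sum_nonzero_representation_eq[OF ind, of z] span by simp
  show "coord c b = (if c = b then 1 else 0)" if "b \<in> B"
    unfolding coord_def using representation_basis[OF ind that] by auto
  have vk: "vector_space ((*) :: 'k \<Rightarrow> 'k \<Rightarrow> 'k)" by unfold_locales (simp_all add: algebra_simps)
  show "coord b \<in> dual H"
    unfolding dual_def coord_def using vector_space_scl vk span
    by (simp add: Vector_Spaces.linear_iff representation_add[OF ind] representation_scale[OF ind])
qed

lemma hlin_coord_sum:
  assumes "hlin f" "finite C" "\<And>b. coord b z \<noteq> 0 \<Longrightarrow> b \<in> C"
  shows "(\<Sum>b\<in>C. fscale (coord b z) (f b)) = f z"
proof -
  have s: "f (\<Sum>b\<in>A. scl H (c b) b) = (\<Sum>b\<in>A. fscale (c b) (f b))" for A c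
    by (induction A rule: infinite_finite_induct) (auto simp: hlinD[OF assms(1)])
  have "(\<Sum>b\<in>C. fscale (coord b z) (f b)) = (\<Sum>b | coord b z \<noteq> 0. fscale (coord b z) (f b))"
    by (rule sum.mono_neutral_right) (use assms(2,3) in auto)
  then show ?thesis using s coord_props(4)[of z] by metis
qed

text \<open>The finite set \<open>C\<close> is carried along explicitly so that two expansions can
  be added after both sets have been enlarged by \<open>expand_superset\<close>.\<close>

definition expandable :: "nat \<Rightarrow> ('h, 'm::ab_group_add, 'z) hmodule_scheme \<Rightarrow> 'h set \<Rightarrow> ('k, 'h, 'm) pseudo \<Rightarrow> bool" where
  "expandable n M C X \<longleftrightarrow> finite C \<and> C \<subseteq> B \<and> (\<forall>b. b \<notin> C \<longrightarrow> slice n M (coord b) X = 0) \<and>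
     X = (\<Sum>b\<in>C. pinsert n M b (slice n M (coord b) X))"

lemma expand_superset:
  assumes "expandable n M C X" "C \<subseteq> C'" "finite C'" "C' \<subseteq> B"
  shows "expandable n M C' X"
proof -
  have "(\<Sum>b\<in>C'. pinsert n M b (slice n M (coord b) X)) = (\<Sum>b\<in>C. pinsert n M b (slice n M (coord b) X))"
    by (rule sum.mono_neutral_right) (use assms in \<open>auto simp: expandable_def flinD(3)[OF flin_pinsert]\<close>)
  then show ?thesis using assms by (auto simp: expandable_def)
qed

text \<open>For a pure tensor with first two factors \<open>f\<close>, \<open>g\<close>, summing
  over coordinates and inserting the slices back produces \<open>f S(g1) g2\<close> in the first
  factor, which the antipode axiom collapses to \<open>f\<close>.\<close>

lemma expand:
  assumes M: "left_module M" and n: "n \<ge> 1" and X: "X \<in> pseudo H (Suc n) M"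
  shows "\<exists>C. expandable n M C X"
proof -
  have "X \<in> free.span {ptn (Suc n) M xs c | xs c. length xs = Suc n \<and> c \<in> carr M}"
    using X by (simp add: pseudo_eq_pspan[OF M] pspan_tens[OF M])
  then show ?thesis
  proof (rule free.span_induct)
    show "free.subspace {X. \<exists>C. expandable n M C X}"
    proof (rule free.subspaceI)
      show "0 \<in> {X. \<exists>C. expandable n M C X}"
        by (auto simp: expandable_def flinD(3)[OF flin_slice] intro!: exI[of _ "{}"])
    next
      fix x y assume "x \<in> {X. \<exists>C. expandable n M C X}" "y \<in> {X. \<exists>C. expandable n M C X}"
      then obtain C D where CD: "expandable n M C x" "expandable n M D y" by blast
      then have f: "finite (C \<union> D)" "C \<union> D \<subseteq> B" by (auto simp: expandable_def)
      have "expandable n M (C \<union> D) x" "expandable n M (C \<union> D) y"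
        using CD f by (auto intro: expand_superset)
      then have "expandable n M (C \<union> D) (x + y)"
        unfolding expandable_def by (auto simp: flinD(1)[OF flin_slice] flinD(1)[OF flin_pinsert] sum.distrib)
      then show "x + y \<in> {X. \<exists>C. expandable n M C X}" by blast
    next
      fix c x assume "x \<in> {X. \<exists>C. expandable n M C X}"
      then obtain C where C: "expandable n M C x" by blast
      then have "expandable n M C (fscale c x)"
        unfolding expandable_def
        by (auto simp: flinD(2)[OF flin_slice] flinD(2)[OF flin_pinsert] free.scale_sum_right[symmetric])
      then show "fscale c x \<in> {X. \<exists>C. expandable n M C X}" by blast
    qed
  next
    fix X assume "X \<in> {ptn (Suc n) M xs c | xs c. length xs = Suc n \<and> c \<in> carr M}"
    then obtain xs c where X: "X = ptn (Suc n) M xs c" and xs: "length xs = Suc n" and c: "c \<in> carr M"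
      by blast
    obtain f g r where r: "xs = f # g # r" "length (g # r) = n" by (rule length_ge_2E[OF xs n])
    let ?S = "antipode H" and ?k = "\<lambda>u. ptn n M u c" and ?K = "\<lambda>u. ptn (Suc n) M u c"
    have K: "mlin (Suc n) ?K" by (rule mlin_ptens[OF M c])
    have sl: "slice n M y X = sw (\<lambda>a b. fscale (y (f * ?S a)) (?k (b # r))) g" if "y \<in> dual H" for y
      using slice_tens[OF M that n xs c] by (simp add: X r(1) slice_list_Cons)
    \<comment> \<open>The finitely many elements of \<open>H\<close> whose coordinates enter the
      slices; they come from the lists in the representative of the coproduct of
      \<open>g\<close>.\<close>
    define A where "A = (\<lambda>xs. f * ?S (xs ! 0)) ` Poly_Mapping.keys (comult H g)"
    define C where "C = (\<Union>z\<in>A. {b. coord b z \<noteq> 0})"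
    have fin: "finite C" by (simp add: C_def A_def coord_props(2))
    have CB: "C \<subseteq> B" using coord_props(3) by (auto simp: C_def)
    have out: "slice n M (coord b) X = 0" if "b \<notin> C" for b
    proof -
      have "slice n M (coord b) X = fext (\<lambda>xs. 0) (comult H g)"
        unfolding sl[OF coord_props(1)] sw_def
        by (rule fext_cong) (use that in \<open>auto simp: C_def A_def\<close>)
      then show ?thesis by simp
    qed
    have ins: "pinsert n M b (slice n M (coord b) X)
        = fext (\<lambda>xs. fscale (coord b (f * ?S (xs ! 0))) (insert_list b ?K (xs ! 1 # r))) (comult H g)" for b
    proof -
      have "pinsert n M b (?k (xs ! 1 # r)) = insert_list b ?K (xs ! 1 # r)" for xs :: "'h list"
        using r(2) by (intro pinsert_tens[OF M n _ c]) simp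
      then show ?thesis
        unfolding sl[OF coord_props(1)] sw_def flin_fext_comm[OF flin_pinsert] flinD(2)[OF flin_pinsert] by simp
    qed
    have hl: "hlin (\<lambda>b. insert_list b ?K (x # r))" for x
      unfolding insert_list_def
    proof (rule hlin_sw_fun)
      fix a e show "hlin (\<lambda>b. ?K (b * a # e # tl (x # r)))"
        by (rule hlin_mult(2)[OF mlin_hd[OF K]]) (use r(2) in simp)
    qed
    have "(\<Sum>b\<in>C. pinsert n M b (slice n M (coord b) X))
        = fext (\<lambda>xs. \<Sum>b\<in>C. fscale (coord b (f * ?S (xs ! 0))) (insert_list b ?K (xs ! 1 # r))) (comult H g)"
      unfolding ins by (simp add: lin_ext_def free.scale_sum_right sum.swap[of _ C])
    also have "\<dots> = fext (\<lambda>xs. insert_list (f * ?S (xs ! 0)) ?K (xs ! 1 # r)) (comult H g)"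
      by (rule fext_cong, rule hlin_coord_sum[OF hl fin]) (auto simp: C_def A_def)
    also have "\<dots> = sw (\<lambda>a e. sw (\<lambda>p q. ?K (f * ?S a * p # q # r)) e) g"
      by (simp add: sw_def insert_list_def)
    also have "\<dots> = sw (\<lambda>e q. sw (\<lambda>a p. ?K (f * ?S a * p # q # r)) e) g"
    proof (rule sw_coassoc[symmetric, of "\<lambda>a p q. ?K (f * ?S a * p # q # r)"])
      obtain n' where n': "n = Suc n'" "length r = n'" using r(2) by auto
      have h1: "hlin (\<lambda>z. ?K (z # q # r))" for q by (rule mlin_hd[OF K]) (use r(2) in simp)
      show "hlin (\<lambda>p. ?K (f * ?S a * p # q # r))" for a q by (rule hlin_mult(1)[OF h1])
      show "hlin (\<lambda>a. ?K (f * ?S a * p # q # r))" for p q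
        using hlin_antipode[OF hlin_mult(1)[OF hlin_mult(2)[OF h1, of p], of f]] by simp
      show "hlin (\<lambda>q. ?K (f * ?S a * p # q # r))" for a p
        using mlin_hd[OF mlin_Cons[OF K[unfolded n'(1)]] n'(2)] n' by simp
    qed
    also have "\<dots> = sw (\<lambda>e q. fscale (counit H e) (?K (f # q # r))) g"
    proof (intro sw_cong refl)
      fix e q
      have h1: "hlin (\<lambda>z. ?K (f * z # q # r))" by (rule hlin_mult(1)[OF mlin_hd[OF K]]) (use r(2) in simp)
      from sw_antipode(1)[OF this, of e]
      show "sw (\<lambda>a p. ?K (f * ?S a * p # q # r)) e = fscale (counit H e) (?K (f # q # r))"
        by (simp add: mult.assoc)
    qed
    also have "\<dots> = X"
    proof -
      obtain n' where n': "n = Suc n'" "length r = n'" using r(2) by auto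
      show ?thesis unfolding X r(1)
        by (rule sw_counit(1)) (use mlin_hd[OF mlin_Cons[OF K[unfolded n'(1)]] n'(2)] n' in simp)
    qed
    finally have "X = (\<Sum>b\<in>C. pinsert n M b (slice n M (coord b) X))" ..
    then show "\<exists>C. expandable n M C X" using fin CB out unfolding expandable_def by blast
  qed
qed

text \<open>An element is put together from its slices by \<open>pinsert\<close>, which preserves
  \<open>pspan\<close>; membership can therefore be tested on slices.\<close>

lemma pspan_from_slices:
  assumes "left_module M" "N \<subseteq> carr M" "n \<ge> 1" "X \<in> pseudo H (Suc n) M"
    "\<And>y. y \<in> dual H \<Longrightarrow> slice n M y X \<in> pspan n M N"
  shows "X \<in> pspan (Suc n) M N"
proof -
  obtain C where C: "expandable n M C X" using expand[OF assms(1,3,4)] by blast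
  have "(\<Sum>b\<in>C. pinsert n M b (slice n M (coord b) X)) \<in> pspan (Suc n) M N"
    by (intro free.subspace_sum[OF subspace_pspan] pinsert_pspan[OF assms(1-3)] assms(5) coord_props(1))
  then show ?thesis using C by (simp add: expandable_def)
qed

end

context cocommutative_hopf
begin

subsection \<open>The identification of \<open>M\<close> with \<open>pseudo H 1 M\<close>\<close>

definition tens1_val :: "('k, 'h) tensor \<Rightarrow> 'h" where
  "tens1_val = lin_ext (scl H) (\<lambda>xs. xs ! 0)"

text \<open>Values in \<open>M\<close> are not formal combinations, so the universal properties
  above do not apply. The inverse of \<open>emb\<close> is written down on formal sums, and its
  vanishing on the relators is checked separately in \<open>unemb_rels\<close>.\<close>

definition unemb :: "('h, 'm::ab_group_add, 'z) hmodule_scheme \<Rightarrow> ('k, 'h, 'm) pseudo \<Rightarrow> 'm" where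
  "unemb M = lin_ext (\<lambda>c m. act M (scl H c 1) m) (\<lambda>(F, m). act M (tens1_val F) m)"

lemma tens_tens1_val: "F \<in> tensor_power H 1 \<Longrightarrow> F = tens H [tens1_val F]"
proof -
  assume F: "F \<in> tensor_power H 1"
  have "tens H [tens1_val F] = fext (\<lambda>xs. tens H [xs ! 0]) F"
    unfolding tens1_val_def by (rule hlin_lin_ext[OF hlin_tens1])
  also have "\<dots> = fext (tens H) F"
  proof (rule fext_cong)
    fix x assume "x \<in> Poly_Mapping.keys F"
    then have "length x = 1" by (rule keys_tensor_power[OF F])
    then show "tens H [x ! 0] = tens H x" by (cases x) auto
  qed
  also have "\<dots> = F" by (rule fext_tens_id[OF F])
  finally show ?thesis by simp
qed

lemma tens1_val_tens: "tens1_val (tens H [f]) = f"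
  using tens_tens1_val[of "tens H [f]"] by (intro tens1_inj) simp

lemma iter_comult_1: "iter_comult H 1 h = tens H [h]"
  by (simp add: One_nat_def del: One_nat_def[symmetric])

lemma tens1_val_rules:
  assumes F: "F \<in> tensor_power H 1"
  shows "G \<in> tensor_power H 1 \<Longrightarrow> tens1_val (F + G) = tens1_val F + tens1_val G"
    "tens1_val (fscale c F) = scl H c (tens1_val F)"
    "tens1_val (tmul H F (iter_comult H 1 h)) = tens1_val F * h"
proof -
  obtain f where f: "F = tens H [f]" using tens_tens1_val[OF F] by blast
  show "tens1_val (F + G) = tens1_val F + tens1_val G" if G: "G \<in> tensor_power H 1"
  proof -
    obtain g where g: "G = tens H [g]" using tens_tens1_val[OF G] by blast
    show ?thesis unfolding f g hlinD(1)[OF hlin_tens1, symmetric] by (simp add: tens1_val_tens)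
  qed
  show "tens1_val (fscale c F) = scl H c (tens1_val F)"
    unfolding f hlinD(2)[OF hlin_tens1, symmetric] by (simp add: tens1_val_tens)
  show "tens1_val (tmul H F (iter_comult H 1 h)) = tens1_val F * h"
    unfolding f by (simp add: tmul_tens tens1_val_tens iter_comult_1)
qed

lemma unemb_formal:
  assumes M: "left_module M"
  shows "X \<in> formal (pseudo_gens H 1 M) \<Longrightarrow> unemb M X \<in> carr M"
    "X \<in> formal (pseudo_gens H 1 M) \<Longrightarrow> Y \<in> formal (pseudo_gens H 1 M) \<Longrightarrow> unemb M (X + Y) = unemb M X + unemb M Y"
    "X \<in> formal (pseudo_gens H 1 M) \<Longrightarrow> unemb M (fscale c X) = act M (scl H c 1) (unemb M X)"
    "(F, m) \<in> pseudo_gens H 1 M \<Longrightarrow> unemb M (Poly_Mapping.single (F, m) 1) = act M (tens1_val F) m"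
proof -
  let ?s = "\<lambda>c m. act M (scl H c 1) m" and ?g = "\<lambda>(F, m). act M (tens1_val F) m"
  have g: "?g p \<in> carr M" if "p \<in> pseudo_gens H 1 M" for p
    using that by (auto simp: pseudo_gens_def intro: left_moduleD(5)[OF M])
  have s0: "?s 0 m = 0" if "m \<in> carr M" for m
    using left_moduleD(7)[OF M that, of 0 0] by simp
  have sum_in: "(\<Sum>p\<in>K. ?s (c p) (?g p)) \<in> carr M" if "K \<subseteq> pseudo_gens H 1 M" for K c
    using that
  proof (induction K rule: infinite_finite_induct)
    case (insert p K)
    then show ?case using left_moduleD(3)[OF M left_moduleD(5)[OF M g[of p]]] by simp
  qed (simp_all add: left_moduleD(1)[OF M])
  have K: "unemb M X = (\<Sum>p\<in>K. ?s (Poly_Mapping.lookup X p) (?g p))"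
    if "finite K" "Poly_Mapping.keys X \<subseteq> K" "K \<subseteq> pseudo_gens H 1 M" for K X
    unfolding unemb_def lin_ext_def
    using that s0 g by (intro sum.mono_neutral_left) (auto simp: in_keys_iff)
  have keys: "Poly_Mapping.keys X \<subseteq> pseudo_gens H 1 M" if "X \<in> formal (pseudo_gens H 1 M)" for X :: "('k, 'h, 'a) pseudo"
    using that by (simp add: formal_def)
  show "unemb M X \<in> carr M" if "X \<in> formal (pseudo_gens H 1 M)"
    using sum_in[OF keys[OF that]] K[OF finite_keys subset_refl keys[OF that]] by simp
  show "unemb M (X + Y) = unemb M X + unemb M Y"
    if "X \<in> formal (pseudo_gens H 1 M)" "Y \<in> formal (pseudo_gens H 1 M)"
  proof -
    let ?K = "Poly_Mapping.keys X \<union> Poly_Mapping.keys Y"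
    have k: "finite ?K" "?K \<subseteq> pseudo_gens H 1 M" "Poly_Mapping.keys (X + Y) \<subseteq> ?K"
      using keys that keys_add[of X Y] by auto
    have "?s (a + b) (?g p) = ?s a (?g p) + ?s b (?g p)" if "p \<in> ?K" for a b p
    proof -
      have "p \<in> pseudo_gens H 1 M" using that k(2) by blast
      from left_moduleD(7)[OF M g[OF this]] show ?thesis by (simp add: scl_rules)
    qed
    then show ?thesis
      using k by (simp add: K[of ?K] lookup_add sum.distrib)
  qed
  show "unemb M (fscale c X) = act M (scl H c 1) (unemb M X)" if X: "X \<in> formal (pseudo_gens H 1 M)"
  proof -
    let ?K = "Poly_Mapping.keys X"
    have k: "finite ?K" "?K \<subseteq> pseudo_gens H 1 M" "Poly_Mapping.keys (fscale c X) \<subseteq> ?K"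
      using keys[OF X] by (auto simp: in_keys_iff lookup_fscale)
    have "?s (c * a) (?g p) = ?s c (?s a (?g p))" if "p \<in> ?K" for a p
    proof -
      have "p \<in> pseudo_gens H 1 M" using that k(2) by blast
      from left_moduleD(8)[OF M g[OF this], of "scl H c 1" "scl H a 1"] show ?thesis by (simp add: scl_rules mult.commute)
    qed
    then have "unemb M (fscale c X) = (\<Sum>p\<in>?K. ?s c (?s (Poly_Mapping.lookup X p) (?g p)))"
      using k by (simp add: K[of ?K] lookup_fscale)
    also have "\<dots> = ?s c (\<Sum>p\<in>?K. ?s (Poly_Mapping.lookup X p) (?g p))"
    proof -
      have "(\<Sum>p\<in>L. ?s c (?s (Poly_Mapping.lookup X p) (?g p))) = ?s c (\<Sum>p\<in>L. ?s (Poly_Mapping.lookup X p) (?g p))"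
        if "L \<subseteq> ?K" for L
        using that
      proof (induction L rule: infinite_finite_induct)
        case (insert p L)
        have "?s (Poly_Mapping.lookup X p) (?g p) \<in> carr M"
          using insert.prems k(2) by (intro left_moduleD(5)[OF M] g) auto
        moreover have "(\<Sum>p\<in>L. ?s (Poly_Mapping.lookup X p) (?g p)) \<in> carr M"
          using insert.prems k(2) by (intro sum_in) auto
        ultimately show ?case using insert by (simp add: left_moduleD(6)[OF M])
      qed (simp_all add: left_moduleD(10)[OF M])
      then show ?thesis by blast
    qed
    also have "\<dots> = act M (scl H c 1) (unemb M X)" using K[OF k(1) subset_refl k(2)] by simp
    finally show ?thesis .
  qed
  show "unemb M (Poly_Mapping.single (F, m) 1) = act M (tens1_val F) m" if "(F, m) \<in> pseudo_gens H 1 M"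
    using left_moduleD(9)[OF M g[OF that]] scl_rules(4)[of 1] by (simp add: unemb_def lin_ext_def)
qed

lemma unemb_rels:
  assumes M: "left_module M" and X: "X \<in> pseudo_rels H 1 M"
  shows "unemb M X = 0"
proof -
  note u = unemb_formal[OF M]
  note rels = pseudo_rels_facts(2)[OF M, of 1]
  have d: "unemb M (X - Y) = unemb M X - unemb M Y"
    if "X \<in> formal (pseudo_gens H 1 M)" "Y \<in> formal (pseudo_gens H 1 M)" for X Y
    using u(2)[OF formal_diff[OF that] that(2)] by simp
  have t: "F + G \<in> tensor_power H 1" "fscale c F \<in> tensor_power H 1"
    if "F \<in> tensor_power H 1" "G \<in> tensor_power H 1" for F G c
    using that free.subspace_add[OF subspace_tensor_power] free.subspace_scale[OF subspace_tensor_power] by auto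
  have gen: "(F, m) \<in> pseudo_gens H 1 M" if "F \<in> tensor_power H 1" "m \<in> carr M" for F m
    using that by (simp add: pseudo_gens_def)
  note mD = left_moduleD(3,5)[OF M]
  have "unemb M X = 0 \<and> X \<in> formal (pseudo_gens H 1 M)"
    using X unfolding pseudo_rels_def
  proof (rule free.span_induct)
    show "free.subspace {X. unemb M X = 0 \<and> X \<in> formal (pseudo_gens H 1 M)}"
      by (rule free.subspaceI)
        (auto simp: u(2,3) left_moduleD(10)[OF M] free.subspace_0[OF subspace_formal]
          free.subspace_add[OF subspace_formal] formal_scale, simp add: unemb_def lin_ext_def)
  next
    fix X assume "X \<in> {Poly_Mapping.single (F + G, a) 1 - Poly_Mapping.single (F, a) 1 - Poly_Mapping.single (G, a) 1
        | F G a. F \<in> tensor_power H 1 \<and> G \<in> tensor_power H 1 \<and> a \<in> carr M} \<union>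
     {Poly_Mapping.single (F, a + b) 1 - Poly_Mapping.single (F, a) 1 - Poly_Mapping.single (F, b) 1
        | F a b. F \<in> tensor_power H 1 \<and> a \<in> carr M \<and> b \<in> carr M} \<union>
     {Poly_Mapping.single (fscale c F, a) 1 - fscale c (Poly_Mapping.single (F, a) 1)
        | c F a. F \<in> tensor_power H 1 \<and> a \<in> carr M} \<union>
     {Poly_Mapping.single (tmul H F (iter_comult H 1 h), a) 1 - Poly_Mapping.single (F, act M h a) 1
        | F h a. F \<in> tensor_power H 1 \<and> a \<in> carr M}"
    then show "unemb M X = 0 \<and> X \<in> formal (pseudo_gens H 1 M)"
    proof (elim UnE CollectE exE conjE)
      fix F G a assume "X = Poly_Mapping.single (F + G, a) 1 - Poly_Mapping.single (F, a) 1 - Poly_Mapping.single (G, a) 1"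
        and h: "F \<in> tensor_power H 1" "G \<in> tensor_power H 1" "a \<in> carr M"
      then show ?thesis
        using gen[OF t(1)[OF h(1,2)] h(3)] gen[OF h(1,3)] gen[OF h(2,3)] left_moduleD(7)[OF M h(3)]
        by (simp add: d u(4) formal_diff tens1_val_rules(1))
    next
      fix F a b assume "X = Poly_Mapping.single (F, a + b) 1 - Poly_Mapping.single (F, a) 1 - Poly_Mapping.single (F, b) 1"
        and h: "F \<in> tensor_power H 1" "a \<in> carr M" "b \<in> carr M"
      then show ?thesis
        using gen[OF h(1) mD(1)[OF h(2,3)]] gen[OF h(1,2)] gen[OF h(1,3)] left_moduleD(6)[OF M h(2,3)]
        by (simp add: d u(4) formal_diff)
    next
      fix c F a assume "X = Poly_Mapping.single (fscale c F, a) 1 - fscale c (Poly_Mapping.single (F, a) 1)"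
        and h: "F \<in> tensor_power H 1" "a \<in> carr M"
      then show ?thesis
        using gen[OF t(2)[OF h(1) h(1)] h(2)] gen[OF h(1,2)] left_moduleD(8)[OF M h(2), of "scl H c 1" "tens1_val F"]
        by (simp add: d u(3,4) formal_diff formal_scale tens1_val_rules(2) scl_rules)
    next
      fix F h a assume "X = Poly_Mapping.single (tmul H F (iter_comult H 1 h), a) 1 - Poly_Mapping.single (F, act M h a) 1"
        and h: "F \<in> tensor_power H 1" "a \<in> carr M"
      then show ?thesis
        using gen[OF tmul_in[OF h(1) iter_comult_in] h(2)] gen[OF h(1) mD(2)[OF h(2)]] left_moduleD(8)[OF M h(2)]
        by (simp add: d u(4) formal_diff tens1_val_rules(3) del: iter_comult.simps)
    qed
  qed
  then show ?thesis by simp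
qed

lemma unemb_ptens:
  assumes M: "left_module M" and F: "F \<in> tensor_power H 1" and m: "m \<in> carr M"
  shows "unemb M (ptens H 1 M F m) = act M (tens1_val F) m"
proof -
  let ?s = "Poly_Mapping.single (F, m) (1::'k)"
  have f: "?s \<in> formal (pseudo_gens H 1 M)" using F m by (simp add: pseudo_gens_def)
  have "ptens H 1 M F m - ?s \<in> pseudo_rels H 1 M"
    unfolding ptens_def by (rule qmap_rep[OF pseudo_rels_facts[OF M] f])
  then have "unemb M (ptens H 1 M F m - ?s) = 0" and r: "ptens H 1 M F m - ?s \<in> formal (pseudo_gens H 1 M)"
    using unemb_rels[OF M] pseudo_rels_facts(2)[OF M] by auto
  then have "unemb M (ptens H 1 M F m) = unemb M ?s"
    using unemb_formal(2)[OF M r f] by simp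
  then show ?thesis using unemb_formal(4)[OF M, of F m] F m by (simp add: pseudo_gens_def)
qed

lemma pseudo_subset_formal: "left_module M \<Longrightarrow> pseudo H n M \<subseteq> formal (pseudo_gens H n M)"
  unfolding pseudo_def using qmap_formal[OF pseudo_rels_facts, of M] by blast

lemma unemb_rules:
  assumes M: "left_module M" and X: "X \<in> pseudo H 1 M"
  shows "unemb M X \<in> carr M" "Y \<in> pseudo H 1 M \<Longrightarrow> unemb M (X + Y) = unemb M X + unemb M Y"
    "unemb M (fscale c X) = act M (scl H c 1) (unemb M X)"
  using unemb_formal(1-3)[OF M] pseudo_subset_formal[OF M] X by blast+

lemma unemb_emb: "left_module M \<Longrightarrow> m \<in> carr M \<Longrightarrow> unemb M (emb H M m) = m"
  by (simp add: emb_def unemb_ptens tens1_val_tens left_moduleD(9))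

lemma emb_rules:
  assumes M: "left_module M" and a: "a \<in> carr M"
  shows "b \<in> carr M \<Longrightarrow> emb H M (a + b) = emb H M a + emb H M b"
    "b \<in> carr M \<Longrightarrow> emb H M (a - b) = emb H M a - emb H M b"
    "emb H M (act M h a) = ptn 1 M [h] a" "emb H M (- a) = - emb H M a"
    "emb H M (act M (scl H c 1) a) = fscale c (emb H M a)" "emb H M 0 = 0"
proof -
  have add: "emb H M (a + b) = emb H M a + emb H M b" if "a \<in> carr M" "b \<in> carr M" for a b
    using that by (simp add: emb_def ptens_rules(2)[OF M])
  then show "b \<in> carr M \<Longrightarrow> emb H M (a + b) = emb H M a + emb H M b" using a .
  show "emb H M (a - b) = emb H M a - emb H M b" if "b \<in> carr M"
    using add[OF left_moduleD(2)[OF M a that] that] by simp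
  show act: "emb H M (act M h a) = ptn 1 M [h] a" for h
    using ptens_rules(4)[OF M _ a, of "tens H [1]" 1 h] by (simp add: emb_def tmul_tens iter_comult_1)
  show z: "emb H M 0 = 0" by (simp add: emb_def ptens_zero[OF M])
  show "emb H M (- a) = - emb H M a" by (simp add: emb_def ptens_minus[OF M _ a])
  have "tens H [scl H c 1] = fscale c (tens H [1])" by (rule hlinD(2)[OF hlin_tens1])
  then show "emb H M (act M (scl H c 1) a) = fscale c (emb H M a)"
    using act[of "scl H c 1"] ptens_rules(3)[OF M _ a, of "tens H [1]" 1 c] by (simp add: emb_def)
qed

text \<open>In rank one the tensor factor can be moved across to \<open>M\<close>, where it acts,
  and \<open>N\<close> is stable under the action.\<close>

lemma pspan_1: assumes M: "left_module M" and N: "submodule M N" shows "pspan 1 M N = emb H M ` N"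
proof
  note Nc = submoduleD(1)[OF N]
  show "emb H M ` N \<subseteq> pspan 1 M N" by (auto simp: emb_def intro: pspan_base)
  show "pspan 1 M N \<subseteq> emb H M ` N"
    unfolding pspan_def
  proof (rule free.span_minimal, clarify)
    fix F c assume F: "F \<in> tensor_power H 1" and c: "c \<in> N"
    have "ptens H 1 M F c = emb H M (act M (tens1_val F) c)"
      using emb_rules(3)[OF M, of c "tens1_val F"] tens_tens1_val[OF F] c Nc by auto
    then show "ptens H 1 M F c \<in> emb H M ` N" using submoduleD(6)[OF N c] by blast
  next
    show "free.subspace (emb H M ` N)"
    proof (rule free.subspaceI)
      show "0 \<in> emb H M ` N"
        using submoduleD(2)[OF N] emb_rules(6)[OF M left_moduleD(1)[OF M]] by force
      show "x + y \<in> emb H M ` N" if xy: "x \<in> emb H M ` N" "y \<in> emb H M ` N" for x y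
      proof -
        obtain a b where "x = emb H M a" "y = emb H M b" "a \<in> N" "b \<in> N" using xy by blast
        then show ?thesis using emb_rules(1)[OF M, of a b] Nc submoduleD(5)[OF N, of a b] by (metis image_eqI subsetD)
      qed
      show "fscale c x \<in> emb H M ` N" if x: "x \<in> emb H M ` N" for c x
      proof -
        obtain a where "x = emb H M a" "a \<in> N" using x by blast
        then show ?thesis using emb_rules(5)[OF M, of a c] Nc submoduleD(6)[OF N] by (metis image_eqI subsetD)
      qed
    qed
  qed
qed

lemma emb_unemb: assumes M: "left_module M" and X: "X \<in> pseudo H 1 M" shows "emb H M (unemb M X) = X"
proof -
  have "X \<in> emb H M ` carr M" using X by (simp add: pseudo_eq_pspan[OF M] pspan_1[OF M submodule_carr[OF M]])
  then show ?thesis by (auto simp: unemb_emb[OF M])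
qed

lemma emb_inj: "left_module M \<Longrightarrow> a \<in> carr M \<Longrightarrow> b \<in> carr M \<Longrightarrow> emb H M a = emb H M b \<Longrightarrow> a = b"
  by (metis unemb_emb)

end

context cocommutative_hopf_basis
begin

text \<open>A property that passes to slices is followed down to one factor, where the tensor is an
  element of \<open>M\<close>; \<open>pspan_from_slices\<close> then rebuilds the original tensor
  from elements of \<open>N\<close>.\<close>

lemma slice_induct:
  assumes M: "left_module M" and N: "submodule M N"
    and step: "\<And>n y X. n \<ge> 1 \<Longrightarrow> y \<in> dual H \<Longrightarrow> X \<in> pseudo H (Suc n) M \<Longrightarrow> K (Suc n) X \<Longrightarrow> K n (slice n M y X)"
    and base: "\<And>m. m \<in> carr M \<Longrightarrow> K 1 (emb H M m) \<Longrightarrow> m \<in> N"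
    and X: "X \<in> pseudo H n M" and n: "n \<ge> 1" and K: "K n X"
  shows "X \<in> pspan n M N"
  using n X K
proof (induction n arbitrary: X rule: nat_induct_at_least)
  case base
  have "emb H M (unemb M X) = X" by (rule emb_unemb[OF M base(1)])
  then have "unemb M X \<in> N" using assms(4)[OF unemb_rules(1)[OF M base(1)]] base(2) by simp
  then show ?case using emb_unemb[OF M base(1)] by (simp only: pspan_1[OF M N]) (metis image_eqI)
next
  case (Suc n)
  show ?case
    by (rule pspan_from_slices[OF M submoduleD(1)[OF N] Suc.hyps(1) Suc.prems(1)])
      (intro Suc.IH slice_in[OF M _ Suc.hyps(1) Suc.prems(1)] step[OF Suc.hyps(1) _ Suc.prems])
qed

lemma slice_induct_zero:
  assumes M: "left_module M"
    and step: "\<And>n y X. n \<ge> 1 \<Longrightarrow> y \<in> dual H \<Longrightarrow> X \<in> pseudo H (Suc n) M \<Longrightarrow> K (Suc n) X \<Longrightarrow> K n (slice n M y X)"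
    and base: "\<And>m. m \<in> carr M \<Longrightarrow> K 1 (emb H M m) \<Longrightarrow> m = 0"
    and X: "X \<in> pseudo H n M" and n: "n \<ge> 1" and K: "K n X"
  shows "X = 0"
  using slice_induct[OF M submodule_zero[OF M] step _ X n K] base by (simp add: pspan_zero[OF M])

text \<open>Up to composing \<open>y\<close> with the antipode this is the Fourier coefficient, by
  \<open>fourier_eq_coef\<close>; unlike the latter it does not refer to the basis.\<close>

definition coef :: "('h, 'm::ab_group_add, 'z) hmodule_scheme \<Rightarrow> ('h \<Rightarrow> 'k) \<Rightarrow> ('k, 'h, 'm) pseudo \<Rightarrow> 'm" where
  "coef M y X = unemb M (slice 1 M y X)"

lemma slice_2_in: "left_module M \<Longrightarrow> y \<in> dual H \<Longrightarrow> X \<in> pseudo H 2 M \<Longrightarrow> slice 1 M y X \<in> pseudo H 1 M"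
  using slice_in[of M y 1 X] by simp

lemma coef_in: "left_module M \<Longrightarrow> y \<in> dual H \<Longrightarrow> X \<in> pseudo H 2 M \<Longrightarrow> coef M y X \<in> carr M"
  unfolding coef_def by (intro unemb_rules(1) slice_2_in)

lemma emb_coef: "left_module M \<Longrightarrow> y \<in> dual H \<Longrightarrow> X \<in> pseudo H 2 M \<Longrightarrow> emb H M (coef M y X) = slice 1 M y X"
  unfolding coef_def by (intro emb_unemb slice_2_in)

text \<open>Links the two languages of the proof: products contained in a tensor product over
  \<open>N\<close>, as for ideals, and coefficients contained in \<open>N\<close>.\<close>

lemma coef_mem_iff:
  assumes M: "left_module M" and N: "submodule M N" and X: "X \<in> pseudo H 2 M"
  shows "X \<in> pspan 2 M N \<longleftrightarrow> (\<forall>y\<in>dual H. coef M y X \<in> N)"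
proof
  assume "X \<in> pspan 2 M N"
  then have "slice 1 M y X \<in> emb H M ` N" if "y \<in> dual H" for y
    using slice_pspan[OF M submoduleD(1)[OF N] that, of 1 X] by (simp add: pspan_1[OF M N, simplified])
  then show "\<forall>y\<in>dual H. coef M y X \<in> N"
    using unemb_emb[OF M] submoduleD(1)[OF N] unfolding coef_def by fastforce
next
  assume a: "\<forall>y\<in>dual H. coef M y X \<in> N"
  have "slice 1 M y X \<in> pspan 1 M N" if "y \<in> dual H" for y
    using a emb_coef[OF M that X] that unfolding pspan_1[OF M N] by (metis image_eqI)
  then have "X \<in> pspan (Suc 1) M N"
    using pspan_from_slices[OF M submoduleD(1)[OF N], of 1 X] X by simp
  then show "X \<in> pspan 2 M N" by simp
qed

lemma slice_tens_1:
  assumes M: "left_module M" and y: "y \<in> dual H" and m: "m \<in> carr M"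
  shows "slice 1 M y (ptn 2 M [h, 1] m) = fscale (y h) (emb H M m)"
proof -
  have h: "hlin (\<lambda>b. ptn 1 M [b] m)"
    using mlin_hd[of 0 "\<lambda>u. ptn 1 M u m" "[]"] mlin_ptens[OF M m, of 1] by simp
  have "blin (\<lambda>a b. fscale (y (h * antipode H a)) (ptn 1 M [b] m))"
    unfolding blin_def by (intro conjI allI hlin_fscale h)
      (simp add: hlin_def antipode_rules distrib_left scl_rules dualD[OF y] free.scale_left_distrib)
  from sw_one[OF this] show ?thesis
    using slice_tens[OF M y _ _ m, of 1 "[h, 1]"] by (simp add: slice_list_Cons antipode_1 emb_def)
qed

lemma expansion_unique:
  assumes M: "left_module M" and c: "\<And>h. c h \<in> carr M" "{h. c h \<noteq> 0} \<subseteq> B" "finite {h. c h \<noteq> 0}"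
    and y: "y \<in> dual H"
  shows "slice 1 M y (\<Sum>h | c h \<noteq> 0. ptn 2 M [h, 1] (c h)) = emb H M (\<Sum>h | c h \<noteq> 0. act M (scl H (y h) 1) (c h))"
proof -
  have "emb H M (\<Sum>h\<in>A. act M (scl H (y h) 1) (c h)) = (\<Sum>h\<in>A. fscale (y h) (emb H M (c h)))
      \<and> (\<Sum>h\<in>A. act M (scl H (y h) 1) (c h)) \<in> carr M" for A
    by (induction A rule: infinite_finite_induct)
      (auto simp: emb_rules(1)[OF M] emb_rules(5)[OF M c(1)] emb_rules(6)[OF M left_moduleD(1)[OF M]] c(1)
        left_moduleD(1,3,5)[OF M])
  then show ?thesis by (simp add: flin_sum[OF flin_slice] slice_tens_1[OF M y] c(1))
qed

text \<open>Makes the definite description in \<open>coeffs\<close> legitimate: the coefficient at a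
  basis element \<open>b\<close> can only be \<open>coef M (coord b) X\<close>, and
  \<open>expand\<close> shows that these do represent \<open>X\<close>.\<close>

lemma coeffs_eq:
  assumes M: "left_module M" and X: "X \<in> pseudo H 2 M"
  shows "(\<forall>h. coeffs H B M X h \<in> carr M) \<and> {h. coeffs H B M X h \<noteq> 0} \<subseteq> B \<and> finite {h. coeffs H B M X h \<noteq> 0} \<and>
     X = (\<Sum>h | coeffs H B M X h \<noteq> 0. ptn 2 M [h, 1] (coeffs H B M X h))"
proof -
  have X': "X \<in> pseudo H (Suc 1) M" using X by simp
  let ?P = "\<lambda>c. (\<forall>h. c h \<in> carr M) \<and> {h. c h \<noteq> 0} \<subseteq> B \<and> finite {h. c h \<noteq> 0} \<and>
     X = (\<Sum>h | c h \<noteq> 0. ptn 2 M [h, 1] (c h))"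
  obtain C where C: "expandable 1 M C X" using expand[OF M _ X'] by auto
  define c where "c h = (if h \<in> C then coef M (coord h) X else 0)" for h
  have cc: "c h \<in> carr M" for h
    using coef_in[OF M coord_props(1) X] left_moduleD(1)[OF M] by (simp add: c_def)
  have sub: "{h. c h \<noteq> 0} \<subseteq> C" by (auto simp: c_def)
  have ins: "pinsert 1 M b (emb H M m) = ptn 2 M [b, 1] m" if m: "m \<in> carr M" for b m
  proof -
    have "blin (\<lambda>a c. ptn 2 M [b * a, c] m)"
      unfolding blin_def
      by (intro conjI allI)
        (rule blinD(1)[OF mlin_2D[OF mlin_ptens[OF M m]]], rule hlin_mult(1)[OF blinD(2)[OF mlin_2D[OF mlin_ptens[OF M m]]]])
    from sw_one[OF this] show ?thesis
      using pinsert_tens[OF M _ _ m, of 1 "[1]" b] by (simp add: emb_def insert_list_def)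
  qed
  have "X = (\<Sum>b\<in>C. pinsert 1 M b (slice 1 M (coord b) X))" using C unfolding expandable_def by blast
  also have "\<dots> = (\<Sum>b\<in>C. ptn 2 M [b, 1] (c b))"
    by (rule sum.cong) (simp_all add: c_def ins[symmetric] coef_in[OF M coord_props(1) X] emb_coef[OF M coord_props(1) X])
  also have "\<dots> = (\<Sum>h | c h \<noteq> 0. ptn 2 M [h, 1] (c h))"
    using C sub by (intro sum.mono_neutral_right) (auto simp: expandable_def ptens_zero[OF M])
  finally have P: "?P c"
    using cc sub C finite_subset[of "{h. c h \<noteq> 0}" C] by (auto simp: expandable_def)
  have uniq: "c' = c" if P': "?P c'" for c'
  proof
    fix b
    have v: "d b = coef M (coord b) X" if Pd: "?P d" and b: "b \<in> B" for d
    proof -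
      have ys: "(\<Sum>h | d h \<noteq> 0. act M (scl H (coord b h) 1) (d h)) = d b"
      proof -
        have "act M (scl H (coord b h) 1) (d h) = (if h = b then d b else 0)" if "d h \<noteq> 0" for h
        proof -
          have "h \<in> B" "d h \<in> carr M" using that Pd by auto
          then show ?thesis
            using left_moduleD(9)[OF M] left_moduleD(7)[OF M, of "d h" 0 0] by (auto simp: coord_props(5) scl_rules)
        qed
        then have "(\<Sum>h | d h \<noteq> 0. act M (scl H (coord b h) 1) (d h)) = (\<Sum>h | d h \<noteq> 0. if h = b then d b else 0)"
          by (intro sum.cong) auto
        also have "\<dots> = d b" using Pd by (simp add: sum.delta)
        finally show ?thesis .
      qed
      have "slice 1 M (coord b) X = emb H M (\<Sum>h | d h \<noteq> 0. act M (scl H (coord b h) 1) (d h))"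
        using expansion_unique[OF M, of d "coord b"] Pd coord_props(1) by auto
      then have "emb H M (d b) = emb H M (coef M (coord b) X)"
        using ys emb_coef[OF M coord_props(1) X] by simp
      then show ?thesis using emb_inj[OF M] Pd coef_in[OF M coord_props(1) X] by blast
    qed
    show "c' b = c b"
    proof (cases "b \<in> B")
      case True then show ?thesis using v[OF P'] v[OF P] by simp
    next
      case False
      then have "c' b = 0" "c b = 0"
        using P'[THEN conjunct2, THEN conjunct1] P[THEN conjunct2, THEN conjunct1] by blast+
      then show ?thesis by simp
    qed
  qed
  show ?thesis unfolding coeffs_def by (rule theI2[of ?P, OF P uniq]) auto
qed

lemma dual_antipode: "y \<in> dual H \<Longrightarrow> (\<lambda>h. y (antipode H h)) \<in> dual H"
  by (auto simp: dual_def Vector_Spaces.linear_iff antipode_rules)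

text \<open>Both apply a functional to the first factors of the same expansion; in
  \<open>fourier\<close> the antipode comes first.\<close>

lemma fourier_eq_coef:
  assumes M: "left_module M" and X: "X \<in> pseudo H 2 M" and x: "x \<in> dual H"
  shows "fourier H B M x X = coef M (\<lambda>h. x (antipode H h)) X"
proof -
  let ?c = "coeffs H B M X" and ?y = "\<lambda>h. x (antipode H h)"
  note c = coeffs_eq[OF M X]
  have "slice 1 M ?y X = emb H M (\<Sum>h | ?c h \<noteq> 0. act M (scl H (?y h) 1) (?c h))"
    using expansion_unique[OF M _ _ _ dual_antipode[OF x], of ?c] c by auto
  moreover have "fourier H B M x X \<in> carr M"
  proof -
    have "(\<Sum>h\<in>A. act M (scl H (?y h) 1) (?c h)) \<in> carr M" for A
      using c by (induction A rule: infinite_finite_induct) (auto simp: left_moduleD(1,3,5)[OF M])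
    then show ?thesis unfolding fourier_def .
  qed
  ultimately show ?thesis unfolding coef_def fourier_def by (simp add: unemb_emb[OF M])
qed

end

context cocommutative_hopf
begin

section \<open>Left multiplication, permutations and the extended product\<close>

lemma mult_ones: "length xs = n \<Longrightarrow> map2 (*) (replicate n 1) xs = (xs :: 'h list)"
  by (intro nth_equalityI) auto

lemma replicate_1 [simp]: "replicate 1 x = [x]"
  by (simp add: One_nat_def del: One_nat_def[symmetric])

lemma lmul_lmul:
  assumes M: "left_module M" and fs: "length fs = n" "length gs = n" and X: "X \<in> pseudo H n M"
  shows "lmul H n M (tens H fs) (lmul H n M (tens H gs) X) = lmul H n M (tens H (map2 (*) fs gs)) X"
proof (rule pseudo_eqI[OF M flin_comp[OF flin_lmul(1) flin_lmul(1)] flin_lmul(1) _ X])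
  fix xs :: "'h list" and c assume xs: "length xs = n" and c: "c \<in> carr M"
  have "map2 (*) fs (map2 (*) gs xs) = map2 (*) (map2 (*) fs gs) xs"
    using xs fs by (intro nth_equalityI) (auto simp: mult.assoc)
  then show "lmul H n M (tens H fs) (lmul H n M (tens H gs) (ptn n M xs c))
    = lmul H n M (tens H (map2 (*) fs gs)) (ptn n M xs c)"
    using xs fs c by (simp add: lmul_tens[OF M])
qed

lemma lmul_ones:
  assumes M: "left_module M" and X: "X \<in> pseudo H n M"
  shows "lmul H n M (tens H (replicate n 1)) X = X"
  by (rule pseudo_eqI[OF M flin_lmul(1) _ _ X]) (auto simp: lmul_tens[OF M] mult_ones flin_def)

lemma lmul_add_left:
  assumes M: "left_module M" and X: "X \<in> pseudo H n M" and n: "Suc (length us + length vs) = n"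
  shows "lmul H n M (tens H (us @ (a + b) # vs)) X
    = lmul H n M (tens H (us @ a # vs)) X + lmul H n M (tens H (us @ b # vs)) X"
proof (rule pseudo_eqI[OF M flin_lmul(1) _ _ X])
  show "flin (\<lambda>X. lmul H n M (tens H (us @ a # vs)) X + lmul H n M (tens H (us @ b # vs)) X)"
    unfolding flin_def by (simp add: flinD(1,2)[OF flin_lmul(1)] free.scale_right_distrib)
  fix xs :: "'h list" and c assume xs: "length xs = n" and c: "c \<in> carr M"
  have "hlin (\<lambda>a. ptn n M (map2 (*) (us @ a # vs) xs) c)"
    by (rule mlinD[OF mlin_map2'[OF mlin_ptens[OF M c] xs] n])
  from hlinD(1)[OF this, of a b] show "lmul H n M (tens H (us @ (a + b) # vs)) (ptn n M xs c)
    = lmul H n M (tens H (us @ a # vs)) (ptn n M xs c) + lmul H n M (tens H (us @ b # vs)) (ptn n M xs c)"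
    using xs n c by (simp add: lmul_tens[OF M])
qed

lemma lact_map2: "length gs = length fs \<Longrightarrow> lact k (map2 (*) gs fs) h = lact (\<lambda>u. k (map2 (*) gs u)) fs h"
proof (induction gs fs arbitrary: k h rule: list_induct2)
  case (Cons g gs f fs)
  then show ?case by (simp add: mult.assoc)
qed simp

lemma pext_lmul:
  assumes A: "left_module A" and B: "left_module B" and C: "left_module C" and \<mu>: "hbilinear A B C \<mu>"
    and ks: "length ks = n" and ls: "length ls = m" and X: "X \<in> pseudo H n A" and Y: "Y \<in> pseudo H m B"
  shows "pext H n m C \<mu> (lmul H n A (tens H ks) X) (lmul H m B (tens H ls) Y)
    = lmul H (n + m) C (tens H (ks @ ls)) (pext H n m C \<mu> X Y)"
proof (rule pseudo_eqI[OF A flin_comp[OF flin_pext(1) flin_lmul(1)] flin_comp[OF flin_lmul(1) flin_pext(1)] _ X])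
  fix fs :: "'h list" and a assume fs: "length fs = n" and a: "a \<in> carr A"
  show "pext H n m C \<mu> (lmul H n A (tens H ks) (ptn n A fs a)) (lmul H m B (tens H ls) Y)
    = lmul H (n + m) C (tens H (ks @ ls)) (pext H n m C \<mu> (ptn n A fs a) Y)"
  proof (rule pseudo_eqI[OF B flin_comp[OF flin_pext(2) flin_lmul(1)] flin_comp[OF flin_lmul(1) flin_pext(2)] _ Y])
    fix gs :: "'h list" and b assume gs: "length gs = m" and b: "b \<in> carr B"
    let ?T = "\<lambda>w c. ptn (n + m) C w c"
    have lens: "length (map2 (*) ks fs) = n" "length (map2 (*) ls gs) = m" using fs gs ks ls by simp_all
    have "pfun (twofold ?T (map2 (*) ks fs) (map2 (*) ls gs)) Z
        = lmul H (n + m) C (tens H (ks @ ls)) (pfun (twofold ?T fs gs) Z)" if Z: "Z \<in> pseudo H 2 C" for Z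
    proof (rule pseudo_eqI[OF C flin_pfun flin_comp[OF flin_lmul(1) flin_pfun] _ Z])
      fix xs :: "'h list" and c assume xs: "length xs = 2" and c: "c \<in> carr C"
      note p = pfun_ptens[OF C balanced_twofold[OF C balanced_ptens[OF C] lens] xs c]
        pfun_ptens[OF C balanced_twofold[OF C balanced_ptens[OF C] fs gs] xs c]
      have "lmul H (n + m) C (tens H (ks @ ls)) (lact (\<lambda>u. lact (\<lambda>v. ?T (u @ v) c) gs (xs ! 1)) fs (xs ! 0))
         = lact (\<lambda>u. lact (\<lambda>v. lmul H (n + m) C (tens H (ks @ ls)) (?T (u @ v) c)) gs (xs ! 1)) fs (xs ! 0)"
        by (simp add: lact_flin[OF flin_lmul(1)])
      also have "\<dots> = lact (\<lambda>u. lact (\<lambda>v. ?T (map2 (*) ks u @ map2 (*) ls v) c) gs (xs ! 1)) fs (xs ! 0)"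
        using fs gs ks ls c by (intro lact_cong_length) (simp add: lmul_tens[OF C])
      finally show "pfun (twofold ?T (map2 (*) ks fs) (map2 (*) ls gs)) (ptn 2 C xs c)
          = lmul H (n + m) C (tens H (ks @ ls)) (pfun (twofold ?T fs gs) (ptn 2 C xs c))"
        unfolding p using fs gs ks ls by (simp add: twofold_def lact_map2)
    qed
    from this[OF hbilinearD(1)[OF \<mu> a b]]
    show "pext H n m C \<mu> (lmul H n A (tens H ks) (ptn n A fs a)) (lmul H m B (tens H ls) (ptn m B gs b))
      = lmul H (n + m) C (tens H (ks @ ls)) (pext H n m C \<mu> (ptn n A fs a) (ptn m B gs b))"
      using fs gs ks ls a b by (simp add: lmul_tens[OF A] lmul_tens[OF B] pext_tens[OF A B C \<mu>])
  qed
qed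

lemma pext_emb_emb:
  assumes A: "left_module A" and B: "left_module B" and C: "left_module C" and \<mu>: "hbilinear A B C \<mu>"
    and a: "a \<in> carr A" and b: "b \<in> carr B"
  shows "pext H 1 1 C \<mu> (emb H A a) (emb H B b) = \<mu> a b"
proof -
  let ?T = "\<lambda>w c. ptn (1 + 1) C w c"
  have l: "length [1::'h] = 1" by simp
  have "pfun (twofold ?T [1] [1]) Z = Z" if Z: "Z \<in> pseudo H 2 C" for Z
  proof (rule pseudo_eqI[OF C flin_pfun _ _ Z])
    show "flin (\<lambda>X. X)" by (simp add: flin_def)
    fix xs :: "'h list" and c assume l2: "length xs = 2" and c: "c \<in> carr C"
    then obtain p q where xs: "xs = [p, q]" by (blast elim: length2E)
    have m: "mlin (1 + 1) (\<lambda>w. ?T w c)" by (rule mlin_ptens[OF C c])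
    have "lact (\<lambda>u. lact (\<lambda>v. ?T (u @ v) c) [1] q) [1] p = lact (\<lambda>u. ?T (u @ [1 * q]) c) [1] p"
      by (rule lact_cong_length, rule lact_single, rule mlin_append2[OF m]) simp
    also have "\<dots> = ?T ([1 * p] @ [1 * q]) c"
      by (rule lact_single, rule mlin_append1[OF m]) simp
    finally show "pfun (twofold ?T [1] [1]) (ptn 2 C xs c) = ptn 2 C xs c"
      unfolding pfun_ptens[OF C balanced_twofold[OF C balanced_ptens[OF C] l l] l2 c]
      by (simp add: twofold_def xs)
  qed
  from this[OF hbilinearD(1)[OF \<mu> a b]] show ?thesis
    unfolding emb_def pext_tens[OF A B C \<mu> l l a b] .
qed

lemma pperm_lmul_2:
  assumes M: "left_module M" and X: "X \<in> pseudo H 2 M"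
  shows "pswap M (lmul H 2 M (tens H [f, g]) X) = lmul H 2 M (tens H [g, f]) (pswap M X)"
proof (rule pseudo_eqI[OF M flin_comp[OF flin_lmul(2) flin_lmul(1)] flin_comp[OF flin_lmul(1) flin_lmul(2)] _ X])
  fix xs :: "'h list" and c assume "length xs = 2" and c: "c \<in> carr M"
  then obtain p q where xs: "xs = [p, q]" by (blast elim: length2E)
  have s: "transpose 0 (1::nat) permutes {..<2}" by (rule permutes_swap_id) auto
  have "permute_list (transpose 0 1) [a, b] = [b, a]" for a b :: 'h by (simp add: permute_list_def upt_rec)
  then show "pswap M (lmul H 2 M (tens H [f, g]) (ptn 2 M xs c))
    = lmul H 2 M (tens H [g, f]) (pswap M (ptn 2 M xs c))"
    using c by (simp add: xs lmul_tens[OF M] pperm_tens[OF M s])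
qed

lemma pperm_pperm:
  assumes M: "left_module M" and X: "X \<in> pseudo H n M" and ij: "i < n" "j < n"
  shows "pperm H n M (transpose i j) (pperm H n M (transpose i j) X) = X"
proof (rule pseudo_eqI[OF M flin_comp[OF flin_lmul(2) flin_lmul(2)] _ _ X])
  show "flin (\<lambda>X. X)" by (simp add: flin_def)
  have s: "transpose i j permutes {..<n}" by (rule permutes_swap_id) (use ij in auto)
  fix xs :: "'h list" and c assume xs: "length xs = n" and c: "c \<in> carr M"
  have "permute_list (transpose i j) (permute_list (transpose i j) xs) = xs"
    using permute_list_compose[of "transpose i j" xs "transpose i j"] s xs by simp
  then show "pperm H n M (transpose i j) (pperm H n M (transpose i j) (ptn n M xs c)) = ptn n M xs c"
    using xs c by (simp add: pperm_tens[OF M s])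
qed

section \<open>Conformal endomorphisms\<close>

lemma cend_carr:
  "\<phi> \<in> carr (cend H P) \<longleftrightarrow> (\<forall>a\<in>carr P. \<phi> a \<in> pseudo H 2 P) \<and> (\<forall>a. a \<notin> carr P \<longrightarrow> \<phi> a = 0) \<and>
      (\<forall>a\<in>carr P. \<forall>b\<in>carr P. \<phi> (a + b) = \<phi> a + \<phi> b) \<and>
      (\<forall>h. \<forall>a\<in>carr P. \<phi> (act P h a) = lmul H 2 P (tens H [1, h]) (\<phi> a))"
  by (simp add: cend_def)

lemma cend_act: "act (cend H P) h \<phi> = (\<lambda>a. lmul H 2 P (tens H [h, 1]) (\<phi> a))"
  by (simp add: cend_def)

lemma left_module_cend:
  assumes P: "left_module P" shows "left_module (cend H P)"
  unfolding left_module_def cend_act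
proof (intro conjI allI ballI)
  note sub = subspace_pseudo[OF P, of 2]
  show "0 \<in> carr (cend H P)"
    using free.subspace_0[OF sub] by (simp add: cend_carr flinD(3)[OF flin_lmul(1)])
  show "\<phi> - \<psi> \<in> carr (cend H P)" if "\<phi> \<in> carr (cend H P)" "\<psi> \<in> carr (cend H P)" for \<phi> \<psi>
    using that free.subspace_diff[OF sub] by (auto simp: cend_carr flinD(5)[OF flin_lmul(1)])
  fix f \<phi> assume \<phi>: "\<phi> \<in> carr (cend H P)"
  have \<phi>a: "\<phi> a \<in> pseudo H 2 P" for a
    using \<phi> free.subspace_0[OF sub] by (cases "a \<in> carr P") (auto simp: cend_carr)
  have r: "replicate 2 (1::'h) = [1, 1]" by (simp only: numeral_2_eq_2 replicate_Suc replicate_0)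
  show "(\<lambda>a. lmul H 2 P (tens H [f, 1]) (\<phi> a)) \<in> carr (cend H P)"
    unfolding cend_carr
  proof (intro conjI ballI allI impI)
    show "lmul H 2 P (tens H [f, 1]) (\<phi> a) \<in> pseudo H 2 P" for a by (rule lmul_in[OF P _ \<phi>a]) simp
    show "lmul H 2 P (tens H [f, 1]) (\<phi> a) = 0" if "a \<notin> carr P" for a
      using \<phi> that by (simp add: cend_carr flinD(3)[OF flin_lmul(1)])
    fix a assume a: "a \<in> carr P"
    show "lmul H 2 P (tens H [f, 1]) (\<phi> (a + b)) = lmul H 2 P (tens H [f, 1]) (\<phi> a) + lmul H 2 P (tens H [f, 1]) (\<phi> b)"
      if "b \<in> carr P" for b
      using \<phi> a that by (simp add: cend_carr flinD(1)[OF flin_lmul(1)])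
    have "\<phi> (act P h a) = lmul H 2 P (tens H [1, h]) (\<phi> a)" for h
      using \<phi> a by (simp add: cend_carr)
    then show "lmul H 2 P (tens H [f, 1]) (\<phi> (act P h a)) = lmul H 2 P (tens H [1, h]) (lmul H 2 P (tens H [f, 1]) (\<phi> a))" for h
      by (simp add: lmul_lmul[OF P _ _ \<phi>a])
  qed
  show "(\<lambda>a. lmul H 2 P (tens H [f, 1]) ((\<phi> + \<psi>) a)) = (\<lambda>a. lmul H 2 P (tens H [f, 1]) (\<phi> a)) + (\<lambda>a. lmul H 2 P (tens H [f, 1]) (\<psi> a))" for \<psi>
    by (simp add: fun_eq_iff flinD[OF flin_lmul(1)])
  show "(\<lambda>a. lmul H 2 P (tens H [f + g, 1]) (\<phi> a)) = (\<lambda>a. lmul H 2 P (tens H [f, 1]) (\<phi> a)) + (\<lambda>a. lmul H 2 P (tens H [g, 1]) (\<phi> a))" for g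
    using lmul_add_left[OF P \<phi>a, of "[]" "[1]"] by (simp add: fun_eq_iff)
  show "(\<lambda>a. lmul H 2 P (tens H [f * g, 1]) (\<phi> a)) = (\<lambda>a. lmul H 2 P (tens H [f, 1]) (lmul H 2 P (tens H [g, 1]) (\<phi> a)))" for g
    by (simp add: fun_eq_iff lmul_lmul[OF P _ _ \<phi>a])
  show "(\<lambda>a. lmul H 2 P (tens H [1, 1]) (\<phi> a)) = \<phi>"
    using lmul_ones[OF P \<phi>a, unfolded r] by (simp add: fun_eq_iff)
qed

lemma hbilinear_cend:
  assumes P: "left_module P" shows "hbilinear (cend H P) P P (\<lambda>\<phi> a. \<phi> a)"
  unfolding hbilinear_def
proof (intro conjI ballI allI)
  fix f g \<phi> a assume \<phi>: "\<phi> \<in> carr (cend H P)" and a: "a \<in> carr P"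
  then have "\<phi> a \<in> pseudo H 2 P" "\<phi> (act P g a) = lmul H 2 P (tens H [1, g]) (\<phi> a)" by (simp_all add: cend_carr)
  then show "act (cend H P) f \<phi> (act P g a) = lmul H 2 P (tens H [f, g]) (\<phi> a)"
    by (simp add: cend_act lmul_lmul[OF P])
qed (simp_all add: cend_carr)

end

context cocommutative_hopf_basis
begin

text \<open>Slicing commutes with \<open>push\<close>, so the claim reduces to rank one, where the
  map is the inclusion of \<open>N\<close> into \<open>M\<close>.\<close>

lemma push_incl_inj:
  assumes M: "left_module M" and N: "submodule M (carr N)" "act N = act M"
    and X: "X \<in> pseudo H n N" and n: "n \<ge> 1" and z: "push H n M (\<lambda>a. a) X = 0"
  shows "X = 0"
proof -
  have lN: "left_module N" by (rule left_module_submodule[OF M N])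
  have q: "module_hom_on N M (\<lambda>a. a)" by (rule module_hom_on_id[OF N])
  show ?thesis
  proof (rule slice_induct_zero[where K = "\<lambda>n X. push H n M (\<lambda>a. a) X = 0", OF lN _ _ X n z])
    fix n y X assume "n \<ge> 1" "y \<in> dual H" "X \<in> pseudo H (Suc n) N" "push H (Suc n) M (\<lambda>a. a) X = 0"
    then show "push H n M (\<lambda>a. a) (slice n N y X) = 0"
      using slice_push[OF lN M q, of y n X] by (simp add: flinD(3)[OF flin_slice])
  next
    fix m assume m: "m \<in> carr N" "push H 1 M (\<lambda>a. a) (emb H N m) = 0"
    then have "emb H M m = emb H M 0"
      by (simp add: emb_def push_ptens[OF lN M q] ptens_zero[OF M])
    then show "m = 0" using emb_inj[OF M, of m 0] m(1) module_hom_onD(1)[OF q] left_moduleD(1)[OF M] by blast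
  qed
qed

text \<open>Preimages exist for the generators of \<open>pspan\<close>, hence for all its elements,
  and they are unique by \<open>push_incl_inj\<close>; so the description in \<open>restr\<close>
  denotes.\<close>

lemma restr_props:
  assumes M: "left_module M" and N: "submodule M (carr N)" "act N = act M"
    and X: "X \<in> pspan n M (carr N)" and n: "n \<ge> 1"
  shows "restr H n N M X \<in> pseudo H n N" "push H n M (\<lambda>a. a) (restr H n N M X) = X"
proof -
  have lN: "left_module N" by (rule left_module_submodule[OF M N])
  have q: "module_hom_on N M (\<lambda>a. a)" by (rule module_hom_on_id[OF N])
  have "X \<in> push H n M (\<lambda>a. a) ` pseudo H n N"
    using X unfolding pspan_def
  proof (rule free.span_induct)
    show "free.subspace {X. X \<in> push H n M (\<lambda>a. a) ` pseudo H n N}"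
    proof (rule free.subspaceI)
      show "0 \<in> {X. X \<in> push H n M (\<lambda>a. a) ` pseudo H n N}"
        using flinD(3)[OF flin_lmul(3)] free.subspace_0[OF subspace_pseudo[OF lN]] by force
      show "x + y \<in> {X. X \<in> push H n M (\<lambda>a. a) ` pseudo H n N}"
        if "x \<in> {X. X \<in> push H n M (\<lambda>a. a) ` pseudo H n N}" "y \<in> {X. X \<in> push H n M (\<lambda>a. a) ` pseudo H n N}" for x y
        using that free.subspace_add[OF subspace_pseudo[OF lN]] by (auto simp: flinD(1)[OF flin_lmul(3), symmetric])
      show "fscale c x \<in> {X. X \<in> push H n M (\<lambda>a. a) ` pseudo H n N}"
        if "x \<in> {X. X \<in> push H n M (\<lambda>a. a) ` pseudo H n N}" for c x
        using that free.subspace_scale[OF subspace_pseudo[OF lN]] by (auto simp: flinD(2)[OF flin_lmul(3), symmetric])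
    qed
    fix X assume "X \<in> {ptens H n M F c | F c. F \<in> tensor_power H n \<and> c \<in> carr N}"
    then obtain F c where "X = ptens H n M F c" "F \<in> tensor_power H n" "c \<in> carr N" by blast
    then show "X \<in> push H n M (\<lambda>a. a) ` pseudo H n N"
      using push_ptens[OF lN M q, of F n c] ptens_in[of F n c N] by (metis image_eqI)
  qed
  then obtain Y where Y: "Y \<in> pseudo H n N" "push H n M (\<lambda>a. a) Y = X" by blast
  have uniq: "Y' = Y" if "Y' \<in> pseudo H n N \<and> push H n M (\<lambda>a. a) Y' = X" for Y'
    using push_incl_inj[OF M N free.subspace_diff[OF subspace_pseudo[OF lN]] n, of Y' Y] that Y
    by (simp add: flinD(5)[OF flin_lmul(3)])
  have "restr H n N M X = Y" unfolding restr_def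
    by (rule the_equality) (use Y in blast, rule uniq)
  then show "restr H n N M X \<in> pseudo H n N" "push H n M (\<lambda>a. a) (restr H n N M X) = X" using Y by auto
qed

text \<open>Slicing commutes with application to \<open>a\<close>. In rank one the claim is that a
  conformal endomorphism vanishing on \<open>carr P\<close> is zero, which holds because it is 0
  elsewhere by definition.\<close>

lemma capp_inj:
  assumes P: "left_module P" and A: "A \<in> pseudo H n (cend H P)" and n: "n \<ge> 1"
    and z: "\<And>a. a \<in> carr P \<Longrightarrow> capp H P n 1 A (emb H P a) = 0"
  shows "A = 0"
proof -
  note C = left_module_cend[OF P] and bil = hbilinear_cend[OF P]
  show ?thesis
  proof (rule slice_induct_zero[where K = "\<lambda>n A. \<forall>a\<in>carr P. capp H P n 1 A (emb H P a) = 0", OF C _ _ A n])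
    fix n y X assume h: "n \<ge> 1" "y \<in> dual H" "X \<in> pseudo H (Suc n) (cend H P)"
      "\<forall>a\<in>carr P. capp H P (Suc n) 1 X (emb H P a) = 0"
    show "\<forall>a\<in>carr P. capp H P n 1 (slice n (cend H P) y X) (emb H P a) = 0"
    proof
      fix a assume a: "a \<in> carr P"
      show "capp H P n 1 (slice n (cend H P) y X) (emb H P a) = 0"
        using slice_pext[OF C P P bil h(2,1,3) emb_in[OF a]] h(4) a by (simp add: flinD(3)[OF flin_slice])
    qed
  next
    fix \<phi> assume h: "\<phi> \<in> carr (cend H P)" "\<forall>a\<in>carr P. capp H P 1 1 (emb H (cend H P) \<phi>) (emb H P a) = 0"
    show "\<phi> = 0"
    proof
      fix a show "\<phi> a = 0 a"
        using h pext_emb_emb[OF C P P bil h(1), of a] by (cases "a \<in> carr P") (auto simp: cend_carr)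
    qed
  qed (use z in auto)
qed

lemma slice_lmul:
  assumes M: "left_module M" and y: "y \<in> dual H" and n: "n \<ge> 1" and hs: "length hs + 1 = n"
    and X: "X \<in> pseudo H (Suc n) M"
  shows "slice n M y (lmul H (Suc n) M (tens H (1 # 1 # hs)) X) = lmul H n M (tens H (1 # hs)) (slice n M y X)"
proof (rule pseudo_eqI[OF M flin_comp[OF flin_slice flin_lmul(1)] flin_comp[OF flin_lmul(1) flin_slice] _ X])
  fix xs :: "'h list" and c assume xs: "length xs = Suc n" and c: "c \<in> carr M"
  obtain f g r where r: "xs = f # g # r" "length (g # r) = n" by (rule length_ge_2E[OF xs n])
  have l: "length (1 # 1 # hs) = Suc n" "length (1 # hs) = n" using hs by auto
  have l2: "length (map2 (*) (1 # 1 # hs) xs) = Suc n" using xs l by simp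
  have "lmul H n M (tens H (1 # hs)) (ptn n M (b # r) c) = ptn n M (b # map2 (*) hs r) c" for b
    using lmul_tens[OF M l(2) _ c, of "b # r"] r(2) by simp
  then show "slice n M y (lmul H (Suc n) M (tens H (1 # 1 # hs)) (ptn (Suc n) M xs c))
    = lmul H n M (tens H (1 # hs)) (slice n M y (ptn (Suc n) M xs c))"
    unfolding lmul_tens[OF M l(1) xs c] slice_tens[OF M y n l2 c] slice_tens[OF M y n xs c] slice_list_flin[OF flin_lmul(1)]
    by (simp add: r(1) slice_list_Cons)
qed

text \<open>Applying \<open>(b \<otimes> 1) \<otimes> \<chi>\<close> to \<open>a\<close> inserts
  \<open>b\<close> into \<open>\<chi> a\<close>. This allows the product of conformal endomorphisms
  to be built coefficient by coefficient.\<close>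

lemma capp_pinsert:
  assumes P: "left_module P" and \<chi>: "\<chi> \<in> carr (cend H P)" and a: "a \<in> carr P"
  shows "capp H P 2 1 (ptn 2 (cend H P) [b, 1] \<chi>) (emb H P a) = pinsert 2 P b (\<chi> a)"
proof -
  note C = left_module_cend[OF P] and bil = hbilinear_cend[OF P]
  let ?T = "\<lambda>w c. ptn (2 + 1) P w c"
  have l: "length [b, 1] = 2" "length [1::'h] = 1" by simp_all
  have "pfun (twofold ?T [b, 1] [1]) Z = pinsert 2 P b Z" if Z: "Z \<in> pseudo H 2 P" for Z
  proof (rule pseudo_eqI[OF P flin_pfun flin_pinsert _ Z])
    fix xs :: "'h list" and c assume l2: "length xs = 2" and c: "c \<in> carr P"
    then obtain p q where xs: "xs = [p, q]" by (blast elim: length2E)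
    have m: "mlin (2 + 1) (\<lambda>w. ?T w c)" by (rule mlin_ptens[OF P c])
    have "lact (\<lambda>u. lact (\<lambda>v. ?T (u @ v) c) [1] q) [b, 1] p = lact (\<lambda>u. ?T (u @ [1 * q]) c) [b, 1] p"
      by (rule lact_cong_length, rule lact_single, rule mlin_append2[OF m]) simp
    also have "\<dots> = sw (\<lambda>p1 p2. ?T ([b * p1, 1 * p2] @ [1 * q]) c) p"
      by (rule lact_2, rule mlin_append1[OF m]) simp
    finally show "pfun (twofold ?T [b, 1] [1]) (ptn 2 P xs c) = pinsert 2 P b (ptn 2 P xs c)"
      unfolding pfun_ptens[OF P balanced_twofold[OF P balanced_ptens[OF P] l] l2 c]
      using pinsert_tens[OF P _ l2 c, of b] by (simp add: twofold_def xs insert_list_def)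
  qed
  moreover have "\<chi> a \<in> pseudo H 2 P" using \<chi> a by (simp add: cend_carr)
  ultimately show ?thesis
    using pext_tens[OF C P P bil l \<chi> a] by (simp add: emb_def)
qed

lemma generated_induct:
  assumes M: "left_module M" and X: "X \<subseteq> carr M" and gen: "generated_submodule M X = carr M"
    and Q: "\<And>a. a \<in> X \<Longrightarrow> Q a" "Q 0" "\<And>a b. a \<in> carr M \<Longrightarrow> b \<in> carr M \<Longrightarrow> Q a \<Longrightarrow> Q b \<Longrightarrow> Q (a - b)"
      "\<And>h a. a \<in> carr M \<Longrightarrow> Q a \<Longrightarrow> Q (act M h a)"
    and a: "a \<in> carr M"
  shows "Q a"
proof -
  have "submodule M {a \<in> carr M. Q a}"
    by (rule submoduleI) (auto simp: Q left_moduleD[OF M])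
  from generated_submodule_props(3)[OF M X this] show ?thesis using X Q(1) gen a by blast
qed

text \<open>The coefficient of \<open>\<phi> * \<psi>\<close> at a basis element \<open>b\<close>
  must send \<open>a\<close> to the slice of \<open>\<phi> * (\<psi> * a)\<close> by
  \<open>coord b\<close>. A tensor is a finite sum, and finite generation ensures that only finitely
  many of these maps are nonzero.\<close>

lemma cend_prod_exists:
  assumes P: "left_module P" and fg: "finitely_generated P"
    and \<phi>: "\<phi> \<in> carr (cend H P)" and \<psi>: "\<psi> \<in> carr (cend H P)"
  shows "\<exists>A \<in> pseudo H 2 (cend H P).
    \<forall>a\<in>carr P. capp H P 2 1 A (emb H P a) = capp H P 1 2 (emb H (cend H P) \<phi>) (\<psi> a)"
proof -
  note C = left_module_cend[OF P] and bil = hbilinear_cend[OF P]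
  define R where "R a = capp H P 1 2 (emb H (cend H P) \<phi>) (\<psi> a)" for a
  have \<psi>a: "\<psi> a \<in> pseudo H 2 P" if "a \<in> carr P" for a using \<psi> that by (simp add: cend_carr)
  have R_in: "R a \<in> pseudo H (Suc 2) P" if "a \<in> carr P" for a
    using pext_in[OF C P P bil emb_in[OF \<phi>] \<psi>a[OF that]] by (simp add: R_def)
  have R_add: "R (a + b) = R a + R b" if "a \<in> carr P" "b \<in> carr P" for a b
    using \<psi> that by (simp add: R_def cend_carr flinD(1)[OF flin_pext(2)])
  have R_act: "R (act P h a) = lmul H 3 P (tens H [1, 1, h]) (R a)" if a: "a \<in> carr P" for h a
  proof -
    have "lmul H 1 (cend H P) (tens H [1]) (emb H (cend H P) \<phi>) = emb H (cend H P) \<phi>"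
      using lmul_ones[OF C emb_in[OF \<phi>]] by simp
    moreover have "\<psi> (act P h a) = lmul H 2 P (tens H [1, h]) (\<psi> a)" using \<psi> a by (simp add: cend_carr)
    ultimately show ?thesis
      using pext_lmul[OF C P P bil, of "[1]" 1 "[1, h]" 2, OF _ _ emb_in[OF \<phi>] \<psi>a[OF a]] by (simp add: R_def)
  qed
  define \<chi> where "\<chi> b a = (if a \<in> carr P then slice 2 P (coord b) (R a) else 0)" for b a
  have \<chi>_act: "slice 2 P y (R (act P h a)) = lmul H 2 P (tens H [1, h]) (slice 2 P y (R a))"
    if "a \<in> carr P" "y \<in> dual H" for y h a
    using slice_lmul[OF P that(2), of 2 "[h]" "R a"] R_in[OF that(1)] that by (simp add: R_act)
  have \<chi>: "\<chi> b \<in> carr (cend H P)" for b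
    unfolding cend_carr \<chi>_def
    using slice_in[OF P coord_props(1) _ R_in] \<chi>_act[OF _ coord_props(1)]
    by (simp add: left_moduleD(3,5)[OF P] R_add flinD(1)[OF flin_slice])
  obtain X where X: "finite X" "X \<subseteq> carr P" "generated_submodule P X = carr P"
    using fg unfolding finitely_generated_def by blast
  have "\<forall>a\<in>carr P. \<exists>D. expandable 2 P D (R a)"
    using expand[OF P _ R_in] by simp
  then obtain D where D: "\<And>a. a \<in> carr P \<Longrightarrow> expandable 2 P (D a) (R a)" by metis
  \<comment> \<open>The basis elements in the expansions for the generators. The slices are
    \<open>H\<close>-linear in \<open>a\<close>, so by \<open>out\<close> no other basis element
    contributes for any \<open>a\<close>.\<close>
  define E where "E = (\<Union>a\<in>X. D a)"
  have E: "finite E" using X D by (auto simp: E_def expandable_def subset_iff)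
  have R0: "R 0 = 0" using R_add[of 0 0] left_moduleD(1)[OF P] by simp
  have out: "slice 2 P (coord b) (R a) = 0" if b: "b \<notin> E" and a: "a \<in> carr P" for a b
  proof (rule generated_induct[OF P X(2,3) _ _ _ _ a])
    show "slice 2 P (coord b) (R a) = 0" if "a \<in> X" for a
      using D[of a] that X(2) b by (auto simp: E_def expandable_def)
    show "slice 2 P (coord b) (R 0) = 0" by (simp add: R0 flinD(3)[OF flin_slice])
    show "slice 2 P (coord b) (R (a - a')) = 0"
      if "a \<in> carr P" "a' \<in> carr P" "slice 2 P (coord b) (R a) = 0" "slice 2 P (coord b) (R a') = 0" for a a'
      using R_add[OF left_moduleD(2)[OF P that(1,2)] that(2)] that(3,4) by (simp add: flinD(1)[OF flin_slice])
    show "slice 2 P (coord b) (R (act P h a)) = 0" if "a \<in> carr P" "slice 2 P (coord b) (R a) = 0" for h a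
      using \<chi>_act[OF that(1) coord_props(1), of b h] that(2) by (simp add: flinD(3)[OF flin_lmul(1)])
  qed
  define A where "A = (\<Sum>b\<in>E. ptn 2 (cend H P) [b, 1] (\<chi> b))"
  have "A \<in> pseudo H 2 (cend H P)"
    unfolding A_def by (intro free.subspace_sum[OF subspace_pseudo[OF C]] ptens_in \<chi>) simp
  moreover have "capp H P 2 1 A (emb H P a) = R a" if a: "a \<in> carr P" for a
  proof -
    have "capp H P 2 1 A (emb H P a) = (\<Sum>b\<in>E. pinsert 2 P b (slice 2 P (coord b) (R a)))"
      unfolding A_def flin_sum[OF flin_pext(1)] using capp_pinsert[OF P \<chi> a] a by (simp add: \<chi>_def)
    also have "\<dots> = (\<Sum>b\<in>E \<union> D a. pinsert 2 P b (slice 2 P (coord b) (R a)))"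
      using D[OF a] E out[OF _ a]
      by (intro sum.mono_neutral_left) (auto simp: expandable_def flinD(3)[OF flin_pinsert])
    also have "\<dots> = (\<Sum>b\<in>D a. pinsert 2 P b (slice 2 P (coord b) (R a)))"
      using D[OF a] E
      by (intro sum.mono_neutral_right) (auto simp: expandable_def flinD(3)[OF flin_pinsert])
    also have "\<dots> = R a" using D[OF a] by (simp add: expandable_def)
    finally show ?thesis .
  qed
  ultimately show ?thesis unfolding R_def by blast
qed

lemma capp_eqI:
  assumes P: "left_module P" and A: "A \<in> pseudo H n (cend H P)" "A' \<in> pseudo H n (cend H P)" and n: "n \<ge> 1"
    and eq: "\<And>a. a \<in> carr P \<Longrightarrow> capp H P n 1 A (emb H P a) = capp H P n 1 A' (emb H P a)"
  shows "A = A'"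
  using capp_inj[OF P free.subspace_diff[OF subspace_pseudo[OF left_module_cend[OF P]] A] n] eq
  by (simp add: flinD(5)[OF flin_pext(1)])

lemma cend_prod:
  assumes P: "left_module P" and fg: "finitely_generated P"
    and \<phi>: "\<phi> \<in> carr (cend H P)" and \<psi>: "\<psi> \<in> carr (cend H P)"
  shows "cend_prod H P \<phi> \<psi> \<in> pseudo H 2 (cend H P)"
    "a \<in> carr P \<Longrightarrow> capp H P 2 1 (cend_prod H P \<phi> \<psi>) (emb H P a) = capp H P 1 2 (emb H (cend H P) \<phi>) (\<psi> a)"
proof -
  obtain A where A: "A \<in> pseudo H 2 (cend H P)"
    "\<forall>a\<in>carr P. capp H P 2 1 A (emb H P a) = capp H P 1 2 (emb H (cend H P) \<phi>) (\<psi> a)"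
    using cend_prod_exists[OF assms] by blast
  have "cend_prod H P \<phi> \<psi> = A"
    unfolding cend_prod_def
  proof (rule the_equality)
    fix A' assume "A' \<in> pseudo H 2 (cend H P) \<and>
      (\<forall>a\<in>carr P. capp H P 2 1 A' (emb H P a) = capp H P 1 2 (emb H (cend H P) \<phi>) (\<psi> a))"
    then show "A' = A" using A by (intro capp_eqI[OF P, of A' 2 A]) auto
  qed (use A in auto)
  then show "cend_prod H P \<phi> \<psi> \<in> pseudo H 2 (cend H P)"
    "a \<in> carr P \<Longrightarrow> capp H P 2 1 (cend_prod H P \<phi> \<psi>) (emb H P a) = capp H P 1 2 (emb H (cend H P) \<phi>) (\<psi> a)"
    using A by auto
qed

lemma emb_act_lmul: "left_module M \<Longrightarrow> a \<in> carr M \<Longrightarrow> emb H M (act M h a) = lmul H 1 M (tens H [h]) (emb H M a)"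
  by (simp add: emb_rules(3)) (simp add: emb_def lmul_tens)

text \<open>By \<open>capp_eqI\<close> elements of the target are compared after application to
  \<open>a\<close>; there \<open>f\<close> and \<open>g\<close> multiply the first two of three
  factors.\<close>

lemma hbilinear_cend_prod:
  assumes P: "left_module P" and fg: "finitely_generated P"
  shows "hbilinear (cend H P) (cend H P) (cend H P) (cend_prod H P)"
proof -
  note C = left_module_cend[OF P] and bil = hbilinear_cend[OF P]
  note prod = cend_prod[OF P fg]
  note add_in = free.subspace_add[OF subspace_pseudo[OF C]]
  show ?thesis
    unfolding hbilinear_def
  proof (intro conjI ballI allI)
    fix \<phi> \<psi> assume \<phi>: "\<phi> \<in> carr (cend H P)" and \<psi>: "\<psi> \<in> carr (cend H P)"
    show "cend_prod H P \<phi> \<psi> \<in> pseudo H 2 (cend H P)" by (rule prod(1)[OF \<phi> \<psi>])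
    have \<psi>a: "\<psi> a \<in> pseudo H 2 P" if "a \<in> carr P" for a using \<psi> that by (simp add: cend_carr)
    show "cend_prod H P (\<phi> + \<phi>') \<psi> = cend_prod H P \<phi> \<psi> + cend_prod H P \<phi>' \<psi>" if \<phi>': "\<phi>' \<in> carr (cend H P)" for \<phi>'
      by (rule capp_eqI[OF P prod(1)[OF left_moduleD(3)[OF C \<phi> \<phi>'] \<psi>] add_in[OF prod(1)[OF \<phi> \<psi>] prod(1)[OF \<phi>' \<psi>]]])
        (simp_all add: prod(2)[OF left_moduleD(3)[OF C \<phi> \<phi>'] \<psi>] flinD(1)[OF flin_pext(1)] prod(2)[OF \<phi> \<psi>] prod(2)[OF \<phi>' \<psi>]
          emb_rules(1)[OF C \<phi> \<phi>'])
    show "cend_prod H P \<phi> (\<psi> + \<psi>') = cend_prod H P \<phi> \<psi> + cend_prod H P \<phi> \<psi>'" if \<psi>': "\<psi>' \<in> carr (cend H P)" for \<psi>'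
      by (rule capp_eqI[OF P prod(1)[OF \<phi> left_moduleD(3)[OF C \<psi> \<psi>']] add_in[OF prod(1)[OF \<phi> \<psi>] prod(1)[OF \<phi> \<psi>']]])
        (simp_all add: prod(2)[OF \<phi> left_moduleD(3)[OF C \<psi> \<psi>']] flinD(1)[OF flin_pext(1)] flinD(1)[OF flin_pext(2)]
          prod(2)[OF \<phi> \<psi>] prod(2)[OF \<phi> \<psi>'])
    fix f g
    note f\<phi> = left_moduleD(5)[OF C \<phi>, of f] and g\<psi> = left_moduleD(5)[OF C \<psi>, of g]
    show "cend_prod H P (act (cend H P) f \<phi>) (act (cend H P) g \<psi>) = lmul H 2 (cend H P) (tens H [f, g]) (cend_prod H P \<phi> \<psi>)"
    proof (rule capp_eqI[OF P prod(1)[OF f\<phi> g\<psi>] lmul_in[OF C _ prod(1)[OF \<phi> \<psi>]]])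
      fix a assume a: "a \<in> carr P"
      have e: "lmul H 1 P (tens H [1]) (emb H P a) = emb H P a"
        using lmul_ones[OF P emb_in[OF a]] by simp
      have "capp H P 2 1 (cend_prod H P (act (cend H P) f \<phi>) (act (cend H P) g \<psi>)) (emb H P a)
          = capp H P 1 2 (lmul H 1 (cend H P) (tens H [f]) (emb H (cend H P) \<phi>)) (lmul H 2 P (tens H [g, 1]) (\<psi> a))"
        using prod(2)[OF f\<phi> g\<psi> a] emb_act_lmul[OF C \<phi>] by (simp add: cend_act)
      also have "\<dots> = lmul H 3 P (tens H [f, g, 1]) (capp H P 1 2 (emb H (cend H P) \<phi>) (\<psi> a))"
        using pext_lmul[OF C P P bil, of "[f]" 1 "[g, 1]" 2, OF _ _ emb_in[OF \<phi>] \<psi>a[OF a]] by simp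
      also have "\<dots> = capp H P 2 1 (lmul H 2 (cend H P) (tens H [f, g]) (cend_prod H P \<phi> \<psi>)) (emb H P a)"
        using pext_lmul[OF C P P bil, of "[f, g]" 2 "[1]" 1, OF _ _ prod(1)[OF \<phi> \<psi>] emb_in[OF a]]
        by (simp add: e prod(2)[OF \<phi> \<psi> a])
      finally show "capp H P 2 1 (cend_prod H P (act (cend H P) f \<phi>) (act (cend H P) g \<psi>)) (emb H P a)
        = capp H P 2 1 (lmul H 2 (cend H P) (tens H [f, g]) (cend_prod H P \<phi> \<psi>)) (emb H P a)" .
    qed simp_all
  qed
qed

lemma transpose_permutes [simp]: "i < n \<Longrightarrow> j < n \<Longrightarrow> transpose i j permutes {..<n}"
  by (rule permutes_swap_id) auto

lemma hbilinear_cend_bracket: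
  assumes P: "left_module P" and fg: "finitely_generated P"
  shows "hbilinear (cend H P) (cend H P) (cend H P) (cend_bracket H P)"
proof -
  note C = left_module_cend[OF P] and b = hbilinear_cend_prod[OF P fg]
  note D = hbilinearD[OF b]
  show ?thesis
    unfolding hbilinear_def cend_bracket_def
    by (auto simp: D(2-4) left_moduleD(3,5)[OF C] flinD[OF flin_lmul(2)] flinD[OF flin_lmul(1)] pperm_lmul_2[OF C D(1)]
        intro!: free.subspace_diff[OF subspace_pseudo[OF C]] pperm_in[OF C] D(1))
qed

lemma cend_bracket_skew:
  assumes P: "left_module P" and fg: "finitely_generated P"
    and \<phi>: "\<phi> \<in> carr (cend H P)" and \<psi>: "\<psi> \<in> carr (cend H P)"
  shows "pperm H 2 (cend H P) (transpose 0 1) (cend_bracket H P \<phi> \<psi>) = - cend_bracket H P \<psi> \<phi>"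
  unfolding cend_bracket_def flinD(5)[OF flin_lmul(2)]
  using pperm_pperm[OF left_module_cend[OF P] cend_prod(1)[OF P fg \<psi> \<phi>], of 0 1] by simp

end

section \<open>Jordan pseudoalgebras and their structure maps on words\<close>

context cocommutative_hopf
begin

lemmas wmul_lin = flinD(1)[OF flin_wmul(1)] flinD(2)[OF flin_wmul(1)] flinD(3)[OF flin_wmul(1)]
  flinD(4)[OF flin_wmul(1)] flinD(5)[OF flin_wmul(1)]
  flinD(1)[OF flin_wmul(2)] flinD(2)[OF flin_wmul(2)] flinD(3)[OF flin_wmul(2)]
  flinD(4)[OF flin_wmul(2)] flinD(5)[OF flin_wmul(2)]

lemmas wpush_lin = flinD[OF flin_wpush]

lemmas scale_distribs = free.scale_right_distrib free.scale_right_diff_distrib free.scale_minus_right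

end

lemma permute_list_transpose:
  "permute_list (transpose 0 1) [a, b] = [b, a]"
  "permute_list (transpose 0 1) [a, b, c] = [b, a, c]" "permute_list (transpose 1 2) [a, b, c] = [a, c, b]"
  "permute_list (transpose 0 2) [a, b, c, d] = [c, b, a, d]" "permute_list (transpose 0 3) [a, b, c, d] = [d, b, c, a]"
  "permute_list (transpose 1 2) [a, b, c, d] = [a, c, b, d]" "permute_list (transpose 1 3) [a, b, c, d] = [a, d, c, b]"
  "permute_list (transpose 2 3) [a, b, c, d] = [a, b, d, c]"
  by (simp_all add: permute_list_def upt_rec transpose_def)

lemma (in cocommutative_hopf) pext_emb_3:
  assumes A: "left_module A" and B': "left_module B'" and M: "left_module M" and \<mu>: "hbilinear A B' M \<mu>"
  shows "a \<in> carr A \<Longrightarrow> Y \<in> pseudo H 2 B' \<Longrightarrow> pext H 1 2 M \<mu> (emb H A a) Y \<in> pseudo H 3 M"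
    "a \<in> carr A \<Longrightarrow> Y \<in> pseudo H 2 B' \<Longrightarrow>
      Theta M [w0, w1, w2] (pext H 1 2 M \<mu> (emb H A a) Y) = wmul M \<mu> (wtens A w0 a) (Theta B' [w1, w2] Y)"
    "X \<in> pseudo H 2 A \<Longrightarrow> b \<in> carr B' \<Longrightarrow> pext H 2 1 M \<mu> X (emb H B' b) \<in> pseudo H 3 M"
    "X \<in> pseudo H 2 A \<Longrightarrow> b \<in> carr B' \<Longrightarrow>
      Theta M [w0, w1, w2] (pext H 2 1 M \<mu> X (emb H B' b)) = wmul M \<mu> (Theta A [w0, w1] X) (wtens B' w2 b)"
  using pext_in[OF A B' M \<mu> emb_in, of a Y 2] pext_in[OF A B' M \<mu> _ emb_in, of X 2 b]
    Theta_pext[OF A B' M \<mu>, of "[w0]" 1 "[w1, w2]" 2 "emb H A a" Y] Theta_pext[OF A B' M \<mu>, of "[w0, w1]" 2 "[w2]" 1 X "emb H B' b"]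
  by (simp_all add: emb_in Theta_emb[OF A] Theta_emb[OF B'])

locale finite_jordan = cocommutative_hopf_basis H B for H :: "('k::field_char_0, 'h::ring_1) hopf" and B +
  fixes J :: "('k, 'h, 'm::ab_group_add) pseudoalg"
  assumes jordan: "jordan_pseudoalgebra H J" and finite_J: "finitely_generated J"
begin

abbreviation "C \<equiv> cend H J"
abbreviation "jm \<equiv> wmul J (pprod J)"
abbreviation "ap \<equiv> wmul J (\<lambda>\<phi>. \<phi> :: ('k, 'h, 'm) conf)"
abbreviation "cb \<equiv> wmul C (cend_bracket H J)"

lemma J: "left_module J"
  using jordan by (simp add: jordan_pseudoalgebra_def pseudoalgebra_def)

lemma C: "left_module C" by (rule left_module_cend[OF J])

lemma J_bil: "hbilinear J J J (pprod J)"
  using jordan unfolding hbilinear_def jordan_pseudoalgebra_def pseudoalgebra_def by blast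

lemma ap_bil: "hbilinear C J J (\<lambda>\<phi>. \<phi>)" by (rule hbilinear_cend[OF J])

lemma cb_bil: "hbilinear C C C (cend_bracket H J)" by (rule hbilinear_cend_bracket[OF J finite_J])

lemma jm_in: "u \<in> word_space J \<Longrightarrow> v \<in> word_space J \<Longrightarrow> jm u v \<in> word_space J"
  by (rule wmul_in[OF J J J J_bil])

lemma ap_in: "u \<in> word_space C \<Longrightarrow> v \<in> word_space J \<Longrightarrow> ap u v \<in> word_space J"
  by (rule wmul_in[OF C J J ap_bil])

lemma cb_in: "u \<in> word_space C \<Longrightarrow> v \<in> word_space C \<Longrightarrow> cb u v \<in> word_space C"
  by (rule wmul_in[OF C C C cb_bil])

lemmas jm_wtens = wmul_wtens[OF J J J J_bil]
lemmas ap_wtens = wmul_wtens[OF C J J ap_bil]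
lemmas cb_wtens = wmul_wtens[OF C C C cb_bil]

lemma J_prod_in: "a \<in> carr J \<Longrightarrow> b \<in> carr J \<Longrightarrow> pprod J a b \<in> pseudo H 2 J"
  by (rule hbilinearD(1)[OF J_bil])

lemma app_in: "\<phi> \<in> carr C \<Longrightarrow> a \<in> carr J \<Longrightarrow> \<phi> a \<in> pseudo H 2 J"
  by (rule hbilinearD(1)[OF ap_bil])

lemma J_comm: "a \<in> carr J \<Longrightarrow> b \<in> carr J \<Longrightarrow> pprod J a b = pswap J (pprod J b a)"
  using jordan unfolding jordan_pseudoalgebra_def by blast

lemma Theta_swap:
  assumes "left_module M" "X \<in> pseudo H 2 M"
  shows "Theta M [w, w'] (pswap M X) = Theta M [w', w] X"
  using Theta_pperm[OF assms(1) _ _ assms(2), of "transpose 0 1" "[w, w']"] by (simp add: permute_list_transpose)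

text \<open>On pure words the permutation in the commutativity law of \<open>J\<close> exchanges the
  two words, as does exchanging the arguments.\<close>

lemma jm_commute:
  assumes u: "u \<in> word_space J" and v: "v \<in> word_space J" shows "jm u v = jm v u"
proof (rule word_space_eqI[OF J flin_wmul(1) flin_wmul(2) _ u])
  fix w a assume a: "a \<in> carr J"
  show "jm (wtens J w a) v = jm v (wtens J w a)"
  proof (rule word_space_eqI[OF J flin_wmul(2) flin_wmul(1) _ v])
    fix w' b assume b: "b \<in> carr J"
    show "jm (wtens J w a) (wtens J w' b) = jm (wtens J w' b) (wtens J w a)"
      unfolding jm_wtens[OF a b] jm_wtens[OF b a] J_comm[OF a b] by (rule Theta_swap[OF J J_prod_in[OF b a]])
  qed
qed

lemma Theta_jm_2: "a \<in> carr J \<Longrightarrow> b \<in> carr J \<Longrightarrow> Theta J [w, w'] (pprod J a b) = jm (wtens J w a) (wtens J w' b)"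
  by (simp add: jm_wtens)

lemma Theta_ap_2: "\<phi> \<in> carr C \<Longrightarrow> b \<in> carr J \<Longrightarrow> Theta J [w, w'] (\<phi> b) = ap (wtens C w \<phi>) (wtens J w' b)"
  by (simp add: ap_wtens)

lemmas pseudo_3_in = pext_emb_3(1,3)[OF J J J J_bil] pext_emb_3(1,3)[OF C J J ap_bil]
lemmas Theta_3 = pext_emb_3(2,4)[OF J J J J_bil] pext_emb_3(2,4)[OF C J J ap_bil]

text \<open>\<open>Theta\<close> at four arbitrary words turns the permutations in the Jordan
  identity into exchanges of words. What remains is the linearised Jordan identity of a commutative
  algebra.\<close>

lemma jordan_words_wtens:
  fixes w0 w1 w2 w3 :: "(nat \<times> 'h) list"
  assumes a: "a \<in> carr J" and b: "b \<in> carr J" and c: "c \<in> carr J" and d: "d \<in> carr J"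
  defines "x \<equiv> wtens J w0 a" and "y \<equiv> wtens J w1 b" and "z \<equiv> wtens J w2 c" and "t \<equiv> wtens J w3 d"
  shows "jm x (jm y (jm z t)) + jm t (jm y (jm z x)) + jm z (jm y (jm x t))
    = jm (jm x y) (jm z t) + jm (jm x z) (jm y t) + jm (jm x t) (jm z y)"
proof -
  have n13: "pp H J 1 3 (emb H J a) (pp H J 1 2 (emb H J b) (pprod J c d)) \<in> pseudo H 4 J"
    and t13: "Theta J [w0, w1, w2, w3] (pp H J 1 3 (emb H J a) (pp H J 1 2 (emb H J b) (pprod J c d)))
      = jm (wtens J w0 a) (jm (wtens J w1 b) (jm (wtens J w2 c) (wtens J w3 d)))"
    if "a \<in> carr J" "b \<in> carr J" "c \<in> carr J" "d \<in> carr J" for a b c d w0 w1 w2 w3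
  proof -
    have X: "pp H J 1 2 (emb H J b) (pprod J c d) \<in> pseudo H 3 J"
      by (rule pseudo_3_in(1)[OF that(2) J_prod_in[OF that(3,4)]])
    show "pp H J 1 3 (emb H J a) (pp H J 1 2 (emb H J b) (pprod J c d)) \<in> pseudo H 4 J"
      using pext_in[OF J J J J_bil emb_in[OF that(1)] X] by simp
    show "Theta J [w0, w1, w2, w3] (pp H J 1 3 (emb H J a) (pp H J 1 2 (emb H J b) (pprod J c d)))
      = jm (wtens J w0 a) (jm (wtens J w1 b) (jm (wtens J w2 c) (wtens J w3 d)))"
      using Theta_pext[OF J J J J_bil, of "[w0]" 1 "[w1, w2, w3]" 3, OF _ _ emb_in[OF that(1)] X]
      by (simp add: Theta_emb[OF J that(1)] Theta_3(1)[OF that(2) J_prod_in[OF that(3,4)]] Theta_jm_2 that)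
  qed
  have n22: "pp H J 2 2 (pprod J a b) (pprod J c d) \<in> pseudo H 4 J"
    and t22: "Theta J [w0, w1, w2, w3] (pp H J 2 2 (pprod J a b) (pprod J c d))
      = jm (jm (wtens J w0 a) (wtens J w1 b)) (jm (wtens J w2 c) (wtens J w3 d))"
    if "a \<in> carr J" "b \<in> carr J" "c \<in> carr J" "d \<in> carr J" for a b c d w0 w1 w2 w3
    using pext_in[OF J J J J_bil J_prod_in[OF that(1,2)] J_prod_in[OF that(3,4)]]
      Theta_pext[OF J J J J_bil, of "[w0, w1]" 2 "[w2, w3]" 2, OF _ _ J_prod_in[OF that(1,2)] J_prod_in[OF that(3,4)]]
    by (simp_all add: Theta_jm_2 that)
  have p: "Theta J [w0, w1, w2, w3] (pperm H 4 J \<sigma> X) = Theta J (permute_list \<sigma> [w0, w1, w2, w3]) X"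
    if "X \<in> pseudo H 4 J" "\<sigma> permutes {..<4}" for X \<sigma>
    by (rule Theta_pperm[OF J that(2) _ that(1)]) simp
  have "pp H J 1 3 (emb H J a) (pp H J 1 2 (emb H J b) (pprod J c d))
      + pperm H 4 J (transpose 0 3) (pp H J 1 3 (emb H J d) (pp H J 1 2 (emb H J b) (pprod J c a)))
      + pperm H 4 J (transpose 0 2) (pp H J 1 3 (emb H J c) (pp H J 1 2 (emb H J b) (pprod J a d)))
      = pp H J 2 2 (pprod J a b) (pprod J c d)
      + pperm H 4 J (transpose 1 2) (pp H J 2 2 (pprod J a c) (pprod J b d))
      + pperm H 4 J (transpose 1 3) (pp H J 2 2 (pprod J a d) (pprod J c b))"
    using jordan a b c d unfolding jordan_pseudoalgebra_def by blast
  from arg_cong[OF this, of "Theta J [w0, w1, w2, w3]"] show ?thesis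
    unfolding flinD(1)[OF flin_Theta]
    by (simp add: p n13 n22 t13 t22 a b c d permute_list_transpose x_def y_def z_def t_def)
qed

lemma jordan_words:
  assumes "x \<in> word_space J" "y \<in> word_space J" "z \<in> word_space J" "t \<in> word_space J"
  shows "jm x (jm y (jm z t)) + jm t (jm y (jm z x)) + jm z (jm y (jm x t))
    = jm (jm x y) (jm z t) + jm (jm x z) (jm y t) + jm (jm x t) (jm z y)"
proof (rule word_space_eqI[OF J _ _ _ assms(1)], goal_cases)
  case (3 w0 a)
  show ?case
  proof (rule word_space_eqI[OF J _ _ _ assms(2)], goal_cases)
    case (3 w1 b)
    show ?case
    proof (rule word_space_eqI[OF J _ _ _ assms(3)], goal_cases)
      case (3 w2 c)
      show ?case
      proof (rule word_space_eqI[OF J _ _ _ assms(4)], goal_cases)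
        case (3 w3 d)
        show ?case by (rule jordan_words_wtens) fact+
      qed (simp_all add: flin_def wmul_lin scale_distribs)
    qed (simp_all add: flin_def wmul_lin scale_distribs)
  qed (simp_all add: flin_def wmul_lin scale_distribs)
qed (simp_all add: flin_def wmul_lin scale_distribs)

text \<open>By commutativity the right-hand side of the Jordan identity is symmetric in its first
  two arguments. Subtracting the identity with these exchanged shows that \<open>[L_x, L_y]\<close>
  is a derivation.\<close>

lemma jm_commutator_derivation:
  assumes x: "x \<in> word_space J" and y: "y \<in> word_space J" and z: "z \<in> word_space J" and t: "t \<in> word_space J"
  shows "jm x (jm y (jm z t)) - jm y (jm x (jm z t))
    = jm (jm x (jm y z) - jm y (jm x z)) t + jm z (jm x (jm y t) - jm y (jm x t))"
  using jordan_words[OF x y z t] jordan_words[OF y x z t]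
    jm_commute[OF jm_in[OF x jm_in[OF y z]] t] jm_commute[OF jm_in[OF y jm_in[OF x z]] t]
    jm_commute[OF y z] jm_commute[OF x z] jm_commute[OF x y]
    jm_commute[OF jm_in[OF y z] jm_in[OF x t]] jm_commute[OF jm_in[OF y t] jm_in[OF x z]]
    jm_commute[OF jm_in[OF x z] jm_in[OF y t]]
  by (simp add: wmul_lin algebra_simps)

text \<open>Here the second argument of the Jordan identity serves as the operand \<open>t\<close>.
  Collecting terms, the commutators \<open>[L_(x y), L_z]\<close> sum to zero over cyclic
  permutations of \<open>x\<close>, \<open>y\<close>, \<open>z\<close>.\<close>

lemma jm_cyclic:
  assumes x: "x \<in> word_space J" and y: "y \<in> word_space J" and z: "z \<in> word_space J" and t: "t \<in> word_space J"
  shows "jm (jm x y) (jm z t) - jm z (jm (jm x y) t) + (jm (jm z x) (jm y t) - jm y (jm (jm z x) t))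
    + (jm (jm z y) (jm x t) - jm x (jm (jm z y) t)) = 0"
  using jordan_words[OF z t x y]
    jm_commute[OF jm_in[OF x y] t] jm_commute[OF jm_in[OF z x] t] jm_commute[OF jm_in[OF z y] t]
    jm_commute[OF x y] jm_commute[OF z x] jm_commute[OF z y] jm_commute[OF z t] jm_commute[OF y t] jm_commute[OF x t]
    jm_commute[OF jm_in[OF x y] jm_in[OF z t]] jm_commute[OF jm_in[OF z x] jm_in[OF y t]]
    jm_commute[OF jm_in[OF z y] jm_in[OF x t]]
  by (simp add: algebra_simps)

lemma ap_cend_prod:
  assumes u: "u \<in> word_space C" and v: "v \<in> word_space C" and z: "z \<in> word_space J"
  shows "ap (wmul C (cend_prod H J) u v) z = ap u (ap v z)"
proof (rule word_space_eqI[OF C _ _ _ u], goal_cases)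
  case (3 w0 \<phi>)
  show ?case
  proof (rule word_space_eqI[OF C _ _ _ v], goal_cases)
    case (3 w1 \<psi>)
    show ?case
    proof (rule word_space_eqI[OF J _ _ _ z], goal_cases)
      case (3 w2 a)
      note \<phi> = \<open>\<phi> \<in> carr C\<close> and \<psi> = \<open>\<psi> \<in> carr C\<close> and a = \<open>a \<in> carr J\<close>
      note pr = cend_prod[OF J finite_J \<phi> \<psi>]
      have "ap (Theta C [w0, w1] (cend_prod H J \<phi> \<psi>)) (wtens J w2 a) = ap (wtens C w0 \<phi>) (Theta J [w1, w2] (\<psi> a))"
        using Theta_3(4)[OF pr(1) a, of w0 w1 w2] Theta_3(3)[OF \<phi> app_in[OF \<psi> a], of w0 w1 w2] pr(2)[OF a] by simp
      then show ?case
        by (simp add: wmul_wtens[OF C C C hbilinear_cend_prod[OF J finite_J] \<phi> \<psi>] ap_wtens[OF \<psi> a])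
    qed (simp_all add: flin_def wmul_lin scale_distribs)
  qed (simp_all add: flin_def wmul_lin scale_distribs)
qed (simp_all add: flin_def wmul_lin scale_distribs)

lemma cb_eq:
  assumes u: "u \<in> word_space C" and v: "v \<in> word_space C"
  shows "cb u v = wmul C (cend_prod H J) u v - wmul C (cend_prod H J) v u"
proof (rule word_space_eqI[OF C _ _ _ u], goal_cases)
  case (3 w0 \<phi>)
  show ?case
  proof (rule word_space_eqI[OF C _ _ _ v], goal_cases)
    case (3 w1 \<psi>)
    note \<phi> = \<open>\<phi> \<in> carr C\<close> and \<psi> = \<open>\<psi> \<in> carr C\<close>
    note W = wmul_wtens[OF C C C hbilinear_cend_prod[OF J finite_J]]
    show ?case
      using Theta_swap[OF C cend_prod(1)[OF J finite_J \<psi> \<phi>], of w0 w1]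
      unfolding cb_wtens[OF \<phi> \<psi>] W[OF \<phi> \<psi>] W[OF \<psi> \<phi>] by (simp add: cend_bracket_def flinD(5)[OF flin_Theta])
  qed (simp_all add: flin_def wmul_lin scale_distribs algebra_simps)
qed (simp_all add: flin_def wmul_lin scale_distribs algebra_simps)

lemma ap_cb:
  assumes "u \<in> word_space C" "v \<in> word_space C" "z \<in> word_space J"
  shows "ap (cb u v) z = ap u (ap v z) - ap v (ap u z)"
  using assms by (simp add: cb_eq wmul_lin ap_cend_prod)

lemma lmap_hom: "module_hom_on J C (lmap J)"
  unfolding module_hom_on_def
proof (intro conjI ballI allI)
  fix a assume a: "a \<in> carr J"
  show "lmap J a \<in> carr C"
    using hbilinearD(1,3)[OF J_bil a] hbilinear_act(2)[OF J_bil J J a]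
    by (simp add: cend_carr lmap_def left_moduleD(3,5)[OF J])
  show "lmap J (a + b) = lmap J a + lmap J b" if "b \<in> carr J" for b
    using hbilinearD(2)[OF J_bil a that] by (simp add: lmap_def fun_eq_iff)
  show "lmap J (act J h a) = act C h (lmap J a)" for h
    using hbilinear_act(1)[OF J_bil J J a] by (simp add: lmap_def cend_act fun_eq_iff flinD(3)[OF flin_lmul(1)])
qed

abbreviation "pushL \<equiv> push H 2 C (lmap J)"

lemma lmap_in: "a \<in> carr J \<Longrightarrow> lmap J a \<in> carr C"
  by (rule module_hom_onD(1)[OF lmap_hom])

abbreviation "lm \<equiv> wpush C (lmap J)"

lemma lm_wtens: "a \<in> carr J \<Longrightarrow> lm (wtens J w a) = wtens C w (lmap J a)"
  by (rule wpush_wtens[OF J C lmap_hom])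

lemma lm_in: "u \<in> word_space J \<Longrightarrow> lm u \<in> word_space C"
  by (rule wpush_in[OF J C lmap_hom])

lemma ap_lm:
  assumes u: "u \<in> word_space J" and v: "v \<in> word_space J" shows "ap (lm u) v = jm u v"
proof (rule word_space_eqI[OF J _ _ _ u], goal_cases)
  case (3 w a)
  show ?case
  proof (rule word_space_eqI[OF J _ _ _ v], goal_cases)
    case (3 w' b)
    then show ?case
      using \<open>a \<in> carr J\<close> by (simp add: lm_wtens ap_wtens[OF lmap_in] jm_wtens) (simp add: lmap_def)
  qed (simp_all add: flin_def wmul_lin scale_distribs)
qed (simp_all add: flin_def wmul_lin wpush_lin scale_distribs)

section \<open>Pseudoderivations\<close>

definition der_words :: "((nat \<times> 'h) list \<times> ('k, 'h, 'm) conf \<Rightarrow>\<^sub>0 'k) set" where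
  "der_words = {u \<in> word_space C. \<forall>x\<in>word_space J. \<forall>y\<in>word_space J. ap u (jm x y) = jm (ap u x) y + jm x (ap u y)}"

lemma der_wordsD:
  assumes "u \<in> der_words"
  shows "u \<in> word_space C"
    "x \<in> word_space J \<Longrightarrow> y \<in> word_space J \<Longrightarrow> ap u (jm x y) = jm (ap u x) y + jm x (ap u y)"
  using assms by (auto simp: der_words_def)

lemma subspace_der_words: "free.subspace der_words"
  by (rule free.subspaceI)
    (auto simp: der_words_def wmul_lin scale_distribs free.subspace_0[OF subspace_word_space[OF C]]
      free.subspace_add[OF subspace_word_space[OF C]] free.subspace_scale[OF subspace_word_space[OF C]])

lemma letters_3: "letters 3 = [[(0, 1)], [(1, 1)], [(2, 1)]]"
  and letters_4: "letters 4 = [[(0, 1)], [(1, 1)], [(2, 1)], [(3, 1)]]"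
  by (simp_all add: upt_rec)

lemma Theta_swap_3:
  assumes "left_module M" "X \<in> pseudo H 3 M"
  shows "Theta M [w0, w1, w2] (pperm H 3 M (transpose 0 1) X) = Theta M [w1, w0, w2] X"
    "Theta M [w0, w1, w2] (pperm H 3 M (transpose 1 2) X) = Theta M [w0, w2, w1] X"
  using Theta_pperm[OF assms(1) _ _ assms(2), of "transpose 0 1" "[w0, w1, w2]"]
    Theta_pperm[OF assms(1) _ _ assms(2), of "transpose 1 2" "[w0, w1, w2]"] by (simp_all add: permute_list_transpose)

text \<open>One direction applies \<open>Theta\<close> at arbitrary words; the other returns from
  words by using three distinct letters and \<open>Theta_letters_inj\<close>.\<close>

lemma der_iff: "D \<in> carr (der H J) \<longleftrightarrow> D \<in> carr C \<and> (\<forall>w. wtens C w D \<in> der_words)"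
proof -
  have T: "Theta J [w0, w1, w2] (capp H J 1 2 (emb H C D) (pprod J a b)) = ap (wtens C w0 D) (jm (wtens J w1 a) (wtens J w2 b))"
    "Theta J [w0, w1, w2] (pp H J 2 1 (D a) (emb H J b)
        + pperm H 3 J (transpose 0 1) (pp H J 1 2 (emb H J a) (D b)))
      = jm (ap (wtens C w0 D) (wtens J w1 a)) (wtens J w2 b) + jm (wtens J w1 a) (ap (wtens C w0 D) (wtens J w2 b))"
    if D: "D \<in> carr C" and a: "a \<in> carr J" and b: "b \<in> carr J" for D a b w0 w1 w2
    by (simp_all add: Theta_3 D a b J_prod_in app_in Theta_jm_2 Theta_ap_2 flinD(1)[OF flin_Theta]
        Theta_swap_3[OF J] pseudo_3_in)
  show ?thesis
  proof
    assume "D \<in> carr (der H J)"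
    then have D: "D \<in> carr C" and eq: "\<And>a b. a \<in> carr J \<Longrightarrow> b \<in> carr J \<Longrightarrow>
        capp H J 1 2 (emb H C D) (pprod J a b)
        = pp H J 2 1 (D a) (emb H J b) + pperm H 3 J (transpose 0 1) (pp H J 1 2 (emb H J a) (D b))"
      by (auto simp: der_def)
    have "ap (wtens C w D) (jm x y) = jm (ap (wtens C w D) x) y + jm x (ap (wtens C w D) y)"
      if x: "x \<in> word_space J" and y: "y \<in> word_space J" for w x y
    proof (rule word_space_eqI[OF J _ _ _ x], goal_cases)
      case (3 w1 a)
      show ?case
      proof (rule word_space_eqI[OF J _ _ _ y], goal_cases)
        case (3 w2 b)
        show ?case
          using T[OF D \<open>a \<in> carr J\<close> \<open>b \<in> carr J\<close>, of w w1 w2] eq[OF \<open>a \<in> carr J\<close> \<open>b \<in> carr J\<close>] by simp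
      qed (simp_all add: flin_def wmul_lin scale_distribs)
    qed (simp_all add: flin_def wmul_lin scale_distribs)
    then show "D \<in> carr C \<and> (\<forall>w. wtens C w D \<in> der_words)"
      using D by (simp add: der_words_def wtens_in)
  next
    assume h: "D \<in> carr C \<and> (\<forall>w. wtens C w D \<in> der_words)"
    then have D: "D \<in> carr C" by blast
    have "capp H J 1 2 (emb H C D) (pprod J a b)
        = pp H J 2 1 (D a) (emb H J b) + pperm H 3 J (transpose 0 1) (pp H J 1 2 (emb H J a) (D b))"
      if a: "a \<in> carr J" and b: "b \<in> carr J" for a b
    proof (rule Theta_letters_inj[OF J, of _ 3])
      show "capp H J 1 2 (emb H C D) (pprod J a b) \<in> pseudo H 3 J"
        by (rule pseudo_3_in(3)[OF D J_prod_in[OF a b]])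
      show "pp H J 2 1 (D a) (emb H J b) + pperm H 3 J (transpose 0 1) (pp H J 1 2 (emb H J a) (D b)) \<in> pseudo H 3 J"
        by (intro free.subspace_add[OF subspace_pseudo[OF J]] pseudo_3_in pperm_in[OF J] app_in D a b) simp
      show "Theta J (letters 3) (capp H J 1 2 (emb H C D) (pprod J a b)) =
        Theta J (letters 3) (pp H J 2 1 (D a) (emb H J b) + pperm H 3 J (transpose 0 1) (pp H J 1 2 (emb H J a) (D b)))"
        unfolding letters_3 T[OF D a b] using h a b by (intro der_wordsD(2)) (auto intro: wtens_in)
    qed
    then show "D \<in> carr (der H J)" using D by (simp add: der_def)
  qed
qed

lemma der_act: "act (der H J) = act C"
  by (simp add: der_def)

lemma submodule_der: "submodule C (carr (der H J))"
proof (rule submoduleI)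
  show "carr (der H J) \<subseteq> carr C" using der_iff by blast
  show "0 \<in> carr (der H J)"
    unfolding der_iff using left_moduleD(1)[OF C] free.subspace_0[OF subspace_der_words] by (simp add: wtens_zero[OF C])
  fix D assume D: "D \<in> carr (der H J)"
  then have D': "D \<in> carr C" and Dw: "wtens C w D \<in> der_words" for w using der_iff by auto
  show "D - T \<in> carr (der H J)" if T: "T \<in> carr (der H J)" for T
  proof -
    have T': "T \<in> carr C" and Tw: "wtens C w T \<in> der_words" for w using der_iff T by auto
    have "wtens C w (D - T) = wtens C w D - wtens C w T" for w
      using wtens_rules(3)[OF C left_moduleD(2)[OF C D' T'] T', of w] by simp
    then show ?thesis
      unfolding der_iff using left_moduleD(2)[OF C D' T'] free.subspace_diff[OF subspace_der_words Dw Tw] by simp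
  qed
  show "act C h D \<in> carr (der H J)" for h
    unfolding der_iff using left_moduleD(5)[OF C D'] wtens_rules(4)[OF C D', symmetric]
      wact_mem[OF subspace_der_words, of "\<lambda>u. wtens C u D" _ h] Dw by simp
qed

lemma left_module_der: "left_module (der H J)"
  by (rule left_module_submodule[OF C submodule_der der_act])

text \<open>The slice changes the first two factors and the permutation the last two; after the
  slice all positions are lower by one.\<close>

lemma slice_pperm_4:
  assumes y: "y \<in> dual H" and X: "X \<in> pseudo H 4 J"
  shows "slice 3 J y (pperm H 4 J (transpose 2 3) X) = pperm H 3 J (transpose 1 2) (slice 3 J y X)"
proof (rule pseudo_eqI[OF J flin_comp[OF flin_slice flin_lmul(2)] flin_comp[OF flin_lmul(2) flin_slice] _ X])
  have s: "Suc 3 = 4" by simp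
  note sl = slice_tens[OF J y, of 3, unfolded s]
  fix xs :: "'h list" and c assume xs: "length xs = 4" and c: "c \<in> carr J"
  have "xs = [xs ! 0, xs ! 1, xs ! 2, xs ! 3]"
    by (rule nth_equalityI) (use xs in \<open>auto simp: less_Suc_eq eval_nat_numeral simp del: Suc_1 One_nat_def[symmetric]\<close>)
  then obtain f g p q where r: "xs = [f, g, p, q]" by blast
  show "slice 3 J y (pperm H 4 J (transpose 2 3) (ptn 4 J xs c))
      = pperm H 3 J (transpose 1 2) (slice 3 J y (ptn 4 J xs c))"
    using c by (simp add: pperm_tens[OF J] r permute_list_transpose sl slice_list_flin[OF flin_lmul(2)])
      (simp add: slice_list_Cons pperm_tens[OF J] permute_list_transpose)
qed

text \<open>The derivation property is given for \<open>A\<close> on words and wanted for its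
  coefficients. Distinct letters bring it back to an identity with four factors, and slicing off the
  first one leaves it for \<open>coef C y A\<close>.\<close>

lemma pspan_derI:
  assumes A: "A \<in> pseudo H 2 C" and der: "\<And>w w'. Theta C [w, w'] A \<in> der_words"
  shows "A \<in> pspan 2 C (carr (der H J))"
  unfolding coef_mem_iff[OF C submodule_der A]
proof
  fix y assume y: "y \<in> dual H"
  define \<chi> where "\<chi> = coef C y A"
  have \<chi>: "\<chi> \<in> carr C" unfolding \<chi>_def by (rule coef_in[OF C y A])
  have e\<chi>: "emb H C \<chi> = slice 1 C y A" unfolding \<chi>_def by (rule emb_coef[OF C y A])
  \<comment> \<open>By commutativity the term \<open>a * (A * b)\<close> is written as
    \<open>(A * b) * a\<close> with the last two factors exchanged. The first two factors then
    belong to \<open>A\<close> in every term and can be sliced.\<close>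
  have four: "capp H J 2 2 A (pprod J a b) = pp H J 3 1 (capp H J 2 1 A (emb H J a)) (emb H J b)
      + pperm H 4 J (transpose 2 3) (pp H J 3 1 (capp H J 2 1 A (emb H J b)) (emb H J a))"
    and in4: "pp H J 3 1 (capp H J 2 1 A (emb H J a)) (emb H J b) \<in> pseudo H 4 J"
    if a: "a \<in> carr J" and b: "b \<in> carr J" for a b
  proof -
    note A3 = pseudo_3_in(4)[OF A]
    have i: "pp H J 3 1 (capp H J 2 1 A (emb H J a)) (emb H J b) \<in> pseudo H 4 J" if "a \<in> carr J" "b \<in> carr J" for a b
      using pext_in[OF J J J J_bil A3[OF that(1)] emb_in[OF that(2)]] by simp
    show "pp H J 3 1 (capp H J 2 1 A (emb H J a)) (emb H J b) \<in> pseudo H 4 J" by (rule i[OF a b])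
    have t: "Theta J [w0, w1, w2, w3] (pp H J 3 1 (capp H J 2 1 A (emb H J a)) (emb H J b))
        = jm (ap (Theta C [w0, w1] A) (wtens J w2 a)) (wtens J w3 b)" if "a \<in> carr J" "b \<in> carr J" for a b w0 w1 w2 w3
      using Theta_pext[OF J J J J_bil, of "[w0, w1, w2]" 3 "[w3]" 1, OF _ _ A3[OF that(1)] emb_in[OF that(2)]]
      by (simp add: Theta_emb[OF J that(2)] Theta_3(4)[OF A that(1)])
    show "capp H J 2 2 A (pprod J a b) = pp H J 3 1 (capp H J 2 1 A (emb H J a)) (emb H J b)
      + pperm H 4 J (transpose 2 3) (pp H J 3 1 (capp H J 2 1 A (emb H J b)) (emb H J a))"
    proof (rule Theta_letters_inj[OF J, of _ 4])
      show "capp H J 2 2 A (pprod J a b) \<in> pseudo H 4 J"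
        using pext_in[OF C J J ap_bil A J_prod_in[OF a b]] by simp
      show "pp H J 3 1 (capp H J 2 1 A (emb H J a)) (emb H J b)
        + pperm H 4 J (transpose 2 3) (pp H J 3 1 (capp H J 2 1 A (emb H J b)) (emb H J a)) \<in> pseudo H 4 J"
        by (intro free.subspace_add[OF subspace_pseudo[OF J]] i pperm_in[OF J] a b) simp
      have "Theta J [w0, w1, w2, w3] (capp H J 2 2 A (pprod J a b)) =
        Theta J [w0, w1, w2, w3] (pp H J 3 1 (capp H J 2 1 A (emb H J a)) (emb H J b)
        + pperm H 4 J (transpose 2 3) (pp H J 3 1 (capp H J 2 1 A (emb H J b)) (emb H J a)))" for w0 w1 w2 w3
      proof -
        have "Theta J [w0, w1, w2, w3] (capp H J 2 2 A (pprod J a b))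
            = ap (Theta C [w0, w1] A) (jm (wtens J w2 a) (wtens J w3 b))"
          using Theta_pext[OF C J J ap_bil, of "[w0, w1]" 2 "[w2, w3]" 2, OF _ _ A J_prod_in[OF a b]]
          by (simp add: Theta_jm_2 a b)
        moreover have "Theta J [w0, w1, w2, w3] (pperm H 4 J (transpose 2 3) (pp H J 3 1 (capp H J 2 1 A (emb H J b)) (emb H J a)))
            = jm (ap (Theta C [w0, w1] A) (wtens J w3 b)) (wtens J w2 a)"
          using Theta_pperm[OF J _ _ i[OF b a], of "transpose 2 3" "[w0, w1, w2, w3]"] t[OF b a]
          by (simp add: permute_list_transpose)
        ultimately show ?thesis
          using der_wordsD(2)[OF der wtens_in[OF a] wtens_in[OF b]] t[OF a b]
            jm_commute[OF wtens_in[OF a] ap_in[OF der_wordsD(1)[OF der] wtens_in[OF b]]]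
          by (simp add: flinD(1)[OF flin_Theta])
      qed
      then show "Theta J (letters 4) (capp H J 2 2 A (pprod J a b)) =
        Theta J (letters 4) (pp H J 3 1 (capp H J 2 1 A (emb H J a)) (emb H J b)
        + pperm H 4 J (transpose 2 3) (pp H J 3 1 (capp H J 2 1 A (emb H J b)) (emb H J a)))"
        unfolding letters_4 .
    qed
  qed
  have A': "A \<in> pseudo H (Suc 1) C" using A by simp
  have sl1: "slice 2 J y (capp H J 2 1 A (emb H J a)) = \<chi> a" if a: "a \<in> carr J" for a
    using slice_pext[OF C J J ap_bil y _ A' emb_in[OF a]] pext_emb_emb[OF C J J ap_bil \<chi> a] by (simp add: e\<chi>)
  have sl2: "slice 3 J y (pp H J 3 1 (capp H J 2 1 A (emb H J a)) (emb H J b)) = pp H J 2 1 (\<chi> a) (emb H J b)"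
    if a: "a \<in> carr J" and b: "b \<in> carr J" for a b
    using slice_pext[OF J J J J_bil y, of 2 "capp H J 2 1 A (emb H J a)" "emb H J b" 1] pseudo_3_in(4)[OF A a]
      emb_in[OF b] by (simp add: sl1 a)
  have eq: "capp H J 1 2 (emb H C \<chi>) (pprod J a b)
      = pp H J 2 1 (\<chi> a) (emb H J b) + pperm H 3 J (transpose 1 2) (pp H J 2 1 (\<chi> b) (emb H J a))"
    if a: "a \<in> carr J" and b: "b \<in> carr J" for a b
    using arg_cong[OF four[OF a b], of "slice 3 J y"] slice_pext[OF C J J ap_bil y _ A' J_prod_in[OF a b]]
    by (simp add: e\<chi> flinD(1)[OF flin_slice] sl2 a b slice_pperm_4[OF y in4])
  have "wtens C w \<chi> \<in> der_words" for w
    unfolding der_words_def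
  proof (intro CollectI conjI ballI)
    show "wtens C w \<chi> \<in> word_space C" by (rule wtens_in[OF \<chi>])
    fix x z assume x: "x \<in> word_space J" and z: "z \<in> word_space J"
    show "ap (wtens C w \<chi>) (jm x z) = jm (ap (wtens C w \<chi>) x) z + jm x (ap (wtens C w \<chi>) z)"
    proof (rule word_space_eqI[OF J _ _ _ x], goal_cases)
      case (3 w1 a)
      show ?case
      proof (rule word_space_eqI[OF J _ _ _ z], goal_cases)
        case (3 w2 b)
        note a = \<open>a \<in> carr J\<close> and b = \<open>b \<in> carr J\<close>
        show ?case
          using arg_cong[OF eq[OF a b], of "Theta J [w, w1, w2]"]
            jm_commute[OF wtens_in[OF a] ap_in[OF wtens_in[OF \<chi>] wtens_in[OF b]]]
          by (simp add: Theta_3 \<chi> a b J_prod_in app_in Theta_jm_2 Theta_ap_2 flinD(1)[OF flin_Theta]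
              Theta_swap_3[OF J] pseudo_3_in)
      qed (simp_all add: flin_def wmul_lin scale_distribs)
    qed (simp_all add: flin_def wmul_lin scale_distribs)
  qed
  then show "coef C y A \<in> carr (der H J)" using \<chi> by (simp add: der_iff \<chi>_def[symmetric])
qed

lemma Theta_cb: "\<phi> \<in> carr C \<Longrightarrow> \<psi> \<in> carr C \<Longrightarrow> Theta C [w, w'] (cend_bracket H J \<phi> \<psi>) = cb (wtens C w \<phi>) (wtens C w' \<psi>)"
  by (simp add: cb_wtens)

lemma cend_bracket_in: "\<phi> \<in> carr C \<Longrightarrow> \<psi> \<in> carr C \<Longrightarrow> cend_bracket H J \<phi> \<psi> \<in> pseudo H 2 C"
  by (rule hbilinearD(1)[OF cb_bil])

lemma cb_der_words:
  assumes u: "u \<in> der_words" and v: "v \<in> der_words" shows "cb u v \<in> der_words"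
  unfolding der_words_def
proof (intro CollectI conjI ballI)
  note uw = der_wordsD(1)[OF u] and vw = der_wordsD(1)[OF v]
  show "cb u v \<in> word_space C" by (rule cb_in[OF uw vw])
  fix x y assume x: "x \<in> word_space J" and y: "y \<in> word_space J"
  show "ap (cb u v) (jm x y) = jm (ap (cb u v) x) y + jm x (ap (cb u v) y)"
    by (simp add: ap_cb uw vw x y jm_in ap_in der_wordsD(2)[OF u] der_wordsD(2)[OF v] wmul_lin)
qed

lemma cb_lm_der_words:
  assumes u: "u \<in> word_space J" and v: "v \<in> word_space J" shows "cb (lm u) (lm v) \<in> der_words"
  unfolding der_words_def
proof (intro CollectI conjI ballI)
  show "cb (lm u) (lm v) \<in> word_space C" by (rule cb_in[OF lm_in[OF u] lm_in[OF v]])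
  fix x y assume x: "x \<in> word_space J" and y: "y \<in> word_space J"
  show "ap (cb (lm u) (lm v)) (jm x y) = jm (ap (cb (lm u) (lm v)) x) y + jm x (ap (cb (lm u) (lm v)) y)"
    using jm_commutator_derivation[OF u v x y] by (simp add: ap_cb lm_in ap_lm u v x y jm_in)
qed

lemma cend_bracket_der:
  "D \<in> carr (der H J) \<Longrightarrow> T \<in> carr (der H J) \<Longrightarrow> cend_bracket H J D T \<in> pspan 2 C (carr (der H J))"
  "a \<in> carr J \<Longrightarrow> b \<in> carr J \<Longrightarrow> cend_bracket H J (lmap J a) (lmap J b) \<in> pspan 2 C (carr (der H J))"
proof -
  show "cend_bracket H J D T \<in> pspan 2 C (carr (der H J))" if "D \<in> carr (der H J)" "T \<in> carr (der H J)"
    using that unfolding der_iff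
    by (intro pspan_derI cend_bracket_in) (auto simp: Theta_cb intro: cb_der_words)
  show "cend_bracket H J (lmap J a) (lmap J b) \<in> pspan 2 C (carr (der H J))" if "a \<in> carr J" "b \<in> carr J"
    using that
    by (intro pspan_derI cend_bracket_in lmap_in) (auto simp: Theta_cb lmap_in lm_wtens[symmetric] intro: cb_lm_der_words wtens_in)
qed

lemma cb_der_lm:
  assumes u: "u \<in> der_words" and x: "x \<in> word_space J" and z: "z \<in> word_space J"
  shows "ap (cb u (lm x)) z = jm (ap u x) z"
  using der_wordsD[OF u] x z by (simp add: ap_cb lm_in ap_lm ap_in)

end

context cocommutative_hopf
begin

section \<open>Functoriality in the module and closure properties of bilinear maps\<close>

lemma push_push:
  assumes "left_module M" "left_module N" "left_module K" "module_hom_on M N q" "module_hom_on N K r" "X \<in> pseudo H n M"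
  shows "push H n K r (push H n N q X) = push H n K (\<lambda>a. r (q a)) X"
proof (rule pseudo_eqI[OF assms(1) flin_comp[OF flin_lmul(3) flin_lmul(3)] flin_lmul(3) _ assms(6)])
  have h: "module_hom_on M K (\<lambda>a. r (q a))"
    using module_hom_onD[OF assms(4)] module_hom_onD[OF assms(5)] by (simp add: module_hom_on_def)
  fix xs :: "'h list" and c assume "length xs = n" "c \<in> carr M"
  then show "push H n K r (push H n N q (ptn n M xs c)) = push H n K (\<lambda>a. r (q a)) (ptn n M xs c)"
    by (simp add: push_ptens[OF assms(1,2,4)] push_ptens[OF assms(2,3,5)] push_ptens[OF assms(1,3) h]
        module_hom_onD(1)[OF assms(4)])
qed

lemma push_zero:
  assumes "left_module M" "left_module N" "X \<in> pseudo H n M" shows "push H n N (\<lambda>a. 0) X = 0"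
proof (rule pseudo_eqI[OF assms(1) flin_lmul(3) _ _ assms(3)])
  have h: "module_hom_on M N (\<lambda>a. 0)"
    using left_moduleD(1,10)[OF assms(2)] by (simp add: module_hom_on_def)
  show "flin (\<lambda>X. 0)" by (simp add: flin_def)
  fix xs :: "'h list" and c assume "length xs = n" "c \<in> carr M"
  then show "push H n N (\<lambda>a. 0) (ptn n M xs c) = 0"
    by (simp add: push_ptens[OF assms(1,2) h] ptens_zero[OF assms(2)])
qed

lemma push_id:
  assumes "left_module M" "X \<in> pseudo H n M" shows "push H n M (\<lambda>a. a) X = X"
proof (rule pseudo_eqI[OF assms(1) flin_lmul(3) _ _ assms(2)])
  have h: "module_hom_on M M (\<lambda>a. a)" by (simp add: module_hom_on_def)
  show "flin (\<lambda>X. X)" by (simp add: flin_def)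
  fix xs :: "'h list" and c assume "length xs = n" "c \<in> carr M"
  then show "push H n M (\<lambda>a. a) (ptn n M xs c) = ptn n M xs c"
    by (simp add: push_ptens[OF assms(1,1) h])
qed

lemma push_pperm:
  assumes M: "left_module M" and N: "left_module N" and q: "module_hom_on M N q"
    and s: "\<sigma> permutes {..<n}" and X: "X \<in> pseudo H n M"
  shows "push H n N q (pperm H n M \<sigma> X) = pperm H n N \<sigma> (push H n N q X)"
  by (rule pseudo_eqI[OF M flin_comp[OF flin_lmul(3) flin_lmul(2)] flin_comp[OF flin_lmul(2) flin_lmul(3)] _ X])
    (simp add: pperm_tens[OF M s] pperm_tens[OF N s] push_ptens[OF M N q] module_hom_onD(1)[OF q])

lemma push_lmul:
  assumes M: "left_module M" and N: "left_module N" and q: "module_hom_on M N q"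
    and F: "F \<in> tensor_power H n" and X: "X \<in> pseudo H n M"
  shows "push H n N q (lmul H n M F X) = lmul H n N F (push H n N q X)"
  by (rule pseudo_eqI[OF M flin_comp[OF flin_lmul(3) flin_lmul(1)] flin_comp[OF flin_lmul(1) flin_lmul(3)] _ X])
    (simp add: lmul_ptens[OF M F] lmul_ptens[OF N F] push_ptens[OF M N q] module_hom_onD(1)[OF q] F)

lemma hbilinear_comp:
  assumes "hbilinear A B C \<mu>" "module_hom_on A' A p" "module_hom_on B' B q"
  shows "hbilinear A' B' C (\<lambda>x y. \<mu> (p x) (q y))"
  unfolding hbilinear_def
  by (simp add: hbilinearD[OF assms(1)] module_hom_onD[OF assms(2)] module_hom_onD[OF assms(3)])

lemma hbilinear_add:
  assumes C: "left_module C" and "hbilinear A B C \<mu>" "hbilinear A B C \<nu>"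
  shows "hbilinear A B C (\<lambda>x y. \<mu> x y + \<nu> x y)"
  unfolding hbilinear_def
  by (auto simp: hbilinearD[OF assms(2)] hbilinearD[OF assms(3)] flinD(1)[OF flin_lmul(1)] add_ac
      intro!: free.subspace_add[OF subspace_pseudo[OF C]])

lemma hbilinear_uminus:
  assumes C: "left_module C" and "hbilinear A B C \<mu>" shows "hbilinear A B C (\<lambda>x y. - \<mu> x y)"
  unfolding hbilinear_def
  by (auto simp: hbilinearD[OF assms(2)] flinD(4)[OF flin_lmul(1)] intro!: free.subspace_neg[OF subspace_pseudo[OF C]])

lemma hbilinear_diff:
  assumes C: "left_module C" and "hbilinear A B C \<mu>" "hbilinear A B C \<nu>"
  shows "hbilinear A B C (\<lambda>x y. \<mu> x y - \<nu> x y)"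
  using hbilinear_add[OF C assms(2) hbilinear_uminus[OF C assms(3)]] by simp

lemma hbilinear_swap:
  assumes C: "left_module C" and "hbilinear A B C \<mu>"
  shows "hbilinear B A C (\<lambda>x y. pswap C (\<mu> y x))"
  unfolding hbilinear_def
  by (auto simp: hbilinearD(2-4)[OF assms(2)] flinD(1)[OF flin_lmul(2)] pperm_lmul_2[OF C hbilinearD(1)[OF assms(2)]]
      intro!: pperm_in[OF C] hbilinearD(1)[OF assms(2)] permutes_swap_id)

lemma hbilinear_push:
  assumes C: "left_module C" and D: "left_module D" and q: "module_hom_on C D q" and "hbilinear A B C \<mu>"
  shows "hbilinear A B D (\<lambda>x y. push H 2 D q (\<mu> x y))"
  unfolding hbilinear_def
  by (auto simp: hbilinearD(2-4)[OF assms(4)] flinD(1)[OF flin_lmul(3)] push_lmul[OF C D q _ hbilinearD(1)[OF assms(4)]]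
      intro!: push_in[OF C D q] hbilinearD(1)[OF assms(4)])

end

section \<open>The structure pseudoalgebra\<close>

lemma (in cocommutative_hopf_basis) coef_push:
  assumes M: "left_module M" and N: "left_module N" and q: "module_hom_on M N q" and y: "y \<in> dual H"
    and X: "X \<in> pseudo H 2 M"
  shows "coef N y (push H 2 N q X) = q (coef M y X)"
proof (rule emb_inj[OF N coef_in[OF N y push_in[OF M N q X]] module_hom_onD(1)[OF q coef_in[OF M y X]]])
  have X': "X \<in> pseudo H (Suc 1) M" using X by simp
  have "emb H N (coef N y (push H 2 N q X)) = push H 1 N q (emb H M (coef M y X))"
    using emb_coef[OF N y push_in[OF M N q X]] slice_push[OF M N q y _ X'] emb_coef[OF M y X] by simp
  also have "\<dots> = emb H N (q (coef M y X))"
    unfolding emb_def by (rule push_ptens[OF M N q _ coef_in[OF M y X]]) simp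
  finally show "emb H N (coef N y (push H 2 N q X)) = emb H N (q (coef M y X))" .
qed

context finite_jordan
begin

abbreviation "S \<equiv> str_module H J"
abbreviation "Amb \<equiv> tkk_ambient H J"

text \<open>\<open>lmap J\<close> is \<open>H\<close>-linear, so its image is already a submodule.
  Each element of \<open>lmodule H J\<close> is thus a single \<open>L_a\<close>, as the choice in
  \<open>str_bracket\<close> presupposes.\<close>

lemma lmodule_eq: "lmodule H J = lmap J ` carr J"
proof
  have sub: "submodule C (lmap J ` carr J)" by (rule submodule_image[OF J submodule_carr[OF J] lmap_hom])
  have X: "lmap J ` carr J \<subseteq> carr C" using lmap_in by blast
  show "lmodule H J \<subseteq> lmap J ` carr J"
    unfolding lmodule_def by (rule generated_submodule_props(3)[OF C X sub subset_refl])
  show "lmap J ` carr J \<subseteq> lmodule H J"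
    unfolding lmodule_def by (rule generated_submodule_props(2)[OF C X])
qed

lemma submodule_lmodule: "submodule C (lmodule H J)"
  unfolding lmodule_def by (rule generated_submodule_props(1)[OF C]) (use lmap_in in blast)

lemma lmodule_subset: "l \<in> lmodule H J \<Longrightarrow> l \<in> carr C"
  using submoduleD(1)[OF submodule_lmodule] by blast

lemma der_subset: "D \<in> carr (der H J) \<Longrightarrow> D \<in> carr C"
  using submoduleD(1)[OF submodule_der] by blast

lemma S_carr: "carr S = lmodule H J \<times> carr (der H J)" and S_act: "act S h (l, D) = (act C h l, act C h D)"
  by (simp_all add: str_module_def)

lemma S_module: "left_module S"
proof -
  note L = submoduleD(2-)[OF submodule_lmodule] and D = submoduleD(2-)[OF submodule_der]
    and m = left_moduleD(6-9)[OF C lmodule_subset] and m' = left_moduleD(6-9)[OF C der_subset]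
  show ?thesis
    unfolding left_module_def S_carr
    by (auto simp: S_act zero_prod_def L D m(3,4) m'(3,4)
        m(1)[OF _ lmodule_subset] m'(1)[OF _ der_subset] m(2) m'(2))
qed

lemma Amb_carr: "carr Amb = carr J \<times> (lmodule H J \<times> carr (der H J)) \<times> carr J"
  and Amb_act: "act Amb h (a, (l, D), b) = (act J h a, (act C h l, act C h D), act J h b)"
  by (simp_all add: tkk_ambient_def structure_pseudoalgebra_def str_module_def)

lemma Amb_module: "left_module Amb"
proof -
  note L = left_moduleD(1-5)[OF S_module, unfolded S_carr] and j = left_moduleD[OF J]
  have "carr (structure_pseudoalgebra H J) = carr S" "act (structure_pseudoalgebra H J) = act S"
    by (simp_all add: structure_pseudoalgebra_def)
  then have S': "left_module (structure_pseudoalgebra H J)"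
    using left_module_cong[of "structure_pseudoalgebra H J" S] S_module by blast
  show ?thesis
    using S' J unfolding left_module_def tkk_ambient_def by (simp add: zero_prod_def split_def)
qed

text \<open>Projections onto the minus copy, the plus copy, the multiplications and the
  pseudoderivations. Identities in tensor products over the direct sum are tested by pushing them
  forward along these maps.\<close>

definition "qm = (\<lambda>(a :: 'm, \<Sigma> :: ('k, 'h, 'm) conf \<times> ('k, 'h, 'm) conf, b :: 'm). a)"
definition "qp = (\<lambda>(a :: 'm, \<Sigma> :: ('k, 'h, 'm) conf \<times> ('k, 'h, 'm) conf, b :: 'm). b)"
definition "ql = (\<lambda>(a :: 'm, \<Sigma> :: ('k, 'h, 'm) conf \<times> ('k, 'h, 'm) conf, b :: 'm). fst \<Sigma>)"
definition "qD = (\<lambda>(a :: 'm, \<Sigma> :: ('k, 'h, 'm) conf \<times> ('k, 'h, 'm) conf, b :: 'm). snd \<Sigma>)"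

lemmas q_defs = qm_def qp_def ql_def qD_def

lemma Amb_homs: "module_hom_on Amb J qm" "module_hom_on Amb J qp" "module_hom_on Amb C ql" "module_hom_on Amb C qD"
  by (auto simp: module_hom_on_def q_defs Amb_carr Amb_act lmodule_subset der_subset)

lemma S_homs: "module_hom_on S C fst" "module_hom_on S C snd"
  by (auto simp: module_hom_on_def S_carr S_act lmodule_subset der_subset)

lemma incl_homs:
  "module_hom_on J Amb (\<lambda>c. (c, 0, 0))" "module_hom_on S Amb (\<lambda>\<Theta>. (0, \<Theta>, 0))" "module_hom_on J Amb (\<lambda>c. (0, 0, c))"
  "module_hom_on J S (\<lambda>a. (lmap J a, 0))" "module_hom_on (der H J) S (\<lambda>D. (0, D))"
proof -
  note z = submoduleD(2)[OF submodule_lmodule] submoduleD(2)[OF submodule_der] left_moduleD(1)[OF J]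
    left_moduleD(10)[OF J] left_moduleD(10)[OF C]
  show "module_hom_on J Amb (\<lambda>c. (c, 0, 0))" "module_hom_on J Amb (\<lambda>c. (0, 0, c))"
    using z by (simp_all add: module_hom_on_def Amb_carr Amb_act zero_prod_def)
  show "module_hom_on S Amb (\<lambda>\<Theta>. (0, \<Theta>, 0))"
    using z by (auto simp: module_hom_on_def Amb_carr Amb_act S_carr S_act)
  show "module_hom_on J S (\<lambda>a. (lmap J a, 0))"
    using z module_hom_onD(2,3)[OF lmap_hom] by (simp add: module_hom_on_def S_carr S_act lmodule_eq)
  show "module_hom_on (der H J) S (\<lambda>D. (0, D))"
    using z by (simp add: module_hom_on_def S_carr S_act der_act)
qed

lemma C_eqI2:
  assumes X: "X \<in> pseudo H 2 C" and Y: "Y \<in> pseudo H 2 C"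
    and eq: "\<And>w w' z. z \<in> word_space J \<Longrightarrow> ap (Theta C [w, w'] X) z = ap (Theta C [w, w'] Y) z"
  shows "X = Y"
proof (rule capp_eqI[OF J X Y])
  fix a assume a: "a \<in> carr J"
  show "capp H J 2 1 X (emb H J a) = capp H J 2 1 Y (emb H J a)"
    by (rule Theta_letters_inj[OF J, of _ 3])
      (simp_all only: letters_3 Theta_3(4)[OF X a] Theta_3(4)[OF Y a] pseudo_3_in(4)[OF X a] pseudo_3_in(4)[OF Y a]
        eq[OF wtens_in[OF a]])
qed simp

text \<open>Applied to an element of \<open>J\<close> the tensors gain a factor, so four distinct
  letters are needed to separate the results.\<close>

lemma C_eqI3:
  assumes X: "X \<in> pseudo H 3 C" and Y: "Y \<in> pseudo H 3 C"
    and eq: "\<And>w0 w1 w2 z. z \<in> word_space J \<Longrightarrow> ap (Theta C [w0, w1, w2] X) z = ap (Theta C [w0, w1, w2] Y) z"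
  shows "X = Y"
proof (rule capp_eqI[OF J X Y])
  fix a assume a: "a \<in> carr J"
  have t: "Theta J [w0, w1, w2, w3] (capp H J 3 1 X (emb H J a)) = ap (Theta C [w0, w1, w2] X) (wtens J w3 a)"
    and i: "capp H J 3 1 X (emb H J a) \<in> pseudo H 4 J" if X: "X \<in> pseudo H 3 C" for X w0 w1 w2 w3
    using Theta_pext[OF C J J ap_bil, of "[w0, w1, w2]" 3 "[w3]" 1, OF _ _ X emb_in[OF a]]
      pext_in[OF C J J ap_bil X emb_in[OF a]] by (simp_all add: Theta_emb[OF J a])
  show "capp H J 3 1 X (emb H J a) = capp H J 3 1 Y (emb H J a)"
    by (rule Theta_letters_inj[OF J, of _ 4])
      (simp_all only: letters_4 t[OF X] t[OF Y] i[OF X] i[OF Y] eq[OF wtens_in[OF a]])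
qed simp

lemma Theta_push_2:
  assumes "left_module M" "left_module N" "module_hom_on M N q" "X \<in> pseudo H 2 M"
  shows "Theta N [w, w'] (push H 2 N q X) = wpush N q (Theta M [w, w'] X)"
  using Theta_push[OF assms(1-3), of X "[w, w']"] assms(4) by simp

lemma Theta_push_3:
  assumes "left_module M" "left_module N" "module_hom_on M N q" "X \<in> pseudo H 3 M"
  shows "Theta N [w0, w1, w2] (push H 3 N q X) = wpush N q (Theta M [w0, w1, w2] X)"
  using Theta_push[OF assms(1-3), of X "[w0, w1, w2]"] assms(4) by simp

text \<open>The identity \<open>L_(D b) = [D, L_b]\<close> allows the multiplications in the bracket
  of the structure pseudoalgebra to be expressed by commutators alone.\<close>

lemma push_lmap_der:
  assumes D: "D \<in> carr (der H J)" and b: "b \<in> carr J"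
  shows "pushL (D b) = cend_bracket H J D (lmap J b)"
proof (rule C_eqI2)
  have D': "D \<in> carr C" "wtens C w D \<in> der_words" for w using D der_iff by auto
  show "pushL (D b) \<in> pseudo H 2 C" by (rule push_in[OF J C lmap_hom app_in[OF D'(1) b]])
  show "cend_bracket H J D (lmap J b) \<in> pseudo H 2 C" by (rule cend_bracket_in[OF D'(1) lmap_in[OF b]])
  fix w w' z assume z: "z \<in> word_space J"
  show "ap (Theta C [w, w'] (pushL (D b))) z = ap (Theta C [w, w'] (cend_bracket H J D (lmap J b))) z"
    using cb_der_lm[OF D'(2) wtens_in[OF b] z] z
    by (simp add: Theta_push_2[OF J C lmap_hom app_in[OF D'(1) b]] Theta_ap_2[OF D'(1) b] Theta_cb[OF D'(1) lmap_in[OF b]]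
        ap_lm ap_in wtens_in D'(1) b lm_wtens)
qed

lemma in_L_props:
  assumes A: "A \<in> pseudo H 2 J"
  shows "in_L H J A \<in> pseudo H 2 S" "push H 2 C fst (in_L H J A) = pushL A" "push H 2 C snd (in_L H J A) = 0"
  unfolding in_L_def
  using push_in[OF J S_module incl_homs(4) A] push_push[OF J S_module C incl_homs(4) S_homs(1) A]
    push_push[OF J S_module C incl_homs(4) S_homs(2) A] push_zero[OF J C A] by simp_all

lemma in_Der_props:
  assumes A: "A \<in> pspan 2 C (carr (der H J))"
  shows "in_Der H J A \<in> pseudo H 2 S" "push H 2 C fst (in_Der H J A) = 0" "push H 2 C snd (in_Der H J A) = A"
proof -
  note r = restr_props[OF C submodule_der der_act A]
  have r1: "restr H 2 (der H J) C A \<in> pseudo H 2 (der H J)" by (rule r(1)) simp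
  show "in_Der H J A \<in> pseudo H 2 S" unfolding in_Der_def by (rule push_in[OF left_module_der S_module incl_homs(5) r1])
  show "push H 2 C fst (in_Der H J A) = 0" "push H 2 C snd (in_Der H J A) = A"
    unfolding in_Der_def
    using push_push[OF left_module_der S_module C incl_homs(5) S_homs(1) r1]
      push_push[OF left_module_der S_module C incl_homs(5) S_homs(2) r1] push_zero[OF left_module_der C r1] r(2)
    by simp_all
qed

text \<open>Both components are expressed by \<open>l\<close> and \<open>m\<close> themselves, so
  the elements chosen in \<open>str_bracket\<close> disappear from the computation and the choice
  does not matter.\<close>

lemma str_bracket_props:
  assumes l: "l \<in> lmodule H J" and D: "D \<in> carr (der H J)" and m: "m \<in> lmodule H J" and T: "T \<in> carr (der H J)"
  shows "str_bracket H J (l, D) (m, T) \<in> pseudo H 2 S"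
    "push H 2 C fst (str_bracket H J (l, D) (m, T)) = cend_bracket H J D m + cend_bracket H J l T"
    "push H 2 C snd (str_bracket H J (l, D) (m, T)) = cend_bracket H J l m + cend_bracket H J D T"
proof -
  define a where "a = (SOME a. a \<in> carr J \<and> lmap J a = l)"
  define b where "b = (SOME b. b \<in> carr J \<and> lmap J b = m)"
  have "\<exists>a. a \<in> carr J \<and> lmap J a = l" "\<exists>b. b \<in> carr J \<and> lmap J b = m" using l m lmodule_eq by auto
  then have a: "a \<in> carr J" "lmap J a = l" and b: "b \<in> carr J" "lmap J b = m"
    using someI_ex[of "\<lambda>a. a \<in> carr J \<and> lmap J a = l"] someI_ex[of "\<lambda>b. b \<in> carr J \<and> lmap J b = m"]
    by (auto simp: a_def b_def)
  have eq: "str_bracket H J (l, D) (m, T) = in_L H J (D b) - pswap S (in_L H J (T a))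
      + in_Der H J (cend_bracket H J l m) + in_Der H J (cend_bracket H J D T)"
    unfolding str_bracket_def by (simp add: a_def[symmetric] b_def[symmetric] a(2) b(2))
  note Db = app_in[OF der_subset[OF D] b(1)] and Ta = app_in[OF der_subset[OF T] a(1)]
  have d: "cend_bracket H J l m \<in> pspan 2 C (carr (der H J))"
    using cend_bracket_der(2)[OF a(1) b(1)] a b by simp
  note L = in_L_props[OF Db] in_L_props[OF Ta] and De = in_Der_props[OF d] in_Der_props[OF cend_bracket_der(1)[OF D T]]
  have s: "transpose 0 (1::nat) permutes {..<2}" by simp
  show "str_bracket H J (l, D) (m, T) \<in> pseudo H 2 S"
    unfolding eq by (intro free.subspace_add[OF subspace_pseudo[OF S_module]] free.subspace_diff[OF subspace_pseudo[OF S_module]]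
        pperm_in[OF S_module s] L De)
  have sk: "pswap C (cend_bracket H J T l) = - cend_bracket H J l T"
    by (rule cend_bracket_skew[OF J finite_J der_subset[OF T] lmodule_subset[OF l]])
  show "push H 2 C fst (str_bracket H J (l, D) (m, T)) = cend_bracket H J D m + cend_bracket H J l T"
    unfolding eq flinD(1,5)[OF flin_lmul(3)] push_pperm[OF S_module C S_homs(1) s L(4)] L De
      push_lmap_der[OF D b(1)] push_lmap_der[OF T a(1)] a(2) b(2) sk by simp
  show "push H 2 C snd (str_bracket H J (l, D) (m, T)) = cend_bracket H J l m + cend_bracket H J D T"
    unfolding eq flinD(1,5)[OF flin_lmul(3)] push_pperm[OF S_module C S_homs(2) s L(4)] L De
    by (simp add: flinD(3)[OF flin_lmul(2)])
qed

section \<open>The components of the Tits--Kantor--Koecher bracket\<close>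

lemma tkk_bracket_props:
  assumes a: "a \<in> carr J" and l: "l \<in> lmodule H J" and D: "D \<in> carr (der H J)" and b: "b \<in> carr J"
    and a': "a' \<in> carr J" and l': "l' \<in> lmodule H J" and D': "D' \<in> carr (der H J)" and b': "b' \<in> carr J"
  defines "X \<equiv> tkk_bracket H J (a, (l, D), b) (a', (l', D'), b')"
  shows "X \<in> pseudo H 2 Amb"
    "push H 2 J qm X = l a' + D a' - pswap J (l' a + D' a)"
    "push H 2 J qp X = - l b' + D b' - pswap J (- l' b + D' b)"
    "push H 2 C ql X = cend_bracket H J D l' + cend_bracket H J l D'
      + pushL (pprod J a b') - pushL (pprod J b a')"
    "push H 2 C qD X = cend_bracket H J l l' + cend_bracket H J D D'
      + cend_bracket H J (lmap J a) (lmap J b') + cend_bracket H J (lmap J b) (lmap J a')"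
proof -
  note add = free.subspace_add[OF subspace_pseudo] and diff = free.subspace_diff[OF subspace_pseudo]
    and neg = free.subspace_neg[OF subspace_pseudo]
  have s: "transpose 0 (1::nat) permutes {..<2}" by simp
  define Xm where "Xm = l a' + D a' - pswap J (l' a + D' a)"
  define Xp where "Xp = - l b' + D b' - pswap J (- l' b + D' b)"
  define Xs where "Xs = str_bracket H J (l, D) (l', D') + U_op H J a b' + U_star H J b a'"
  have in_J: "\<phi> c \<in> pseudo H 2 J" if "\<phi> \<in> carr C" "c \<in> carr J" for \<phi> c by (rule app_in[OF that])
  note Ci = lmodule_subset[OF l] lmodule_subset[OF l'] der_subset[OF D] der_subset[OF D']
  have Xm: "Xm \<in> pseudo H 2 J" unfolding Xm_def by (intro add diff J pperm_in[OF J s] in_J Ci a a')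
  have Xp: "Xp \<in> pseudo H 2 J" unfolding Xp_def by (intro add diff neg J pperm_in[OF J s] in_J Ci b b')
  note pr = J_prod_in[OF a b'] J_prod_in[OF b a'] and de = cend_bracket_der(2)[OF a b'] cend_bracket_der(2)[OF b a']
  note L = in_L_props[OF pr(1)] in_L_props[OF pr(2)] and De = in_Der_props[OF de(1)] in_Der_props[OF de(2)]
    and B = str_bracket_props[OF l D l' D']
  have Xs: "Xs \<in> pseudo H 2 S"
    unfolding Xs_def U_op_def U_star_def by (intro add neg S_module L De B)
  have X: "X = push H 2 Amb (\<lambda>c. (c, 0, 0)) Xm + push H 2 Amb (\<lambda>\<Theta>. (0, \<Theta>, 0)) Xs + push H 2 Amb (\<lambda>c. (0, 0, c)) Xp"
    by (simp add: X_def tkk_bracket_def structure_pseudoalgebra_def str_app_def str_star_def Xm_def Xp_def Xs_def)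
  show "X \<in> pseudo H 2 Amb"
    unfolding X by (intro add Amb_module push_in[OF J Amb_module incl_homs(1)] push_in[OF S_module Amb_module incl_homs(2)]
        push_in[OF J Amb_module incl_homs(3)] Xm Xs Xp)
  have pm: "push H 2 N q (push H 2 Amb (\<lambda>c. (c, 0, 0)) Xm) = push H 2 N (\<lambda>c. q (c, 0, 0)) Xm"
    and ps: "push H 2 N q (push H 2 Amb (\<lambda>\<Theta>. (0, \<Theta>, 0)) Xs) = push H 2 N (\<lambda>\<Theta>. q (0, \<Theta>, 0)) Xs"
    and pp: "push H 2 N q (push H 2 Amb (\<lambda>c. (0, 0, c)) Xp) = push H 2 N (\<lambda>c. q (0, 0, c)) Xp"
    if "left_module N" "module_hom_on Amb N q" for N q
    using push_push[OF J Amb_module that(1) incl_homs(1) that(2) Xm]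
      push_push[OF S_module Amb_module that(1) incl_homs(2) that(2) Xs]
      push_push[OF J Amb_module that(1) incl_homs(3) that(2) Xp] by simp_all
  note z = push_zero[OF J J Xm] push_zero[OF J J Xp] push_zero[OF J C Xm] push_zero[OF J C Xp] push_zero[OF S_module J Xs]
  show "push H 2 J qm X = l a' + D a' - pswap J (l' a + D' a)"
    unfolding X flinD(1)[OF flin_lmul(3)] pm[OF J Amb_homs(1)] ps[OF J Amb_homs(1)] pp[OF J Amb_homs(1)]
    by (simp add: qm_def z push_id[OF J Xm]) (simp add: Xm_def)
  show "push H 2 J qp X = - l b' + D b' - pswap J (- l' b + D' b)"
    unfolding X flinD(1)[OF flin_lmul(3)] pm[OF J Amb_homs(2)] ps[OF J Amb_homs(2)] pp[OF J Amb_homs(2)]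
    by (simp add: qp_def z push_id[OF J Xp]) (simp add: Xp_def)
  show "push H 2 C ql X = cend_bracket H J D l' + cend_bracket H J l D'
      + pushL (pprod J a b') - pushL (pprod J b a')"
    unfolding X flinD(1)[OF flin_lmul(3)] pm[OF C Amb_homs(3)] ps[OF C Amb_homs(3)] pp[OF C Amb_homs(3)]
    by (simp add: ql_def split_def z)
      (simp add: Xs_def U_op_def U_star_def flinD[OF flin_lmul(3)] B L De)
  show "push H 2 C qD X = cend_bracket H J l l' + cend_bracket H J D D'
      + cend_bracket H J (lmap J a) (lmap J b') + cend_bracket H J (lmap J b) (lmap J a')"
    unfolding X flinD(1)[OF flin_lmul(3)] pm[OF C Amb_homs(4)] ps[OF C Amb_homs(4)] pp[OF C Amb_homs(4)]
    by (simp add: qD_def split_def z)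
      (simp add: Xs_def U_op_def U_star_def flinD[OF flin_lmul(3)] B L De)
qed

text \<open>Coefficients commute with the projections, so membership in a product of submodules can
  be tested on one component at a time.\<close>

lemma Amb_pspanI:
  assumes X: "X \<in> pseudo H 2 Amb" and N: "submodule Amb (I1 \<times> (I2 \<times> I3) \<times> I4)"
    and sub: "submodule J I1" "submodule C I2" "submodule C I3" "submodule J I4"
    and q: "push H 2 J qm X \<in> pspan 2 J I1" "push H 2 C ql X \<in> pspan 2 C I2"
      "push H 2 C qD X \<in> pspan 2 C I3" "push H 2 J qp X \<in> pspan 2 J I4"
  shows "X \<in> pspan 2 Amb (I1 \<times> (I2 \<times> I3) \<times> I4)"
  unfolding coef_mem_iff[OF Amb_module N X]
proof
  fix y assume y: "y \<in> dual H"
  have c: "q (coef Amb y X) \<in> I" if M: "left_module M" and h: "module_hom_on Amb M q" and I: "submodule M I"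
    and p: "push H 2 M q X \<in> pspan 2 M I" for M :: "('h, 'n::ab_group_add, 'z) hmodule_scheme" and q I
    using bspec[OF coef_mem_iff[OF M I push_in[OF Amb_module M h X], THEN iffD1, OF p] y] coef_push[OF Amb_module M h y X]
    by argo
  show "coef Amb y X \<in> I1 \<times> (I2 \<times> I3) \<times> I4"
    using c[OF J Amb_homs(1) sub(1) q(1)] c[OF C Amb_homs(3) sub(2) q(2)] c[OF C Amb_homs(4) sub(3) q(3)]
      c[OF J Amb_homs(2) sub(4) q(4)]
    by (cases "coef Amb y X") (auto simp: q_defs)
qed

end

context cocommutative_hopf_basis
begin

lemma dual_mult_right: "y \<in> dual H \<Longrightarrow> (\<lambda>z. y (z * p)) \<in> dual H"
  by (auto simp: dual_def Vector_Spaces.linear_iff distrib_right scl_rules)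

section \<open>Linear spans of coefficients\<close>

text \<open>Acting by \<open>h\<close> on a slice precomposes the functional with right
  multiplication by \<open>h1\<close> and multiplies the second factor by \<open>h2\<close>; the
  part \<open>S(h2) h1\<close> that arises cancels by cocommutativity. Later this shows that
  \<open>H\<close> maps coefficients of products to sums of such coefficients.\<close>

lemma slice_act:
  assumes M: "left_module M" and y: "y \<in> dual H" and X: "X \<in> pseudo H 2 M"
  shows "lmul H 1 M (tens H [h]) (slice 1 M y X)
    = sw (\<lambda>p q. slice 1 M (\<lambda>z. y (z * p)) (lmul H 2 M (tens H [1, q]) X)) h"
proof (rule pseudo_eqI[OF M flin_comp[OF flin_lmul(1) flin_slice] _ _ X])
  show "flin (\<lambda>X. sw (\<lambda>p q. slice 1 M (\<lambda>z. y (z * p)) (lmul H 2 M (tens H [1, q]) X)) h)"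
    by (simp add: flin_def flinD(1,2)[OF flin_slice] flinD(1,2)[OF flin_lmul(1)] sw_add_fun sw_scale_fun)
  note yp = dual_mult_right[OF y]
  fix xs :: "'h list" and c assume "length xs = 2" and c: "c \<in> carr M"
  then obtain f g where xs: "xs = [f, g]" by (blast elim: length2E)
  let ?S = "antipode H" and ?T = "\<lambda>b. ptn 1 M [b] c"
  have T: "hlin (\<lambda>b. ?T (d * b))" "hlin (\<lambda>b. ?T (b * d))" for d
    using mlinD[OF mlin_ptens[OF M c], of "[]" "[]" 1] by (simp_all add: hlin_def distrib_left distrib_right scl_rules)
  have sl: "slice 1 M z (ptn 2 M [u, v] c) = sw (\<lambda>a b. fscale (z (u * ?S a)) (?T b)) v"
    if z: "z \<in> dual H" for z u v
    using slice_tens[OF M z, of 1 "[u, v]"] c by (simp add: slice_list_Cons)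
  let ?G = "\<lambda>a b p s d. fscale (y (f * (?S a * (?S s * p)))) (?T (d * b))"
  have G: "hlin (\<lambda>p. ?G a b p s d)" "hlin (\<lambda>s. ?G a b p s d)" "hlin (\<lambda>d. ?G a b p s d)" for a b p s d
    using T(2)[of b] by (simp_all add: hlin_def distrib_left distrib_right scl_rules dualD[OF y] antipode_rules
        free.scale_left_distrib free.scale_right_distrib mult.commute)
  have inner: "sw (\<lambda>p q. sw (\<lambda>s d. ?G a b p s d) q) h = fscale (y (f * ?S a)) (?T (h * b))" for a b
  proof -
    have "sw (\<lambda>p q. sw (\<lambda>s d. ?G a b p s d) q) h = sw (\<lambda>x d. sw (\<lambda>p s. ?G a b p s d) x) h"
      by (rule sw_coassoc[symmetric, of "\<lambda>p s d. ?G a b p s d"]) (rule G)+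
    also have "\<dots> = sw (\<lambda>x d. fscale (counit H x) (fscale (y (f * ?S a)) (?T (d * b)))) h"
    proof (intro sw_cong refl)
      fix x d
      have "sw (\<lambda>p s. ?G a b p s d) x = sw (\<lambda>s p. ?G a b p s d) x"
        by (rule sw_cocomm) (simp add: blin_def G)
      also have "\<dots> = fscale (counit H x) (fscale (y (f * (?S a * 1))) (?T (d * b)))"
        by (rule sw_antipode(1)[where f = "\<lambda>z. fscale (y (f * (?S a * z))) (?T (d * b))"])
          (simp add: hlin_def distrib_left scl_rules dualD[OF y] free.scale_left_distrib)
      finally show "sw (\<lambda>p s. ?G a b p s d) x = fscale (counit H x) (fscale (y (f * ?S a)) (?T (d * b)))" by simp
    qed
    also have "\<dots> = fscale (y (f * ?S a)) (?T (h * b))"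
      by (rule sw_counit(1)[where f = "\<lambda>d. fscale (y (f * ?S a)) (?T (d * b))"])
        (use T(2)[of b] in \<open>simp add: hlin_def free.scale_right_distrib mult.commute\<close>)
    finally show ?thesis .
  qed
  have "sw (\<lambda>p q. slice 1 M (\<lambda>z. y (z * p)) (lmul H 2 M (tens H [1, q]) (ptn 2 M xs c))) h
      = sw (\<lambda>p q. sw (\<lambda>s d. sw (\<lambda>a b. ?G a b p s d) g) q) h"
  proof (intro sw_cong refl)
    fix p q
    have "slice 1 M (\<lambda>z. y (z * p)) (lmul H 2 M (tens H [1, q]) (ptn 2 M xs c))
        = sw (\<lambda>a b. fscale (y (f * ?S a * p)) (?T b)) (q * g)"
      by (simp add: xs lmul_tens[OF M] c sl[OF yp])
    also have "\<dots> = sw (\<lambda>s d. sw (\<lambda>a b. fscale (y (f * ?S (s * a) * p)) (?T (d * b))) g) q"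
      by (rule sw_mult) (use T(1)[of 1] in \<open>simp add: blin_def hlin_def distrib_left distrib_right scl_rules dualD[OF y]
        antipode_rules free.scale_left_distrib free.scale_right_distrib mult.commute\<close>)
    finally show "slice 1 M (\<lambda>z. y (z * p)) (lmul H 2 M (tens H [1, q]) (ptn 2 M xs c))
        = sw (\<lambda>s d. sw (\<lambda>a b. ?G a b p s d) g) q" by (simp add: antipode_mult mult.assoc)
  qed
  also have "\<dots> = sw (\<lambda>p q. sw (\<lambda>a b. sw (\<lambda>s d. ?G a b p s d) q) g) h" by (intro sw_cong refl sw_swap)
  also have "\<dots> = sw (\<lambda>a b. sw (\<lambda>p q. sw (\<lambda>s d. ?G a b p s d) q) h) g" by (rule sw_swap)
  also have "\<dots> = lmul H 1 M (tens H [h]) (slice 1 M y (ptn 2 M xs c))"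
    unfolding inner xs sl[OF y] sw_flin[OF flin_lmul(1)]
    by (intro sw_cong refl) (simp add: flinD(2)[OF flin_lmul(1)] lmul_tens[OF M] c)
  finally show "lmul H 1 M (tens H [h]) (slice 1 M y (ptn 2 M xs c))
    = sw (\<lambda>p q. slice 1 M (\<lambda>z. y (z * p)) (lmul H 2 M (tens H [1, q]) (ptn 2 M xs c))) h" ..
qed

lemma hbilinear_pspan_submodules:
  assumes A: "left_module A" and B': "left_module B'" and M: "left_module M" and \<mu>: "hbilinear A B' M \<mu>"
    and N: "N \<subseteq> carr M"
  shows "b \<in> carr B' \<Longrightarrow> submodule A {a \<in> carr A. \<mu> a b \<in> pspan 2 M N}"
    "a \<in> carr A \<Longrightarrow> submodule B' {b \<in> carr B'. \<mu> a b \<in> pspan 2 M N}"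
proof -
  note z = hbilinear_zero[OF \<mu> A B'] and act = hbilinear_act[OF \<mu> A B'] and p0 = free.subspace_0[OF subspace_pspan]
    and pd = free.subspace_diff[OF subspace_pspan] and l = lmul_pspan[OF M N]
  have d1: "\<mu> (a - a') b = \<mu> a b - \<mu> a' b" if "a \<in> carr A" "a' \<in> carr A" "b \<in> carr B'" for a a' b
    using hbilinearD(2)[OF \<mu> left_moduleD(2)[OF A that(1,2)] that(2,3)] by simp
  have d2: "\<mu> a (b - b') = \<mu> a b - \<mu> a b'" if "a \<in> carr A" "b \<in> carr B'" "b' \<in> carr B'" for a b b'
    using hbilinearD(3)[OF \<mu> that(1) left_moduleD(2)[OF B' that(2,3)] that(3)] by simp
  show "submodule A {a \<in> carr A. \<mu> a b \<in> pspan 2 M N}" if "b \<in> carr B'"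
    using that by (intro submoduleI) (auto simp: left_moduleD(1,2,5)[OF A] z p0 d1 pd act l)
  show "submodule B' {b \<in> carr B'. \<mu> a b \<in> pspan 2 M N}" if "a \<in> carr A"
    using that by (intro submoduleI) (auto simp: left_moduleD(1,2,5)[OF B'] z p0 d2 pd act l)
qed

text \<open>With one argument fixed, the values of the other whose product lies in
  \<open>pspan\<close> form a submodule. Applied to each argument in turn, this reduces the claim to
  generators.\<close>

lemma hbilinear_generated:
  assumes A: "left_module A" and B': "left_module B'" and M: "left_module M" and \<mu>: "hbilinear A B' M \<mu>"
    and N: "N \<subseteq> carr M"
    and X: "X \<subseteq> carr A" "generated_submodule A X = carr A" and Y: "Y \<subseteq> carr B'" "generated_submodule B' Y = carr B'"
    and g: "\<And>a b. a \<in> X \<Longrightarrow> b \<in> Y \<Longrightarrow> \<mu> a b \<in> pspan 2 M N" and a: "a \<in> carr A" and b: "b \<in> carr B'"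
  shows "\<mu> a b \<in> pspan 2 M N"
proof -
  note sub = hbilinear_pspan_submodules[OF A B' M \<mu> N]
  have 1: "\<mu> a b \<in> pspan 2 M N" if a: "a \<in> X" and b: "b \<in> carr B'" for a b
  proof -
    have a': "a \<in> carr A" using X(1) a by blast
    have "Y \<subseteq> {b \<in> carr B'. \<mu> a b \<in> pspan 2 M N}" using g[OF a] Y(1) by blast
    from generated_submodule_props(3)[OF B' Y(1) sub(2)[OF a'] this] show ?thesis using b Y(2) by blast
  qed
  have "X \<subseteq> {a \<in> carr A. \<mu> a b \<in> pspan 2 M N}" using 1[OF _ b] X(1) by blast
  from generated_submodule_props(3)[OF A X(1) sub(1)[OF b] this] show ?thesis using a X(2) by blast
qed

text \<open>By \<open>slice_act\<close>, acting by \<open>h\<close> on a coefficient of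
  \<open>\<mu> a b\<close> gives a combination of coefficients of products \<open>\<mu> a b'\<close>
  with \<open>b'\<close> a multiple of \<open>b\<close>. So the linear span is already stable under
  \<open>H\<close>.\<close>

lemma linear_span_coefs:
  assumes A: "left_module A" and B': "left_module B'" and M: "left_module M" and \<mu>: "hbilinear A B' M \<mu>"
  defines "G \<equiv> {coef M y (\<mu> a b) | a b y. a \<in> carr A \<and> b \<in> carr B' \<and> y \<in> dual H}"
  shows "linear_span H M G = generated_submodule M G"
proof
  have GM: "G \<subseteq> carr M" unfolding G_def using coef_in[OF M] hbilinearD(1)[OF \<mu>] by blast
  define lin where "lin V \<longleftrightarrow> V \<subseteq> carr M \<and> 0 \<in> V \<and> (\<forall>a\<in>V. \<forall>b\<in>V. a + b \<in> V) \<and> (\<forall>c. \<forall>a\<in>V. act M (scl H c 1) a \<in> V)" for V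
  have ls: "linear_span H M G = \<Inter>{V. lin V \<and> G \<subseteq> V}" unfolding linear_span_def lin_def by (rule arg_cong[of _ _ Inter]) blast
  let ?L = "linear_span H M G"
  have "lin (carr M)" unfolding lin_def by (auto simp: left_moduleD(1,3,5)[OF M])
  then have LM: "?L \<subseteq> carr M" unfolding ls using GM by blast
  have linL: "lin ?L" unfolding lin_def
  proof (intro conjI ballI allI LM)
    show "0 \<in> ?L" unfolding ls lin_def by blast
    show "a + b \<in> ?L" if "a \<in> ?L" "b \<in> ?L" for a b using that unfolding ls lin_def by blast
    show "act M (scl H c 1) a \<in> ?L" if "a \<in> ?L" for a c using that unfolding ls lin_def by blast
  qed
  have GL: "G \<subseteq> ?L" unfolding ls by blast
  have "lin (generated_submodule M G)"
    unfolding lin_def by (simp add: submoduleD[OF generated_submodule_props(1)[OF M GM]])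
  with generated_submodule_props(2)[OF M GM] show "?L \<subseteq> generated_submodule M G"
    unfolding ls by (intro Inter_lower CollectI conjI)
  have emb_sub: "free.subspace (emb H M ` ?L)"
  proof (rule free.subspaceI)
    note e = emb_rules[OF M]
    show "0 \<in> emb H M ` ?L" using linL e(6)[OF left_moduleD(1)[OF M]] unfolding lin_def by force
    fix x assume "x \<in> emb H M ` ?L"
    then obtain a where a: "a \<in> ?L" "x = emb H M a" by blast
    show "fscale c x \<in> emb H M ` ?L" for c
      using linL e(5)[of a c] a LM unfolding lin_def by (metis imageI subset_iff)
    show "x + z \<in> emb H M ` ?L" if z: "z \<in> emb H M ` ?L" for z
    proof -
      obtain b where b: "b \<in> ?L" "z = emb H M b" using z by blast
      have "emb H M (a + b) = x + z" using e(1)[of a b] a b LM by blast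
      moreover have "a + b \<in> ?L" using linL a b unfolding lin_def by blast
      ultimately show ?thesis by (metis imageI)
    qed
  qed
  have gact: "act M h v \<in> ?L" if v: "v \<in> G" for v h
  proof -
    obtain a b y where d: "v = coef M y (\<mu> a b)" "a \<in> carr A" "b \<in> carr B'" "y \<in> dual H" using v unfolding G_def by blast
    note X = hbilinearD(1)[OF \<mu> d(2,3)]
    have v': "v \<in> carr M" using GM v by blast
    have "emb H M (act M h v) = sw (\<lambda>p q. slice 1 M (\<lambda>z. y (z * p)) (\<mu> a (act B' q b))) h"
      using slice_act[OF M d(4) X, of h] emb_coef[OF M d(4) X] hbilinear_act(2)[OF \<mu> A B' d(2,3)]
      by (simp add: emb_act_lmul[OF M v', unfolded d(1)] d(1))
    also have "\<dots> \<in> emb H M ` ?L"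
      unfolding sw_def
    proof (intro fext_mem emb_sub)
      fix xs
      have b': "act B' (xs ! 1) b \<in> carr B'" by (rule left_moduleD(5)[OF B' d(3)])
      let ?y = "\<lambda>z. y (z * xs ! 0)"
      have "coef M ?y (\<mu> a (act B' (xs ! 1) b)) \<in> ?L"
        using GL d(2) b' dual_mult_right[OF d(4)] unfolding G_def by blast
      then show "slice 1 M ?y (\<mu> a (act B' (xs ! 1) b)) \<in> emb H M ` ?L"
        using emb_coef[OF M dual_mult_right[OF d(4)] hbilinearD(1)[OF \<mu> d(2) b']] by (metis imageI)
    qed
    finally obtain u where u: "emb H M (act M h v) = emb H M u" "u \<in> ?L" by blast
    then show ?thesis using emb_inj[OF M left_moduleD(5)[OF M v'] _ u(1)] LM by blast
  qed
  \<comment> \<open>Stability under \<open>H\<close> is known for the elements of \<open>G\<close>.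
    The elements with this property form a linear subspace, which therefore contains the whole
    span.\<close>
  let ?V = "{v \<in> ?L. \<forall>h. act M h v \<in> ?L}"
  have "lin ?V" unfolding lin_def
  proof (intro conjI ballI allI)
    note m = left_moduleD[OF M]
    show "?V \<subseteq> carr M" using LM by blast
    show "0 \<in> ?V" using linL m(10) unfolding lin_def by auto
    show "a + b \<in> ?V" if a: "a \<in> ?V" and b: "b \<in> ?V" for a b
    proof -
      have "act M h (a + b) = act M h a + act M h b" for h by (rule m(6)) (use a b LM in auto)
      then show ?thesis using a b linL unfolding lin_def by auto
    qed
    show "act M (scl H c 1) a \<in> ?V" if a: "a \<in> ?V" for a c
    proof -
      have a': "a \<in> carr M" using a LM by blast
      have "act M h (act M (scl H c 1) a) = act M (scl H c 1) (act M h a)" for h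
        using m(8)[OF a', of h "scl H c 1"] m(8)[OF a', of "scl H c 1" h] by (simp add: scl_rules)
      then show ?thesis using a linL unfolding lin_def by auto
    qed
  qed
  then have V: "?L \<subseteq> ?V" using gact GL unfolding ls by blast
  show "generated_submodule M G \<subseteq> ?L"
  proof (rule generated_submodule_props(3)[OF M GM submoduleI GL])
    show "?L \<subseteq> carr M" by (rule LM)
    show "0 \<in> ?L" using linL unfolding lin_def by blast
    show "act M f a \<in> ?L" if "a \<in> ?L" for f a using that V by blast
    show "a - b \<in> ?L" if a: "a \<in> ?L" and b: "b \<in> ?L" for a b
    proof -
      have b': "b \<in> carr M" using b LM by blast
      have "act M (- 1) b \<in> ?L" using b V by blast
      moreover have "act M (- 1) b = - b"
        using left_moduleD(7)[OF M b', of 1 "- 1"] left_moduleD(9)[OF M b'] left_moduleD(7)[OF M b', of 0 0]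
        by (simp add: eq_neg_iff_add_eq_0 add.commute)
      ultimately have "a + (- b) \<in> ?L" using linL a unfolding lin_def by metis
      then show ?thesis by simp
    qed
  qed
qed

text \<open>The four projections come in two pairs because the two kinds of components live in
  modules of different types. Slicing reduces the claim to rank one, where \<open>inj\<close>
  applies.\<close>

lemma eq_components:
  assumes M: "left_module M" and N: "left_module N" and K: "left_module K"
    and h: "module_hom_on M N q1" "module_hom_on M N q2" "module_hom_on M K r1" "module_hom_on M K r2"
    and inj: "\<And>m. m \<in> carr M \<Longrightarrow> q1 m = 0 \<Longrightarrow> q2 m = 0 \<Longrightarrow> r1 m = 0 \<Longrightarrow> r2 m = 0 \<Longrightarrow> m = 0"
    and X: "X \<in> pseudo H n M" "Y \<in> pseudo H n M" and n: "n \<ge> 1"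
    and eq: "push H n N q1 X = push H n N q1 Y" "push H n N q2 X = push H n N q2 Y"
      "push H n K r1 X = push H n K r1 Y" "push H n K r2 X = push H n K r2 Y"
  shows "X = Y"
proof -
  let ?Z = "\<lambda>n X. push H n N q1 X = 0 \<and> push H n N q2 X = 0 \<and> push H n K r1 X = 0 \<and> push H n K r2 X = 0"
  have "X - Y = 0"
  proof (rule slice_induct_zero[where K = ?Z, OF M _ _ free.subspace_diff[OF subspace_pseudo[OF M] X] n])
    fix n y X assume 1: "n \<ge> 1" "y \<in> dual H" "X \<in> pseudo H (Suc n) M" "?Z (Suc n) X"
    show "?Z n (slice n M y X)"
      unfolding slice_push[OF M N h(1) 1(2,1,3), symmetric] slice_push[OF M N h(2) 1(2,1,3), symmetric]
        slice_push[OF M K h(3) 1(2,1,3), symmetric] slice_push[OF M K h(4) 1(2,1,3), symmetric]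
      using 1(4) by (simp add: flinD(3)[OF flin_slice])
  next
    fix m assume m: "m \<in> carr M" and z: "?Z 1 (emb H M m)"
    have q0: "q m = 0" if "left_module L" "module_hom_on M L q" "push H 1 L q (emb H M m) = 0"
      for L :: "('h, 'n::ab_group_add, 'z) hmodule_scheme" and q
    proof (rule emb_inj[OF that(1) module_hom_onD(1)[OF that(2) m] left_moduleD(1)[OF that(1)]])
      show "emb H L (q m) = emb H L 0"
        using push_ptens[OF M that(1,2) _ m, of "tens H [1]" 1] that(3) emb_rules(6)[OF that(1) left_moduleD(1)[OF that(1)]]
        by (simp add: emb_def)
    qed
    show "m = 0"
      using z by (intro inj[OF m] q0[OF N h(1)] q0[OF N h(2)] q0[OF K h(3)] q0[OF K h(4)]) simp_all
  next
    show "?Z n (X - Y)" using eq by (simp add: flinD(5)[OF flin_lmul(3)])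
  qed
  then show ?thesis by simp
qed

lemma hbilinear_components:
  assumes A: "left_module A" and B': "left_module B'" and M: "left_module M" and N: "left_module N" and K: "left_module K"
    and h: "module_hom_on M N q1" "module_hom_on M N q2" "module_hom_on M K r1" "module_hom_on M K r2"
    and inj: "\<And>m. m \<in> carr M \<Longrightarrow> q1 m = 0 \<Longrightarrow> q2 m = 0 \<Longrightarrow> r1 m = 0 \<Longrightarrow> r2 m = 0 \<Longrightarrow> m = 0"
    and \<mu>: "\<And>a b. a \<in> carr A \<Longrightarrow> b \<in> carr B' \<Longrightarrow> \<mu> a b \<in> pseudo H 2 M"
    and bil: "hbilinear A B' N (\<lambda>a b. push H 2 N q1 (\<mu> a b))" "hbilinear A B' N (\<lambda>a b. push H 2 N q2 (\<mu> a b))"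
      "hbilinear A B' K (\<lambda>a b. push H 2 K r1 (\<mu> a b))" "hbilinear A B' K (\<lambda>a b. push H 2 K r2 (\<mu> a b))"
  shows "hbilinear A B' M \<mu>"
proof -
  have eq: "X = Y" if "X \<in> pseudo H 2 M" "Y \<in> pseudo H 2 M" "push H 2 N q1 X = push H 2 N q1 Y" "push H 2 N q2 X = push H 2 N q2 Y"
    "push H 2 K r1 X = push H 2 K r1 Y" "push H 2 K r2 X = push H 2 K r2 Y" for X Y
    by (rule eq_components[OF M N K h inj that(1,2) _ that(3-6)]) simp_all
  note add = free.subspace_add[OF subspace_pseudo[OF M]] and pl = push_lmul[OF M N h(1)] push_lmul[OF M N h(2)]
    push_lmul[OF M K h(3)] push_lmul[OF M K h(4)] and D = hbilinearD[OF bil(1)] hbilinearD[OF bil(2)] hbilinearD[OF bil(3)] hbilinearD[OF bil(4)]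
    and m = left_moduleD(3,5)[OF A] left_moduleD(3,5)[OF B']
  show ?thesis
    unfolding hbilinear_def
  proof (intro conjI ballI allI \<mu>)
    show "\<mu> (a + a') b = \<mu> a b + \<mu> a' b" if "a \<in> carr A" "a' \<in> carr A" "b \<in> carr B'" for a a' b
      by (rule eq) (use that in \<open>simp_all add: add \<mu> m D(2) D(6) D(10) D(14) flinD(1)[OF flin_lmul(3)]\<close>)
    show "\<mu> a (b + b') = \<mu> a b + \<mu> a b'" if "a \<in> carr A" "b \<in> carr B'" "b' \<in> carr B'" for a b b'
      by (rule eq) (use that in \<open>simp_all add: add \<mu> m D(3) D(7) D(11) D(15) flinD(1)[OF flin_lmul(3)]\<close>)
    show "\<mu> (act A f a) (act B' g b) = lmul H 2 M (tens H [f, g]) (\<mu> a b)" if "a \<in> carr A" "b \<in> carr B'" for a b f g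
      by (rule eq) (use that in \<open>simp_all add: lmul_in[OF M] \<mu> m D(4) D(8) D(12) D(16) pl\<close>)
  qed
qed

end

section \<open>Inner pseudoderivations and the pseudoalgebra \<open>S\<^sub>0(J)\<close>\<close>

lemma (in cocommutative_hopf) hbilinear_cong:
  assumes "hbilinear A B' M \<nu>" "left_module A" "left_module B'" "\<And>a b. a \<in> carr A \<Longrightarrow> b \<in> carr B' \<Longrightarrow> \<mu> a b = \<nu> a b"
  shows "hbilinear A B' M \<mu>"
  unfolding hbilinear_def by (simp add: assms(4) hbilinearD[OF assms(1)] left_moduleD(3,5)[OF assms(2)] left_moduleD(3,5)[OF assms(3)])

context finite_jordan
begin

abbreviation "br \<equiv> cend_bracket H J"
abbreviation "Lb a b \<equiv> br (lmap J a) (lmap J b)"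

definition "Inn = generated_submodule C {coef C y (Lb a b) | a b y. a \<in> carr J \<and> b \<in> carr J \<and> y \<in> dual H}"

lemma Lb_in: "a \<in> carr J \<Longrightarrow> b \<in> carr J \<Longrightarrow> Lb a b \<in> pseudo H 2 C"
  by (intro cend_bracket_in lmap_in)

lemma Inn_props:
  shows "submodule C Inn" "a \<in> carr J \<Longrightarrow> b \<in> carr J \<Longrightarrow> y \<in> dual H \<Longrightarrow> coef C y (Lb a b) \<in> Inn"
    "submodule C N \<Longrightarrow> (\<And>a b y. a \<in> carr J \<Longrightarrow> b \<in> carr J \<Longrightarrow> y \<in> dual H \<Longrightarrow> coef C y (Lb a b) \<in> N) \<Longrightarrow> Inn \<subseteq> N"
proof -
  let ?G = "{coef C y (Lb a b) | a b y. a \<in> carr J \<and> b \<in> carr J \<and> y \<in> dual H}"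
  have G: "?G \<subseteq> carr C" using coef_in[OF C _ Lb_in] by blast
  note g = generated_submodule_props[OF C G, folded Inn_def]
  show "submodule C Inn" by (rule g(1))
  show "coef C y (Lb a b) \<in> Inn" if "a \<in> carr J" "b \<in> carr J" "y \<in> dual H" using g(2) that by blast
  show "Inn \<subseteq> N" if N: "submodule C N" and c: "\<And>a b y. a \<in> carr J \<Longrightarrow> b \<in> carr J \<Longrightarrow> y \<in> dual H \<Longrightarrow> coef C y (Lb a b) \<in> N"
  proof (rule g(3)[OF N])
    show "?G \<subseteq> N" using c by auto
  qed
qed

lemma Lb_pspan: "a \<in> carr J \<Longrightarrow> b \<in> carr J \<Longrightarrow> Lb a b \<in> pspan 2 C Inn"
  unfolding coef_mem_iff[OF C Inn_props(1) Lb_in] using Inn_props(2) by simp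

lemma Inn_der: "Inn \<subseteq> carr (der H J)"
proof (rule Inn_props(3)[OF submodule_der])
  fix a b y assume h: "a \<in> carr J" "b \<in> carr J" and y: "y \<in> dual H"
  show "coef C y (Lb a b) \<in> carr (der H J)"
    by (rule bspec[OF coef_mem_iff[OF C submodule_der Lb_in[OF h], THEN iffD1, OF cend_bracket_der(2)[OF h]] y])
qed

lemma cb_jacobi:
  assumes "u \<in> word_space C" "v \<in> word_space C" "w \<in> word_space C" "z \<in> word_space J"
  shows "ap (cb (cb u v) w) z = ap (cb u (cb v w)) z - ap (cb v (cb u w)) z"
  by (simp add: ap_cb cb_in assms ap_in wmul_lin algebra_simps)

text \<open>\<open>[D, L_a]\<close> is \<open>L_(D a)\<close>. Exchanging the arguments changes the
  sign and permutes the factors, and both operations preserve the span.\<close>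

lemma br_lm_pspan:
  assumes a: "a \<in> carr J" and D: "D \<in> carr (der H J)" shows "br (lmap J a) D \<in> pspan 2 C (lmodule H J)"
proof -
  have "pushL (D a) \<in> pspan 2 C (lmodule H J)"
    by (rule push_pspan[OF J C lmap_hom subset_refl])
      (use app_in[OF der_subset[OF D] a] in \<open>simp_all add: lmodule_eq pseudo_eq_pspan[OF J]\<close>)
  then have "pswap C (br D (lmap J a)) \<in> pspan 2 C (lmodule H J)"
    unfolding push_lmap_der[OF D a] using submoduleD(1)[OF submodule_lmodule] by (intro pperm_pspan[OF C]) simp_all
  then show ?thesis
    unfolding cend_bracket_skew[OF J finite_J der_subset[OF D] lmap_in[OF a]]
    using free.subspace_neg[OF subspace_pspan] by fastforce
qed

lemma Lb_lmodule: "l \<in> lmodule H J \<Longrightarrow> m \<in> lmodule H J \<Longrightarrow> br l m \<in> pspan 2 C Inn"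
  using Lb_pspan unfolding lmodule_eq by blast

text \<open>By the Jacobi identity \<open>[[L_a, L_b], D']\<close> is a difference of brackets of
  the form \<open>[L_a, [L_b, D']]\<close>. The bracket with \<open>D'\<close> lies in
  \<open>L(J)\<close>, so the outer one is inner; slicing passes from \<open>[L_a, L_b]\<close> to
  its coefficients.\<close>

lemma br_Inn:
  assumes D: "D \<in> Inn" and D': "D' \<in> Inn" shows "br D D' \<in> pspan 2 C Inn"
proof -
  note IC = submoduleD(1)[OF Inn_props(1)]
  have E: "D' \<in> carr (der H J)" "D' \<in> carr C" using D' Inn_der IC by auto
  note Lsub = submoduleD(1)[OF submodule_lmodule]
  have main: "br (coef C y (Lb a b)) D' \<in> pspan 2 C Inn" if a: "a \<in> carr J" and b: "b \<in> carr J" and y: "y \<in> dual H" for a b y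
  proof -
    note la = lmap_in[OF a] and lb = lmap_in[OF b]
    have part: "pext H 1 2 C br (emb H C (lmap J a)) (br (lmap J b) D') \<in> pspan 3 C Inn" if a: "a \<in> carr J" and b: "b \<in> carr J" for a b
    proof -
      have "emb H C (lmap J a) \<in> pspan 1 C (lmodule H J)"
        unfolding pspan_1[OF C submodule_lmodule] by (rule imageI) (simp add: lmodule_eq a)
      then have "pext H 1 2 C br (emb H C (lmap J a)) (br (lmap J b) D') \<in> pspan (1 + 2) C Inn"
        by (intro pext_pspan[OF C C C cb_bil Lsub Lsub IC] br_lm_pspan[OF b E(1)] Lb_lmodule)
      then show ?thesis by simp
    qed
    note i = pext_emb_3[OF C C C cb_bil]
    let ?X = "pext H 1 2 C br (emb H C (lmap J a)) (br (lmap J b) D')"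
    let ?Y = "pperm H 3 C (transpose 0 1) (pext H 1 2 C br (emb H C (lmap J b)) (br (lmap J a) D'))"
    have XY: "?X \<in> pseudo H 3 C" "pext H 1 2 C br (emb H C (lmap J b)) (br (lmap J a) D') \<in> pseudo H 3 C"
      by (intro i(1) lmap_in cend_bracket_in a b E(2))+
    have jac: "pext H 2 1 C br (Lb a b) (emb H C D') = ?X - ?Y"
    proof (rule C_eqI3)
      show "pext H 2 1 C br (Lb a b) (emb H C D') \<in> pseudo H 3 C" by (rule i(3)[OF Lb_in[OF a b] E(2)])
      show "?X - ?Y \<in> pseudo H 3 C" by (intro free.subspace_diff[OF subspace_pseudo[OF C]] XY pperm_in[OF C]) simp
      fix w0 w1 w2 z assume z: "z \<in> word_space J"
      show "ap (Theta C [w0, w1, w2] (pext H 2 1 C br (Lb a b) (emb H C D'))) z = ap (Theta C [w0, w1, w2] (?X - ?Y)) z"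
        by (simp add: flinD(5)[OF flin_Theta] Theta_swap_3(1)[OF C XY(2)] i(2,4) lmap_in cend_bracket_in a b E(2) Theta_cb
            cb_jacobi wtens_in z wmul_lin)
    qed
    have "?X - ?Y \<in> pspan 3 C Inn"
      by (intro free.subspace_diff[OF subspace_pspan] part pperm_pspan[OF C IC] a b) simp
    then have "slice 2 C y (pext H 2 1 C br (Lb a b) (emb H C D')) \<in> pspan 2 C Inn"
      unfolding jac using slice_pspan[OF C IC y, of 2] by simp
    moreover have "slice 2 C y (pext H 2 1 C br (Lb a b) (emb H C D')) = br (coef C y (Lb a b)) D'"
      using slice_pext[OF C C C cb_bil y, of 1 "Lb a b" "emb H C D'" 1] Lb_in[OF a b] emb_in[OF E(2)]
        emb_coef[OF C y Lb_in[OF a b]] pext_emb_emb[OF C C C cb_bil coef_in[OF C y Lb_in[OF a b]] E(2)] by simp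
    ultimately show ?thesis by simp
  qed
  have "Inn \<subseteq> {D \<in> carr C. br D D' \<in> pspan 2 C Inn}"
    by (rule Inn_props(3)[OF hbilinear_pspan_submodules(1)[OF C C C cb_bil IC E(2)]])
      (use main coef_in[OF C _ Lb_in] in auto)
  then show ?thesis using D by blast
qed

lemma U_props:
  assumes a: "a \<in> carr J" and b: "b \<in> carr J"
  shows "U_op H J a b \<in> pseudo H 2 S" "push H 2 C fst (U_op H J a b) = pushL (pprod J a b)"
    "push H 2 C snd (U_op H J a b) = Lb a b"
  using in_L_props[OF J_prod_in[OF a b]] in_Der_props[OF cend_bracket_der(2)[OF a b]]
  by (simp_all add: U_op_def flinD(1)[OF flin_lmul(3)] free.subspace_add[OF subspace_pseudo[OF S_module]])

lemma U_bil: "hbilinear J J S (U_op H J)"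
\<comment> \<open>The structure module has two projections only; each is supplied twice to fill the
  four places.\<close>
proof (rule hbilinear_components[OF J J S_module C C S_homs S_homs])
  have 1: "hbilinear J J C (\<lambda>a b. push H 2 C fst (U_op H J a b))"
    by (rule hbilinear_cong[OF hbilinear_push[OF J C lmap_hom J_bil] J J U_props(2)])
  have 2: "hbilinear J J C (\<lambda>a b. push H 2 C snd (U_op H J a b))"
    by (rule hbilinear_cong[OF hbilinear_comp[OF cb_bil lmap_hom lmap_hom] J J U_props(3)])
  show "hbilinear J J C (\<lambda>a b. push H 2 C fst (U_op H J a b))" "hbilinear J J C (\<lambda>a b. push H 2 C snd (U_op H J a b))"
    "hbilinear J J C (\<lambda>a b. push H 2 C fst (U_op H J a b))" "hbilinear J J C (\<lambda>a b. push H 2 C snd (U_op H J a b))"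
    by (rule 1 2)+
qed (auto simp: U_props prod_eq_iff)

lemma coef_U:
  assumes "a \<in> carr J" "b \<in> carr J" "y \<in> dual H"
  shows "coef S y (U_op H J a b) = (lmap J (coef J y (pprod J a b)), coef C y (Lb a b))"
  using coef_push[OF S_module C S_homs(1) assms(3) U_props(1)[OF assms(1,2)]]
    coef_push[OF S_module C S_homs(2) assms(3) U_props(1)[OF assms(1,2)]]
    coef_push[OF J C lmap_hom assms(3) J_prod_in[OF assms(1,2)]]
  by (simp add: U_props assms prod_eq_iff)

text \<open>Fourier coefficients compose functionals with the antipode, and since the antipode is
  involutive all functionals arise. Then \<open>linear_span_coefs\<close> turns the linear span into
  a submodule.\<close>

lemma S0_generated: "S0 H B J = generated_submodule S {coef S y (U_op H J a b) | a b y. a \<in> carr J \<and> b \<in> carr J \<and> y \<in> dual H}"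
proof -
  let ?F = "\<lambda>a b x. (lmap J (fourier H B J x (pprod J a b)), fourier H B C x (Lb a b))"
  have F: "?F a b x = coef S (\<lambda>h. x (antipode H h)) (U_op H J a b)" if "a \<in> carr J" "b \<in> carr J" "x \<in> dual H" for a b x
    using fourier_eq_coef[OF J J_prod_in[OF that(1,2)] that(3)] fourier_eq_coef[OF C Lb_in[OF that(1,2)] that(3)]
      coef_U[OF that(1,2) dual_antipode[OF that(3)]] by simp
  have "{?F a b x | a b x. a \<in> carr J \<and> b \<in> carr J \<and> x \<in> dual H}
      = {coef S y (U_op H J a b) | a b y. a \<in> carr J \<and> b \<in> carr J \<and> y \<in> dual H}"
  proof (intro equalityI subsetI)
    fix v assume "v \<in> {?F a b x | a b x. a \<in> carr J \<and> b \<in> carr J \<and> x \<in> dual H}"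
    then obtain a b x where v: "v = ?F a b x" "a \<in> carr J" "b \<in> carr J" "x \<in> dual H" by blast
    then show "v \<in> {coef S y (U_op H J a b) | a b y. a \<in> carr J \<and> b \<in> carr J \<and> y \<in> dual H}"
      using F[OF v(2-4)] dual_antipode[OF v(4)] by blast
  next
    fix v assume "v \<in> {coef S y (U_op H J a b) | a b y. a \<in> carr J \<and> b \<in> carr J \<and> y \<in> dual H}"
    then obtain a b y where v: "v = coef S y (U_op H J a b)" "a \<in> carr J" "b \<in> carr J" "y \<in> dual H" by blast
    have "v = ?F a b (\<lambda>h. y (antipode H h))"
      using F[OF v(2,3) dual_antipode[OF v(4)]] v(1) by (simp add: antipode_antipode)
    then show "v \<in> {?F a b x | a b x. a \<in> carr J \<and> b \<in> carr J \<and> x \<in> dual H}" using v(2,3) dual_antipode[OF v(4)] by blast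
  qed
  then have "S0 H B J = linear_span H S {coef S y (U_op H J a b) | a b y. a \<in> carr J \<and> b \<in> carr J \<and> y \<in> dual H}"
    by (simp add: S0_def linear_span_def structure_pseudoalgebra_def)
  then show ?thesis using linear_span_coefs[OF J J S_module U_bil] by simp
qed

lemma S0_submodule: "submodule S (S0 H B J)"
  and S0_subset: "S0 H B J \<subseteq> lmodule H J \<times> Inn"
  and S0_parts: "a \<in> carr J \<Longrightarrow> b \<in> carr J \<Longrightarrow> y \<in> dual H \<Longrightarrow>
    (lmap J (coef J y (pprod J a b)), 0) \<in> S0 H B J \<and> (0, coef C y (Lb a b)) \<in> S0 H B J"
proof -
  let ?G = "{coef S y (U_op H J a b) | a b y. a \<in> carr J \<and> b \<in> carr J \<and> y \<in> dual H}"
  have G: "?G \<subseteq> carr S" using coef_in[OF S_module _ U_props(1)] by blast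
  note g = generated_submodule_props[OF S_module G, folded S0_generated]
  show s0: "submodule S (S0 H B J)" by (rule g(1))
  note L = submoduleD[OF submodule_lmodule] and I = submoduleD[OF Inn_props(1)]
  show "S0 H B J \<subseteq> lmodule H J \<times> Inn"
  proof (rule g(3))
    show "submodule S (lmodule H J \<times> Inn)"
      using Inn_der by (intro submoduleI) (auto simp: S_carr S_act zero_prod_def L I)
    show "?G \<subseteq> lmodule H J \<times> Inn"
      using coef_in[OF J _ J_prod_in] Inn_props(2) by (auto simp: coef_U lmodule_eq)
  qed
  assume a: "a \<in> carr J" and b: "b \<in> carr J" and y: "y \<in> dual H"
  have U: "U_op H J a b \<in> pspan 2 S (S0 H B J)" if "a \<in> carr J" "b \<in> carr J" for a b
    unfolding coef_mem_iff[OF S_module s0 U_props(1)[OF that]] using g(2) that by blast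
  \<comment> \<open>Compared with \<open>U_op H J a b\<close>, this transpose has the same
    multiplication part and the opposite pseudoderivation part.\<close>
  let ?V = "pswap S (U_op H J b a)"
  have V: "?V \<in> pspan 2 S (S0 H B J)"
    by (rule pperm_pspan[OF S_module submoduleD(1)[OF s0] _ U[OF b a]]) simp
  have Vs: "?V \<in> pseudo H 2 S" by (rule pperm_in[OF S_module _ U_props(1)[OF b a]]) simp
  have Vl: "push H 2 C fst ?V = pushL (pprod J a b)"
    using push_pperm[OF S_module C S_homs(1) _ U_props(1)[OF b a], of "transpose 0 1"]
      push_pperm[OF J C lmap_hom _ J_prod_in[OF b a], of "transpose 0 1"] J_comm[OF a b] by (simp add: U_props a b)
  have Vd: "push H 2 C snd ?V = - Lb a b"
    using push_pperm[OF S_module C S_homs(2) _ U_props(1)[OF b a], of "transpose 0 1"]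
      cend_bracket_skew[OF J finite_J lmap_in[OF b] lmap_in[OF a]] by (simp add: U_props a b)
  \<comment> \<open>Division by two is the action of \<open>scl H (1/2) 1\<close>, which exists in
    characteristic zero.\<close>
  have half: "v \<in> S0 H B J" if "v \<in> carr S" "v + v \<in> S0 H B J" for v
  proof -
    interpret s: vector_space "scl H" by (rule vector_space_scl)
    have 1: "scl H (1/2) 1 + scl H (1/2) 1 = (1::'h)"
      using s.scale_left_distrib[of "1/2" "1/2" 1] by simp
    have "act S (scl H (1/2) 1) (v + v) = act S (scl H (1/2) 1 + scl H (1/2) 1) v"
      using left_moduleD(6)[OF S_module that(1,1)] left_moduleD(7)[OF S_module that(1)] by simp
    then show ?thesis using submoduleD(6)[OF s0 that(2), of "scl H (1/2) 1"] left_moduleD(9)[OF S_module that(1)] unfolding 1 by simp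
  qed
  have c1: "coef S y X \<in> S0 H B J" if "X \<in> pspan 2 S (S0 H B J)" "X \<in> pseudo H 2 S" for X
    by (rule bspec[OF coef_mem_iff[OF S_module s0 that(2), THEN iffD1, OF that(1)] y])
  have c2: "coef S y X = (coef C y (push H 2 C fst X), coef C y (push H 2 C snd X))" if "X \<in> pseudo H 2 S" for X
    using coef_push[OF S_module C S_homs(1) y that] coef_push[OF S_module C S_homs(2) y that] by (simp add: prod_eq_iff)
  have cl: "coef C y (pushL (pprod J a b)) = lmap J (coef J y (pprod J a b))"
    by (rule coef_push[OF J C lmap_hom y J_prod_in[OF a b]])
  have add: "coef C y (X + Y) = coef C y X + coef C y Y" if "X \<in> pseudo H 2 C" "Y \<in> pseudo H 2 C" for X Y
    unfolding coef_def by (simp add: flinD(1)[OF flin_slice] unemb_rules(2)[OF C slice_2_in[OF C y] slice_2_in[OF C y]] that)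
  have z: "coef C y 0 = 0"
    using add[of 0 0] free.subspace_0[OF subspace_pseudo[OF C]] by simp
  note in1 = push_in[OF J C lmap_hom J_prod_in[OF a b]] and in2 = Lb_in[OF a b]
  have lc: "lmap J (coef J y (pprod J a b)) \<in> lmodule H J" using coef_in[OF J y J_prod_in[OF a b]] lmodule_eq by blast
  have dc: "coef C y (Lb a b) \<in> carr (der H J)" using Inn_props(2)[OF a b y] Inn_der by blast
  have zero: "0 \<in> lmodule H J" "0 \<in> carr (der H J)" using L(2) submoduleD(2)[OF submodule_der] by auto
  have "coef S y (U_op H J a b + ?V) = (lmap J (coef J y (pprod J a b)), 0) + (lmap J (coef J y (pprod J a b)), 0)"
    by (simp only: c2 free.subspace_add[OF subspace_pseudo[OF S_module]] U_props a b Vs flinD(1)[OF flin_lmul(3)] Vl Vd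
        add in1 cl add_Pair right_minus z add_0)
  moreover have "coef S y (U_op H J a b - ?V) = (0, coef C y (Lb a b)) + (0, coef C y (Lb a b))"
    by (simp only: c2 free.subspace_diff[OF subspace_pseudo[OF S_module]] U_props a b Vs flinD(5)[OF flin_lmul(3)] Vl Vd
        add in2 add_Pair diff_self diff_minus_eq_add z add_0)
  moreover have "coef S y (U_op H J a b + ?V) \<in> S0 H B J" "coef S y (U_op H J a b - ?V) \<in> S0 H B J"
    by (intro c1 free.subspace_add[OF subspace_pspan] free.subspace_diff[OF subspace_pspan] U V a b
      free.subspace_add[OF subspace_pseudo[OF S_module]] free.subspace_diff[OF subspace_pseudo[OF S_module]] U_props(1) Vs)+
  ultimately show "(lmap J (coef J y (pprod J a b)), 0) \<in> S0 H B J \<and> (0, coef C y (Lb a b)) \<in> S0 H B J"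
    using half[of "(lmap J (coef J y (pprod J a b)), 0)"] half[of "(0, coef C y (Lb a b))"] lc dc zero by (simp add: S_carr)
qed

end

section \<open>The bracket of the Tits--Kantor--Koecher construction\<close>

locale simple_jordan = finite_jordan H B J for H :: "('k::field_char_0, 'h::ring_1) hopf" and B
    and J :: "('k, 'h, 'm::ab_group_add) pseudoalg" +
  assumes simple_J: "simple_pseudoalgebra H J"
begin

text \<open>Such an \<open>N\<close> absorbs all products, so it is an ideal, and it is not 0
  because some product is not 0.\<close>

lemma coefs_generate:
  assumes N: "submodule J N" and g: "\<And>a b y. a \<in> carr J \<Longrightarrow> b \<in> carr J \<Longrightarrow> y \<in> dual H \<Longrightarrow> coef J y (pprod J a b) \<in> N"
  shows "N = carr J"
proof -
  have NJ: "N \<subseteq> carr J" by (rule submoduleD(1)[OF N])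
  have p: "pprod J a b \<in> pspan 2 J N" if "a \<in> carr J" "b \<in> carr J" for a b
    unfolding coef_mem_iff[OF J N J_prod_in[OF that]] using g[OF that] by simp
  then have "pideal H J N" unfolding pideal_def pspan_def[symmetric] using N NJ by blast
  then have "N = {0} \<or> N = carr J" using simple_J unfolding simple_pseudoalgebra_def by simp
  moreover obtain a b where "a \<in> carr J" "b \<in> carr J" "pprod J a b \<noteq> 0" using simple_J unfolding simple_pseudoalgebra_def by blast
  ultimately show ?thesis using p[of a b] by (auto simp: pspan_zero[OF J])
qed

text \<open>\<open>S0_parts\<close> separates the two components of each generator. Since
  \<open>J\<close> is generated by coefficients of products, the first components reach every
  \<open>L_a\<close>; the second ones generate \<open>Inn\<close>.\<close>

lemma S0_eq: "S0 H B J = lmodule H J \<times> Inn"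
proof (rule antisym[OF S0_subset])
  have "{a \<in> carr J. (lmap J a, 0) \<in> S0 H B J} = carr J"
    by (rule coefs_generate[OF submodule_preimage[OF J S0_submodule incl_homs(4)]])
      (use S0_parts coef_in[OF J _ J_prod_in] in auto)
  then have l: "(l, 0) \<in> S0 H B J" if "l \<in> lmodule H J" for l using that unfolding lmodule_eq by blast
  have "Inn \<subseteq> {D \<in> carr (der H J). (0, D) \<in> S0 H B J}"
    by (rule Inn_props(3)[OF submodule_trans[OF submodule_preimage[OF left_module_der S0_submodule incl_homs(5)] submodule_der der_act]])
      (use S0_parts Inn_props(2) Inn_der in auto)
  then have d: "(0, D) \<in> S0 H B J" if "D \<in> Inn" for D using that by blast
  show "lmodule H J \<times> Inn \<subseteq> S0 H B J"
  proof clarify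
    fix l D assume "l \<in> lmodule H J" "D \<in> Inn"
    then have "(l, 0) + (0, D) \<in> S0 H B J" by (intro submoduleD(5)[OF S0_submodule] l d)
    then show "(l, D) \<in> S0 H B J" by simp
  qed
qed

abbreviation "T \<equiv> TKK H B J"

lemma T_carr: "carr T = carr J \<times> (lmodule H J \<times> Inn) \<times> carr J" and T_act: "act T = act Amb"
  by (simp_all add: TKK_def tkk_module_def S0_eq)

lemma T_subset: "x \<in> carr T \<Longrightarrow> x \<in> carr Amb"
  using Inn_der by (auto simp: T_carr Amb_carr)

lemma T_submodule: "submodule Amb (carr T)"
proof (rule submoduleI)
  note r = submoduleD[OF submodule_lmodule] submoduleD[OF Inn_props(1)] left_moduleD(1,2,5)[OF J]
  show "carr T \<subseteq> carr Amb" using T_subset by blast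
  show "0 \<in> carr T" using r by (simp add: T_carr zero_prod_def)
  show "x - y \<in> carr T" if "x \<in> carr T" "y \<in> carr T" for x y using that r by (auto simp: T_carr)
  show "act Amb f x \<in> carr T" if "x \<in> carr T" for f x using that r by (auto simp: T_carr Amb_act)
qed

lemma T: "left_module T"
  by (rule left_module_submodule[OF Amb_module T_submodule T_act])

lemma T_homs: "module_hom_on T J qm" "module_hom_on T J qp" "module_hom_on T C ql" "module_hom_on T C qD"
  using Amb_homs T_subset by (simp_all add: module_hom_on_def T_act)

lemma T_q_mem: "x \<in> carr T \<Longrightarrow> qm x \<in> carr J \<and> qp x \<in> carr J \<and> ql x \<in> lmodule H J \<and> qD x \<in> Inn"
  by (auto simp: T_carr q_defs)

lemma T_inj: "qm x = 0 \<Longrightarrow> qp x = 0 \<Longrightarrow> ql x = 0 \<Longrightarrow> qD x = 0 \<Longrightarrow> x = 0"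
  by (cases x) (auto simp: q_defs zero_prod_def)

text \<open>\<open>TKK\<close> takes its product from the ambient module by \<open>restr\<close>;
  only this membership gives that description a value.\<close>

lemma tkk_bracket_pspan:
  assumes "x \<in> carr T" "y \<in> carr T" shows "tkk_bracket H J x y \<in> pspan 2 Amb (carr T)"
proof -
  obtain a l D b where x: "x = (a, (l, D), b)" by (metis prod.collapse)
  obtain a' l' D' b' where y: "y = (a', (l', D'), b')" by (metis prod.collapse)
  have m: "a \<in> carr J" "l \<in> lmodule H J" "D \<in> Inn" "b \<in> carr J" and m': "a' \<in> carr J" "l' \<in> lmodule H J" "D' \<in> Inn" "b' \<in> carr J"
    using assms by (auto simp: T_carr x y)
  have D: "D \<in> carr (der H J)" "D' \<in> carr (der H J)" using m m' Inn_der by auto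
  note p = tkk_bracket_props[OF m(1,2) D(1) m(4) m'(1,2) D(2) m'(4)]
  note add = free.subspace_add[OF subspace_pspan] and diff = free.subspace_diff[OF subspace_pspan]
  have lD: "br l D \<in> pspan 2 C (lmodule H J)" if "l \<in> lmodule H J" "D \<in> carr (der H J)" for l D
    using that br_lm_pspan unfolding lmodule_eq by blast
  have Dl: "br D l \<in> pspan 2 C (lmodule H J)" if "l \<in> lmodule H J" "D \<in> carr (der H J)" for l D
  proof -
    have "- pswap C (br l D) \<in> pspan 2 C (lmodule H J)"
      using submoduleD(1)[OF submodule_lmodule] by (intro free.subspace_neg[OF subspace_pspan] pperm_pspan[OF C] lD that) simp_all
    then show ?thesis
      unfolding cend_bracket_skew[OF J finite_J lmodule_subset[OF that(1)] der_subset[OF that(2)]] by simp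
  qed
  have pl: "pushL (pprod J a b) \<in> pspan 2 C (lmodule H J)" if "a \<in> carr J" "b \<in> carr J" for a b
    by (rule push_pspan[OF J C lmap_hom subset_refl]) (simp_all add: lmodule_eq J_prod_in that pseudo_eq_pspan[OF J, symmetric])
  show ?thesis
    unfolding x y T_carr
  proof (rule Amb_pspanI[OF p(1) _ submodule_carr[OF J] submodule_lmodule Inn_props(1) submodule_carr[OF J]], goal_cases)
    case 1 then show ?case using T_submodule unfolding T_carr .
  next
    case 2 then show ?case using push_in[OF Amb_module J Amb_homs(1) p(1)] by (simp add: pseudo_eq_pspan[OF J])
  next
    case 3 then show ?case unfolding p(4) by (intro add diff Dl lD pl m m' D)
  next
    case 4 then show ?case unfolding p(5) by (intro add br_Inn Lb_pspan Lb_lmodule m m')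
  next
    case 5 then show ?case using push_in[OF Amb_module J Amb_homs(2) p(1)] by (simp add: pseudo_eq_pspan[OF J])
  qed
qed

abbreviation "\<tau> \<equiv> pprod T"

lemma T_prod:
  assumes x: "x \<in> carr T" and y: "y \<in> carr T"
  shows "\<tau> x y \<in> pseudo H 2 T"
    "push H 2 J qm (\<tau> x y) = ql x (qm y) + qD x (qm y) - pswap J (ql y (qm x) + qD y (qm x))"
    "push H 2 J qp (\<tau> x y) = - ql x (qp y) + qD x (qp y) - pswap J (- ql y (qp x) + qD y (qp x))"
    "push H 2 C ql (\<tau> x y) = br (qD x) (ql y) + br (ql x) (qD y)
      + pushL (pprod J (qm x) (qp y)) - pushL (pprod J (qp x) (qm y))"
    "push H 2 C qD (\<tau> x y) = br (ql x) (ql y) + br (qD x) (qD y) + Lb (qm x) (qp y) + Lb (qp x) (qm y)"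
proof -
  let ?M = "tkk_module H B J"
  have c: "carr ?M = carr T" "act ?M = act T" by (simp_all add: TKK_def)
  have t: "\<tau> x y = restr H 2 ?M Amb (tkk_bracket H J x y)" by (simp add: TKK_def)
  note r = restr_props[of Amb ?M "tkk_bracket H J x y" 2, unfolded c, OF Amb_module T_submodule T_act tkk_bracket_pspan[OF x y], folded t]
  show tin: "\<tau> x y \<in> pseudo H 2 T" using r(1) by (simp add: pseudo_cong(1)[OF c])
  have pq: "push H 2 N q (\<tau> x y) = push H 2 N q (tkk_bracket H J x y)" if "left_module N" "module_hom_on Amb N q"
    for N :: "('h, 'n::ab_group_add, 'z) hmodule_scheme" and q
    using push_push[OF T Amb_module that(1) module_hom_on_id[OF T_submodule T_act] that(2) tin] r(2) by simp
  obtain a l D b where x': "x = (a, (l, D), b)" by (metis prod.collapse)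
  obtain a' l' D' b' where y': "y = (a', (l', D'), b')" by (metis prod.collapse)
  have m: "a \<in> carr J" "l \<in> lmodule H J" "D \<in> carr (der H J)" "b \<in> carr J" "a' \<in> carr J" "l' \<in> lmodule H J" "D' \<in> carr (der H J)" "b' \<in> carr J"
    using x y Inn_der by (auto simp: T_carr x' y')
  note p = tkk_bracket_props[OF m]
  show "push H 2 J qm (\<tau> x y) = ql x (qm y) + qD x (qm y) - pswap J (ql y (qm x) + qD y (qm x))"
    unfolding pq[OF J Amb_homs(1)] unfolding x' y' p by (simp add: q_defs)
  show "push H 2 J qp (\<tau> x y) = - ql x (qp y) + qD x (qp y) - pswap J (- ql y (qp x) + qD y (qp x))"
    unfolding pq[OF J Amb_homs(2)] unfolding x' y' p by (simp add: q_defs)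
  show "push H 2 C ql (\<tau> x y) = br (qD x) (ql y) + br (ql x) (qD y)
      + pushL (pprod J (qm x) (qp y)) - pushL (pprod J (qp x) (qm y))"
    unfolding pq[OF C Amb_homs(3)] unfolding x' y' p by (simp add: q_defs)
  show "push H 2 C qD (\<tau> x y) = br (ql x) (ql y) + br (qD x) (qD y) + Lb (qm x) (qp y) + Lb (qp x) (qm y)"
    unfolding pq[OF C Amb_homs(4)] unfolding x' y' p by (simp add: q_defs)
qed

text \<open>Each projection of the product is assembled from the action on \<open>J\<close>, the
  commutator and the product of \<open>J\<close> by the closure rules for \<open>hbilinear\<close>,
  and the projections together decide.\<close>

lemma T_bil: "hbilinear T T T \<tau>"
proof (rule hbilinear_components[OF T T T J C T_homs T_inj T_prod(1)])
  note c = hbilinear_comp[OF ap_bil] and s = hbilinear_swap[OF J, of T T] and cc = hbilinear_comp[OF cb_bil]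
    and jj = hbilinear_comp[OF hbilinear_push[OF J C lmap_hom J_bil]] and ll = hbilinear_comp[OF hbilinear_comp[OF cb_bil lmap_hom lmap_hom]]
  note t = T_homs
  show "hbilinear T T J (\<lambda>a b. push H 2 J qm (\<tau> a b))"
    by (rule hbilinear_cong[OF hbilinear_diff[OF J hbilinear_add[OF J c[OF t(3,1)] c[OF t(4,1)]]
      s[OF hbilinear_add[OF J c[OF t(3,1)] c[OF t(4,1)]]]] T T T_prod(2)])
  show "hbilinear T T J (\<lambda>a b. push H 2 J qp (\<tau> a b))"
    by (rule hbilinear_cong[OF hbilinear_diff[OF J hbilinear_add[OF J hbilinear_uminus[OF J c[OF t(3,2)]] c[OF t(4,2)]]
      s[OF hbilinear_add[OF J hbilinear_uminus[OF J c[OF t(3,2)]] c[OF t(4,2)]]]] T T T_prod(3)])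
  show "hbilinear T T C (\<lambda>a b. push H 2 C ql (\<tau> a b))"
    by (rule hbilinear_cong[OF hbilinear_diff[OF C hbilinear_add[OF C hbilinear_add[OF C cc[OF t(4,3)] cc[OF t(3,4)]]
      jj[OF t(1,2)]] jj[OF t(2,1)]] T T T_prod(4)])
  show "hbilinear T T C (\<lambda>a b. push H 2 C qD (\<tau> a b))"
    by (rule hbilinear_cong[OF hbilinear_add[OF C hbilinear_add[OF C hbilinear_add[OF C cc[OF t(3,3)] cc[OF t(4,4)]]
      ll[OF t(1,2)]] ll[OF t(2,1)]] T T T_prod(5)])
qed

lemma T_eqI:
  assumes "X \<in> pseudo H n T" "Y \<in> pseudo H n T" "n \<ge> 1"
    "push H n J qm X = push H n J qm Y" "push H n J qp X = push H n J qp Y"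
    "push H n C ql X = push H n C ql Y" "push H n C qD X = push H n C qD Y"
  shows "X = Y"
  by (rule eq_components[OF T J C T_homs T_inj assms])

lemma T_skew:
  assumes x: "x \<in> carr T" and y: "y \<in> carr T"
  shows "\<tau> x y = - pswap T (\<tau> y x)"
proof (rule T_eqI)
  have s: "transpose 0 (1::nat) permutes {..<2}" by simp
  note yx = T_prod(1)[OF y x]
  show "\<tau> x y \<in> pseudo H 2 T" by (rule T_prod(1)[OF x y])
  show "- pswap T (\<tau> y x) \<in> pseudo H 2 T"
    by (intro free.subspace_neg[OF subspace_pseudo[OF T]] pperm_in[OF T s] yx)
  have q: "qm x \<in> carr J" "qp x \<in> carr J" "ql x \<in> carr C" "qD x \<in> carr C" "qm y \<in> carr J" "qp y \<in> carr J" "ql y \<in> carr C" "qD y \<in> carr C"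
    using T_q_mem[OF x] T_q_mem[OF y] lmodule_subset submoduleD(1)[OF Inn_props(1)] by auto
  note pp = flinD[OF flin_lmul(2)] pperm_pperm[OF J app_in] pperm_pperm[OF C] flinD(4)[OF flin_lmul(3)]
  note sk = cend_bracket_skew[OF J finite_J]
  have cm: "pswap C (pushL (pprod J a b)) = pushL (pprod J b a)"
    if "a \<in> carr J" "b \<in> carr J" for a b
    using push_pperm[OF J C lmap_hom s J_prod_in[OF that]] J_comm[OF that(2,1)] by simp
  show "push H 2 J qm (\<tau> x y) = push H 2 J qm (- pswap T (\<tau> y x))"
    by (simp add: push_pperm[OF T J T_homs(1) s yx] T_prod x y pp q)
  show "push H 2 J qp (\<tau> x y) = push H 2 J qp (- pswap T (\<tau> y x))"
    by (simp add: push_pperm[OF T J T_homs(2) s yx] T_prod x y pp q)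
  show "push H 2 C ql (\<tau> x y) = push H 2 C ql (- pswap T (\<tau> y x))"
    by (simp add: push_pperm[OF T C T_homs(3) s yx] T_prod x y pp q sk cm)
  show "push H 2 C qD (\<tau> x y) = push H 2 C qD (- pswap T (\<tau> y x))"
    by (simp add: push_pperm[OF T C T_homs(4) s yx] T_prod x y pp q sk lmap_in)
qed simp_all

end

context finite_jordan
begin

section \<open>The Jacobi identity\<close>

text \<open>The Jordan triple product \<open>{a b z}\<close>, symmetric in its outer arguments by
  \<open>V_sym\<close>. It is also the action of \<open>U_op\<close> on the minus copy, read on
  words.\<close>

definition "V a b z = jm (jm a b) z + jm a (jm b z) - jm b (jm a z)"

lemma V_in: "a \<in> word_space J \<Longrightarrow> b \<in> word_space J \<Longrightarrow> z \<in> word_space J \<Longrightarrow> V a b z \<in> word_space J"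
  unfolding V_def
  by (intro free.subspace_add[OF subspace_word_space[OF J]] free.subspace_diff[OF subspace_word_space[OF J]] jm_in)

lemma V_lin:
  "V (a + a') b z = V a b z + V a' b z" "V (a - a') b z = V a b z - V a' b z" "V (- a) b z = - V a b z"
  "V a (b + b') z = V a b z + V a b' z" "V a (b - b') z = V a b z - V a b' z" "V a (- b) z = - V a b z"
  "V a b (z + z') = V a b z + V a b z'" "V a b (z - z') = V a b z - V a b z'" "V a b (- z) = - V a b z"
  by (simp_all add: V_def wmul_lin)

lemma V_sym:
  assumes "a \<in> word_space J" "b \<in> word_space J" "z \<in> word_space J" shows "V a b z = V z b a"
  using jm_commute[OF jm_in[OF assms(1,2)] assms(3)] jm_commute[OF jm_in[OF assms(3,2)] assms(1)]
    jm_commute[OF assms(1,2)] jm_commute[OF assms(2,3)] jm_commute[OF assms(1,3)]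
  by (simp add: V_def)

text \<open>The sum of \<open>jm_cyclic\<close> and of the derivation property of
  \<open>[L_a, L_b]\<close>. The sign at the middle argument reflects that \<open>L_c\<close> acts
  on the plus copy by \<open>- L_c\<close>.\<close>

lemma jm_V:
  assumes c: "c \<in> word_space J" and a: "a \<in> word_space J" and b: "b \<in> word_space J" and z: "z \<in> word_space J"
  shows "jm c (V a b z) = V (jm c a) b z - V a (jm c b) z + V a b (jm c z)"
  using arg_cong2[where f = "(+)", OF jm_cyclic[OF a b c z, symmetric] jm_commutator_derivation[OF a b c z, symmetric]]
    jm_commute[OF b c] jm_commute[OF a c] jm_commute[OF a jm_in[OF c b]] jm_commute[OF b jm_in[OF c a]]
  by (simp add: V_def wmul_lin algebra_simps)

lemma der_V:
  assumes "u \<in> der_words" "a \<in> word_space J" "b \<in> word_space J" "z \<in> word_space J"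
  shows "ap u (V a b z) = V (ap u a) b z + V a (ap u b) z + V a b (ap u z)"
  by (simp add: V_def wmul_lin der_wordsD[OF assms(1)] jm_in ap_in assms algebra_simps)

end

lemma (in cocommutative_hopf) double_inj:
  fixes a b :: "'x \<Rightarrow>\<^sub>0 'c::field_char_0"
  assumes "a + a = b + b" shows "a = b"
proof -
  have "fscale 2 (a - b) = (a - b) + (a - b)" by (rule poly_mapping_eqI) (simp add: lookup_fscale lookup_add)
  also have "\<dots> = 0" using assms by (simp only: add_diff_add[symmetric] diff_self)
  finally show ?thesis by (simp add: free.scale_eq_0_iff)
qed

context simple_jordan
begin

abbreviation "tm \<equiv> wmul T \<tau>"
abbreviation "wm \<equiv> wpush J qm"
abbreviation "wp \<equiv> wpush J qp"
abbreviation "wl \<equiv> wpush C ql"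
abbreviation "wd \<equiv> wpush C qD"

text \<open>The actions of the component in \<open>S\<^sub>0(J)\<close> on \<open>J\<^sup>-\<close> and on \<open>J\<^sup>+\<close>.\<close>

definition "P u z = ap (wl u) z + ap (wd u) z"
definition "Q u z = ap (wd u) z - ap (wl u) z"

lemma tm_in: "u \<in> word_space T \<Longrightarrow> v \<in> word_space T \<Longrightarrow> tm u v \<in> word_space T"
  by (rule wmul_in[OF T T T T_bil])

lemmas wq_wtens = wpush_wtens[OF T J T_homs(1)] wpush_wtens[OF T J T_homs(2)] wpush_wtens[OF T C T_homs(3)] wpush_wtens[OF T C T_homs(4)]

lemma wq_in:
  assumes u: "u \<in> word_space T"
  shows "wm u \<in> word_space J" "wp u \<in> word_space J" "wl u \<in> word_space C" "wd u \<in> der_words" "\<exists>a\<in>word_space J. wl u = lm a"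
proof -
  show "wm u \<in> word_space J" "wp u \<in> word_space J" "wl u \<in> word_space C"
    by (rule wpush_in[OF T _ _ u], rule J C, rule T_homs)+
  show "wd u \<in> der_words"
  proof (rule word_space_memI[OF T flin_wpush subspace_der_words _ u])
    fix w x assume x: "x \<in> carr T"
    then have "qD x \<in> carr (der H J)" using T_q_mem Inn_der by blast
    then show "wd (wtens T w x) \<in> der_words" unfolding wq_wtens(4)[OF x] using der_iff by blast
  qed
  have sub: "free.subspace (lm ` word_space J)"
  proof (rule free.subspaceI)
    note W = subspace_word_space[OF J]
    show "0 \<in> lm ` word_space J" by (rule image_eqI[OF _ free.subspace_0[OF W]]) (simp add: wpush_lin)
    fix x assume "x \<in> lm ` word_space J"
    then obtain a where a: "x = lm a" "a \<in> word_space J" by (rule imageE)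
    show "x + y \<in> lm ` word_space J" if y: "y \<in> lm ` word_space J" for y
    proof -
      from y obtain b where b: "y = lm b" "b \<in> word_space J" by (rule imageE)
      show ?thesis by (rule image_eqI[OF _ free.subspace_add[OF W a(2) b(2)]]) (simp add: wpush_lin a b)
    qed
    show "fscale c x \<in> lm ` word_space J" for c
      by (rule image_eqI[OF _ free.subspace_scale[OF W a(2), of c]]) (simp add: wpush_lin a)
  qed
  have "wl u \<in> lm ` word_space J"
  proof (rule word_space_memI[OF T flin_wpush sub _ u])
    fix w x assume x: "x \<in> carr T"
    then obtain a where a: "a \<in> carr J" "ql x = lmap J a" using T_q_mem lmodule_eq by blast
    show "wl (wtens T w x) \<in> lm ` word_space J" unfolding wq_wtens(3)[OF x] a(2)
      by (rule image_eqI[OF _ wtens_in[OF a(1)]]) (simp add: lm_wtens[OF a(1)])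
  qed
  then show "\<exists>a\<in>word_space J. wl u = lm a" by blast
qed

text \<open>On words the permutations have disappeared from the bracket, and what remains are the
  classical Tits-Kantor-Koecher formulas for an ordinary algebra.\<close>

lemma tm_components:
  assumes u: "u \<in> word_space T" and v: "v \<in> word_space T"
  shows "wm (tm u v) = P u (wm v) - P v (wm u)" "wp (tm u v) = Q u (wp v) - Q v (wp u)"
    "wl (tm u v) = cb (wd u) (wl v) + cb (wl u) (wd v) + lm (jm (wm u) (wp v)) - lm (jm (wp u) (wm v))"
    "wd (tm u v) = cb (wl u) (wl v) + cb (wd u) (wd v) + cb (lm (wm u)) (lm (wp v)) + cb (lm (wp u)) (lm (wm v))"
proof -
  have agree: "L u v = R u v" if "\<And>v. flin (\<lambda>u. L u v)" "\<And>u. flin (L u)" "\<And>v. flin (\<lambda>u. R u v)" "\<And>u. flin (R u)"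
    "\<And>w x w' y. x \<in> carr T \<Longrightarrow> y \<in> carr T \<Longrightarrow> L (wtens T w x) (wtens T w' y) = R (wtens T w x) (wtens T w' y)"
    for L R :: "((nat \<times> 'h) list \<times> ('k, 'h, 'm) tkk \<Rightarrow>\<^sub>0 'k) \<Rightarrow> ((nat \<times> 'h) list \<times> ('k, 'h, 'm) tkk \<Rightarrow>\<^sub>0 'k) \<Rightarrow> ('x \<Rightarrow>\<^sub>0 'k)"
    by (rule word_space_eqI[OF T that(1,3) _ u], rule word_space_eqI[OF T that(2,4) _ v], rule that(5))
  let ?m = "\<lambda>u v. P u (wm v) - P v (wm u)" and ?p = "\<lambda>u v. Q u (wp v) - Q v (wp u)"
    and ?l = "\<lambda>u v. cb (wd u) (wl v) + cb (wl u) (wd v) + lm (jm (wm u) (wp v)) - lm (jm (wp u) (wm v))"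
    and ?d = "\<lambda>u v. cb (wl u) (wl v) + cb (wd u) (wd v) + cb (lm (wm u)) (lm (wp v)) + cb (lm (wp u)) (lm (wm v))"
  let ?G = "\<lambda>u v. wm (tm u v) = ?m u v \<and> wp (tm u v) = ?p u v \<and> wl (tm u v) = ?l u v \<and> wd (tm u v) = ?d u v"
  have base: "?G (wtens T w x) (wtens T w' y)" if x: "x \<in> carr T" and y: "y \<in> carr T" for w w' x y
  proof -
    have q: "qm x \<in> carr J" "qp x \<in> carr J" "ql x \<in> carr C" "qD x \<in> carr C" "qm y \<in> carr J" "qp y \<in> carr J" "ql y \<in> carr C" "qD y \<in> carr C"
      using T_q_mem[OF x] T_q_mem[OF y] lmodule_subset submoduleD(1)[OF Inn_props(1)] by auto
    note t = T_prod[OF x y]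
    note th = Theta_push_2[OF T J T_homs(1) t(1), symmetric] Theta_push_2[OF T J T_homs(2) t(1), symmetric]
      Theta_push_2[OF T C T_homs(3) t(1), symmetric] Theta_push_2[OF T C T_homs(4) t(1), symmetric]
    note W = wmul_wtens[OF T T T T_bil x y] and wq = wq_wtens[OF x] wq_wtens[OF y]
    note lin = flinD[OF flin_Theta] flinD[OF flin_lmul(2)] Theta_swap[OF J app_in] Theta_ap_2 Theta_cb Theta_jm_2
      Theta_push_2[OF J C lmap_hom J_prod_in] lm_wtens lmap_in
    show ?thesis
      unfolding W th t P_def Q_def wq by (simp add: lin q)
  qed
  note f = P_def Q_def flin_def wmul_lin wpush_lin scale_distribs
  show "wm (tm u v) = ?m u v" by (rule agree[of "\<lambda>u v. wm (tm u v)" ?m]) (use base in \<open>simp_all add: f\<close>)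
  show "wp (tm u v) = ?p u v" by (rule agree[of "\<lambda>u v. wp (tm u v)" ?p]) (use base in \<open>simp_all add: f\<close>)
  show "wl (tm u v) = ?l u v" by (rule agree[of "\<lambda>u v. wl (tm u v)" ?l]) (use base in \<open>simp_all add: f\<close>)
  show "wd (tm u v) = ?d u v" by (rule agree[of "\<lambda>u v. wd (tm u v)" ?d]) (use base in \<open>simp_all add: f\<close>)
qed

lemma PQ_lin:
  "P (u + v) z = P u z + P v z" "Q (u + v) z = Q u z + Q v z" "P u (z + z') = P u z + P u z'" "Q u (z + z') = Q u z + Q u z'"
  "P u (z - z') = P u z - P u z'" "Q u (z - z') = Q u z - Q u z'"
  by (simp_all add: P_def Q_def wmul_lin wpush_lin)

lemma PQ_in:
  assumes "u \<in> word_space T" "z \<in> word_space J" shows "P u z \<in> word_space J" "Q u z \<in> word_space J"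
  unfolding P_def Q_def using wq_in[OF assms(1)] der_wordsD(1) assms(2)
  by (auto intro!: free.subspace_add[OF subspace_word_space[OF J]] free.subspace_diff[OF subspace_word_space[OF J]] ap_in)

text \<open>The pair of \<open>P u\<close> and \<open>Q u\<close> acts as a derivation on the two
  copies of \<open>J\<close>: the outer arguments of the triple product belong to one copy and the
  middle argument to the other.\<close>

lemma PQ_V:
  assumes u: "u \<in> word_space T" and abz: "a \<in> word_space J" "b \<in> word_space J" "z \<in> word_space J"
  shows "P u (V a b z) = V (P u a) b z + V a (Q u b) z + V a b (P u z)"
    "Q u (V a b z) = V (Q u a) b z + V a (P u b) z + V a b (Q u z)"
proof -
  obtain c where c: "c \<in> word_space J" "wl u = lm c" using wq_in(5)[OF u] by blast
  show "P u (V a b z) = V (P u a) b z + V a (Q u b) z + V a b (P u z)"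
    "Q u (V a b z) = V (Q u a) b z + V a (P u b) z + V a b (Q u z)"
    by (simp_all add: P_def Q_def c(2) ap_lm c(1) abz V_in jm_V der_V[OF wq_in(4)[OF u]] V_lin)
qed

text \<open>The commutators are the action of the bracket within \<open>S0\<close>; the
  \<open>V\<close> terms come from the brackets of minus components with plus components.\<close>

lemma PQ_tm:
  assumes u: "u \<in> word_space T" and v: "v \<in> word_space T" and z: "z \<in> word_space J"
  shows "P (tm u v) z = P u (P v z) - P v (P u z) + V (wm u) (wp v) z - V (wm v) (wp u) z"
    "Q (tm u v) z = Q u (Q v z) - Q v (Q u z) + V (wp u) (wm v) z - V (wp v) (wm u) z"
proof -
  note i = wq_in(1-3)[OF u] wq_in(1-3)[OF v] der_wordsD(1)[OF wq_in(4)[OF u]] der_wordsD(1)[OF wq_in(4)[OF v]]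
  note c = jm_commute[OF i(1,5)] jm_commute[OF i(2,4)]
  show "P (tm u v) z = P u (P v z) - P v (P u z) + V (wm u) (wp v) z - V (wm v) (wp u) z"
    using c by (simp add: P_def V_def tm_components[OF u v] wmul_lin ap_cb ap_lm i z lm_in jm_in algebra_simps)
  show "Q (tm u v) z = Q u (Q v z) - Q v (Q u z) + V (wp u) (wm v) z - V (wp v) (wm u) z"
    using c by (simp add: Q_def V_def tm_components[OF u v] wmul_lin ap_cb ap_lm i z lm_in jm_in algebra_simps)
qed

text \<open>In the minus and the plus component the \<open>V\<close> terms left by
  \<open>PQ_tm\<close> cancel by the symmetry \<open>V_sym\<close>. For the component in
  \<open>S0\<close> it suffices to compare the actions \<open>P\<close> and \<open>Q\<close>, where
  \<open>PQ_V\<close> treats the action on \<open>V\<close> terms.\<close>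

lemma tm_jacobi:
  assumes u: "u \<in> word_space T" and v: "v \<in> word_space T" and w: "w \<in> word_space T"
  defines "L \<equiv> tm u (tm v w)" and "R \<equiv> tm (tm u v) w + tm v (tm u w)"
  shows "wm L = wm R" "wp L = wp R" "z \<in> word_space J \<Longrightarrow> ap (wl L) z = ap (wl R) z" "z \<in> word_space J \<Longrightarrow> ap (wd L) z = ap (wd R) z"
proof -
  note i = wq_in(1,2)[OF u] wq_in(1,2)[OF v] wq_in(1,2)[OF w] and t = tm_in[OF u v] tm_in[OF v w] tm_in[OF u w]
  note s = PQ_lin V_lin PQ_V PQ_in PQ_tm tm_components(1,2) i t u v w wpush_lin
  show "wm L = wm R"
    unfolding L_def R_def using V_sym[OF i(3,6,1)] V_sym[OF i(5,4,1)] V_sym[OF i(5,2,3)]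
    by (simp add: s algebra_simps)
  show "wp L = wp R"
    unfolding L_def R_def using V_sym[OF i(4,5,2)] V_sym[OF i(6,3,2)] V_sym[OF i(6,1,4)]
    by (simp add: s algebra_simps)
  assume z: "z \<in> word_space J"
  have p: "P L z = P R z" "Q L z = Q R z"
    unfolding L_def R_def by (simp_all add: s z algebra_simps)
  \<comment> \<open>The difference and the sum of the two actions are twice the multiplication and
    twice the pseudoderivation.\<close>
  have a: "ap (wl X) z + ap (wl X) z = P X z - Q X z" "ap (wd X) z + ap (wd X) z = P X z + Q X z" for X
    by (simp_all add: P_def Q_def)
  show "ap (wl L) z = ap (wl R) z" "ap (wd L) z = ap (wd R) z"
    by (rule double_inj, simp only: a p)+
qed

text \<open>The components in \<open>J\<close> return from words by three distinct letters; those in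
  \<open>C\<close> are compared by their action on a further argument from \<open>J\<close>, as
  \<open>C_eqI3\<close> permits.\<close>

lemma T_jacobi:
  assumes x: "x \<in> carr T" and y: "y \<in> carr T" and z: "z \<in> carr T"
  shows "pp H T 1 2 (emb H T x) (\<tau> y z) = pp H T 2 1 (\<tau> x y) (emb H T z)
    + pperm H 3 T (transpose 0 1) (pp H T 1 2 (emb H T y) (\<tau> x z))" (is "?L = ?R")
proof -
  note p = pext_emb_3[OF T T T T_bil]
  note i = p(1)[OF x T_prod(1)[OF y z]] p(3)[OF T_prod(1)[OF x y] z] p(1)[OF y T_prod(1)[OF x z]]
  have L: "?L \<in> pseudo H 3 T" by (rule i(1))
  have R: "?R \<in> pseudo H 3 T" by (intro free.subspace_add[OF subspace_pseudo[OF T]] i pperm_in[OF T]) simp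
  note W = wmul_wtens[OF T T T T_bil]
  have tL: "Theta T [w0, w1, w2] ?L = tm (wtens T w0 x) (tm (wtens T w1 y) (wtens T w2 z))"
    and tR: "Theta T [w0, w1, w2] ?R = tm (tm (wtens T w0 x) (wtens T w1 y)) (wtens T w2 z)
      + tm (wtens T w1 y) (tm (wtens T w0 x) (wtens T w2 z))" for w0 w1 w2
    by (simp_all add: flinD(1)[OF flin_Theta] Theta_swap_3(1)[OF T i(3)] p(2,4) T_prod(1) x y z W)
  note jac = tm_jacobi[OF wtens_in[OF x] wtens_in[OF y] wtens_in[OF z]]
  have s3: "(1::nat) \<le> 3" by simp
  show ?thesis
  proof (rule T_eqI[OF L R s3])
    have eqJ: "push H 3 J q ?L = push H 3 J q ?R" if q: "module_hom_on T J q"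
      and e: "\<And>w0 w1 w2. wpush J q (Theta T [w0, w1, w2] ?L) = wpush J q (Theta T [w0, w1, w2] ?R)" for q
      by (rule Theta_letters_inj[OF J push_in[OF T J q L] push_in[OF T J q R]])
        (simp only: letters_3 Theta_push_3[OF T J q L] Theta_push_3[OF T J q R] e)
    show "push H 3 J qm ?L = push H 3 J qm ?R" by (rule eqJ[OF T_homs(1)]) (simp only: tL tR jac(1))
    show "push H 3 J qp ?L = push H 3 J qp ?R" by (rule eqJ[OF T_homs(2)]) (simp only: tL tR jac(2))
    have eqC: "push H 3 C q ?L = push H 3 C q ?R" if q: "module_hom_on T C q"
      and e: "\<And>w0 w1 w2 z. z \<in> word_space J \<Longrightarrow> ap (wpush C q (Theta T [w0, w1, w2] ?L)) z = ap (wpush C q (Theta T [w0, w1, w2] ?R)) z" for q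
      by (rule C_eqI3[OF push_in[OF T C q L] push_in[OF T C q R]])
        (simp only: Theta_push_3[OF T C q L] Theta_push_3[OF T C q R] e)
    show "push H 3 C ql ?L = push H 3 C ql ?R" by (rule eqC[OF T_homs(3)]) (simp only: tL tR jac(3))
    show "push H 3 C qD ?L = push H 3 C qD ?R" by (rule eqC[OF T_homs(4)]) (simp only: tL tR jac(4))
  qed
qed

lemma T_lie: "lie_pseudoalgebra H T"
  unfolding lie_pseudoalgebra_def pseudoalgebra_def
  by (intro conjI ballI allI T hbilinearD[OF T_bil] T_jacobi T_skew)

end

context cocommutative_hopf
begin

section \<open>Finite generation and simplicity\<close>

lemma pspan_finite:
  assumes "X \<in> pspan n M N" shows "\<exists>F. finite F \<and> F \<subseteq> N \<and> X \<in> pspan n M F"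
  using assms unfolding pspan_def[of n M N]
proof (rule free.span_induct)
  show "free.subspace {X. \<exists>F. finite F \<and> F \<subseteq> N \<and> X \<in> pspan n M F}"
  proof (rule free.subspaceI)
    show "0 \<in> {X. \<exists>F. finite F \<and> F \<subseteq> N \<and> X \<in> pspan n M F}"
      using free.subspace_0[OF subspace_pspan, of n M "{}"] by blast
    fix X assume "X \<in> {X. \<exists>F. finite F \<and> F \<subseteq> N \<and> X \<in> pspan n M F}"
    then obtain F where F: "finite F" "F \<subseteq> N" "X \<in> pspan n M F" by blast
    show "fscale c X \<in> {X. \<exists>F. finite F \<and> F \<subseteq> N \<and> X \<in> pspan n M F}" for c
      by (intro CollectI exI[of _ F] conjI F free.subspace_scale[OF subspace_pspan F(3)])
    show "X + Y \<in> {X. \<exists>F. finite F \<and> F \<subseteq> N \<and> X \<in> pspan n M F}" if Y: "Y \<in> {X. \<exists>F. finite F \<and> F \<subseteq> N \<and> X \<in> pspan n M F}" for Y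
    proof -
      obtain G where G: "finite G" "G \<subseteq> N" "Y \<in> pspan n M G" using Y by blast
      have "X + Y \<in> pspan n M (F \<union> G)"
        using F(3) G(3) pspan_mono[of F "F \<union> G" n M] pspan_mono[of G "F \<union> G" n M]
        by (intro free.subspace_add[OF subspace_pspan]) auto
      moreover have "finite (F \<union> G)" "F \<union> G \<subseteq> N" using F G by auto
      ultimately show ?thesis by (intro CollectI exI[of _ "F \<union> G"] conjI)
    qed
  qed
  fix Y assume "Y \<in> {ptens H n M P c | P c. P \<in> tensor_power H n \<and> c \<in> N}"
  then obtain P c where Y: "Y = ptens H n M P c" "P \<in> tensor_power H n" "c \<in> N" by blast
  then have "Y \<in> pspan n M {c}" by (simp add: pspan_base)
  then show "\<exists>F. finite F \<and> F \<subseteq> N \<and> Y \<in> pspan n M F" using Y(3) by (intro exI[of _ "{c}"]) simp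
qed

end

context cocommutative_hopf_basis
begin

lemma coef_zero: "left_module M \<Longrightarrow> y \<in> dual H \<Longrightarrow> coef M y 0 = 0"
  using unemb_emb[of M 0] emb_rules(6)[of M 0] left_moduleD(1)[of M] by (simp add: coef_def flinD(3)[OF flin_slice])

lemma coef_neg:
  assumes M: "left_module M" and y: "y \<in> dual H" and X: "X \<in> pseudo H 2 M" shows "coef M y (- X) = - coef M y X"
proof -
  have X': "- X \<in> pseudo H 2 M" by (rule free.subspace_neg[OF subspace_pseudo[OF M] X])
  have "emb H M (coef M y (- X)) = emb H M (- coef M y X)"
    using emb_coef[OF M y X] emb_coef[OF M y X'] emb_rules(4)[OF M coef_in[OF M y X]] by (simp add: flinD(4)[OF flin_slice])
  then show ?thesis by (rule emb_inj[OF M coef_in[OF M y X'] left_moduleD(4)[OF M coef_in[OF M y X]]])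
qed

lemma coef_eq_zeroD:
  assumes M: "left_module M" and X: "X \<in> pseudo H 2 M" and z: "\<And>y. y \<in> dual H \<Longrightarrow> coef M y X = 0" shows "X = 0"
proof -
  have "X \<in> pspan 2 M {0}" unfolding coef_mem_iff[OF M submodule_zero[OF M] X] using z by simp
  then show ?thesis by (simp add: pspan_zero[OF M])
qed

end

context simple_jordan
begin

lemma q_simps [simp]:
  "qm (a, \<Sigma>, b) = a" "qp (a, \<Sigma>, b) = b" "ql (a, \<Sigma>, b) = fst \<Sigma>" "qD (a, \<Sigma>, b) = snd \<Sigma>"
  by (simp_all add: q_defs)

lemma zeros:
  "0 \<in> carr J" "0 \<in> lmodule H J" "0 \<in> Inn" "lmap J 0 = 0"
  using left_moduleD(1)[OF J] submoduleD(2)[OF submodule_lmodule] submoduleD(2)[OF Inn_props(1)] module_hom_on_zero[OF J lmap_hom]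
  by auto

text \<open>The carriers are restricted to \<open>Inn\<close> and to \<open>S0\<close> so that
  preimages of submodules of \<open>T\<close> can be formed inside them.\<close>

lemma T_incl_homs:
  "module_hom_on J T (\<lambda>a. (a, 0, 0))" "module_hom_on J T (\<lambda>a. (0, 0, a))" "module_hom_on J T (\<lambda>a. (0, (lmap J a, 0), 0))"
  "module_hom_on (C\<lparr>carr := Inn\<rparr>) T (\<lambda>D. (0, (0, D), 0))" "module_hom_on (S\<lparr>carr := S0 H B J\<rparr>) T (\<lambda>\<Sigma>. (0, \<Sigma>, 0))"
  using zeros left_moduleD(10)[OF J] left_moduleD(10)[OF C] module_hom_onD[OF lmap_hom]
  by (auto simp: module_hom_on_def T_carr T_act Amb_act zero_prod_def lmodule_eq S0_eq S_act)

text \<open>Submodules of finite modules need not be finite, so \<open>Inn\<close> needs generators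
  of its own: the finitely many elements occurring in \<open>[L_a, L_b]\<close> for generators
  \<open>a\<close>, \<open>b\<close> of \<open>J\<close>. By \<open>H\<close>-bilinearity they
  generate the coefficients of all \<open>[L_a, L_b]\<close>.\<close>

lemma finitely_generated_T: "finitely_generated T"
proof -
  obtain X where X: "finite X" "X \<subseteq> carr J" "generated_submodule J X = carr J" using finite_J unfolding finitely_generated_def by blast
  have "\<exists>F. finite F \<and> F \<subseteq> Inn \<and> Lb a b \<in> pspan 2 C F" if "a \<in> X" "b \<in> X" for a b
    using pspan_finite[OF Lb_pspan] that X(2) by blast
  then obtain F where F: "finite (F a b)" "F a b \<subseteq> Inn" "Lb a b \<in> pspan 2 C (F a b)" if "a \<in> X" "b \<in> X" for a b by metis
  define E where "E = (\<Union>a\<in>X. \<Union>b\<in>X. F a b)"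
  have E: "finite E" "E \<subseteq> Inn" unfolding E_def using X(1) F(1,2) by (blast intro: UN_least)+
  have LbE: "Lb a b \<in> pspan 2 C N" if "submodule C N" "E \<subseteq> N" "a \<in> carr J" "b \<in> carr J" for a b N
  proof (rule hbilinear_generated[OF J J C hbilinear_comp[OF cb_bil lmap_hom lmap_hom] submoduleD(1)[OF that(1)] X(2,3) X(2,3) _ that(3,4)])
    fix a b assume "a \<in> X" "b \<in> X"
    moreover from this have "F a b \<subseteq> N" using that(2) unfolding E_def by blast
    ultimately show "Lb a b \<in> pspan 2 C N" using F(3) pspan_mono[of "F a b" N 2 C] by blast
  qed
  let ?m = "\<lambda>a. (a, 0, 0)" and ?p = "\<lambda>a. (0, 0, a)" and ?l = "\<lambda>a. (0, (lmap J a, 0), 0)" and ?d = "\<lambda>D. (0, (0, D), 0)"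
  define G where "G = ?m ` X \<union> ?p ` X \<union> ?l ` X \<union> ?d ` E"
  have finG: "finite G" unfolding G_def using X(1) E(1) by simp
  have GT: "G \<subseteq> carr T" using X(2) E(2) zeros unfolding G_def by (auto simp: T_carr zero_prod_def lmodule_eq)
  note g = generated_submodule_props[OF T GT]
  let ?W = "generated_submodule T G"
  have J_all: "\<forall>a\<in>carr J. q a \<in> ?W" if h: "module_hom_on J T q" and X': "q ` X \<subseteq> G" for q
  proof -
    have "generated_submodule J X \<subseteq> {a \<in> carr J. q a \<in> ?W}"
      by (rule generated_submodule_props(3)[OF J X(2) submodule_preimage[OF J g(1) h]]) (use X(2) X' g(2) in blast)
    then show ?thesis using X(3) by blast
  qed
  have all: "?m a \<in> ?W" "?p a \<in> ?W" "?l a \<in> ?W" if "a \<in> carr J" for a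
    using J_all[OF T_incl_homs(1)] J_all[OF T_incl_homs(2)] J_all[OF T_incl_homs(3)] that unfolding G_def by auto
  have d: "?d D \<in> ?W" if D: "D \<in> Inn" for D
  proof -
    let ?I = "C\<lparr>carr := Inn\<rparr>"
    have I: "left_module ?I" by (rule left_module_submodule[OF C]) (simp_all add: Inn_props(1))
    have s: "submodule C {D \<in> Inn. ?d D \<in> ?W}"
      using submodule_trans[OF submodule_preimage[OF I g(1) T_incl_homs(4)], of C] Inn_props(1) by simp
    have E': "E \<subseteq> {D \<in> Inn. ?d D \<in> ?W}" using E(2) g(2) unfolding G_def by blast
    have "Inn \<subseteq> {D \<in> Inn. ?d D \<in> ?W}"
    proof (rule Inn_props(3)[OF s])
      fix a b y assume h: "a \<in> carr J" "b \<in> carr J" and y: "y \<in> dual H"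
      show "coef C y (Lb a b) \<in> {D \<in> Inn. ?d D \<in> ?W}"
        by (rule bspec[OF coef_mem_iff[OF C s Lb_in[OF h], THEN iffD1, OF LbE[OF s E' h]] y])
    qed
    then show ?thesis using D by blast
  qed
  have "carr T \<subseteq> ?W"
  proof
    fix x assume x: "x \<in> carr T"
    obtain a l D b where x': "x = (a, (l, D), b)" by (metis prod.collapse)
    obtain c where c: "c \<in> carr J" "l = lmap J c" using x by (auto simp: T_carr x' lmodule_eq)
    have "?m a + ?l c + ?d D + ?p b \<in> ?W"
      using x c(1) by (intro submoduleD(5)[OF g(1)] all d) (auto simp: T_carr x')
    then show "x \<in> ?W" by (simp add: x' c)
  qed
  then show ?thesis unfolding finitely_generated_def using finG GT submoduleD(1)[OF g(1)] by blast
qed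

section \<open>Coefficients of brackets in the Tits-Kantor-Koecher construction\<close>

lemma coef_tau:
  assumes x: "x \<in> carr T" and z: "z \<in> carr T" and y: "y \<in> dual H"
  shows "qm (coef T y (\<tau> x z)) = coef J y (ql x (qm z) + qD x (qm z) - pswap J (ql z (qm x) + qD z (qm x)))"
    "qp (coef T y (\<tau> x z)) = coef J y (- ql x (qp z) + qD x (qp z) - pswap J (- ql z (qp x) + qD z (qp x)))"
    "ql (coef T y (\<tau> x z)) = coef C y (br (qD x) (ql z) + br (ql x) (qD z)
      + pushL (pprod J (qm x) (qp z)) - pushL (pprod J (qp x) (qm z)))"
    "qD (coef T y (\<tau> x z)) = coef C y (br (ql x) (ql z) + br (qD x) (qD z) + Lb (qm x) (qp z) + Lb (qp x) (qm z))"
  unfolding T_prod(2-5)[OF x z, symmetric]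
  by (rule coef_push[symmetric, OF T _ _ y T_prod(1)[OF x z]], rule J C, rule T_homs)+

lemma q_eqI: "qm x = a \<Longrightarrow> qp x = b \<Longrightarrow> ql x = fst \<Sigma> \<Longrightarrow> qD x = snd \<Sigma> \<Longrightarrow> x = (a, \<Sigma>, b)"
  by (cases x) (auto simp: prod_eq_iff)

lemma zero_rules:
  "\<phi> \<in> carr C \<Longrightarrow> \<phi> 0 = 0" "\<phi> \<in> carr C \<Longrightarrow> br 0 \<phi> = 0" "\<phi> \<in> carr C \<Longrightarrow> br \<phi> 0 = 0"
  "a \<in> carr J \<Longrightarrow> pprod J a 0 = 0" "a \<in> carr J \<Longrightarrow> pprod J 0 a = 0" "pperm H 2 J \<sigma> 0 = 0" "push H 2 C r 0 = 0" "lmap J 0 = 0"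
  "y \<in> dual H \<Longrightarrow> coef J y 0 = 0" "y \<in> dual H \<Longrightarrow> coef C y 0 = 0"
  using hbilinear_zero[OF ap_bil C J] hbilinear_zero[OF cb_bil C C] hbilinear_zero[OF J_bil J J] zeros
  by (simp_all add: flinD(3)[OF flin_lmul(2)] flinD(3)[OF flin_lmul(3)] coef_zero J C)

lemma zero_in: "0 \<in> carr C" by (rule left_moduleD(1)[OF C])

lemma T_mem: "a \<in> carr J \<Longrightarrow> (a, 0, 0) \<in> carr T" "a \<in> carr J \<Longrightarrow> (0, 0, a) \<in> carr T" "a \<in> carr J \<Longrightarrow> (0, (lmap J a, 0), 0) \<in> carr T"
  using zeros by (auto simp: T_carr zero_prod_def lmodule_eq)

lemma T_q_in: "x \<in> carr T \<Longrightarrow> qm x \<in> carr J" "x \<in> carr T \<Longrightarrow> qp x \<in> carr J" "x \<in> carr T \<Longrightarrow> ql x \<in> carr C" "x \<in> carr T \<Longrightarrow> qD x \<in> carr C"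
  using T_q_mem lmodule_subset submoduleD(1)[OF Inn_props(1)] by blast+

lemma lmap_apply: "b \<in> carr J \<Longrightarrow> lmap J a b = pprod J a b"
  by (simp add: lmap_def)

lemma coef_tau_special:
  assumes y: "y \<in> dual H"
  shows "c \<in> carr J \<Longrightarrow> a \<in> carr J \<Longrightarrow> coef T y (\<tau> (0, (lmap J c, 0), 0) (a, 0, 0)) = (coef J y (pprod J c a), 0, 0)"
    "c \<in> carr J \<Longrightarrow> a \<in> carr J \<Longrightarrow> coef T y (\<tau> (0, (lmap J c, 0), 0) (0, 0, a)) = (0, 0, - coef J y (pprod J c a))"
    "a \<in> carr J \<Longrightarrow> b \<in> carr J \<Longrightarrow> coef T y (\<tau> (a, 0, 0) (0, 0, b)) = (0, coef S y (U_op H J a b), 0)"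
    "c \<in> carr J \<Longrightarrow> x \<in> carr T \<Longrightarrow> qp (coef T y (\<tau> (0, (lmap J c, 0), 0) x)) = - coef J y (pprod J c (qp x))"
    "c \<in> carr J \<Longrightarrow> x \<in> carr T \<Longrightarrow> qp (coef T y (\<tau> (c, 0, 0) x)) = 0"
    "c \<in> carr J \<Longrightarrow> x \<in> carr T \<Longrightarrow>
      (ql (coef T y (\<tau> (c, 0, 0) x)), qD (coef T y (\<tau> (c, 0, 0) x))) = coef S y (U_op H J c (qp x))"
    "x \<in> carr T \<Longrightarrow> qp x = 0 \<Longrightarrow> d \<in> carr J \<Longrightarrow> coef T y (\<tau> x (d, 0, 0)) = (coef J y (ql x d + qD x d), 0, 0)"
    "x \<in> carr T \<Longrightarrow> qp x = 0 \<Longrightarrow> d \<in> carr J \<Longrightarrow> qp (coef T y (\<tau> x (0, 0, d))) = coef J y (- ql x d + qD x d)"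
proof -
  note s = coef_tau[OF _ _ y] T_mem zero_rules zero_rules(9,10)[OF y] zero_in lmap_in T_q_in lmap_apply zeros(1) J_prod_in
    coef_neg[OF J y] coef_U[OF _ _ y] coef_push[OF J C lmap_hom y]
  show "coef T y (\<tau> (0, (lmap J c, 0), 0) (a, 0, 0)) = (coef J y (pprod J c a), 0, 0)" if "c \<in> carr J" "a \<in> carr J"
    using that by (intro q_eqI) (simp_all add: s)
  show "coef T y (\<tau> (0, (lmap J c, 0), 0) (0, 0, a)) = (0, 0, - coef J y (pprod J c a))" if "c \<in> carr J" "a \<in> carr J"
    using that by (intro q_eqI) (simp_all add: s)
  show "coef T y (\<tau> (a, 0, 0) (0, 0, b)) = (0, coef S y (U_op H J a b), 0)" if "a \<in> carr J" "b \<in> carr J"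
    unfolding coef_U[OF that y] using that by (intro q_eqI) (simp_all add: s)
  show "qp (coef T y (\<tau> (0, (lmap J c, 0), 0) x)) = - coef J y (pprod J c (qp x))" if "c \<in> carr J" "x \<in> carr T"
    using that by (simp add: s)
  show "qp (coef T y (\<tau> (c, 0, 0) x)) = 0" if "c \<in> carr J" "x \<in> carr T"
    using that by (simp add: s)
  show "(ql (coef T y (\<tau> (c, 0, 0) x)), qD (coef T y (\<tau> (c, 0, 0) x))) = coef S y (U_op H J c (qp x))" if "c \<in> carr J" "x \<in> carr T"
    using that by (simp add: s)
  show "coef T y (\<tau> x (d, 0, 0)) = (coef J y (ql x d + qD x d), 0, 0)" if "x \<in> carr T" "qp x = 0" "d \<in> carr J"
    using that by (intro q_eqI) (simp_all add: s)
  show "qp (coef T y (\<tau> x (0, 0, d))) = coef J y (- ql x d + qD x d)" if "x \<in> carr T" "qp x = 0" "d \<in> carr J"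
    using that by (simp add: s)
qed

text \<open>Commutativity turns products from one side into products from the other by permuting the
  factors, which preserves \<open>pspan\<close>.\<close>

lemma J_ideal:
  assumes N: "submodule J N" and c: "\<And>a b y. a \<in> carr J \<Longrightarrow> b \<in> N \<Longrightarrow> y \<in> dual H \<Longrightarrow> coef J y (pprod J a b) \<in> N"
  shows "N = {0} \<or> N = carr J"
proof -
  have NJ: "b \<in> N \<Longrightarrow> b \<in> carr J" for b using submoduleD(1)[OF N] by blast
  have r: "pprod J a b \<in> pspan 2 J N" if "a \<in> carr J" "b \<in> N" for a b
    unfolding coef_mem_iff[OF J N J_prod_in[OF that(1) NJ[OF that(2)]]] using c[OF that] by simp
  have l: "pprod J b a \<in> pspan 2 J N" if "a \<in> carr J" "b \<in> N" for a b
    unfolding J_comm[OF NJ[OF that(2)] that(1)]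
    by (rule pperm_pspan[OF J submoduleD(1)[OF N] _ r[OF that]]) simp
  have "pideal H J N" unfolding pideal_def pspan_def[symmetric] using N r l by simp
  then show ?thesis using simple_J unfolding simple_pseudoalgebra_def by simp
qed

lemma S0_sub_induct:
  assumes Z: "submodule S Z" and g: "\<And>a b y. a \<in> carr J \<Longrightarrow> b \<in> carr J \<Longrightarrow> y \<in> dual H \<Longrightarrow> coef S y (U_op H J a b) \<in> Z"
  shows "S0 H B J \<subseteq> Z"
  unfolding S0_generated
proof (rule generated_submodule_props(3)[OF S_module _ Z])
  show "{coef S y (U_op H J a b) | a b y. a \<in> carr J \<and> b \<in> carr J \<and> y \<in> dual H} \<subseteq> Z" using g by auto
  then show "{coef S y (U_op H J a b) | a b y. a \<in> carr J \<and> b \<in> carr J \<and> y \<in> dual H} \<subseteq> carr S" using submoduleD(1)[OF Z] by simp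
qed

lemma T_simple: "simple_pseudoalgebra H T"
  unfolding simple_pseudoalgebra_def
proof (intro conjI allI impI)
  obtain a b where ab: "a \<in> carr J" "b \<in> carr J" "pprod J a b \<noteq> 0" using simple_J unfolding simple_pseudoalgebra_def by blast
  have "push H 2 J qm (\<tau> (0, (lmap J a, 0), 0) (b, 0, 0)) = pprod J a b"
    using T_prod(2)[OF T_mem(3)[OF ab(1)] T_mem(1)[OF ab(2)]] ab by (simp add: lmap_apply zero_rules)
  then have "\<tau> (0, (lmap J a, 0), 0) (b, 0, 0) \<noteq> 0" using ab(3) by (metis flinD(3)[OF flin_lmul(3)])
  then show "\<exists>x\<in>carr T. \<exists>z\<in>carr T. \<tau> x z \<noteq> 0" using T_mem(3)[OF ab(1)] T_mem(1)[OF ab(2)] by blast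
  fix I assume "pideal H T I"
  then have I: "submodule T I" and Il: "\<And>x z. x \<in> I \<Longrightarrow> z \<in> carr T \<Longrightarrow> \<tau> x z \<in> pspan 2 T I \<and> \<tau> z x \<in> pspan 2 T I"
    unfolding pideal_def pspan_def by blast+
  have IT: "x \<in> I \<Longrightarrow> x \<in> carr T" for x using submoduleD(1)[OF I] by blast
  have cI: "coef T y (\<tau> x z) \<in> I \<and> coef T y (\<tau> z x) \<in> I" if x: "x \<in> I" and z: "z \<in> carr T" and y: "y \<in> dual H" for x z y
    using bspec[OF coef_mem_iff[OF T I T_prod(1)[OF IT[OF x] z], THEN iffD1, OF conjunct1[OF Il[OF x z]]] y]
      bspec[OF coef_mem_iff[OF T I T_prod(1)[OF z IT[OF x]], THEN iffD1, OF conjunct2[OF Il[OF x z]]] y] by blast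
  note cI1 = conjunct1[OF cI] and cI2 = conjunct2[OF cI]
  \<comment> \<open>The elements of the minus copy in \<open>I\<close>. Brackets with
    \<open>L_a\<close> show that they absorb products by \<open>a\<close>.\<close>
  let ?Im = "{a \<in> carr J. (a, 0, 0) \<in> I}"
  have "?Im = {0} \<or> ?Im = carr J"
  proof (rule J_ideal[OF submodule_preimage[OF J I T_incl_homs(1)]])
    fix a b y assume a: "a \<in> carr J" and b: "b \<in> ?Im" and y: "y \<in> dual H"
    then have b': "b \<in> carr J" "(b, 0, 0) \<in> I" by auto
    show "coef J y (pprod J a b) \<in> ?Im"
      using cI2[OF b'(2) T_mem(3)[OF a] y] coef_tau_special(1)[OF y a b'(1)] coef_in[OF J y J_prod_in[OF a b'(1)]] by simp
  qed
  then consider (full) "?Im = carr J" | (zero) "?Im = {0}" by blast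
  then show "I = {0} \<or> I = carr T"
  proof cases
    case full
    then have m: "(a, 0, 0) \<in> I" if "a \<in> carr J" for a using that by blast
    let ?Z = "{\<Sigma> \<in> S0 H B J. (0, \<Sigma>, 0) \<in> I}" and ?S' = "S\<lparr>carr := S0 H B J\<rparr>"
    have S': "left_module ?S'" by (rule left_module_submodule[OF S_module]) (simp_all add: S0_submodule)
    have Z: "submodule S ?Z" using submodule_trans[OF submodule_preimage[OF S' I T_incl_homs(5)], of S] S0_submodule by simp
    have "S0 H B J \<subseteq> ?Z"
    proof (rule S0_sub_induct[OF Z])
      fix a b y assume a: "a \<in> carr J" and b: "b \<in> carr J" and y: "y \<in> dual H"
      have i: "(0, coef S y (U_op H J a b), 0) \<in> I"
        using cI1[OF m[OF a] T_mem(2)[OF b] y] coef_tau_special(3)[OF y a b] by simp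
      then show "coef S y (U_op H J a b) \<in> ?Z" using IT[OF i] by (simp add: T_carr S0_eq)
    qed
    then have s: "(0, \<Sigma>, 0) \<in> I" if "\<Sigma> \<in> S0 H B J" for \<Sigma> using that by blast
    have "{a \<in> carr J. (0, 0, a) \<in> I} = carr J"
    proof (rule coefs_generate[OF submodule_preimage[OF J I T_incl_homs(2)]])
      fix a b y assume a: "a \<in> carr J" and b: "b \<in> carr J" and y: "y \<in> dual H"
      \<comment> \<open>\<open>L_a\<close> acts on the plus copy with a minus sign, so the
        coefficient of the bracket has to be negated afterwards.\<close>
      have "(0, (lmap J a, 0), 0) \<in> I" by (rule s) (simp add: S0_eq lmodule_eq a zeros)
      from submoduleD(4)[OF I cI1[OF this T_mem(2)[OF b] y]] show "coef J y (pprod J a b) \<in> {a \<in> carr J. (0, 0, a) \<in> I}"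
        using coef_tau_special(2)[OF y a b] coef_in[OF J y J_prod_in[OF a b]] by simp
    qed
    then have p: "(0, 0, a) \<in> I" if "a \<in> carr J" for a using that by blast
    have "carr T \<subseteq> I"
    proof
      fix x assume x: "x \<in> carr T"
      obtain a \<Sigma> b where x': "x = (a, \<Sigma>, b)" by (metis prod.collapse)
      have "(a, 0, 0) + (0, \<Sigma>, 0) + (0, 0, b) \<in> I"
        using x by (intro submoduleD(5)[OF I] m s p) (auto simp: T_carr x' S0_eq)
      then show "x \<in> I" by (simp add: x')
    qed
    then show ?thesis using submoduleD(1)[OF I] by blast
  next
    case zero
    have m: "a = 0" if "a \<in> carr J" "(a, 0, 0) \<in> I" for a using zero that by blast
    \<comment> \<open>If an element of \<open>I\<close> has no plus component, its bracket with the
      minus copy stays in the minus copy, which meets \<open>I\<close> only in 0.\<close>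
    have kill: "ql x d + qD x d = 0" if x: "x \<in> I" "qp x = 0" and d: "d \<in> carr J" for x d
    proof (rule coef_eq_zeroD[OF J])
      show i: "ql x d + qD x d \<in> pseudo H 2 J"
        by (intro free.subspace_add[OF subspace_pseudo[OF J]] app_in T_q_in IT x d)
      fix y assume y: "y \<in> dual H"
      show "coef J y (ql x d + qD x d) = 0"
        using cI1[OF x(1) T_mem(1)[OF d] y] coef_tau_special(7)[OF y IT[OF x(1)] x(2) d] by (intro m coef_in[OF J y i]) simp
    qed
    \<comment> \<open>The plus components of the elements of \<open>I\<close>, rather than the plus
      elements in \<open>I\<close>. They form an ideal of \<open>J\<close>, since a bracket with
      \<open>L_a\<close> multiplies the plus component by \<open>- a\<close>.\<close>
    let ?K = "qp ` I"
    have "?K = {0} \<or> ?K = carr J"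
    proof (rule J_ideal[OF submodule_image[OF T I T_homs(2)]])
      show "coef J y (pprod J a b) \<in> ?K" if a: "a \<in> carr J" and b: "b \<in> ?K" and y: "y \<in> dual H" for a b y
      proof -
        obtain x where x: "b = qp x" "x \<in> I" using b by blast
        let ?x = "coef T y (\<tau> (0, (lmap J a, 0), 0) x)"
        have i': "?x \<in> I" by (rule cI2[OF x(2) T_mem(3)[OF a] y])
        have "qp (- ?x) = - qp ?x" by (cases ?x) simp
        then show ?thesis
          using coef_tau_special(4)[OF y a IT[OF x(2)]] x(1) by (intro image_eqI[OF _ submoduleD(4)[OF I i']]) simp
      qed
    qed
    then consider (K0) "?K = {0}" | (KJ) "?K = carr J" by blast
    then show ?thesis
    proof cases
      case K0
      then have p: "qp x = 0" if "x \<in> I" for x using that by blast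
      have "x = 0" if x: "x \<in> I" for x
      proof -
        note xT = IT[OF x]
        \<comment> \<open>The bracket with \<open>d\<close> in the plus copy gives
          \<open>D d - L d = 0\<close>, and the bracket with \<open>d\<close> in the minus copy
          gives \<open>D d + L d = 0\<close>; in characteristic zero both terms vanish.\<close>
        have z: "ql x d = 0 \<and> qD x d = 0" for d
        proof (cases "d \<in> carr J")
          case True
          have i: "- ql x d + qD x d \<in> pseudo H 2 J"
            by (intro free.subspace_add[OF subspace_pseudo[OF J]] free.subspace_neg[OF subspace_pseudo[OF J]] app_in T_q_in xT True)
          have 1: "- ql x d + qD x d = 0"
          proof (rule coef_eq_zeroD[OF J i])
            fix y assume y: "y \<in> dual H"
            show "coef J y (- ql x d + qD x d) = 0"
              using p[OF cI1[OF x T_mem(2)[OF True] y]] coef_tau_special(8)[OF y xT p[OF x] True] by simp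
          qed
          have 2: "ql x d + qD x d = 0" by (rule kill[OF x p[OF x] True])
          have eq: "qD x d = ql x d" using 1 by (simp add: neg_eq_iff_add_eq_0[symmetric])
          have "ql x d = 0" by (rule double_inj) (use 2 eq in simp)
          then show ?thesis using eq by simp
        next
          case False
          then show ?thesis using T_q_in(3,4)[OF xT] by (simp add: cend_carr)
        qed
        then have lD: "ql x = 0" "qD x = 0" by (auto simp: fun_eq_iff)
        have "x = (qm x, 0, 0)" by (rule q_eqI) (simp_all add: p[OF x] lD)
        then have "qm x = 0" using m[OF T_q_in(1)[OF xT]] x by simp
        then show ?thesis by (rule T_inj) (simp_all add: p[OF x] lD)
      qed
      then show ?thesis using submoduleD(2)[OF I] by blast
    next
      case KJ
      \<comment> \<open>The annihilator of the minus copy. The contradiction will be that it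
        contains all of \<open>S0\<close>, although some \<open>L_a\<close> acts
        nontrivially.\<close>
      let ?Z = "{\<Sigma> \<in> carr S. \<forall>d\<in>carr J. fst \<Sigma> d + snd \<Sigma> d = 0}"
      have Z: "submodule S ?Z"
      proof (rule submoduleI)
        note s = left_moduleD[OF S_module]
        show "0 \<in> ?Z" using s(1) by simp
        show "\<Sigma> - \<Sigma>' \<in> ?Z" if "\<Sigma> \<in> ?Z" "\<Sigma>' \<in> ?Z" for \<Sigma> \<Sigma>'
        proof -
          have eq: "fst \<Sigma> d - fst \<Sigma>' d + (snd \<Sigma> d - snd \<Sigma>' d) = (fst \<Sigma> d + snd \<Sigma> d) - (fst \<Sigma>' d + snd \<Sigma>' d)" for d by simp
          show ?thesis using that s(2) by (simp add: eq)
        qed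
        show "act S f \<Sigma> \<in> ?Z" if "\<Sigma> \<in> ?Z" for f \<Sigma>
        proof -
          obtain l D where \<Sigma>: "\<Sigma> = (l, D)" by (cases \<Sigma>)
          have "act C f l d + act C f D d = 0" if "d \<in> carr J" for d
            using \<open>\<Sigma> \<in> ?Z\<close> that by (simp add: \<Sigma> cend_act flinD(1)[OF flin_lmul(1), symmetric] flinD(3)[OF flin_lmul(1)])
          then show ?thesis using that s(5)[of \<Sigma> f] by (simp add: \<Sigma> S_act)
        qed
      qed auto
      have "S0 H B J \<subseteq> ?Z"
      proof (rule S0_sub_induct[OF Z])
        fix c b y assume c: "c \<in> carr J" and b: "b \<in> carr J" and y: "y \<in> dual H"
        have "b \<in> ?K" using KJ b by simp
        then obtain x where xb: "b = qp x" "x \<in> I" by (rule imageE)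
        note x = xb(2) xb(1)[symmetric]
        \<comment> \<open>This coefficient of the bracket of \<open>c\<close> in the minus copy with
          \<open>x\<close> has no plus component, and its component in \<open>S0\<close> is the
          coefficient of \<open>U_op H J c b\<close>; hence \<open>kill\<close> applies.\<close>
        let ?x = "coef T y (\<tau> (c, 0, 0) x)"
        have i: "?x \<in> I" by (rule cI2[OF x(1) T_mem(1)[OF c] y])
        have U: "coef S y (U_op H J c b) = (ql ?x, qD ?x)" using coef_tau_special(6)[OF y c IT[OF x(1)]] x(2) by simp
        show "coef S y (U_op H J c b) \<in> ?Z"
          using kill[OF i coef_tau_special(5)[OF y c IT[OF x(1)]]] coef_in[OF S_module y U_props(1)[OF c b]] by (simp add: U)
      qed
      moreover have "(lmap J a, 0) \<in> S0 H B J" using ab(1) zeros by (simp add: S0_eq lmodule_eq)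
      ultimately have "lmap J a b = 0" using ab(2) by auto
      then show ?thesis using ab by (simp add: lmap_apply)
    qed
  qed
qed

end

theorem proposition2:
  fixes H :: "('k::field_char_0, 'h::ring_1) hopf"
    and B :: "'h set"
    and J :: "('k, 'h, 'm::ab_group_add) pseudoalg"
  assumes "cocommutative_hopf_algebra H"
    and "is_basis H B"
    and "jordan_pseudoalgebra H J"
    and "finitely_generated J"
    and "simple_pseudoalgebra H J"
  shows "lie_pseudoalgebra H (TKK H B J) \<and> finitely_generated (TKK H B J) \<and>
    simple_pseudoalgebra H (TKK H B J)"
proof -
  interpret simple_jordan H B J
    by unfold_locales (rule assms)+
  show ?thesis using T_lie finitely_generated_T T_simple by blast
qed

end
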